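(* Let $k\ge 2$ be an integer. Assume: (1) $\inf_{t\in[0,1]}\psi(t)=\psi(1)=0$ and $\psi'(1)<0$, and $2k<\kappa<\infty$; (2) there exists $\delta_1>0$ such that $\psi(t)<\infty$ for all $t\in[1-\delta_1,\lceil\kappa+\delta_1\rceil]$ and, for all $1\le j\le\lceil\kappa+\delta_1\rceil$ and all $\beta=(\beta_1,\dots,\beta_j)\in(\mathbb N^* )^j$ with $\sum_{i=1}^j\beta_i\le\lceil\kappa+\delta_1\rceil$, $c_j(\beta):=\mathbf E\big[\sum_{\mathbf x\in\Delta^j_1}e^{-\sum_{i=1}^j\beta_iV(x^{(i)})}\big]<\infty$; (3) there exists $\mathfrak h>0$ such that $\mathbf P\big(\inf_{x\in\mathbb T,x\ne e}(V(x)-V(x^* ))\ge-\mathfrak h\big)=1$; (4) $(\ell_n)$ and $(\mathfrak L_n)$ are sequences of positive integers with $\delta_0^{-1}\log n\le\ell_n\le\mathfrak L_n$ and, for some $l_0\in\mathbb N$, $\lim_{n\to\infty}\frac{\mathfrak L_n}{n^{1/2}}\Lambda_{l_0}(\mathfrak L_n)=0$. Let $L_n:=\mathfrak L_n-\ell_n+1$ and, for $m\in\mathbb N^*$ and $\mathbf x\in\Delta^k$, $f_m(\mathbf x):=\mathbf 1_{\{\mathcal S^k(\mathbf x)\le m\}}$. Then, for every $m\in\mathbb N^*$: 1. in $\mathbb P^*$-probability, $$\frac1{(n^{1/2}L_n)^k}\mathcal A^k(\mathcal D_n,f_m)\underset{n\to\infty}{\longrightarrow}(c_\infty)^k\mathcal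 A^k_\infty(f_m),$$ and $\lim_{m\to\infty}\mathcal A^k_\infty(f_m)=(W_\infty)^k$ in $L^2(\mathbf P^* )$; 2. the sequence $(\mathcal S^k(\mathcal X^{(n)}))_n$ converges in law under $\mathbb P^*$: for every $m\in\mathbb N^*$, $$\mathbb P^*\big(\mathcal S^k(\mathcal X^{(n)})\le m\big)\underset{n\to\infty}{\longrightarrow}\mathbf E^*\Big[\frac{\mathcal A^k_\infty(f_m)}{(W_\infty)^k}\Big].$$
   Context: $\mathbb N=\{0,1,\dots\}$, $\mathbb N^*=\{1,2,\dots\}$; $|E|$ is the cardinality of a finite set $E$. Environment. Under a probability $\mathbf P$ (expectation $\mathbf E$), $\mathcal P$ is a random finite sequence of reals of length $N$, with $\mathbf E[N]>1$. $(\mathbb T,(A_x)_{x\in\mathbb T})$ is the marked Galton–Watson tree with root $e$, $A_e=0$, where each vertex, independently of the others in its generation, has $N$-many marked children whose marks are distributed as $\mathcal P$. $|x|$ is the generation of $x$, $x^*$ its parent; $x\le y$ means $x$ is an ancestor of $y$ or $x=y$; $x\wedge y$ is the most recent common ancestor; $\mathbb T_l=\{x:|x|=l\}$. $V(e)=0$, $V(x)=\sum_{e<z\le x}A_z$, $\mathcal E=(\mathbb T,(V(x))_{x\in\mathbb T})$. $\mathbf P^*=\mathbf P(\cdot\mid\text{non-extinction of }\mathbb T)$, with expectation $\mathbf E^*$. $\psi(t)=\log\mathbf E[\sum_{|x|=1}e^{-tV(x)}]$ and $\kappa=\inf\{t>1:\psi(t)=0\}$. Walk. Add a parent $e^*$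 to $e$. Given $\mathcal E$, under $\mathbb P^{\mathcal E}$, $(X_j)_{j\ge0}$ is the Markov chain on $\mathbb T\cup\{e^*\}$ with $X_0=e$, which from $x\in\mathbb T$ with children $x^1,\dots,x^{N_x}$ jumps to $x^*$ with probability $e^{-V(x)}/(e^{-V(x)}+\sum_ie^{-V(x^i)})$ and to $x^j$ with probability $e^{-V(x^j)}/(e^{-V(x)}+\sum_ie^{-V(x^i)})$, and from $e^*$ jumps to $e$ with probability 1. $\mathbb P^*=\mathbf E^*[\mathbb P^{\mathcal E}(\cdot)]$, with expectation $\mathbb E^*$. $T^0=0$, $T^j=\inf\{i>T^{j-1}:X_i=e^*\}$. $\mathcal R_T=\{u\in\mathbb T:\exists\,1\le j\le T,\ X_j=u\}$. When used as an index, $n^{1/2}$ means its integer part. $\delta_0>0$ is a constant fixed once and for all such that, for some $\rho_1>1/2$ and every positive integer $\zeta$, $\mathbf P(\min_{|z|=\lceil\delta_0^{-1}\zeta\rceil}V(z)\ge3\zeta)\ge1-e^{-\rho_1\zeta}$ (such a constant exists under (1)). $\Lambda_0(t)=t$ and $\Lambda_{i-1}(t)=e^{\Lambda_i(t)}$ for $i\ge1$ (iterated logarithms). Tuples. $\Delta^k$ is the set of $\mathbf x=(x^{(1)},\dots,x^{(k)})\in\mathbb T^k$ such that for all $i\ne j$ neither $x^{(i)}\le x^{(j)}$ nor $x^{(j)}\le x^{(i)}$. For $\mathfrak D\subset\mathbb T$, $\Delta^k(\mathfrak D)=\Delta^k\cap\mathfrak D^k$; $\Delta^k_l=\Delta^k(\mathbb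 T_l)$. $\mathcal A^k(\mathfrak D,f)=\sum_{\mathbf x\in\Delta^k(\mathfrak D)}f(\mathbf x)$ ($0$ if $\Delta^k(\mathfrak D)=\emptyset$). $\mathcal D_n=\{x\in\mathcal R_{T^{n^{1/2}}}:\ell_n\le|x|\le\mathfrak L_n\}$. $\mathcal S^k(\mathbf x)=\min\{m\ge1:\ |x^{(i)}\wedge x^{(j)}|<m\ \text{for all }i\ne j\}$ is the first generation at which no two of the $x^{(i)}$ share a common ancestor. Sampling. $\mathcal X^{(n)}=(\mathcal X^{(1,n)},\dots,\mathcal X^{(k,n)})$ is a $k$-tuple picked uniformly in $\Delta^k(\mathcal D_n)$ conditionally on $|\Delta^k(\mathcal D_n)|>0$, i.e. for bounded $h:\Delta^k\to[0,\infty)$ its (annealed) law under $\mathbb P^*$ is given by $\mathbb E^*[h(\mathcal X^{(n)})]=\frac1{\mathbb P^*(|\Delta^k(\mathcal D_n)|>0)}\mathbb E^*\big[\frac{\mathcal A^k(\mathcal D_n,h)}{\mathcal A^k(\mathcal D_n,1)}\mathbf 1_{\{|\Delta^k(\mathcal D_n)|>0\}}\big]$ (the probability in the denominator tends to 1). Limits. $\mathcal A^k_l(f)=\sum_{\mathbf x\in\Delta^k_l}f(\mathbf x)e^{-\sum_{i=1}^kV(x^{(i)})}$ and $\mathcal A^k_\infty(f)=\lim_{l\to\infty}\mathcal A^k_l(f)$ in $L^2(\mathbf P^* )$ (the limit exists for $f=f_m$). $(S_j)_{j\ge0}$ is a random walk with i.i.d. increments, $S_0=0$, $\mathbf E[\mathfrak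 t(S_1)]=\mathbf E[\sum_{|x|=1}\mathfrak t(V(x))e^{-V(x)}]$ for bounded measurable $\mathfrak t$; $c_\infty=\mathbf E[(\sum_{j\ge0}e^{-S_j})^{-1}]$. $W_\infty$ is the almost sure limit of the martingale $W_n=\sum_{|x|=n}e^{-V(x)}$ ($\mathbf P^*(W_\infty>0)=1$ under the assumptions). *)

theory Defs
  imports "HOL-Probability.Probability" "HOL-Library.Sublist"
begin

section \<open>Marked trees\<close>

text \<open>
  Vertices are Ulam--Harris words. An environment assigns to every word \<open>u\<close> the finite sequence of
  marks carried by the children \<open>u @ [0], u @ [1], \<dots>\<close> of \<open>u\<close>; only the values at vertices of the
  tree matter. The order \<open>x \<le> y\<close> on the tree is \<^const>\<open>prefix\<close>, and the most recent common
  ancestor is \<^const>\<open>longest_common_prefix\<close>.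
\<close>

type_synonym vertex = "nat list"
type_synonym environment = "vertex \<Rightarrow> real list"

definition tree :: "environment \<Rightarrow> vertex set" where
  "tree E = {u. \<forall>j<length u. u ! j < length (E (take j u))}"

definition generation :: "environment \<Rightarrow> nat \<Rightarrow> vertex set" where
  "generation E l = {u \<in> tree E. length u = l}"

definition potential :: "environment \<Rightarrow> vertex \<Rightarrow> real" where
  "potential E u = (\<Sum>j<length u. E (take j u) ! (u ! j))"

text \<open>The measurable space of finite sequences of reals, generated by the length and the entries.\<close>

definition real_seqs :: "real list measure" where
  "real_seqs = vimage_algebra UNIV
     (\<lambda>xs. (length xs, \<lambda>i. if i < length xs then xs ! i else 0))
     (count_space UNIV \<Otimes>\<^sub>M (\<Pi>\<^sub>M i\<in>(UNIV :: nat set). (borel :: real measure)))"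


section \<open>The biased walk on the tree\<close>

text \<open>
  The state space is the set of vertices together with the extra parent \<open>e\<^sup>*\<close> of the root,
  which is encoded by \<^const>\<open>None\<close>.
\<close>

definition parent :: "vertex \<Rightarrow> vertex option" where
  "parent x = (if x = [] then None else Some (butlast x))"

fun trans_prob :: "environment \<Rightarrow> vertex option \<Rightarrow> vertex option \<Rightarrow> real" where
  "trans_prob E None y = (if y = Some [] then 1 else 0)"
| "trans_prob E (Some x) y =
     (let Z = exp (- potential E x) + (\<Sum>i<length (E x). exp (- potential E (x @ [i])))
      in if y = parent x then exp (- potential E x) / Z
         else if \<exists>i<length (E x). y = Some (x @ [i]) then exp (- potential E (the y)) / Z
         else 0)"

definition path_prob :: "environment \<Rightarrow> nat \<Rightarrow> (nat \<Rightarrow> vertex option) \<Rightarrow> real" where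
  "path_prob E n p =
     (if p 0 = Some [] then \<Prod>i<n. trans_prob E (p i) (p (Suc i)) else 0)"

text \<open>
  A probability space carrying the environment of a marked Galton--Watson tree whose offspring point
  process has law \<open>\<mu>\<close>, together with a process \<open>X\<close> which, conditionally on the environment, is the
  Markov chain with transition probabilities \<^const>\<open>trans_prob\<close> started at the root. Thus \<open>M\<close> is
  the annealed law; its restriction to events depending on the environment only is the law of the
  environment.
\<close>

locale walk_in_random_environment = prob_space M
  for M :: "'w measure" +
  fixes \<mu> :: "real list measure"
    and env :: "'w \<Rightarrow> environment"
    and X :: "nat \<Rightarrow> 'w \<Rightarrow> vertex option"
  assumes env_indep: "indep_vars (\<lambda>_. real_seqs) (\<lambda>u \<omega>. env \<omega> u) UNIV"
    and env_law: "\<And>u. distr M real_seqs (\<lambda>\<omega>. env \<omega> u) = \<mu>"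
    and supercritical: "(\<integral>\<^sup>+ xs. of_nat (length xs) \<partial>\<mu>) > 1"
    and walk_measurable: "\<And>j. X j \<in> measurable M (count_space UNIV)"
    and walk_law: "\<And>B n p. B \<in> sets (\<Pi>\<^sub>M u\<in>(UNIV :: vertex set). real_seqs) \<Longrightarrow>
      prob {\<omega> \<in> space M. env \<omega> \<in> B \<and> (\<forall>i\<le>n. X i \<omega> = p i)}
        = (\<integral>\<omega>. indicator B (env \<omega>) * path_prob (env \<omega>) n p \<partial>M)"

definition survival_cond :: "'w measure \<Rightarrow> ('w \<Rightarrow> environment) \<Rightarrow> 'w measure" where
  "survival_cond M env =
     uniform_measure M {\<omega> \<in> space M. \<forall>l. generation (env \<omega>) l \<noteq> {}}"

text \<open>\<open>return_time p j\<close> is \<open>T\<^sup>j\<close>, with \<open>inf \<emptyset> = \<infinity>\<close>.\<close>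

primrec return_time :: "(nat \<Rightarrow> vertex option) \<Rightarrow> nat \<Rightarrow> enat" where
  "return_time p 0 = 0"
| "return_time p (Suc j) = Inf {enat i | i. return_time p j < enat i \<and> p i = None}"

definition visited :: "environment \<Rightarrow> (nat \<Rightarrow> vertex option) \<Rightarrow> enat \<Rightarrow> vertex set" where
  "visited E p T = {u \<in> tree E. \<exists>j\<ge>1. enat j \<le> T \<and> p j = Some u}"

definition visited_between ::
  "environment \<Rightarrow> (nat \<Rightarrow> vertex option) \<Rightarrow> (nat \<Rightarrow> nat) \<Rightarrow> (nat \<Rightarrow> nat) \<Rightarrow> nat \<Rightarrow> vertex set" where
  "visited_between E p lo hi n =
     {x \<in> visited E p (return_time p (nat \<lfloor>sqrt (real n)\<rfloor>)). lo n \<le> length x \<and> length x \<le> hi n}"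


section \<open>Tuples of vertices\<close>

definition incomparable_tuples :: "nat \<Rightarrow> vertex set \<Rightarrow> vertex list set" where
  "incomparable_tuples k D = {xs. length xs = k \<and> set xs \<subseteq> D \<and>
     (\<forall>i<k. \<forall>j<k. i \<noteq> j \<longrightarrow> \<not> prefix (xs ! i) (xs ! j))}"

definition tuple_sum :: "nat \<Rightarrow> vertex set \<Rightarrow> (vertex list \<Rightarrow> real) \<Rightarrow> real" where
  "tuple_sum k D f = (\<Sum>xs\<in>incomparable_tuples k D. f xs)"

definition split_generation :: "vertex list \<Rightarrow> nat" where
  "split_generation xs = (LEAST m. 1 \<le> m \<and>
     (\<forall>i<length xs. \<forall>j<length xs. i \<noteq> j \<longrightarrow>
        length (longest_common_prefix (xs ! i) (xs ! j)) < m))"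

definition split_indicator :: "nat \<Rightarrow> vertex list \<Rightarrow> real" where
  "split_indicator m xs = (if split_generation xs \<le> m then 1 else 0)"

definition weighted_tuple_sum ::
  "nat \<Rightarrow> nat \<Rightarrow> (vertex list \<Rightarrow> real) \<Rightarrow> environment \<Rightarrow> real" where
  "weighted_tuple_sum k l f E =
     tuple_sum k (generation E l) (\<lambda>xs. f xs * exp (- (\<Sum>i<k. potential E (xs ! i))))"

text \<open>
  The law of a tuple picked uniformly among the incomparable \<open>k\<close>-tuples of the random set \<open>D\<close>,
  under \<open>P\<close> conditioned on the existence of such a tuple.
\<close>

definition uniform_tuple_law ::
  "'w measure \<Rightarrow> nat \<Rightarrow> ('w \<Rightarrow> vertex set) \<Rightarrow> vertex list measure" where
  "uniform_tuple_law P k D =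
     uniform_measure P {\<omega> \<in> space P. incomparable_tuples k (D \<omega>) \<noteq> {}}
       \<bind> (\<lambda>\<omega>. measure_pmf (pmf_of_set (incomparable_tuples k (D \<omega>))))"


section \<open>Laplace exponent and moments\<close>

definition log_ennreal :: "ennreal \<Rightarrow> ereal" where
  "log_ennreal x =
     (if x = 0 then - \<infinity> else if x = \<infinity> then \<infinity> else ereal (ln (enn2real x)))"

definition \<psi> :: "'w measure \<Rightarrow> ('w \<Rightarrow> environment) \<Rightarrow> real \<Rightarrow> ereal" where
  "\<psi> M env t = log_ennreal
     (\<integral>\<^sup>+ \<omega>. ennreal (\<Sum>x\<in>generation (env \<omega>) 1. exp (- t * potential (env \<omega>) x)) \<partial>M)"

text \<open>The infimum is \<open>\<infinity>\<close> if there is no zero of \<open>\<psi>\<close> beyond \<open>1\<close>.\<close>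

definition \<kappa> :: "'w measure \<Rightarrow> ('w \<Rightarrow> environment) \<Rightarrow> ereal" where
  "\<kappa> M env = Inf (ereal ` {t. 1 < t \<and> \<psi> M env t = 0})"

definition tuple_moment :: "'w measure \<Rightarrow> ('w \<Rightarrow> environment) \<Rightarrow> nat \<Rightarrow> nat list \<Rightarrow> ennreal" where
  "tuple_moment M env j \<beta> =
     (\<integral>\<^sup>+ \<omega>. ennreal (tuple_sum j (generation (env \<omega>) 1)
        (\<lambda>xs. exp (- (\<Sum>i<j. real (\<beta> ! i) * potential (env \<omega>) (xs ! i))))) \<partial>M)"

text \<open>\<open>\<Lambda>\<^sub>i\<close> is the \<open>i\<close>-fold iterate of the logarithm.\<close>

definition iter_log :: "nat \<Rightarrow> real \<Rightarrow> real" where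
  "iter_log i = ln ^^ i"


section \<open>The random walk $S$ and the constant $c_\infty$\<close>

locale spine_walk = prob_space Q
  for Q :: "'s measure" +
  fixes M :: "'w measure"
    and env :: "'w \<Rightarrow> environment"
    and S :: "nat \<Rightarrow> 's \<Rightarrow> real"
  assumes start: "\<And>\<omega>. \<omega> \<in> space Q \<Longrightarrow> S 0 \<omega> = 0"
    and increments_indep: "indep_vars (\<lambda>_. borel) (\<lambda>j \<omega>. S (Suc j) \<omega> - S j \<omega>) UNIV"
    and increments_law: "\<And>j. distr Q borel (\<lambda>\<omega>. S (Suc j) \<omega> - S j \<omega>) = distr Q borel (S 1)"
    and step_law: "\<And>h :: real \<Rightarrow> real. h \<in> borel_measurable borel \<Longrightarrow> bounded (range h) \<Longrightarrow>
      expectation (\<lambda>\<omega>. h (S 1 \<omega>)) =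
        (\<integral>\<omega>. (\<Sum>x\<in>generation (env \<omega>) 1.
                h (potential (env \<omega>) x) * exp (- potential (env \<omega>) x)) \<partial>M)"

text \<open>The series may diverge, in which case its inverse is \<open>0\<close>; it is at least \<open>1\<close>.\<close>

definition c_inf :: "'s measure \<Rightarrow> (nat \<Rightarrow> 's \<Rightarrow> real) \<Rightarrow> real" where
  "c_inf Q S = enn2real (\<integral>\<^sup>+ \<omega>. inverse (\<Sum>j. ennreal (exp (- S j \<omega>))) \<partial>Q)"


section \<open>Modes of convergence and limits\<close>

definition tendsto_in_prob ::
  "'w measure \<Rightarrow> (nat \<Rightarrow> 'w \<Rightarrow> real) \<Rightarrow> ('w \<Rightarrow> real) \<Rightarrow> bool" where
  "tendsto_in_prob P Y Z \<longleftrightarrow>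
     (\<forall>n. Y n \<in> borel_measurable P) \<and> Z \<in> borel_measurable P \<and>
     (\<forall>\<epsilon>>0. (\<lambda>n. measure P {\<omega> \<in> space P. \<bar>Y n \<omega> - Z \<omega>\<bar> > \<epsilon>}) \<longlonglongrightarrow> 0)"

definition in_L2 :: "'w measure \<Rightarrow> ('w \<Rightarrow> real) \<Rightarrow> bool" where
  "in_L2 P Y \<longleftrightarrow> Y \<in> borel_measurable P \<and> integrable P (\<lambda>\<omega>. (Y \<omega>)\<^sup>2)"

definition tendsto_L2 :: "'w measure \<Rightarrow> (nat \<Rightarrow> 'w \<Rightarrow> real) \<Rightarrow> ('w \<Rightarrow> real) \<Rightarrow> bool" where
  "tendsto_L2 P Y Z \<longleftrightarrow>
     (\<forall>n. in_L2 P (Y n)) \<and> in_L2 P Z \<and> (\<lambda>n. \<integral>\<omega>. (Y n \<omega> - Z \<omega>)\<^sup>2 \<partial>P) \<longlonglongrightarrow> 0"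

text \<open>\<open>L\<^sup>2\<close> limits are unique up to null sets; one version is chosen.\<close>

definition A_inf ::
  "'w measure \<Rightarrow> ('w \<Rightarrow> environment) \<Rightarrow> nat \<Rightarrow> (vertex list \<Rightarrow> real) \<Rightarrow> 'w \<Rightarrow> real" where
  "A_inf M env k f = (SOME Z. tendsto_L2 (survival_cond M env)
     (\<lambda>l \<omega>. weighted_tuple_sum k l f (env \<omega>)) Z)"

definition W_inf :: "environment \<Rightarrow> real" where
  "W_inf E = lim (\<lambda>n. \<Sum>x\<in>generation E n. exp (- potential E x))"

end

theory Submission
  imports Defs
begin

text \<open>
 Everything follows from the number of visited descendants of one fixed vertex. A \<open>k\<close>-tuple has
 split by generation \<open>m\<close> iff the ancestors of its entries in that generation are distinct, and once
 the ancestors are chosen the entries are chosen independently. A sum over such tuples is therefore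
 a fixed polynomial in the sums below the single vertices of generation \<open>m\<close>
 (\<open>tuple_sum_split\<close>). So it suffices that, for every vertex \<open>u\<close>, the number of visited vertices of
 the window below \<open>u\<close>, divided by \<open>sqrt n * L\<^sub>n\<close>, converges in probability to \<open>c_inf\<close> times
 \<open>exp (- V u)\<close> times the martingale limit of the subtree of \<open>u\<close> (\<open>visit_count_tendsto\<close>). There are
 countably many \<open>u\<close>, so along suitable subsequences all these limits hold at once and almost surely,
 and the limits of all tuple sums can be read off pathwise (\<open>tuple_counts_tendsto\<close>). When
 \<open>m\<close> grows, the masses in generation \<open>m\<close> become small with constant sum, tuples with a repeated
 ancestor become negligible, and the limit tends to \<open>W_inf ^ k\<close>.

 The law of large numbers for one vertex has a quenched and an annealed part. Given the environment,
 \<open>x\<close> is visited during one excursion with probability \<open>1 / resistance E x\<close>, and the probability that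
 two vertices are visited in the same excursion is controlled by the resistance down to their common
 ancestor. Since the potential is large in the window while there are only \<open>sqrt n\<close> excursions,
 vertices are rarely visited in two excursions, and since \<open>hi n\<close> is small compared to \<open>sqrt n\<close>
 the correlations within one excursion are negligible; so the count is close to \<open>sqrt n\<close> times
 the sum of the inverse resistances (\<open>visit_count_concentration\<close>). This sum, over one generation,
 converges to \<open>c_inf * W_inf\<close> in \<open>L\<^sup>1\<close> (\<open>hit_sum_below_L1\<close>): only the last few terms
 of the resistance matter, so that it is nearly a sum of independent contributions of the subtrees
 of an intermediate generation, whose mean is computed by the many-to-one formula as the expectation
 of the inverse of a partial sum of \<open>exp (- S\<^sub>j)\<close>.

 The hypotheses on \<open>\<psi>\<close> and on the mixed moments enter mainly through one fact: the additive
 martingale is bounded in \<open>L\<^sup>p\<close> for some \<open>p > 2 k\<close> (\<open>W_moment_bounded\<close>). The Laplace transform is smaller than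
 one strictly between \<open>1\<close> and a zero of \<open>\<psi>\<close> beyond \<open>2 k\<close>, by convexity and the negative derivative at \<open>1\<close>,
 and the moments of the first generation are sums of the mixed moments. This turns almost
 sure convergence of tuple sums into convergence in \<open>L\<^sup>2\<close>. Finally \<open>W_inf\<close> is positive on
 survival, so that the law of the split generation of a uniform tuple, a ratio of two tuple sums,
 converges by dominated convergence.
\<close>

section \<open>Measurability of functionals of the environment\<close>

definition env_space :: "environment measure" where
 "env_space = (\<Pi>\<^sub>M u\<in>UNIV. real_seqs)"

definition subtree :: "environment \<Rightarrow> vertex \<Rightarrow> environment" where
 "subtree E u = (\<lambda>v. E (u @ v))"

lemma space_real_seqs [simp]: "space real_seqs = UNIV"
 by (simp add: real_seqs_def)

lemma space_env_space [simp]: "space env_space = UNIV"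
 by (simp add: env_space_def space_PiM)

text \<open>
 Entries beyond the end of a list are unspecified, but they depend only on how far beyond the end
 they are; hence they do not disturb measurability.
\<close>

lemma nth_beyond: "length xs \<le> i \<Longrightarrow> xs ! i = [] ! (i - length xs)"
proof (induction xs arbitrary: i)
 case (Cons x xs)
 then show ?case by (cases i) auto
qed simp

lemma real_seqs_coding_measurable:
 "(\<lambda>xs. (length xs, \<lambda>i. if i < length xs then xs ! i else 0)) \<in>
   real_seqs \<rightarrow>\<^sub>M (count_space UNIV \<Otimes>\<^sub>M (\<Pi>\<^sub>M i\<in>(UNIV :: nat set). (borel :: real measure)))"
 unfolding real_seqs_def by (rule measurable_vimage_algebra1) (auto simp: space_pair_measure space_PiM)

lemma length_measurable [measurable]: "length \<in> real_seqs \<rightarrow>\<^sub>M count_space UNIV"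
 using measurable_compose[OF real_seqs_coding_measurable measurable_fst] by simp

lemma nth_measurable [measurable]: "(\<lambda>xs. xs ! i) \<in> borel_measurable real_seqs"
proof -
 have [measurable]: "(\<lambda>xs. if i < length xs then xs ! i else 0) \<in> borel_measurable real_seqs"
  using measurable_compose[OF measurable_compose[OF real_seqs_coding_measurable measurable_snd]
    measurable_component_singleton[of i UNIV]]
  by simp
 have *: "(\<lambda>xs. xs ! i) =
   (\<lambda>xs. if i < length xs then (if i < length xs then xs ! i else 0) else ([] :: real list) ! (i - length xs))"
  using nth_beyond[of _ i] by (auto simp: fun_eq_iff not_less)
 have [measurable]: "(\<lambda>xs. ([] :: real list) ! (i - length xs)) \<in> borel_measurable real_seqs"
  by (rule measurable_compose[OF length_measurable]) simp
 have [measurable]: "Measurable.pred real_seqs (\<lambda>xs. i < length xs)"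
  by (rule measurable_compose[OF length_measurable]) simp
 show ?thesis
  unfolding * by (rule measurable_If) measurable
qed

lemma env_component_measurable [measurable]: "(\<lambda>E. E u) \<in> env_space \<rightarrow>\<^sub>M real_seqs"
 unfolding env_space_def by (rule measurable_component_singleton) simp

lemma into_env_spaceI:
 assumes "\<And>u. (\<lambda>x. f x u) \<in> N \<rightarrow>\<^sub>M real_seqs"
 shows "f \<in> N \<rightarrow>\<^sub>M env_space"
 unfolding env_space_def
 using measurable_PiM_single'[of UNIV "\<lambda>u x. f x u" N "\<lambda>_. real_seqs"] assms
 by simp

lemma subtree_measurable [measurable]: "(\<lambda>E. subtree E u) \<in> env_space \<rightarrow>\<^sub>M env_space"
 by (rule into_env_spaceI) (simp add: subtree_def)

lemma subtree_Nil [simp]: "subtree E [] = E"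
 by (simp add: subtree_def)

lemma subtree_subtree [simp]: "subtree (subtree E u) v = subtree E (u @ v)"
 by (simp add: subtree_def)

lemma subtree_root [simp]: "subtree E u [] = E u"
 by (simp add: subtree_def)

lemma subtree_apply: "subtree E u v = E (u @ v)"
 by (simp add: subtree_def)

lemma tree_measurable [measurable]: "Measurable.pred env_space (\<lambda>E. u \<in> tree E)"
 unfolding tree_def by measurable

lemma potential_measurable [measurable]: "(\<lambda>E. potential E u) \<in> borel_measurable env_space"
 unfolding potential_def by measurable

lemma sum_lessThan_measurable:
 fixes f :: "nat \<Rightarrow> 'a \<Rightarrow> 'b :: {second_countable_topology, topological_comm_monoid_add}"
 assumes [measurable]: "n \<in> N \<rightarrow>\<^sub>M count_space UNIV" "\<And>i. f i \<in> borel_measurable N"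
 shows "(\<lambda>x. \<Sum>i<n x. f i x) \<in> borel_measurable N"
 by (rule measurable_compose_countable[where g = n and f = "\<lambda>m x. \<Sum>i<m. f i x"]) measurable

text \<open>
 A finite random set of vertices takes countably many values, so that membership of each single
 vertex being an event makes every functional of the set measurable.
\<close>

lemma measurable_compose_finite_set:
 fixes A :: "'a \<Rightarrow> 'b :: countable set"
 assumes A: "\<And>x. Measurable.pred N (\<lambda>w. x \<in> A w)" and fin: "\<And>w. finite (A w)"
  and f: "\<And>S. finite S \<Longrightarrow> f S \<in> N \<rightarrow>\<^sub>M L"
 shows "(\<lambda>w. f (A w) w) \<in> N \<rightarrow>\<^sub>M L"
proof (rule measurable_compose_countable'[where I = "Collect finite"])
 show "countable (Collect finite :: 'b set set)"
  using uncountable_def countable_Collect_finite by blast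
 then show "A \<in> N \<rightarrow>\<^sub>M count_space (Collect finite)"
 proof (subst measurable_count_space_eq_countable, safe)
  fix S :: "'b set"
  have "A -` {S} \<inter> space N = {w\<in>space N. \<forall>x. (x \<in> A w) = (x \<in> S)}"
   by auto
  also have "\<dots> \<in> sets N"
   using A by measurable
  finally show "A -` {S} \<inter> space N \<in> sets N" .
 qed (auto simp: fin)
qed (use f in auto)

lemma tree_Nil [simp]: "[] \<in> tree E"
 by (simp add: tree_def)

lemma tree_Cons: "i # u \<in> tree E \<longleftrightarrow> i < length (E []) \<and> u \<in> tree (subtree E [i])"
 by (simp add: tree_def subtree_apply All_less_Suc2)

lemma potential_Nil [simp]: "potential E [] = 0"
 by (simp add: potential_def)

lemma potential_Cons: "potential E (i # u) = E [] ! i + potential (subtree E [i]) u"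
 by (simp add: potential_def subtree_apply sum.lessThan_Suc_shift del: sum.lessThan_Suc)

lemma potential_append: "potential E (u @ v) = potential E u + potential (subtree E u) v"
 by (induction u arbitrary: E) (auto simp: potential_Cons)

lemma tree_append: "u @ v \<in> tree E \<longleftrightarrow> u \<in> tree E \<and> v \<in> tree (subtree E u)"
 by (induction u arbitrary: E) (auto simp: tree_Cons)

lemma generation_0 [simp]: "generation E 0 = {[]}"
 by (auto simp: generation_def)

lemma generation_Suc:
 "generation E (Suc l) = (\<Union>i<length (E []). (#) i ` generation (subtree E [i]) l)"
 by (auto simp: generation_def tree_Cons length_Suc_conv)

lemma finite_generation [simp, intro]: "finite (generation E l)"
 by (induction l arbitrary: E) (auto simp: generation_Suc)

lemma sum_generation_Suc:
 "(\<Sum>x\<in>generation E (Suc l). f x) =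
   (\<Sum>i<length (E []). \<Sum>x\<in>generation (subtree E [i]) l. f (i # x))"
 unfolding generation_Suc
 by (subst sum.UNION_disjoint) (auto simp: sum.reindex)

lemma sum_generation_add:
 "(\<Sum>x\<in>generation E (l + m). f x) =
   (\<Sum>x\<in>generation E l. \<Sum>y\<in>generation (subtree E x) m. f (x @ y))"
 by (induction l arbitrary: E f) (auto simp: sum_generation_Suc)

lemma mem_generation_measurable [measurable]: "Measurable.pred env_space (\<lambda>E. u \<in> generation E l)"
 unfolding generation_def by measurable

lemma generation_sum_measurable [measurable]:
 fixes f :: "vertex \<Rightarrow> environment \<Rightarrow> 'b :: {second_countable_topology, topological_comm_monoid_add}"
 assumes "\<And>x. f x \<in> borel_measurable env_space"
 shows "(\<lambda>E. \<Sum>x\<in>generation E l. f x E) \<in> borel_measurable env_space"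
proof -
 note [measurable] = assms
 show ?thesis
  by (rule measurable_compose_finite_set[where f = "\<lambda>S E. \<Sum>x\<in>S. f x E"]) (simp_all add: assms)
qed


section \<open>Branching sums\<close>

definition branch_sum :: "(environment \<Rightarrow> real) \<Rightarrow> environment \<Rightarrow> real" where
 "branch_sum F E = (\<Sum>i<length (E []). exp (- (E [] ! i)) * F (subtree E [i]))"

definition gen_sum :: "nat \<Rightarrow> (environment \<Rightarrow> real) \<Rightarrow> environment \<Rightarrow> real" where
 "gen_sum l F E = (\<Sum>x\<in>generation E l. exp (- potential E x) * F (subtree E x))"

lemma gen_sum_0 [simp]: "gen_sum 0 F = F"
 by (simp add: gen_sum_def fun_eq_iff)

lemma exp_uminus_add: "exp (- (a + b)) = exp (- a) * exp (- b :: real)"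
 by (simp add: exp_add[symmetric])

lemma gen_sum_Suc: "gen_sum (Suc l) F = branch_sum (gen_sum l F)"
 by (simp add: gen_sum_def branch_sum_def fun_eq_iff sum_generation_Suc potential_Cons exp_uminus_add
   sum_distrib_left mult.assoc del: minus_add_distrib)

lemma gen_sum_add: "gen_sum (l + m) F = gen_sum l (gen_sum m F)"
 by (simp add: gen_sum_def fun_eq_iff sum_generation_add potential_append exp_uminus_add
   sum_distrib_left mult.assoc del: minus_add_distrib)

lemma branch_sum_measurable [measurable]:
 assumes [measurable]: "F \<in> borel_measurable env_space"
 shows "branch_sum F \<in> borel_measurable env_space"
 unfolding branch_sum_def by (rule sum_lessThan_measurable) measurable

lemma gen_sum_measurable [measurable]:
 assumes [measurable]: "F \<in> borel_measurable env_space"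
 shows "gen_sum l F \<in> borel_measurable env_space"
 by (induction l) (auto simp: gen_sum_Suc)

lemma branch_sum_nonneg: "(\<And>E. F E \<ge> 0) \<Longrightarrow> branch_sum F E \<ge> 0"
 by (auto simp: branch_sum_def intro!: sum_nonneg)

lemma gen_sum_nonneg: "(\<And>E. F E \<ge> 0) \<Longrightarrow> gen_sum l F E \<ge> 0"
 by (auto simp: gen_sum_def intro!: sum_nonneg)


section \<open>The branching property\<close>

lemma sum_lessThan_eq_suminf:
 fixes g :: "nat \<Rightarrow> ennreal"
 shows "(\<Sum>i<n. g i) = (\<Sum>i. if i < n then g i else 0)"
 by (subst suminf_finite[where N = "{..<n}"]) auto

text \<open>
 The environment \<open>E\<close> with the subtree of the child \<open>i\<close> of the root replaced by \<open>E'\<close>.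
\<close>

definition graft :: "nat \<Rightarrow> environment \<Rightarrow> environment \<Rightarrow> environment" where
 "graft i E E' u = (if u \<noteq> [] \<and> hd u = i then E' (tl u) else E u)"

lemma graft_root [simp]: "graft i E E' [] = E []"
 by (simp add: graft_def)

lemma subtree_graft: "subtree (graft i E E') [j] = (if i = j then E' else subtree E [j])"
 by (auto simp: graft_def subtree_apply fun_eq_iff)

text \<open>
 The intensity of the offspring process, weighted by \<open>exp (- V)\<close>, is assumed to be a probability
 measure \<open>\<nu>\<close>; it is the step law of the spine in the many-to-one formula.
\<close>

locale branching_law = prob_space \<mu> for \<mu> :: "real list measure" +
 fixes \<nu> :: "real measure"
 assumes sets_\<mu> [measurable_cong]: "sets \<mu> = sets real_seqs"
  and prob_space_\<nu>: "prob_space \<nu>"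
  and sets_\<nu> [measurable_cong]: "sets \<nu> = sets borel"
  and nn_integral_\<nu>: "\<And>h :: real \<Rightarrow> ennreal. h \<in> borel_measurable borel \<Longrightarrow>
   (\<integral>\<^sup>+a. h a \<partial>\<nu>) = (\<integral>\<^sup>+xs. (\<Sum>i<length xs. ennreal (exp (- (xs ! i))) * h (xs ! i)) \<partial>\<mu>)"
begin

definition GW :: "environment measure" where
 "GW = (\<Pi>\<^sub>M u\<in>UNIV. \<mu>)"

sublocale nu: prob_space \<nu> by (rule prob_space_\<nu>)

sublocale GW: prob_space GW
 unfolding GW_def by (rule prob_space_PiM) unfold_locales

abbreviation mean :: "(environment \<Rightarrow> real) \<Rightarrow> ennreal" (binder "\<bbbE>" 10) where
 "mean F \<equiv> \<integral>\<^sup>+E. ennreal (F E) \<partial>GW"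

abbreviation nn_mean :: "(environment \<Rightarrow> ennreal) \<Rightarrow> ennreal" (binder "\<bbbE>\<^sup>+" 10) where
 "nn_mean F \<equiv> \<integral>\<^sup>+E. F E \<partial>GW"

lemma sets_GW [measurable_cong]: "sets GW = sets env_space"
 unfolding GW_def env_space_def by (rule sets_PiM_cong) (auto simp: sets_\<mu>)

lemma space_GW [simp]: "space GW = UNIV"
 using sets_eq_imp_space_eq[OF sets_GW] by simp

lemma space_\<mu> [simp]: "space \<mu> = UNIV"
 using sets_eq_imp_space_eq[OF sets_\<mu>] by simp

lemma graft_measurable: "(\<lambda>(E, E'). graft i E E') \<in> GW \<Otimes>\<^sub>M GW \<rightarrow>\<^sub>M GW"
proof -
 have "(\<lambda>(E, E'). graft i E E') \<in> GW \<Otimes>\<^sub>M GW \<rightarrow>\<^sub>M env_space"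
 proof (rule into_env_spaceI)
  fix u
  show "(\<lambda>x. (case x of (E, E') \<Rightarrow> graft i E E') u) \<in> GW \<Otimes>\<^sub>M GW \<rightarrow>\<^sub>M real_seqs"
   by (cases "u \<noteq> [] \<and> hd u = i") (auto simp: graft_def split_beta)
 qed
 then show ?thesis
  by (simp cong: measurable_cong_sets add: sets_GW)
qed

text \<open>
 The branching property: the subtree of a child may be resampled independently of all the rest.
\<close>

lemma distr_graft: "distr (GW \<Otimes>\<^sub>M GW) GW (\<lambda>(E, E'). graft i E E') = GW"
proof -
 interpret PP: pair_prob_space GW GW by unfold_locales
 have "distr (GW \<Otimes>\<^sub>M GW) GW (\<lambda>(E, E'). graft i E E') = (\<Pi>\<^sub>M u\<in>(UNIV::vertex set). \<mu>)"
 proof (rule measure_eqI_PiM_infinite)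
  show "sets (distr (GW \<Otimes>\<^sub>M GW) GW (\<lambda>(E, E'). graft i E E')) = sets (\<Pi>\<^sub>M u\<in>UNIV. \<mu>)"
   by (simp add: GW_def)
  show "finite_measure (distr (GW \<Otimes>\<^sub>M GW) GW (\<lambda>(E, E'). graft i E E'))"
   by (rule prob_space.finite_measure[OF PP.prob_space_distr[OF graft_measurable]])
 next
  fix A and J :: "vertex set"
  assume J: "finite J" and A: "\<And>i. i \<in> J \<Longrightarrow> A i \<in> sets \<mu>"
  define J1 where "J1 = {u\<in>J. \<not> (u \<noteq> [] \<and> hd u = i)}"
  define J2 where "J2 = {v. i # v \<in> J}"
  have J2: "finite J2"
   unfolding J2_def using finite_vimageI[OF J, of "(#) i"] by (simp add: vimage_def)
  have Jeq: "J = J1 \<union> (#) i ` J2" "J1 \<inter> (#) i ` J2 = {}"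
   unfolding J1_def J2_def by (auto simp: neq_Nil_conv)
  let ?C = "\<lambda>K B. prod_emb UNIV (\<lambda>_. \<mu>) K (Pi\<^sub>E K B)"
  have C: "?C K B = {E. \<forall>u\<in>K. E u \<in> B u}" for K :: "vertex set" and B
   by (auto simp: prod_emb_def PiE_iff restrict_def extensional_def)
  have CS: "?C K B \<in> sets GW" if "finite K" "\<And>u. u \<in> K \<Longrightarrow> B u \<in> sets \<mu>" for K :: "vertex set" and B
   unfolding GW_def using that by (intro sets_PiM_I) auto
  have em: "emeasure GW (?C K B) = (\<Prod>u\<in>K. emeasure \<mu> (B u))"
   if "finite K" "\<And>u. u \<in> K \<Longrightarrow> B u \<in> sets \<mu>" for K :: "vertex set" and B
   unfolding GW_def using that by (intro emeasure_PiM_emb) (auto intro: prob_space_axioms)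
  have g1: "graft i E E' u = E u" if "u \<in> J1" for E E' u
   using that by (auto simp: graft_def J1_def)
  have g2: "graft i E E' (i # v) = E' v" for E E' v
   by (simp add: graft_def)
  have *: "(\<lambda>(E, E'). graft i E E') -` ?C J A \<inter> space (GW \<Otimes>\<^sub>M GW) =
    ?C J1 A \<times> ?C J2 (\<lambda>v. A (i # v))"
   unfolding C Jeq(1) by (auto simp: space_pair_measure g1 g2 ball_Un)
  have "emeasure (distr (GW \<Otimes>\<^sub>M GW) GW (\<lambda>(E, E'). graft i E E')) (?C J A) =
    emeasure (GW \<Otimes>\<^sub>M GW) (?C J1 A \<times> ?C J2 (\<lambda>v. A (i # v)))"
   using J A by (subst emeasure_distr[OF graft_measurable CS]) (auto simp: *)
  also have "\<dots> = emeasure GW (?C J1 A) * emeasure GW (?C J2 (\<lambda>v. A (i # v)))"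
   by (intro GW.emeasure_pair_measure_Times CS) (use J2 J A in \<open>auto simp: J1_def J2_def\<close>)
  also have "\<dots> = (\<Prod>u\<in>J1. emeasure \<mu> (A u)) * (\<Prod>v\<in>J2. emeasure \<mu> (A (i # v)))"
   by (subst (1 2) em) (use J2 J A in \<open>auto simp: J1_def J2_def\<close>)
  also have "\<dots> = (\<Prod>u\<in>J. emeasure \<mu> (A u))"
  proof -
   have "finite J1"
    using J by (simp add: J1_def)
   then show ?thesis
    unfolding Jeq(1) by (subst prod.union_disjoint) (use J2 Jeq(2) in \<open>auto simp: prod.reindex\<close>)
  qed
  also have "\<dots> = emeasure (\<Pi>\<^sub>M u\<in>UNIV. \<mu>) (?C J A)"
   using em[of J A] J A by (simp add: GW_def)
  finally show "emeasure (distr (GW \<Otimes>\<^sub>M GW) GW (\<lambda>(E, E'). graft i E E')) (?C J A) =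
    emeasure (\<Pi>\<^sub>M u\<in>UNIV. \<mu>) (?C J A)" .
 qed (rule refl)
 then show ?thesis
  by (simp add: GW_def)
qed

lemma nn_integral_graft:
 assumes [measurable]: "F \<in> borel_measurable env_space"
 shows "(\<bbbE>\<^sup>+E. F E) = (\<bbbE>\<^sup>+E. \<integral>\<^sup>+E'. F (graft i E E') \<partial>GW)"
proof -
 have m: "(\<lambda>(E, E'). F (graft i E E')) \<in> borel_measurable (GW \<Otimes>\<^sub>M GW)"
  using measurable_compose[OF graft_measurable, of F borel i] by (simp add: split_beta sets_GW cong: measurable_cong_sets)
 have "(\<bbbE>\<^sup>+E. F E) = (\<integral>\<^sup>+E. F E \<partial>distr (GW \<Otimes>\<^sub>M GW) GW (\<lambda>(E, E'). graft i E E'))"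
  by (simp add: distr_graft)
 also have "\<dots> = (\<integral>\<^sup>+x. F (case x of (E, E') \<Rightarrow> graft i E E') \<partial>(GW \<Otimes>\<^sub>M GW))"
  by (rule nn_integral_distr[OF graft_measurable]) measurable
 also have "\<dots> = (\<bbbE>\<^sup>+E. \<integral>\<^sup>+E'. F (graft i E E') \<partial>GW)"
  using GW.nn_integral_fst[OF m] by (simp add: case_prod_unfold)
 finally show ?thesis .
qed

lemma nn_integral_subtree_indep:
 assumes [measurable]: "\<Theta> \<in> borel_measurable env_space" "F \<in> borel_measurable env_space"
  and \<Theta>: "\<And>E E'. \<Theta> (graft i E E') = \<Theta> E"
 shows "(\<bbbE>\<^sup>+E. \<Theta> E * F (subtree E [i])) = (\<bbbE>\<^sup>+E. \<Theta> E) * (\<bbbE>\<^sup>+E. F E)"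
 by (subst nn_integral_graft[where i = i])
   (simp_all add: \<Theta> subtree_graft nn_integral_cmult nn_integral_multc)

lemma nn_integral_root:
 assumes [measurable]: "h \<in> borel_measurable real_seqs"
 shows "(\<bbbE>\<^sup>+E. h (E [])) = (\<integral>\<^sup>+xs. h xs \<partial>\<mu>)"
proof -
 interpret product_prob_space "\<lambda>_. \<mu>" "UNIV :: vertex set" by unfold_locales
 have "distr GW \<mu> (\<lambda>E. E []) = \<mu>"
  unfolding GW_def by (rule PiM_component) simp
 then have "(\<integral>\<^sup>+xs. h xs \<partial>\<mu>) = (\<integral>\<^sup>+xs. h xs \<partial>distr GW \<mu> (\<lambda>E. E []))"
  by simp
 also have "\<dots> = (\<bbbE>\<^sup>+E. h (E []))"
 proof (rule nn_integral_distr)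
  show "(\<lambda>E. E []) \<in> GW \<rightarrow>\<^sub>M \<mu>"
   using env_component_measurable[of "[]"] by (simp add: sets_GW sets_\<mu> cong: measurable_cong_sets)
 qed (use assms in \<open>simp add: sets_\<mu> cong: measurable_cong_sets\<close>)
 finally show ?thesis by simp
qed

lemma nn_integral_children:
 assumes [measurable]: "(\<lambda>(a, E). f a E) \<in> borel_measurable (borel \<Otimes>\<^sub>M env_space)"
 shows "(\<bbbE>\<^sup>+E. (\<Sum>i<length (E []). ennreal (exp (- (E [] ! i))) * f (E [] ! i) (subtree E [i]))) =
  (\<integral>\<^sup>+a. \<integral>\<^sup>+E. f a E \<partial>GW \<partial>\<nu>)"
proof -
 have f2 [measurable]: "(\<lambda>x. f (g x) (h x)) \<in> borel_measurable N"
  if "g \<in> borel_measurable N" "h \<in> N \<rightarrow>\<^sub>M env_space" for g h and N :: "'z measure"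
  using measurable_compose[OF measurable_Pair[OF that], of "\<lambda>(a, E). f a E" borel] by simp
 have [measurable]: "(\<lambda>a. \<integral>\<^sup>+E. f a E \<partial>GW) \<in> borel_measurable borel"
  by measurable
 let ?g = "\<lambda>i E. if i < length (E []) then ennreal (exp (- (E [] ! i))) else 0"
 have "(\<bbbE>\<^sup>+E. (\<Sum>i<length (E []). ennreal (exp (- (E [] ! i))) * f (E [] ! i) (subtree E [i]))) =
   (\<bbbE>\<^sup>+E. (\<Sum>i. ?g i E * f (E [] ! i) (subtree E [i])))"
  by (auto simp: sum_lessThan_eq_suminf intro!: nn_integral_cong suminf_cong)
 also have "\<dots> = (\<Sum>i. \<integral>\<^sup>+E. ?g i E * f (E [] ! i) (subtree E [i]) \<partial>GW)"
  by (rule nn_integral_suminf) measurable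
 also have "\<dots> = (\<Sum>i. \<integral>\<^sup>+E. ?g i E * (\<bbbE>\<^sup>+E'. f (E [] ! i) E') \<partial>GW)"
 proof (rule suminf_cong)
  fix i
  show "(\<bbbE>\<^sup>+E. ?g i E * f (E [] ! i) (subtree E [i])) =
    (\<bbbE>\<^sup>+E. ?g i E * (\<bbbE>\<^sup>+E'. f (E [] ! i) E'))"
   by (subst nn_integral_graft[where i = i])
     (auto simp: subtree_graft nn_integral_cmult intro!: nn_integral_cong)
 qed
 also have "\<dots> = (\<bbbE>\<^sup>+E. (\<Sum>i. ?g i E * (\<bbbE>\<^sup>+E'. f (E [] ! i) E')))"
  by (rule nn_integral_suminf[symmetric]) measurable
 also have "\<dots> = (\<bbbE>\<^sup>+E. (\<Sum>i<length (E []). ennreal (exp (- (E [] ! i))) * (\<bbbE>\<^sup>+E'. f (E [] ! i) E')))"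
  by (auto simp: sum_lessThan_eq_suminf intro!: nn_integral_cong suminf_cong)
 also have "\<dots> = (\<integral>\<^sup>+a. \<integral>\<^sup>+E. f a E \<partial>GW \<partial>\<nu>)"
  by (subst nn_integral_\<nu>, measurable,
    rule nn_integral_root[where h = "\<lambda>xs. \<Sum>i<length xs. ennreal (exp (- (xs ! i))) * (\<bbbE>\<^sup>+E'. f (xs ! i) E')"])
    (rule sum_lessThan_measurable; measurable)
 finally show ?thesis .
qed

lemma nn_integral_branch_sum:
 assumes [measurable]: "F \<in> borel_measurable env_space" and F: "\<And>E. F E \<ge> 0"
 shows "(\<bbbE>E. branch_sum F E) = (\<bbbE>E. F E)"
 using nn_integral_children[of "\<lambda>_ E. ennreal (F E)"] nu.emeasure_space_1 F
 by (simp add: branch_sum_def sum_ennreal[symmetric] ennreal_mult' del: sum_ennreal)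

lemma nn_integral_gen_sum:
 assumes [measurable]: "F \<in> borel_measurable env_space" and F: "\<And>E. F E \<ge> 0"
 shows "(\<bbbE>E. gen_sum l F E) = (\<bbbE>E. F E)"
 by (induction l) (use F in \<open>simp_all add: gen_sum_Suc nn_integral_branch_sum gen_sum_nonneg\<close>)

end


lemma ennreal_sum_mult_split:
 fixes a b :: "nat \<Rightarrow> real"
 assumes a: "\<And>i. a i \<ge> 0" and b: "\<And>i. b i \<ge> 0"
 shows "ennreal ((\<Sum>i<n. a i) * (\<Sum>j<n. b j)) = (\<Sum>i<n. ennreal (a i * b i)) +
  (\<Sum>i. \<Sum>j. if i < n \<and> j < n \<and> i \<noteq> j then ennreal (a i * b j) else 0)"
proof -
 have inner: "(\<Sum>j. if i < n \<and> j < n \<and> i \<noteq> j then ennreal (a i * b j) else 0) =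
   (if i < n then \<Sum>j\<in>{..<n} - {i}. ennreal (a i * b j) else 0)" for i
 proof (cases "i < n")
  case True
  have "(\<Sum>j. if i < n \<and> j < n \<and> i \<noteq> j then ennreal (a i * b j) else 0) =
    (\<Sum>j\<in>{..<n} - {i}. if i < n \<and> j < n \<and> i \<noteq> j then ennreal (a i * b j) else 0)"
   by (rule suminf_finite) auto
  also have "\<dots> = (\<Sum>j\<in>{..<n} - {i}. ennreal (a i * b j))"
   using True by (intro sum.cong) auto
  finally show ?thesis
   using True by simp
 qed simp
 have "(\<Sum>i<n. a i) * (\<Sum>j<n. b j) = (\<Sum>i<n. a i * b i + (\<Sum>j\<in>{..<n} - {i}. a i * b j))"
  unfolding sum_product by (intro sum.cong refl, subst sum.remove) auto
 then have "ennreal ((\<Sum>i<n. a i) * (\<Sum>j<n. b j)) =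
   (\<Sum>i<n. ennreal (a i * b i)) + (\<Sum>i<n. \<Sum>j\<in>{..<n} - {i}. ennreal (a i * b j))"
  using a b by (simp add: sum.distrib ennreal_plus sum_nonneg)
 then show ?thesis
  by (simp only: inner sum_lessThan_eq_suminf[symmetric])
qed

context branching_law
begin

lemma AE_subtrees_generation:
 assumes "AE E in GW. P E"
 shows "AE E in GW. \<forall>x\<in>generation E l. P (subtree E x)"
proof -
 obtain N where N: "{E. \<not> P E} \<subseteq> N" "emeasure GW N = 0" "N \<in> sets GW"
  using assms by (auto elim!: AE_E simp: null_sets_def)
 then have [measurable]: "N \<in> sets env_space"
  by (simp add: sets_GW)
 have "(\<bbbE>E. gen_sum l (indicator N) E) = (\<bbbE>E. indicator N E)"
  by (rule nn_integral_gen_sum) auto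
 also have "\<dots> = 0"
  using N(2,3) by (simp add: ennreal_indicator)
 finally have "AE E in GW. ennreal (gen_sum l (indicator N) E) = 0"
  by (subst (asm) nn_integral_0_iff_AE) measurable
 then show ?thesis
 proof (rule AE_mp, intro AE_I2 impI ballI)
  fix E x assume *: "ennreal (gen_sum l (indicator N) E) = 0" and x: "x \<in> generation E l"
  have "gen_sum l (indicator N) E = 0"
   using * gen_sum_nonneg[of "indicator N" l E] by simp
  then have "exp (- potential E x) * indicator N (subtree E x) = (0::real)"
   unfolding gen_sum_def using x by (subst (asm) sum_nonneg_eq_0_iff) auto
  then show "P (subtree E x)"
   using N(1) by (auto simp: indicator_def split: if_splits)
 qed
qed

text \<open>
 Almost sure properties are inherited by all subtrees at once: by the many-to-one identity the
 expected weighted number of bad vertices in any generation is zero.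
\<close>

lemma AE_subtrees:
 assumes "AE E in GW. P E"
 shows "AE E in GW. \<forall>x\<in>tree E. P (subtree E x)"
proof -
 have "AE E in GW. \<forall>l. \<forall>x\<in>generation E l. P (subtree E x)"
  using AE_subtrees_generation[OF assms] by (simp add: AE_all_countable)
 then show ?thesis
  by (rule AE_mp) (auto simp: generation_def)
qed

text \<open>
 Together with \<open>\<rho>\<close> below these are the weights of the pairs of distinct and of equal children in the
 second moment of a branching sum.
\<close>

definition offdiag :: ennreal where
 "offdiag = (\<Sum>i. \<Sum>j. \<integral>\<^sup>+E. (if i < length (E []) \<and> j < length (E []) \<and> i \<noteq> j
   then ennreal (exp (- (E [] ! i)) * exp (- (E [] ! j))) else 0) \<partial>GW)"

definition \<rho> :: ennreal where
 "\<rho> = (\<integral>\<^sup>+a. ennreal (exp (- a)) \<partial>\<nu>)"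

lemma nn_integral_branch_sum_mult:
 assumes [measurable]: "F \<in> borel_measurable env_space" "G \<in> borel_measurable env_space"
  and F: "\<And>E. F E \<ge> 0" and G: "\<And>E. G E \<ge> 0"
 shows "(\<bbbE>E. branch_sum F E * branch_sum G E) =
  \<rho> * (\<bbbE>E. F E * G E) +
  offdiag * ((\<bbbE>E. F E) * (\<bbbE>E. G E))"
proof -
 let ?A = "\<lambda>E i. exp (- (E [] ! i))"
 let ?h = "\<lambda>i j E. if i < length (E []) \<and> j < length (E []) \<and> i \<noteq> j
   then ennreal (exp (- (E [] ! i)) * exp (- (E [] ! j))) else 0"
 let ?D = "\<lambda>E. \<Sum>i<length (E []). ennreal (?A E i) * ennreal (?A E i * F (subtree E [i]) * G (subtree E [i]))"
 let ?O = "\<lambda>E. \<Sum>i. \<Sum>j. ?h i j E * ennreal (F (subtree E [i])) * ennreal (G (subtree E [j]))"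
 have [measurable]: "?D \<in> borel_measurable env_space"
  by (rule sum_lessThan_measurable) measurable
 have split: "ennreal (branch_sum F E * branch_sum G E) = ?D E + ?O E" for E
 proof -
  have "ennreal (branch_sum F E * branch_sum G E) =
    (\<Sum>i<length (E []). ennreal ((?A E i * F (subtree E [i])) * (?A E i * G (subtree E [i])))) +
    (\<Sum>i. \<Sum>j. if i < length (E []) \<and> j < length (E []) \<and> i \<noteq> j
     then ennreal ((?A E i * F (subtree E [i])) * (?A E j * G (subtree E [j]))) else 0)"
   unfolding branch_sum_def by (rule ennreal_sum_mult_split) (simp_all add: F G)
  also have "(\<lambda>i j. if i < length (E []) \<and> j < length (E []) \<and> i \<noteq> j
     then ennreal ((?A E i * F (subtree E [i])) * (?A E j * G (subtree E [j]))) else 0) =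
    (\<lambda>i j. ?h i j E * ennreal (F (subtree E [i])) * ennreal (G (subtree E [j])))"
  proof (intro ext)
   fix i j
   have "ennreal ((?A E i * F (subtree E [i])) * (?A E j * G (subtree E [j]))) =
     ennreal ((?A E i * ?A E j) * F (subtree E [i]) * G (subtree E [j]))"
    by (simp only: mult_ac)
   also have "\<dots> = ennreal (?A E i * ?A E j) * ennreal (F (subtree E [i])) * ennreal (G (subtree E [j]))"
    using F[of "subtree E [i]"] G[of "subtree E [j]"] by (simp only: ennreal_mult'' mult_nonneg_nonneg)
   finally show "(if i < length (E []) \<and> j < length (E []) \<and> i \<noteq> j
     then ennreal ((?A E i * F (subtree E [i])) * (?A E j * G (subtree E [j]))) else 0) =
    ?h i j E * ennreal (F (subtree E [i])) * ennreal (G (subtree E [j]))"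
    by simp
  qed
  also have "(\<lambda>i. ennreal ((?A E i * F (subtree E [i])) * (?A E i * G (subtree E [i])))) =
    (\<lambda>i. ennreal (?A E i) * ennreal (?A E i * F (subtree E [i]) * G (subtree E [i])))"
   by (intro ext) (simp add: ennreal_mult'[symmetric] mult_ac)
  finally show ?thesis .
 qed
 have "(\<bbbE>E. branch_sum F E * branch_sum G E) = (\<bbbE>\<^sup>+E. ?D E) + (\<bbbE>\<^sup>+E. ?O E)"
  unfolding split by (rule nn_integral_add) measurable
 also have "(\<bbbE>\<^sup>+E. ?D E) = (\<integral>\<^sup>+a. \<integral>\<^sup>+E. ennreal (exp (- a) * F E * G E) \<partial>GW \<partial>\<nu>)"
  by (rule nn_integral_children) measurable
 also have "\<dots> = \<rho> * (\<bbbE>E. F E * G E)"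
  unfolding \<rho>_def using F G by (simp add: ennreal_mult' mult.assoc nn_integral_cmult nn_integral_multc)
 also have "(\<bbbE>\<^sup>+E. ?O E) =
   (\<Sum>i. \<Sum>j. \<integral>\<^sup>+E. ?h i j E * ennreal (F (subtree E [i])) * ennreal (G (subtree E [j])) \<partial>GW)"
  by (simp add: nn_integral_suminf)
 also have "\<dots> = (\<Sum>i. \<Sum>j. (\<bbbE>\<^sup>+E. ?h i j E) *
   ((\<bbbE>E. F E) * (\<bbbE>E. G E)))"
 proof (intro suminf_cong)
  fix i j :: nat
  show "(\<bbbE>\<^sup>+E. ?h i j E * ennreal (F (subtree E [i])) * ennreal (G (subtree E [j]))) =
   (\<bbbE>\<^sup>+E. ?h i j E) * ((\<bbbE>E. F E) * (\<bbbE>E. G E))"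
  proof (cases "i = j")
   case False
   then show ?thesis
    by (subst nn_integral_subtree_indep, measurable, simp add: subtree_graft,
      subst nn_integral_subtree_indep, measurable, simp, simp add: mult.assoc)
  qed simp
 qed
 also have "\<dots> = offdiag * ((\<bbbE>E. F E) * (\<bbbE>E. G E))"
  unfolding offdiag_def by simp
 finally show ?thesis .
qed

end

abbreviation W :: "nat \<Rightarrow> environment \<Rightarrow> real" where
 "W n \<equiv> gen_sum n (\<lambda>_. 1)"

lemma W_nonneg: "W n E \<ge> 0"
 by (rule gen_sum_nonneg) simp

lemma W_inf_eq: "W_inf E = lim (\<lambda>n. W n E)"
 by (simp add: W_inf_def gen_sum_def)

lemma W_inf_measurable [measurable]: "W_inf \<in> borel_measurable env_space"
 unfolding W_inf_eq[abs_def] by measurable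

locale L2_branching_law = branching_law +
 assumes \<rho>_less_1: "\<rho> < 1"
  and W1_square: "(\<bbbE>E. (W 1 E)\<^sup>2) < \<infinity>"
begin

lemma offdiag_finite: "offdiag < \<infinity>"
proof -
 have "(\<bbbE>E. (W 1 E)\<^sup>2) = \<rho> + offdiag"
  using nn_integral_branch_sum_mult[of "\<lambda>_. 1" "\<lambda>_. 1"]
  by (simp add: gen_sum_Suc power2_eq_square GW.emeasure_space_1[simplified])
 then show ?thesis
  using W1_square by (auto simp: less_top)
qed

text \<open>
 Since the means agree, the contributions of pairs of distinct children cancel.
\<close>

lemma nn_integral_branch_sum_diff:
 assumes [measurable]: "F \<in> borel_measurable env_space" "G \<in> borel_measurable env_space"
  and F: "\<And>E. F E \<ge> 0" and G: "\<And>E. G E \<ge> 0"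
  and F2: "(\<bbbE>E. (F E)\<^sup>2) < \<infinity>" and G2: "(\<bbbE>E. (G E)\<^sup>2) < \<infinity>"
  and mean: "(\<bbbE>E. F E) = ennreal c" "(\<bbbE>E. G E) = ennreal c"
 shows "(\<bbbE>E. (branch_sum F E - branch_sum G E)\<^sup>2) =
   \<rho> * (\<bbbE>E. (F E - G E)\<^sup>2)"
proof -
 let ?I = "\<lambda>f. \<integral>\<^sup>+E. ennreal (f E) \<partial>GW"
 have expand: "?I (\<lambda>E. (f E - g E)\<^sup>2) + 2 * ?I (\<lambda>E. f E * g E) = ?I (\<lambda>E. f E * f E) + ?I (\<lambda>E. g E * g E)"
  if [measurable]: "f \<in> borel_measurable env_space" "g \<in> borel_measurable env_space"
   and fg: "\<And>E. f E \<ge> 0" "\<And>E. g E \<ge> 0" for f g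
 proof -
  have "?I (\<lambda>E. (f E - g E)\<^sup>2) + 2 * ?I (\<lambda>E. f E * g E) =
    (\<bbbE>\<^sup>+E. ennreal ((f E - g E)\<^sup>2) + 2 * ennreal (f E * g E))"
   by (simp add: nn_integral_add nn_integral_cmult)
  also have "\<dots> = (\<bbbE>\<^sup>+E. ennreal (f E * f E) + ennreal (g E * g E))"
  proof (rule nn_integral_cong)
   fix E
   have "ennreal ((f E - g E)\<^sup>2) + 2 * ennreal (f E * g E) = ennreal ((f E - g E)\<^sup>2 + 2 * (f E * g E))"
    using fg[of E] by (simp add: ennreal_plus ennreal_mult')
   also have "(f E - g E)\<^sup>2 + 2 * (f E * g E) = f E * f E + g E * g E"
    by (simp add: power2_eq_square algebra_simps)
   finally show "ennreal ((f E - g E)\<^sup>2) + 2 * ennreal (f E * g E) = ennreal (f E * f E) + ennreal (g E * g E)"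
    using fg[of E] by (simp add: ennreal_plus)
  qed
  also have "\<dots> = ?I (\<lambda>E. f E * f E) + ?I (\<lambda>E. g E * g E)"
   by (simp add: nn_integral_add)
  finally show ?thesis .
 qed
 define x where "x = 2 * (\<rho> * ?I (\<lambda>E. F E * G E) + offdiag * (ennreal c * ennreal c))"
 have FG: "?I (\<lambda>E. F E * G E) < \<infinity>"
 proof -
  have "?I (\<lambda>E. F E * G E) \<le> (\<bbbE>\<^sup>+E. ennreal ((F E)\<^sup>2) + ennreal ((G E)\<^sup>2))"
  proof (intro nn_integral_mono)
   fix E
   have "F E * G E \<le> (F E)\<^sup>2 + (G E)\<^sup>2"
    using sum_squares_bound[of "F E" "G E"] mult_nonneg_nonneg[OF F[of E] G[of E]] by (simp add: mult.assoc)
   then show "ennreal (F E * G E) \<le> ennreal ((F E)\<^sup>2) + ennreal ((G E)\<^sup>2)"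
    by (simp add: ennreal_plus[symmetric] ennreal_leI del: ennreal_plus)
  qed
  also have "\<dots> = ?I (\<lambda>E. (F E)\<^sup>2) + ?I (\<lambda>E. (G E)\<^sup>2)"
   by (rule nn_integral_add) measurable
  also have "\<dots> < \<infinity>"
   using F2 G2 by simp
  finally show ?thesis .
 qed
 have x: "x < top"
  unfolding x_def using FG offdiag_finite \<rho>_less_1
  by (auto simp: ennreal_mult_less_top intro: less_trans[OF _ ennreal_one_less_top])
 have "?I (\<lambda>E. (branch_sum F E - branch_sum G E)\<^sup>2) + x =
   ?I (\<lambda>E. branch_sum F E * branch_sum F E) + ?I (\<lambda>E. branch_sum G E * branch_sum G E)"
  unfolding x_def mean(1)[symmetric] using mean
  by (subst expand[symmetric]) (simp_all add: branch_sum_nonneg F G nn_integral_branch_sum_mult)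
 also have "\<dots> = \<rho> * (?I (\<lambda>E. F E * F E) + ?I (\<lambda>E. G E * G E)) + 2 * (offdiag * (ennreal c * ennreal c))"
  using mean by (simp add: nn_integral_branch_sum_mult F G distrib_left mult_2 add_ac)
 also have "\<dots> = \<rho> * ?I (\<lambda>E. (F E - G E)\<^sup>2) + x"
  unfolding x_def by (subst expand[symmetric]) (simp_all add: F G distrib_left mult_ac add_ac)
 finally show ?thesis
  using x by (auto simp: add.commute[of _ x] ennreal_add_left_cancel)
qed

lemma branch_sum_square_finite:
 assumes [measurable]: "F \<in> borel_measurable env_space" and F: "\<And>E. F E \<ge> 0"
  and F2: "(\<bbbE>E. (F E)\<^sup>2) < \<infinity>" and F1: "(\<bbbE>E. F E) < \<infinity>"
 shows "(\<bbbE>E. (branch_sum F E)\<^sup>2) < \<infinity>"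
proof -
 have "(\<bbbE>E. (branch_sum F E)\<^sup>2) = \<rho> * (\<bbbE>E. (F E)\<^sup>2) +
   offdiag * ((\<bbbE>E. F E) * (\<bbbE>E. F E))"
  using nn_integral_branch_sum_mult[of F F] F by (simp add: power2_eq_square)
 also have "\<dots> < \<infinity>"
  using F1 F2 offdiag_finite \<rho>_less_1
  by (auto simp: ennreal_mult_less_top intro: less_trans[OF _ ennreal_one_less_top])
 finally show ?thesis .
qed

text \<open>
 Two functionals with the same mean become indistinguishable when summed over late generations:
 given the first generations the differences are centred and independent, so that only the
 diagonal of the square survives, and it is damped by the factor \<open>\<rho> < 1\<close> in each generation.
\<close>

lemma nn_integral_gen_sum_diff:
 assumes [measurable]: "F \<in> borel_measurable env_space" "G \<in> borel_measurable env_space"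
  and F: "\<And>E. F E \<ge> 0" and G: "\<And>E. G E \<ge> 0"
  and F2: "(\<bbbE>E. (F E)\<^sup>2) < \<infinity>" and G2: "(\<bbbE>E. (G E)\<^sup>2) < \<infinity>"
  and mean: "(\<bbbE>E. F E) = ennreal c" "(\<bbbE>E. G E) = ennreal c"
 shows "(\<bbbE>E. (gen_sum l F E - gen_sum l G E)\<^sup>2) =
   \<rho> ^ l * (\<bbbE>E. (F E - G E)\<^sup>2)"
proof -
 have "(\<bbbE>E. (gen_sum l F E - gen_sum l G E)\<^sup>2) =
   \<rho> ^ l * (\<bbbE>E. (F E - G E)\<^sup>2) \<and>
   (\<bbbE>E. (gen_sum l F E)\<^sup>2) < \<infinity> \<and> (\<bbbE>E. (gen_sum l G E)\<^sup>2) < \<infinity>"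
 proof (induction l)
  case (Suc l)
  note m = nn_integral_gen_sum[of F l, OF _ F] nn_integral_gen_sum[of G l, OF _ G]
  have "(\<bbbE>E. (gen_sum (Suc l) F E - gen_sum (Suc l) G E)\<^sup>2) =
    \<rho> * (\<bbbE>E. (gen_sum l F E - gen_sum l G E)\<^sup>2)"
   unfolding gen_sum_Suc
   by (rule nn_integral_branch_sum_diff[where c = c]) (use Suc F G m mean in \<open>auto intro: gen_sum_nonneg\<close>)
  moreover have "(\<bbbE>E. (gen_sum (Suc l) F E)\<^sup>2) < \<infinity>"
    "(\<bbbE>E. (gen_sum (Suc l) G E)\<^sup>2) < \<infinity>"
   unfolding gen_sum_Suc
   by (rule branch_sum_square_finite; use Suc F G m mean in \<open>auto intro: gen_sum_nonneg\<close>)+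
  ultimately show ?case
   using Suc by (simp add: mult.assoc)
 qed (use F2 G2 in simp)
 then show ?thesis ..
qed

lemma nn_integral_W: "(\<bbbE>E. W n E) = 1"
 by (subst nn_integral_gen_sum) (simp_all add: GW.emeasure_space_1[simplified])

lemma W_square_finite: "(\<bbbE>E. (W n E)\<^sup>2) < \<infinity>"
proof (induction n)
 case (Suc n)
 then show ?case
  unfolding gen_sum_Suc by (intro branch_sum_square_finite) (auto simp: W_nonneg nn_integral_W)
qed (simp add: GW.emeasure_space_1[simplified])

lemma W_square_bounded: "\<exists>K\<ge>0. \<forall>n. (\<bbbE>E. (W n E)\<^sup>2) \<le> ennreal K"
proof -
 obtain r where r: "\<rho> = ennreal r" "0 \<le> r" "r < 1"
  using \<rho>_less_1 by (cases \<rho>) (auto simp: ennreal_less_one_iff)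
 obtain d where d: "offdiag = ennreal d" "0 \<le> d"
  using offdiag_finite by (cases offdiag) auto
 define K where "K = (1 + d) / (1 - r)"
 have "K * (1 - r) = 1 + d"
  using r by (simp add: K_def)
 then have K: "1 \<le> K" "r * K + d \<le> K"
 proof -
  have "K * 1 \<ge> K * (1 - r)" if "K \<ge> 0"
   using that r by (intro mult_left_mono) auto
  moreover have "K \<ge> 0"
   using r d by (simp add: K_def)
  ultimately show "1 \<le> K"
   using d \<open>K * (1 - r) = 1 + d\<close> by simp
  show "r * K + d \<le> K"
   using \<open>K * (1 - r) = 1 + d\<close> by (simp add: algebra_simps)
 qed
 have "(\<bbbE>E. (W n E)\<^sup>2) \<le> ennreal K" for n
 proof (induction n)
  case 0
  then show ?case
   using K by (simp add: GW.emeasure_space_1[simplified])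
 next
  case (Suc n)
  have "(\<bbbE>E. (W (Suc n) E)\<^sup>2) = \<rho> * (\<bbbE>E. (W n E)\<^sup>2) + offdiag"
   using nn_integral_branch_sum_mult[of "W n" "W n"]
   by (simp add: gen_sum_Suc W_nonneg nn_integral_W power2_eq_square)
  also have "\<dots> \<le> ennreal r * ennreal K + ennreal d"
   unfolding r(1) d(1) by (intro add_mono mult_left_mono Suc) auto
  also have "\<dots> = ennreal (r * K + d)"
   using r d K by (simp add: ennreal_mult ennreal_plus)
  also have "\<dots> \<le> ennreal K"
   using K by (intro ennreal_leI)
  finally show ?case .
 qed
 then show ?thesis
  using K by (intro exI[of _ K]) auto
qed

lemma nn_integral_abs_le_square:
 assumes [measurable]: "f \<in> borel_measurable GW" and r: "r > 0"
 shows "(\<bbbE>E. \<bar>f E\<bar>) \<le> ennreal r + ennreal (1 / r) * (\<bbbE>E. (f E)\<^sup>2)"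
proof -
 have "(\<bbbE>E. \<bar>f E\<bar>) \<le> (\<bbbE>\<^sup>+E. ennreal r + ennreal (1 / r) * ennreal ((f E)\<^sup>2))"
 proof (rule nn_integral_mono)
  fix E
  have "\<bar>f E\<bar> \<le> r + 1 / r * (f E)\<^sup>2"
  proof (cases "\<bar>f E\<bar> \<le> r")
   case False
   then have "r * \<bar>f E\<bar> \<le> \<bar>f E\<bar> * \<bar>f E\<bar>"
    using r by (intro mult_right_mono) auto
   then have "\<bar>f E\<bar> \<le> 1 / r * (f E)\<^sup>2"
    using r by (simp add: field_simps power2_eq_square abs_mult_self_eq)
   then show ?thesis
    using r by simp
  qed (use r in \<open>simp add: add_increasing2\<close>)
  then show "ennreal \<bar>f E\<bar> \<le> ennreal r + ennreal (1 / r) * ennreal ((f E)\<^sup>2)"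
   using r by (simp add: ennreal_mult'[symmetric] ennreal_plus[symmetric] ennreal_leI del: ennreal_plus)
 qed
 also have "\<dots> = ennreal r + ennreal (1 / r) * (\<bbbE>E. (f E)\<^sup>2)"
  using GW.emeasure_space_1 by (simp add: nn_integral_add nn_integral_cmult)
 finally show ?thesis .
qed

lemma W_increment_L2:
 obtains r K where "\<rho> = ennreal r" "0 \<le> r" "r < 1" "K \<ge> 0"
  "\<And>l n. (\<bbbE>E. (W (l + n) E - W l E)\<^sup>2) \<le> ennreal (K * r ^ l)"
proof -
 obtain r where r: "\<rho> = ennreal r" "0 \<le> r" "r < 1"
  using \<rho>_less_1 by (cases \<rho>) (auto simp: ennreal_less_one_iff)
 obtain K where K: "K \<ge> 0" "\<And>n. (\<bbbE>E. (W n E)\<^sup>2) \<le> ennreal K"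
  using W_square_bounded by auto
 have "(\<bbbE>E. (W (l + n) E - W l E)\<^sup>2) \<le> ennreal ((K + 1) * r ^ l)" for l n
 proof -
  have "(\<bbbE>E. (W (l + n) E - W l E)\<^sup>2) = \<rho> ^ l * (\<bbbE>E. (W n E - 1)\<^sup>2)"
   unfolding gen_sum_add
   by (rule nn_integral_gen_sum_diff[where c = 1])
     (use W_square_finite[of n] in \<open>simp_all add: W_nonneg nn_integral_W GW.emeasure_space_1[simplified]\<close>)
  also have "(\<bbbE>E. (W n E - 1)\<^sup>2) \<le> (\<bbbE>\<^sup>+E. ennreal ((W n E)\<^sup>2) + 1)"
  proof (rule nn_integral_mono)
   fix E
   have "(W n E - 1)\<^sup>2 \<le> (W n E)\<^sup>2 + 1"
    using W_nonneg[of n E] by (simp add: power2_eq_square algebra_simps)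
   then have "ennreal ((W n E - 1)\<^sup>2) \<le> ennreal ((W n E)\<^sup>2 + 1)"
    by (rule ennreal_leI)
   then show "ennreal ((W n E - 1)\<^sup>2) \<le> ennreal ((W n E)\<^sup>2) + 1"
    by (simp add: ennreal_plus)
  qed
  also have "\<dots> = (\<bbbE>E. (W n E)\<^sup>2) + 1"
   by (simp add: nn_integral_add GW.emeasure_space_1[simplified])
  also have "\<dots> \<le> ennreal (K + 1)"
   using K by (simp add: ennreal_plus add_mono)
  also have "\<rho> ^ l * ennreal (K + 1) = ennreal ((K + 1) * r ^ l)"
   using r K by (simp add: ennreal_power ennreal_mult'[symmetric] mult.commute del: ennreal_plus)
  finally show ?thesis
   by (simp add: mult_left_mono)
 qed
 then show ?thesis
  using that[of r "K + 1"] r K by auto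
qed

text \<open>
 The increments are geometrically small in \<open>L\<^sup>2\<close>, hence in \<open>L\<^sup>1\<close>, so that their sum converges
 absolutely almost surely.
\<close>

lemma AE_W_convergent: "AE E in GW. convergent (\<lambda>n. W n E)"
proof -
 obtain r K where "\<rho> = ennreal r" and r: "0 \<le> r" "r < 1" and K: "K \<ge> 0"
  and d: "\<And>l n. (\<bbbE>E. (W (l + n) E - W l E)\<^sup>2) \<le> ennreal (K * r ^ l)"
  by (rule W_increment_L2) (rule that)
 \<comment> \<open>any \<open>q < 1\<close> with \<open>r \<le> q\<^sup>2\<close> bounds the \<open>L\<^sup>1\<close> norms of the increments by a geometric series\<close>
 define q where "q = sqrt ((1 + r) / 2)"
 have q: "0 < q" "q < 1" "r \<le> q\<^sup>2"
  using r by (auto simp: q_def real_sqrt_lt_1_iff)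
 have "(\<bbbE>E. \<bar>W (l + 1) E - W l E\<bar>) \<le> ennreal ((1 + K) * q ^ l)" for l
 proof -
  have "(\<bbbE>E. \<bar>W (l + 1) E - W l E\<bar>) \<le>
    ennreal (q ^ l) + ennreal (1 / q ^ l) * (\<bbbE>E. (W (l + 1) E - W l E)\<^sup>2)"
   using q by (intro nn_integral_abs_le_square) auto
  also have "\<dots> \<le> ennreal (q ^ l) + ennreal (1 / q ^ l) * ennreal (K * r ^ l)"
   by (intro add_mono mult_left_mono d) auto
  also have "\<dots> = ennreal (q ^ l + 1 / q ^ l * (K * r ^ l))"
   using q K r by (simp add: ennreal_plus ennreal_mult'[symmetric])
  also have "\<dots> \<le> ennreal ((1 + K) * q ^ l)"
  proof (rule ennreal_leI)
   have "r ^ l \<le> (q\<^sup>2) ^ l"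
    using q r by (intro power_mono)
   then have "r ^ l \<le> q ^ l * q ^ l"
    by (simp add: power2_eq_square power_mult_distrib)
   then have "1 / q ^ l * (K * r ^ l) \<le> 1 / q ^ l * (K * (q ^ l * q ^ l))"
    using q K by (intro mult_left_mono) auto
   then show "q ^ l + 1 / q ^ l * (K * r ^ l) \<le> (1 + K) * q ^ l"
    using q by (simp add: field_simps)
  qed
  finally show ?thesis .
 qed
 then have "(\<Sum>l. \<integral>\<^sup>+E. ennreal \<bar>W (l + 1) E - W l E\<bar> \<partial>GW) \<le> (\<Sum>l. ennreal ((1 + K) * q ^ l))"
  by (intro suminf_le) auto
 also have "\<dots> = ennreal (\<Sum>l. (1 + K) * q ^ l)"
  using q K by (intro suminf_ennreal2 summable_mult) auto
 finally have "(\<bbbE>\<^sup>+E. (\<Sum>l. ennreal \<bar>W (l + 1) E - W l E\<bar>)) < \<infinity>"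
  by (subst nn_integral_suminf) (auto simp: less_top[symmetric] top_unique)
 then have "AE E in GW. (\<Sum>l. ennreal \<bar>W (l + 1) E - W l E\<bar>) \<noteq> \<infinity>"
  by (intro nn_integral_PInf_AE) auto
 then show ?thesis
 proof (rule AE_mp, intro AE_I2 impI)
  fix E assume "(\<Sum>l. ennreal \<bar>W (l + 1) E - W l E\<bar>) \<noteq> \<infinity>"
  then have "summable (\<lambda>l. \<bar>W (l + 1) E - W l E\<bar>)"
   by (intro summable_suminf_not_top) auto
  then have "summable (\<lambda>l. W (Suc l) E - W l E)"
   unfolding Suc_eq_plus1 by (rule summable_rabs_cancel)
  then have "convergent (\<lambda>n. \<Sum>l<n. W (Suc l) E - W l E)"
   by (simp add: summable_iff_convergent)
  then have "convergent (\<lambda>n. W n E - W 0 E)"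
   by (simp only: sum_lessThan_telescope[where f = "\<lambda>l. W l E"])
  then show "convergent (\<lambda>n. W n E)"
   using convergent_add_const_iff[of "- W 0 E" "\<lambda>n. W n E"] by (simp add: add.commute)
 qed
qed

lemma AE_W_tendsto: "AE E in GW. \<forall>u\<in>tree E. (\<lambda>n. W n (subtree E u)) \<longlonglongrightarrow> W_inf (subtree E u)"
proof -
 have "AE E in GW. (\<lambda>n. W n E) \<longlonglongrightarrow> W_inf E"
  using AE_W_convergent by (simp add: W_inf_eq convergent_LIMSEQ_iff)
 then show ?thesis
  by (rule AE_subtrees)
qed

lemma W_inf_L2:
 obtains r K where "\<rho> = ennreal r" "0 \<le> r" "r < 1" "K \<ge> 0"
  "\<And>l. (\<bbbE>E. (W_inf E - W l E)\<^sup>2) \<le> ennreal (K * r ^ l)"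
proof -
 obtain r K where r: "\<rho> = ennreal r" "0 \<le> r" "r < 1" and K: "K \<ge> 0"
  and d: "\<And>l n. (\<bbbE>E. (W (l + n) E - W l E)\<^sup>2) \<le> ennreal (K * r ^ l)"
  by (rule W_increment_L2) (rule that)
 have "(\<bbbE>E. (W_inf E - W l E)\<^sup>2) \<le> ennreal (K * r ^ l)" for l
 proof -
  have "AE E in GW. ennreal ((W_inf E - W l E)\<^sup>2) = liminf (\<lambda>n. ennreal ((W (l + n) E - W l E)\<^sup>2))"
   using AE_W_tendsto
  proof (rule AE_mp, intro AE_I2 impI)
   fix E assume "\<forall>u\<in>tree E. (\<lambda>n. W n (subtree E u)) \<longlonglongrightarrow> W_inf (subtree E u)"
   then have "(\<lambda>n. W n E) \<longlonglongrightarrow> W_inf E"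
    by (metis subtree_Nil tree_Nil)
   then have "(\<lambda>n. W (l + n) E) \<longlonglongrightarrow> W_inf E"
    by (subst add.commute) (rule LIMSEQ_ignore_initial_segment)
   then have "(\<lambda>n. ennreal ((W (l + n) E - W l E)\<^sup>2)) \<longlonglongrightarrow> ennreal ((W_inf E - W l E)\<^sup>2)"
    by (intro tendsto_intros)
   then show "ennreal ((W_inf E - W l E)\<^sup>2) = liminf (\<lambda>n. ennreal ((W (l + n) E - W l E)\<^sup>2))"
    by (intro lim_imp_Liminf[symmetric]) auto
  qed
  then have "(\<bbbE>E. (W_inf E - W l E)\<^sup>2) =
    (\<bbbE>\<^sup>+E. liminf (\<lambda>n. ennreal ((W (l + n) E - W l E)\<^sup>2)))"
   by (rule nn_integral_cong_AE)
  also have "\<dots> \<le> liminf (\<lambda>n. \<integral>\<^sup>+E. ennreal ((W (l + n) E - W l E)\<^sup>2) \<partial>GW)"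
   by (rule nn_integral_liminf) measurable
  also have "\<dots> \<le> ennreal (K * r ^ l)"
   by (rule Liminf_le) (auto simp: d)
  finally show ?thesis .
 qed
 then show ?thesis
  using that r K by blast
qed

lemma W_inf_gen_sum:
 assumes conv: "\<forall>u\<in>tree E. (\<lambda>n. W n (subtree E u)) \<longlonglongrightarrow> W_inf (subtree E u)"
 shows "W_inf E = gen_sum l W_inf E"
proof (rule LIMSEQ_unique)
 have "(\<lambda>n. W (l + n) E) \<longlonglongrightarrow> gen_sum l W_inf E"
  unfolding gen_sum_add gen_sum_def[of l]
  by (intro tendsto_sum tendsto_mult tendsto_const) (use conv in \<open>auto simp: generation_def\<close>)
 then show "(\<lambda>n. W n E) \<longlonglongrightarrow> gen_sum l W_inf E"
  by (subst (asm) add.commute) (rule LIMSEQ_offset)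
 show "(\<lambda>n. W n E) \<longlonglongrightarrow> W_inf E"
  using conv by (metis subtree_Nil tree_Nil)
qed

lemma W_inf_not_AE_zero: "\<not> (AE E in GW. W_inf E = 0)"
proof
 assume *: "AE E in GW. W_inf E = 0"
 obtain r K where "\<rho> = ennreal r" and r: "0 \<le> r" "r < 1" and K: "K \<ge> 0"
  and d: "\<And>l. (\<bbbE>E. (W_inf E - W l E)\<^sup>2) \<le> ennreal (K * r ^ l)"
  by (rule W_inf_L2) (rule that)
 have "(\<lambda>l. K * r ^ l) \<longlonglongrightarrow> K * 0"
  using r by (intro tendsto_intros LIMSEQ_power_zero) auto
 then have "eventually (\<lambda>l. K * r ^ l < 1 / 8) sequentially"
  by (rule order_tendstoD) simp
 then obtain l where l: "K * r ^ l < 1 / 8"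
  by (auto simp: eventually_sequentially)
 have "(\<bbbE>E. (W l E)\<^sup>2) = (\<bbbE>E. (W_inf E - W l E)\<^sup>2)"
  using * by (intro nn_integral_cong_AE) (auto elim!: AE_mp)
 also note d
 finally have sq: "(\<bbbE>E. (W l E)\<^sup>2) \<le> ennreal (K * r ^ l)" .
 have "(\<bbbE>E. \<bar>W l E\<bar>) \<le> ennreal (1/2) + ennreal (1 / (1/2)) * (\<bbbE>E. (W l E)\<^sup>2)"
  by (rule nn_integral_abs_le_square) auto
 also have "\<dots> \<le> ennreal (1/2) + ennreal (1 / (1/2)) * ennreal (K * r ^ l)"
  by (rule add_mono[OF order_refl mult_left_mono[OF sq]]) simp
 also have "\<dots> = ennreal (1/2) + ennreal (1 / (1/2) * (K * r ^ l))"
  by (rule arg_cong[where f = "\<lambda>x. ennreal (1/2) + x"], rule ennreal_mult'[symmetric]) simp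
 also have "\<dots> = ennreal (1 / 2 + 1 / (1/2) * (K * r ^ l))"
  by (rule ennreal_plus[symmetric]) (use K r in simp_all)
 finally have le: "(\<bbbE>E. \<bar>W l E\<bar>) \<le> ennreal (1 / 2 + 1 / (1/2) * (K * r ^ l))" .
 have "ennreal (1 / 2 + 1 / (1/2) * (K * r ^ l)) < ennreal 1"
  by (rule ennreal_lessI) (use l in simp_all)
 moreover have "(\<bbbE>E. \<bar>W l E\<bar>) = ennreal 1"
  using W_nonneg[of l] nn_integral_W[of l] by (simp del: gen_sum_0)
 ultimately show False
  using le by (metis leD)
qed

end


section \<open>Moments of the additive martingale\<close>

lemma convex_on_powr_nonneg:
 assumes "q \<ge> 1" shows "convex_on {0..} (\<lambda>x :: real. x powr q)"
proof (rule convex_onI)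
 fix t x y :: real
 assume t: "0 < t" "t < 1" and xy: "x \<in> {0..}" "y \<in> {0..}"
 have scale: "s powr q \<le> s" if "0 < s" "s < 1" for s :: real
  using powr_mono'[of 1 q s] that assms by simp
 show "((1 - t) *\<^sub>R x + t *\<^sub>R y) powr q \<le> (1 - t) * x powr q + t * y powr q"
 proof (cases "x > 0 \<and> y > 0")
  case True
  then show ?thesis
   using convex_onD[OF powr_convex[OF assms], of t x y] t by simp
 next
  case False
  then consider "x = 0" | "y = 0"
   using xy by force
  then show ?thesis
  proof cases
   case 1
   then show ?thesis
    using xy t scale[of t] assms by (simp add: powr_mult mult_right_mono)
  next
   case 2
   then show ?thesis
    using xy t scale[of "1 - t"] assms by (simp add: powr_mult mult_right_mono)
  qed
 qed
qed simp

lemma powr_sum_le_weighted: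
 fixes A w :: "'i \<Rightarrow> real"
 assumes q: "q \<ge> 1" and I: "finite I" and A: "\<And>i. i \<in> I \<Longrightarrow> A i > 0" and w: "\<And>i. i \<in> I \<Longrightarrow> w i \<ge> 0"
 shows "(\<Sum>i\<in>I. A i * w i) powr q \<le> (\<Sum>i\<in>I. A i) powr (q - 1) * (\<Sum>i\<in>I. A i * w i powr q)"
proof (cases "I = {}")
 case False
 define S where "S = (\<Sum>i\<in>I. A i)"
 have S: "S > 0"
  unfolding S_def using False I A by (intro sum_pos) auto
 have "(\<Sum>i\<in>I. (A i / S) *\<^sub>R w i) powr q \<le> (\<Sum>i\<in>I. (A i / S) * w i powr q)"
  using convex_on_sum[OF I False convex_on_powr_nonneg[OF q], of "\<lambda>i. A i / S" w] S A w
  by (simp add: sum_divide_distrib[symmetric] S_def[symmetric] less_imp_le)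
 then have "S powr q * (\<Sum>i\<in>I. (A i / S) * w i) powr q \<le> S powr q * (\<Sum>i\<in>I. (A i / S) * w i powr q)"
  by (intro mult_left_mono) auto
 also have "S powr q * (\<Sum>i\<in>I. (A i / S) * w i) powr q = (\<Sum>i\<in>I. A i * w i) powr q"
 proof -
  have "(\<Sum>i\<in>I. (A i / S) * w i) \<ge> 0"
   using S A w by (intro sum_nonneg mult_nonneg_nonneg) (auto simp: less_imp_le)
  then have "S powr q * (\<Sum>i\<in>I. (A i / S) * w i) powr q = (S * (\<Sum>i\<in>I. (A i / S) * w i)) powr q"
   using S by (subst powr_mult) auto
  also have "S * (\<Sum>i\<in>I. (A i / S) * w i) = (\<Sum>i\<in>I. A i * w i)"
   using S by (simp add: sum_distrib_left)
  finally show ?thesis .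
 qed
 also have "S powr q * (\<Sum>i\<in>I. (A i / S) * w i powr q) = S powr (q - 1) * (\<Sum>i\<in>I. A i * w i powr q)"
 proof -
  have "S powr q = S powr (q - 1) * S"
   using S by (simp add: powr_diff)
  then show ?thesis
   using S by (simp add: sum_distrib_left)
 qed
 finally show ?thesis
  unfolding S_def .
qed simp

lemma powr_add_le_weighted:
 fixes a b l q :: real
 assumes q: "q \<ge> 1" and ab: "a \<ge> 0" "b \<ge> 0" and l: "0 < l" "l < 1"
 shows "(a + b) powr q \<le> l powr (1 - q) * a powr q + (1 - l) powr (1 - q) * b powr q"
proof -
 have e: "s * (x / s) powr q = s powr (1 - q) * x powr q" if "0 < s" "x \<ge> 0" for s x :: real
  using that by (simp add: powr_divide powr_diff)
 have "(a + b) powr q = ((1 - l) *\<^sub>R (b / (1 - l)) + l *\<^sub>R (a / l)) powr q"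
  using l by (simp add: add.commute)
 also have "\<dots> \<le> (1 - l) * (b / (1 - l)) powr q + l * (a / l) powr q"
  by (rule convex_onD[OF convex_on_powr_nonneg[OF q]]) (use l ab in auto)
 also have "\<dots> = l powr (1 - q) * a powr q + (1 - l) powr (1 - q) * b powr q"
  using e[of l a] e[of "1 - l" b] l ab by simp
 finally show ?thesis .
qed

context L2_branching_law
begin

text \<open>
 One step of the moment recursion. Write \<open>W (Suc n)\<close> as the sum of \<open>A\<^sub>i W\<^sub>i\<close> over the children;
 then \<open>W (Suc n) powr (q + 1)\<close> is the sum of \<open>A\<^sub>i W\<^sub>i (A\<^sub>i W\<^sub>i + R\<^sub>i) powr q\<close>, where \<open>R\<^sub>i\<close> is independent of
 \<open>W\<^sub>i\<close> given the first generation, so that the remainder only costs moments of order \<open>q\<close>.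
\<close>

lemma W_moment_step:
 assumes q: "q \<ge> 1" and l: "0 < l" "l < 1" and C: "C \<ge> 0"
  and Wq: "(\<bbbE>E. W n E powr q) \<le> ennreal C"
 shows "(\<bbbE>E. W (Suc n) E powr (q + 1)) \<le>
  ennreal (l powr (1 - q)) * ((\<integral>\<^sup>+a. ennreal (exp (- (q * a))) \<partial>\<nu>) * (\<bbbE>E. W n E powr (q + 1))) +
  ennreal ((1 - l) powr (1 - q)) * (ennreal C * (\<bbbE>E. W 1 E powr (q + 1)))"
proof -
 define c1 c2 where "c1 = l powr (1 - q)" and "c2 = (1 - l) powr (1 - q)"
 let ?A = "\<lambda>E i. exp (- (E [] ! i))" and ?w = "\<lambda>E i. W n (subtree E [i])" and ?N = "\<lambda>E. length (E [])"
 define R where "R i E = (\<Sum>j<?N E. if j = i then 0 else ?A E j * ?w E j)" for i E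
 have Rm [measurable]: "R i \<in> borel_measurable env_space" for i
  unfolding R_def by (rule sum_lessThan_measurable) measurable
 have w: "?w E i \<ge> 0" for E i
  by (rule W_nonneg)
 have R: "R i E \<ge> 0" for i E
  unfolding R_def by (intro sum_nonneg) (auto intro: mult_nonneg_nonneg w)
 have WR: "W (Suc n) E = ?A E i * ?w E i + R i E" if "i < ?N E" for i E
  unfolding R_def gen_sum_Suc branch_sum_def using that
  by (subst (1 2) sum.remove[of _ i]) (auto intro!: sum.cong)
 have RW: "R i E \<le> W (Suc n) E" for i E
  unfolding R_def gen_sum_Suc branch_sum_def by (intro sum_mono) (auto intro: mult_nonneg_nonneg w)
 have pointwise: "W (Suc n) E powr (q + 1) \<le>
   (\<Sum>i<?N E. ?A E i * (c1 * exp (- (q * (E [] ! i))) * ?w E i powr (q + 1))) +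
   c2 * (\<Sum>i<?N E. ?A E i * ?w E i * R i E powr q)" for E
 proof -
  have "W (Suc n) E powr (q + 1) = W (Suc n) E * W (Suc n) E powr q"
   using W_nonneg[of "Suc n" E] by (cases "W (Suc n) E = 0") (auto simp: powr_add)
  also have "\<dots> = (\<Sum>i<?N E. ?A E i * ?w E i * W (Suc n) E powr q)"
   by (subst gen_sum_Suc) (simp add: branch_sum_def sum_distrib_right)
  also have "\<dots> \<le> (\<Sum>i<?N E. ?A E i * ?w E i * (c1 * (?A E i * ?w E i) powr q + c2 * R i E powr q))"
  proof (intro sum_mono mult_left_mono)
   fix i assume "i \<in> {..<?N E}"
   then show "W (Suc n) E powr q \<le> c1 * (?A E i * ?w E i) powr q + c2 * R i E powr q"
    unfolding c1_def c2_def using powr_add_le_weighted[OF q _ R[of i E] l, of "?A E i * ?w E i"] w[of E i]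
    by (simp add: WR[of i E])
  qed (use w in auto)
  also have "\<dots> = (\<Sum>i<?N E. ?A E i * (c1 * exp (- (q * (E [] ! i))) * ?w E i powr (q + 1)) +
    c2 * (?A E i * ?w E i * R i E powr q))"
  proof (intro sum.cong refl)
   fix i
   have "(?A E i * ?w E i) powr q = exp (- (q * (E [] ! i))) * ?w E i powr q"
    using w[of E i] by (simp add: powr_mult exp_powr_real mult.commute)
   moreover have "?w E i powr (q + 1) = ?w E i * ?w E i powr q"
    using w[of E i] by (cases "?w E i = 0") (auto simp: powr_add)
   ultimately show "?A E i * ?w E i * (c1 * (?A E i * ?w E i) powr q + c2 * R i E powr q) =
     ?A E i * (c1 * exp (- (q * (E [] ! i))) * ?w E i powr (q + 1)) + c2 * (?A E i * ?w E i * R i E powr q)"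
    by (simp add: algebra_simps)
  qed
  finally show ?thesis
   by (simp add: sum.distrib sum_distrib_left)
 qed
 have c: "c1 \<ge> 0" "c2 \<ge> 0"
  by (simp_all add: c1_def c2_def)
 let ?g = "\<lambda>i E. if i < ?N E then ennreal (?A E i) else 0"
 have "(\<bbbE>\<^sup>+E. (\<Sum>i. ?g i E * ennreal (R i E powr q) * ennreal (?w E i))) =
   (\<Sum>i. \<integral>\<^sup>+E. ?g i E * ennreal (R i E powr q) * ennreal (?w E i) \<partial>GW)"
  by (rule nn_integral_suminf) measurable
 also have "\<dots> = (\<Sum>i. \<integral>\<^sup>+E. ?g i E * ennreal (R i E powr q) \<partial>GW)"
 proof (rule suminf_cong)
  fix i
  have "R i (graft i E E') = R i E" for E E'
   unfolding R_def by (intro sum.cong) (auto simp: subtree_graft)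
  then show "(\<bbbE>\<^sup>+E. ?g i E * ennreal (R i E powr q) * ennreal (?w E i)) = (\<bbbE>\<^sup>+E. ?g i E * ennreal (R i E powr q))"
   by (subst nn_integral_subtree_indep) (simp_all add: nn_integral_W)
 qed
 also have "\<dots> \<le> (\<Sum>i. \<integral>\<^sup>+E. ?g i E * ennreal (W 1 E powr (q - 1) * (\<Sum>j<?N E. ?A E j * ?w E j powr q)) \<partial>GW)"
 proof (intro suminf_le nn_integral_mono mult_left_mono ennreal_leI)
  fix i E
  have "R i E powr q \<le> W (Suc n) E powr q"
   using q by (intro powr_mono2 R RW) auto
  also have "\<dots> \<le> W 1 E powr (q - 1) * (\<Sum>j<?N E. ?A E j * ?w E j powr q)"
   using powr_sum_le_weighted[OF q, of "{..<?N E}" "?A E" "?w E"] w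
   by (simp add: gen_sum_Suc branch_sum_def)
  finally show "R i E powr q \<le> W 1 E powr (q - 1) * (\<Sum>j<?N E. ?A E j * ?w E j powr q)" .
 qed auto
 also have "\<dots> = (\<bbbE>\<^sup>+E. (\<Sum>i. ?g i E * ennreal (W 1 E powr (q - 1) * (\<Sum>j<?N E. ?A E j * ?w E j powr q))))"
 proof -
  have [measurable]: "(\<lambda>E. \<Sum>j<?N E. ?A E j * ?w E j powr q) \<in> borel_measurable env_space"
   by (rule sum_lessThan_measurable) measurable
  show ?thesis
   by (rule nn_integral_suminf[symmetric]) measurable
 qed
 also have "\<dots> = (\<bbbE>\<^sup>+E. (\<Sum>j. (?g j E * ennreal (W 1 E powr q)) * ennreal (?w E j powr q)))"
 proof (rule nn_integral_cong)
  fix E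
  have "(\<Sum>i. ?g i E * ennreal (W 1 E powr (q - 1) * (\<Sum>j<?N E. ?A E j * ?w E j powr q))) =
    (\<Sum>i. ?g i E) * ennreal (W 1 E powr (q - 1) * (\<Sum>j<?N E. ?A E j * ?w E j powr q))"
   by simp
  also have "(\<Sum>i. ?g i E) = ennreal (W 1 E)"
   by (simp add: sum_lessThan_eq_suminf[symmetric] gen_sum_Suc branch_sum_def)
  also have "ennreal (W 1 E) * ennreal (W 1 E powr (q - 1) * (\<Sum>j<?N E. ?A E j * ?w E j powr q)) =
    ennreal ((W 1 E * W 1 E powr (q - 1)) * (\<Sum>j<?N E. ?A E j * ?w E j powr q))"
   using W_nonneg[of 1 E] by (simp add: ennreal_mult'[symmetric] mult.assoc)
  also have "W 1 E * W 1 E powr (q - 1) = W 1 E powr q"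
   using W_nonneg[of 1 E] by (cases "W 1 E = 0") (auto simp: powr_diff)
  also have "ennreal (W 1 E powr q * (\<Sum>j<?N E. ?A E j * ?w E j powr q)) =
    (\<Sum>j<?N E. (ennreal (?A E j) * ennreal (W 1 E powr q)) * ennreal (?w E j powr q))"
   unfolding sum_distrib_left by (subst sum_ennreal[symmetric]) (auto simp: ennreal_mult'[symmetric] mult_ac)
  also have "\<dots> = (\<Sum>j. (?g j E * ennreal (W 1 E powr q)) * ennreal (?w E j powr q))"
   unfolding sum_lessThan_eq_suminf by (intro suminf_cong) auto
  finally show "(\<Sum>i. ?g i E * ennreal (W 1 E powr (q - 1) * (\<Sum>j<?N E. ?A E j * ?w E j powr q))) =
   (\<Sum>j. (?g j E * ennreal (W 1 E powr q)) * ennreal (?w E j powr q))" .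
 qed
 also have "\<dots> = (\<Sum>j. \<integral>\<^sup>+E. (?g j E * ennreal (W 1 E powr q)) * ennreal (?w E j powr q) \<partial>GW)"
  by (rule nn_integral_suminf) measurable
 also have "\<dots> = (\<Sum>j. (\<bbbE>\<^sup>+E. ?g j E * ennreal (W 1 E powr q)) * (\<bbbE>E. W n E powr q))"
 proof (rule suminf_cong)
  fix j
  have "W 1 (graft j E E') = W 1 E" for E E'
   by (simp add: gen_sum_Suc branch_sum_def)
  then show "(\<bbbE>\<^sup>+E. (?g j E * ennreal (W 1 E powr q)) * ennreal (?w E j powr q)) =
    (\<bbbE>\<^sup>+E. ?g j E * ennreal (W 1 E powr q)) * (\<bbbE>E. W n E powr q)"
   by (subst nn_integral_subtree_indep) simp_all
 qed
 also have "\<dots> = (\<bbbE>\<^sup>+E. (\<Sum>j. ?g j E * ennreal (W 1 E powr q))) * (\<bbbE>E. W n E powr q)"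
  by (subst nn_integral_suminf) auto
 also have "(\<bbbE>\<^sup>+E. (\<Sum>j. ?g j E * ennreal (W 1 E powr q))) = (\<bbbE>E. W 1 E powr (q + 1))"
 proof (rule nn_integral_cong)
  fix E
  have "(\<Sum>j. ?g j E * ennreal (W 1 E powr q)) = ennreal (W 1 E) * ennreal (W 1 E powr q)"
   by (simp add: sum_lessThan_eq_suminf[symmetric] gen_sum_Suc branch_sum_def)
  also have "\<dots> = ennreal (W 1 E powr (q + 1))"
   using W_nonneg[of 1 E] by (cases "W 1 E = 0") (auto simp: ennreal_mult'[symmetric] powr_add)
  finally show "(\<Sum>j. ?g j E * ennreal (W 1 E powr q)) = ennreal (W 1 E powr (q + 1))" .
 qed
 also have "(\<bbbE>E. W 1 E powr (q + 1)) * (\<bbbE>E. W n E powr q) \<le>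
   (\<bbbE>E. W 1 E powr (q + 1)) * ennreal C"
  by (intro mult_left_mono Wq) auto
 finally have rest: "(\<bbbE>\<^sup>+E. (\<Sum>i. ?g i E * ennreal (R i E powr q) * ennreal (?w E i))) \<le>
   ennreal C * (\<bbbE>E. W 1 E powr (q + 1))"
  by (simp only: mult.commute)
 have "(\<bbbE>E. W (Suc n) E powr (q + 1)) \<le>
   (\<bbbE>\<^sup>+E. (\<Sum>i<?N E. ennreal (?A E i) * ennreal (c1 * exp (- (q * (E [] ! i))) * ?w E i powr (q + 1))) +
    ennreal c2 * (\<Sum>i. ?g i E * ennreal (R i E powr q) * ennreal (?w E i)))"
 proof (rule nn_integral_mono)
  fix E
  have "ennreal (W (Suc n) E powr (q + 1)) \<le> ennreal ((\<Sum>i<?N E. ?A E i * (c1 * exp (- (q * (E [] ! i))) * ?w E i powr (q + 1))) +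
   c2 * (\<Sum>i<?N E. ?A E i * ?w E i * R i E powr q))"
   by (rule ennreal_leI[OF pointwise])
  also have "\<dots> = ennreal (\<Sum>i<?N E. ?A E i * (c1 * exp (- (q * (E [] ! i))) * ?w E i powr (q + 1))) +
    ennreal c2 * ennreal (\<Sum>i<?N E. ?A E i * ?w E i * R i E powr q)"
   using c w by (subst ennreal_plus) (auto intro!: sum_nonneg mult_nonneg_nonneg simp: ennreal_mult')
  also have "ennreal (\<Sum>i<?N E. ?A E i * (c1 * exp (- (q * (E [] ! i))) * ?w E i powr (q + 1))) =
    (\<Sum>i<?N E. ennreal (?A E i) * ennreal (c1 * exp (- (q * (E [] ! i))) * ?w E i powr (q + 1)))"
   using c by (subst sum_ennreal[symmetric]) (auto simp: ennreal_mult')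
  also have "ennreal (\<Sum>i<?N E. ?A E i * ?w E i * R i E powr q) =
    (\<Sum>i<?N E. ennreal (?A E i) * ennreal (R i E powr q) * ennreal (?w E i))"
   using w by (subst sum_ennreal[symmetric]) (auto simp: ennreal_mult'[symmetric] mult_ac)
  also have "\<dots> = (\<Sum>i. ?g i E * ennreal (R i E powr q) * ennreal (?w E i))"
   unfolding sum_lessThan_eq_suminf by (intro suminf_cong) auto
  finally show "ennreal (W (Suc n) E powr (q + 1)) \<le>
   (\<Sum>i<?N E. ennreal (?A E i) * ennreal (c1 * exp (- (q * (E [] ! i))) * ?w E i powr (q + 1))) +
    ennreal c2 * (\<Sum>i. ?g i E * ennreal (R i E powr q) * ennreal (?w E i))" .
 qed
 also have "\<dots> = (\<bbbE>\<^sup>+E. (\<Sum>i<?N E. ennreal (?A E i) * ennreal (c1 * exp (- (q * (E [] ! i))) * ?w E i powr (q + 1)))) +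
   ennreal c2 * (\<bbbE>\<^sup>+E. (\<Sum>i. ?g i E * ennreal (R i E powr q) * ennreal (?w E i)))"
 proof -
  have [measurable]: "(\<lambda>E. \<Sum>i<?N E. ennreal (?A E i) * ennreal (c1 * exp (- (q * (E [] ! i))) * ?w E i powr (q + 1))) \<in> borel_measurable env_space"
   by (rule sum_lessThan_measurable) measurable
  show ?thesis
   by (simp add: nn_integral_add nn_integral_cmult)
 qed
 also have "(\<bbbE>\<^sup>+E. (\<Sum>i<?N E. ennreal (?A E i) * ennreal (c1 * exp (- (q * (E [] ! i))) * ?w E i powr (q + 1)))) =
   (\<integral>\<^sup>+a. \<integral>\<^sup>+E. ennreal (c1 * exp (- (q * a)) * W n E powr (q + 1)) \<partial>GW \<partial>\<nu>)"
  by (rule nn_integral_children) measurable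
 also have "\<dots> = ennreal c1 * ((\<integral>\<^sup>+a. ennreal (exp (- (q * a))) \<partial>\<nu>) * (\<bbbE>E. W n E powr (q + 1)))"
  using c by (simp add: ennreal_mult' mult.assoc nn_integral_cmult nn_integral_multc)
 also have "\<dots> + ennreal c2 * (\<bbbE>\<^sup>+E. (\<Sum>i. ?g i E * ennreal (R i E powr q) * ennreal (?w E i))) \<le>
   \<dots> + ennreal c2 * (ennreal C * (\<bbbE>E. W 1 E powr (q + 1)))"
  by (intro add_left_mono mult_left_mono rest) simp
 finally show ?thesis
  unfolding c1_def c2_def .
qed

text \<open>
 For \<open>l\<close> close to one the factor in front of the moment of order \<open>q + 1\<close> in \<open>W_moment_step\<close> is still
 smaller than one, and the recursion is contracting.
\<close>

lemma W_moment_bounded_step: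
 assumes q: "q \<ge> 1"
  and bounded: "\<exists>C\<ge>0. \<forall>n. (\<bbbE>E. W n E powr q) \<le> ennreal C"
  and first: "(\<bbbE>E. W 1 E powr (q + 1)) < \<infinity>"
  and less_1: "(\<integral>\<^sup>+a. ennreal (exp (- (q * a))) \<partial>\<nu>) < 1"
 shows "\<exists>C\<ge>0. \<forall>n. (\<bbbE>E. W n E powr (q + 1)) \<le> ennreal C"
proof -
 obtain C where C: "C \<ge> 0" "\<And>n. (\<bbbE>E. W n E powr q) \<le> ennreal C"
  using bounded by auto
 obtain \<alpha> where \<alpha>: "(\<integral>\<^sup>+a. ennreal (exp (- (q * a))) \<partial>\<nu>) = ennreal \<alpha>" "0 \<le> \<alpha>" "\<alpha> < 1"
  using less_1 by (cases "\<integral>\<^sup>+a. ennreal (exp (- (q * a))) \<partial>\<nu>") (auto simp: ennreal_less_one_iff)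
 obtain m where m: "(\<bbbE>E. W 1 E powr (q + 1)) = ennreal m" "0 \<le> m"
  using first by (cases "\<integral>\<^sup>+E. ennreal (W 1 E powr (q + 1)) \<partial>GW") auto
 have "((\<lambda>l. l powr (1 - q) * \<alpha>) \<longlongrightarrow> 1 powr (1 - q) * \<alpha>) (at_left 1)"
  by (intro tendsto_intros tendsto_ident_at) auto
 then have "eventually (\<lambda>l. l powr (1 - q) * \<alpha> < 1) (at_left 1)"
  using \<alpha> by (intro order_tendstoD) auto
 moreover have "eventually (\<lambda>l. l \<in> {0<..<1::real}) (at_left 1)"
  by (rule eventually_at_left_real) simp
 ultimately have "eventually (\<lambda>l. l powr (1 - q) * \<alpha> < 1 \<and> l \<in> {0<..<1}) (at_left 1)"
  by eventually_elim auto
 then obtain l where l: "l powr (1 - q) * \<alpha> < 1" "0 < l" "l < 1"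
  using eventually_happens[of _ "at_left (1::real)"] by (auto simp: trivial_limit_at_left_real)
 define b where "b = l powr (1 - q) * \<alpha>"
 define d where "d = (1 - l) powr (1 - q) * (C * m)"
 define K where "K = (1 + d) / (1 - b)"
 have bd: "0 \<le> b" "b < 1" "0 \<le> d"
  using l \<alpha> m C by (auto simp: b_def d_def)
 then have Kb: "K * (1 - b) = 1 + d" and K0: "K \<ge> 0"
  by (simp_all add: K_def)
 have K1: "1 \<le> K"
  using mult_left_mono[OF _ K0, of "1 - b" 1] Kb bd by simp
 have step: "b * K + d \<le> K"
  using Kb by (simp add: algebra_simps)
 have "(\<bbbE>E. W n E powr (q + 1)) \<le> ennreal K" for n
 proof (induction n)
  case 0
  then show ?case
   using K1 by (simp add: GW.emeasure_space_1[simplified])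
 next
  case (Suc n)
  have "(\<bbbE>E. W (Suc n) E powr (q + 1)) \<le>
   ennreal (l powr (1 - q)) * (ennreal \<alpha> * (\<bbbE>E. W n E powr (q + 1))) +
   ennreal ((1 - l) powr (1 - q)) * (ennreal C * ennreal m)"
   using W_moment_step[OF q l(2,3) C(1) C(2)[of n]] unfolding \<alpha> m .
  also have "\<dots> \<le> ennreal (l powr (1 - q)) * (ennreal \<alpha> * ennreal K) +
   ennreal ((1 - l) powr (1 - q)) * (ennreal C * ennreal m)"
   by (intro add_mono mult_left_mono Suc) auto
  also have "\<dots> = ennreal (b * K + d)"
   using C m \<alpha> K0 bd by (simp add: b_def d_def ennreal_mult'[symmetric] mult.assoc)
  also have "\<dots> \<le> ennreal K"
   by (rule ennreal_leI[OF step])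
  finally show ?case .
 qed
 then show ?thesis
  using K0 by blast
qed

lemma nn_integral_powr_finite_mono:
 assumes "0 \<le> s" "s \<le> t" and [measurable]: "f \<in> borel_measurable GW" and f: "\<And>E. f E \<ge> 0"
 shows "(\<bbbE>E. f E powr s) \<le> 1 + (\<bbbE>E. f E powr t)"
proof -
 have "(\<bbbE>E. f E powr s) \<le> (\<bbbE>\<^sup>+E. 1 + ennreal (f E powr t))"
 proof (rule nn_integral_mono)
  fix E
  have "f E powr s \<le> 1 + f E powr t"
  proof (cases "f E \<le> 1")
   case True
   then have "f E powr s \<le> 1"
    using f[of E] assms(1) by (simp add: powr_le1)
   then show ?thesis
    by (simp add: add_increasing2)
  next
   case False
   then have "f E powr s \<le> f E powr t"
    using powr_mono[of s t "f E"] assms(2) by simp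
   then show ?thesis
    by simp
  qed
  then have "ennreal (f E powr s) \<le> ennreal (1 + f E powr t)"
   by (rule ennreal_leI)
  then show "ennreal (f E powr s) \<le> 1 + ennreal (f E powr t)"
   by (simp add: ennreal_plus)
 qed
 also have "\<dots> = 1 + (\<bbbE>E. f E powr t)"
  by (simp add: nn_integral_add GW.emeasure_space_1[simplified])
 finally show ?thesis .
qed

text \<open>
 The order is raised by one at a time, starting from an order between one and two, where the second
 moment suffices.
\<close>

lemma W_moment_bounded:
 assumes p: "2 \<le> p" and first: "(\<bbbE>E. W 1 E powr p) < \<infinity>"
  and less_1: "\<And>t. 1 < t \<Longrightarrow> t \<le> p \<Longrightarrow> (\<integral>\<^sup>+a. ennreal (exp (- ((t - 1) * a))) \<partial>\<nu>) < 1"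
 shows "\<exists>C\<ge>0. \<forall>n. (\<bbbE>E. W n E powr p) \<le> ennreal C"
proof -
 define N where "N = nat (\<lceil>p\<rceil> - 2)"
 define q where "q = p - real N"
 have q: "1 < q" "q \<le> 2"
  using p unfolding q_def N_def by linarith+
 have "j \<le> N \<Longrightarrow> \<exists>C\<ge>0. \<forall>n. (\<bbbE>E. W n E powr (q + real j)) \<le> ennreal C" for j
 proof (induction j)
  case 0
  obtain K where K: "K \<ge> 0" "\<And>n. (\<bbbE>E. (W n E)\<^sup>2) \<le> ennreal K"
   using W_square_bounded by auto
  have "(\<bbbE>E. W n E powr q) \<le> ennreal (1 + K)" for n
  proof -
   have "(\<bbbE>E. W n E powr q) \<le> 1 + (\<bbbE>E. W n E powr 2)"
    using q by (intro nn_integral_powr_finite_mono) (auto simp: W_nonneg)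
   also have "(\<bbbE>E. W n E powr 2) = (\<bbbE>E. (W n E)\<^sup>2)"
    using W_nonneg by (intro nn_integral_cong) simp
   also have "1 + \<dots> \<le> 1 + ennreal K"
    by (intro add_mono K(2)) simp
   finally show ?thesis
    using K(1) by (simp add: ennreal_plus)
  qed
  then show ?case
   using K(1) by (intro exI[of _ "1 + K"]) auto
 next
  case (Suc j)
  have le: "q + real (Suc j) \<le> p"
   using Suc.prems by (simp add: q_def)
  have "\<exists>C\<ge>0. \<forall>n. (\<bbbE>E. W n E powr ((q + real j) + 1)) \<le> ennreal C"
  proof (rule W_moment_bounded_step)
   show "\<exists>C\<ge>0. \<forall>n. (\<bbbE>E. W n E powr (q + real j)) \<le> ennreal C"
    using Suc by simp
   have "(\<bbbE>E. W 1 E powr ((q + real j) + 1)) \<le> 1 + (\<bbbE>E. W 1 E powr p)"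
    using q le by (intro nn_integral_powr_finite_mono) (auto simp: W_nonneg)
   also have "\<dots> < \<infinity>"
    using first by simp
   finally show "(\<bbbE>E. W 1 E powr ((q + real j) + 1)) < \<infinity>" .
   show "(\<integral>\<^sup>+a. ennreal (exp (- ((q + real j) * a))) \<partial>\<nu>) < 1"
    using less_1[of "q + real (Suc j)"] le q by simp
  qed (use q in simp)
  then show ?case
   by (simp add: add_ac)
 qed
 from this[of N] show ?thesis
  by (simp add: q_def)
qed

end


section \<open>The martingale limit is positive on survival\<close>

lemma power_convex_strict:
 fixes a c :: real
 assumes a: "0 \<le> a" "a < 1" and l: "0 < c" "c < 1"
 shows "(c * a + (1 - c)) ^ Suc n \<le> c * a ^ Suc n + (1 - c)"
  and "n \<ge> 1 \<Longrightarrow> (c * a + (1 - c)) ^ Suc n < c * a ^ Suc n + (1 - c)"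
proof -
 let ?b = "c * a + (1 - c)"
 have b: "0 \<le> ?b"
  using a l by simp
 have id: "c * a ^ Suc m + (1 - c) - ?b * (c * a ^ m + (1 - c)) = c * (1 - c) * (1 - a) * (1 - a ^ m)" for m
  by (simp add: algebra_simps)
 have pos: "0 \<le> c * (1 - c) * (1 - a) * (1 - a ^ m)" for m
  using a l by (intro mult_nonneg_nonneg) (auto simp: power_le_one)
 have le: "?b ^ m \<le> c * a ^ m + (1 - c)" for m
 proof (induction m)
  case (Suc m)
  have "?b ^ Suc m \<le> ?b * (c * a ^ m + (1 - c))"
   using mult_left_mono[OF Suc b] by simp
  then show ?case
   using id[of m] pos[of m] by linarith
 qed simp
 show "?b ^ Suc n \<le> c * a ^ Suc n + (1 - c)"
  by (rule le)
 assume "n \<ge> 1"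
 then have "a ^ n < 1"
  using a power_Suc_less_one[of a "n - 1"] by (cases "a = 0") (auto simp: power_0_left)
 then have "0 < c * (1 - c) * (1 - a) * (1 - a ^ n)"
  using a l by simp
 moreover have "?b ^ Suc n \<le> ?b * (c * a ^ n + (1 - c))"
  using mult_left_mono[OF le[of n] b] by simp
 ultimately show "?b ^ Suc n < c * a ^ Suc n + (1 - c)"
  using id[of n] by linarith
qed

context branching_law
begin

text \<open>
 Extinction and vanishing of the martingale limit both hold iff they hold in the subtrees of all
 children; the probability of such an event is a fixed point of the generating function.
\<close>

lemma hereditary_event_fixpoint:
 assumes C [measurable]: "C \<in> sets env_space"
  and hereditary: "AE E in GW. E \<in> C \<longleftrightarrow> (\<forall>i<length (E []). subtree E [i] \<in> C)"
 shows "emeasure GW C = (\<integral>\<^sup>+xs. emeasure GW C ^ length xs \<partial>\<mu>)"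
proof -
 let ?c = "\<lambda>E i. indicator C (subtree E [i]) :: ennreal"
 have prod: "(\<bbbE>\<^sup>+E. indicator {E. length (E []) = n} E * (\<Prod>i<m. ?c E i)) =
   (\<bbbE>\<^sup>+E. indicator {E. length (E []) = n} E) * emeasure GW C ^ m" for n m
 proof (induction m)
  case (Suc m)
  have "(\<bbbE>\<^sup>+E. indicator {E. length (E []) = n} E * (\<Prod>i<Suc m. ?c E i)) =
    (\<bbbE>\<^sup>+E. (indicator {E. length (E []) = n} E * (\<Prod>i<m. ?c E i)) * ?c E m)"
   by (simp add: mult.assoc)
  also have "\<dots> = (\<bbbE>\<^sup>+E. indicator {E. length (E []) = n} E * (\<Prod>i<m. ?c E i)) * (\<bbbE>\<^sup>+E. indicator C E)"
   by (rule nn_integral_subtree_indep) (auto simp: subtree_graft indicator_def intro!: prod.cong arg_cong2[where f = "(*)"])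
  also have "(\<bbbE>\<^sup>+E. indicator C E) = emeasure GW C"
   by (rule nn_integral_indicator) (simp add: sets_GW)
  finally show ?case
   using Suc by (simp add: mult_ac)
 qed simp
 have "emeasure GW C = (\<bbbE>\<^sup>+E. indicator C E)"
  by (rule nn_integral_indicator[symmetric]) (simp add: sets_GW)
 also have "\<dots> = (\<bbbE>\<^sup>+E. (\<Sum>n. indicator {E. length (E []) = n} E * (\<Prod>i<n. ?c E i)))"
 proof (rule nn_integral_cong_AE, use hereditary in eventually_elim)
  case (elim E)
  have "(\<Sum>n. indicator {E. length (E []) = n} E * (\<Prod>i<n. ?c E i)) =
    (\<Sum>n\<in>{length (E [])}. indicator {E. length (E []) = n} E * (\<Prod>i<n. ?c E i))"
   by (rule suminf_finite) auto
  also have "\<dots> = (\<Prod>i<length (E []). ?c E i)"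
   by simp
  also have "\<dots> = indicator C E"
   using elim by (auto simp: indicator_def prod_zero_iff)
  finally show ?case by simp
 qed
 also have "\<dots> = (\<Sum>n. \<integral>\<^sup>+E. indicator {E. length (E []) = n} E * emeasure GW C ^ n \<partial>GW)"
  by (subst nn_integral_suminf) (simp_all add: prod nn_integral_multc)
 also have "\<dots> = (\<bbbE>\<^sup>+E. (\<Sum>n. indicator {E. length (E []) = n} E * emeasure GW C ^ n))"
  by (rule nn_integral_suminf[symmetric]) measurable
 also have "\<dots> = (\<bbbE>\<^sup>+E. emeasure GW C ^ length (E []))"
 proof (rule nn_integral_cong)
  fix E
  have "(\<Sum>n. indicator {E. length (E []) = n} E * emeasure GW C ^ n) =
    (\<Sum>n\<in>{length (E [])}. indicator {E. length (E []) = n} E * emeasure GW C ^ n)"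
   by (rule suminf_finite) auto
  then show "(\<Sum>n. indicator {E. length (E []) = n} E * emeasure GW C ^ n) = emeasure GW C ^ length (E [])"
   by simp
 qed
 also have "\<dots> = (\<integral>\<^sup>+xs. emeasure GW C ^ length xs \<partial>\<mu>)"
  by (rule nn_integral_root[where h = "\<lambda>xs. emeasure GW C ^ length xs"])
    (rule measurable_compose[OF length_measurable], simp)
 finally show ?thesis .
qed

text \<open>
 The generating function of the offspring number is strictly convex, so that besides \<open>1\<close> it has
 at most one fixed point.
\<close>

lemma generating_function_fixpoint_unique:
 assumes super: "(\<integral>\<^sup>+xs. of_nat (length xs) \<partial>\<mu>) > 1"
  and q: "0 \<le> a" "a \<le> b" "b < 1"
  and fa: "ennreal a = (\<integral>\<^sup>+xs. ennreal a ^ length xs \<partial>\<mu>)"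
  and fb: "ennreal b = (\<integral>\<^sup>+xs. ennreal b ^ length xs \<partial>\<mu>)"
 shows "a = b"
proof (rule ccontr)
 assume "a \<noteq> b"
 then have ab: "a < b" "a < 1"
  using q by auto
 define l where "l = (1 - b) / (1 - a)"
 have l: "0 < l" "l < 1"
  using ab q by (auto simp: l_def field_simps)
 have "l * (1 - a) = 1 - b"
  using ab by (simp add: l_def)
 then have b: "b = l * a + (1 - l)"
  by (simp add: algebra_simps)
 have [measurable]: "(\<lambda>xs. c ^ length xs) \<in> borel_measurable \<mu>" for c :: real
  using measurable_compose[OF length_measurable, of "\<lambda>n. c ^ n" borel] by (simp add: sets_\<mu> cong: measurable_cong_sets)
 have int: "integrable \<mu> (\<lambda>xs. c ^ length xs)" if "0 \<le> c" "c \<le> 1" for c :: real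
  using that by (intro integrable_const_bound[where B = 1]) (auto simp: power_le_one)
 have val: "(\<integral>xs. c ^ length xs \<partial>\<mu>) = c" if "0 \<le> c" "c \<le> 1" "ennreal c = (\<integral>\<^sup>+xs. ennreal c ^ length xs \<partial>\<mu>)" for c :: real
  using that by (subst integral_eq_nn_integral) (auto simp: ennreal_power[symmetric])
 define d where "d xs = l * a ^ length xs + (1 - l) - b ^ length xs" for xs :: "real list"
 have d0: "d xs \<ge> 0" for xs
  using power_convex_strict(1)[OF q(1) ab(2) l, of "length xs - 1"] unfolding d_def b[symmetric]
  by (cases xs) auto
 have dpos: "d xs > 0" if "length xs \<ge> 2" for xs
 proof -
  from that obtain n where "length xs = Suc n" "n \<ge> 1"
   by (cases "length xs") auto
  then show ?thesis
   using power_convex_strict(2)[OF q(1) ab(2) l, of n] unfolding d_def b[symmetric] by simp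
 qed
 have dint: "integrable \<mu> d"
  unfolding d_def using q ab by (intro Bochner_Integration.integrable_add Bochner_Integration.integrable_diff int integrable_mult_right integrable_const) auto
 have "(\<integral>xs. d xs \<partial>\<mu>) = l * a + (1 - l) - b"
  unfolding d_def using q ab by (simp add: int val[OF _ _ fa] val[OF _ _ fb] prob_space[simplified])
 also have "\<dots> = 0"
  using b by simp
 finally have "AE xs in \<mu>. d xs = 0"
  using integral_nonneg_eq_0_iff_AE[OF dint] d0 by simp
 then have "AE xs in \<mu>. length xs \<le> 1"
 proof eventually_elim
  case (elim xs)
  then show ?case
   using dpos[of xs] by (cases "length xs \<ge> 2") auto
 qed
 then have "AE xs in \<mu>. of_nat (length xs) \<le> (1 :: ennreal)"
 proof eventually_elim
  case (elim xs)
  then show ?case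
   using of_nat_mono[of "length xs" 1, where ?'a = ennreal] by simp
 qed
 then have "(\<integral>\<^sup>+xs. of_nat (length xs) \<partial>\<mu>) \<le> (\<integral>\<^sup>+xs. 1 \<partial>\<mu>)"
  by (rule nn_integral_mono_AE)
 then show False
  using super emeasure_space_1 by simp
qed

end

definition survival :: "environment set" where
 "survival = {E. \<forall>l. generation E l \<noteq> {}}"

lemma generation_empty_mono: "generation E l = {} \<Longrightarrow> l \<le> l' \<Longrightarrow> generation E l' = {}"
proof -
 assume *: "generation E l = {}" "l \<le> l'"
 have False if "x \<in> generation E l'" for x
 proof -
  have "take l x \<in> generation E l"
   using that *(2) tree_append[of "take l x" "drop l x" E] by (auto simp: generation_def)
  then show False
   using * by simp
 qed
 then show ?thesis by blast
qed

lemma survival_measurable [measurable]: "survival \<in> sets env_space"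
proof -
 have "survival = {E\<in>space env_space. \<forall>l. \<exists>x. x \<in> generation E l}"
  by (auto simp: survival_def)
 also have "\<dots> \<in> sets env_space"
  by measurable
 finally show ?thesis .
qed

lemma not_survival_iff: "E \<notin> survival \<longleftrightarrow> (\<forall>i<length (E []). subtree E [i] \<notin> survival)"
proof
 assume "E \<notin> survival"
 then obtain l where l: "generation E l = {}"
  by (auto simp: survival_def)
 then have "generation E (Suc l) = {}"
  by (rule generation_empty_mono) simp
 then show "\<forall>i<length (E []). subtree E [i] \<notin> survival"
  by (auto simp: generation_Suc survival_def)
next
 assume "\<forall>i<length (E []). subtree E [i] \<notin> survival"
 then have "\<forall>i. \<exists>l. i < length (E []) \<longrightarrow> generation (subtree E [i]) l = {}"
  by (auto simp: survival_def)
 then obtain l where l: "\<And>i. i < length (E []) \<Longrightarrow> generation (subtree E [i]) (l i) = {}"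
  by metis
 define m where "m = Max (l ` {..<length (E [])})"
 have "generation (subtree E [i]) m = {}" if "i < length (E [])" for i
  using l[OF that] by (rule generation_empty_mono) (use that in \<open>auto simp: m_def\<close>)
 then have "generation E (Suc m) = {}"
  by (auto simp: generation_Suc)
 then show "E \<notin> survival"
  by (auto simp: survival_def)
qed

lemma W_inf_extinct: "E \<notin> survival \<Longrightarrow> W_inf E = 0"
proof -
 assume "E \<notin> survival"
 then obtain l where "generation E l = {}"
  by (auto simp: survival_def)
 then have "\<forall>n\<ge>l. W n E = 0"
  using generation_empty_mono by (auto simp: gen_sum_def)
 then have "(\<lambda>n. W n E) \<longlonglongrightarrow> 0"
  by (intro tendsto_eventually) (auto simp: eventually_sequentially)
 then show ?thesis
  unfolding W_inf_eq by (rule limI)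
qed

context L2_branching_law
begin

text \<open>
 Extinction implies \<open>W_inf = 0\<close>, and the probabilities of both events are fixed points of the
 generating function smaller than one. Hence they are equal, and the events differ by a null set.
\<close>

lemma W_inf_positive:
 assumes super: "(\<integral>\<^sup>+xs. of_nat (length xs) \<partial>\<mu>) > 1"
 shows "emeasure GW survival > 0" "AE E in GW. E \<in> survival \<longrightarrow> W_inf E > 0"
proof -
 define Z where "Z = {E. W_inf E = 0}"
 have Z [measurable]: "Z \<in> sets env_space"
  using measurable_sets[OF W_inf_measurable, of "{0}"] by (simp add: Z_def vimage_def)
 have nonneg: "AE E in GW. \<forall>u\<in>tree E. W_inf (subtree E u) \<ge> 0"
  using AE_W_tendsto
 proof eventually_elim
  case (elim E)
  then show ?case
   by (metis LIMSEQ_le_const W_nonneg)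
 qed
 have "AE E in GW. E \<in> Z \<longleftrightarrow> (\<forall>i<length (E []). subtree E [i] \<in> Z)"
  using AE_W_tendsto nonneg
 proof eventually_elim
  case (elim E)
  have nn: "W_inf (subtree E [i]) \<ge> 0" if "i < length (E [])" for i
   using elim(2) that by (auto simp: tree_Cons)
  have "W_inf E = (\<Sum>i<length (E []). exp (- (E [] ! i)) * W_inf (subtree E [i]))"
   using W_inf_gen_sum[OF elim(1), of 1] by (simp add: gen_sum_Suc branch_sum_def)
  then have "W_inf E = 0 \<longleftrightarrow> (\<forall>i\<in>{..<length (E [])}. exp (- (E [] ! i)) * W_inf (subtree E [i]) = 0)"
   using nn by (simp only:) (rule sum_nonneg_eq_0_iff, auto)
  then show ?case
   by (auto simp: Z_def)
 qed
 then have fZ: "emeasure GW Z = (\<integral>\<^sup>+xs. emeasure GW Z ^ length xs \<partial>\<mu>)"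
  by (rule hereditary_event_fixpoint[OF Z])
 have fS: "emeasure GW (- survival) = (\<integral>\<^sup>+xs. emeasure GW (- survival) ^ length xs \<partial>\<mu>)"
 proof (rule hereditary_event_fixpoint)
  show "- survival \<in> sets env_space"
   using sets.compl_sets[OF survival_measurable] by (simp add: Compl_eq_Diff_UNIV)
  show "AE E in GW. E \<in> - survival \<longleftrightarrow> (\<forall>i<length (E []). subtree E [i] \<in> - survival)"
   unfolding Compl_iff by (intro AE_I2 not_survival_iff)
 qed
 have sub: "- survival \<subseteq> Z"
  using W_inf_extinct by (auto simp: Z_def)
 have ms [measurable]: "Z \<in> sets GW" "survival \<in> sets GW"
  by (auto simp: sets_GW)
 have ms' [measurable]: "- survival \<in> sets GW"
  using sets.compl_sets[OF ms(2)] by (simp add: Compl_eq_Diff_UNIV)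
 have "measure GW Z \<noteq> 1"
 proof
  assume "measure GW Z = 1"
  then have "AE E in GW. E \<in> Z"
   by (subst (asm) GW.prob_eq_1) auto
  then show False
   using W_inf_not_AE_zero by (simp add: Z_def)
 qed
 then have Z1: "measure GW Z < 1"
  using GW.prob_le_1[of Z] by linarith
 have eq: "measure GW (- survival) = measure GW Z"
  by (rule generating_function_fixpoint_unique[OF super])
    (use fZ fS Z1 sub in \<open>auto simp: GW.emeasure_eq_measure intro!: GW.finite_measure_mono\<close>)
 have "measure GW survival = 1 - measure GW (- survival)"
  using GW.prob_compl[of survival] by (simp add: Compl_eq_Diff_UNIV)
 then show "emeasure GW survival > 0"
  using eq Z1 by (simp add: GW.emeasure_eq_measure)
 have "measure GW (Z - - survival) = 0"
  using GW.finite_measure_Diff[OF ms(1) ms' sub] eq by simp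
 then have "AE E in GW. E \<notin> Z - - survival"
  by (subst (asm) GW.prob_eq_0) auto
 then show "AE E in GW. E \<in> survival \<longrightarrow> W_inf E > 0"
  using nonneg
 proof eventually_elim
  case (elim E)
  have "W_inf E \<ge> 0"
   using elim(2) by (metis subtree_Nil tree_Nil)
  then show ?case
   using elim(1) by (auto simp: Z_def)
 qed
qed

end


section \<open>Resistances and the constant $c_\infty$\<close>

text \<open>
 The edge from the parent of \<open>y\<close> to \<open>y\<close> has conductance \<open>exp (- V y)\<close>, which makes the walk reversible;
 this is the effective resistance between \<open>x\<close> and the extra parent of the root.
\<close>

definition resistance :: "environment \<Rightarrow> vertex \<Rightarrow> real" where
 "resistance E x = (\<Sum>j\<le>length x. exp (potential E (take j x)))"

lemma resistance_Nil [simp]: "resistance E [] = 1"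
 by (simp add: resistance_def)

lemma resistance_Cons: "resistance E (i # x) = 1 + exp (E [] ! i) * resistance (subtree E [i]) x"
 by (simp add: resistance_def sum.atMost_Suc_shift potential_Cons exp_add sum_distrib_left del: sum.atMost_Suc)

lemma resistance_snoc: "resistance E (x @ [i]) = resistance E x + exp (potential E (x @ [i]))"
 by (simp add: resistance_def)

lemma resistance_append:
 "resistance E (u @ v) = resistance E u - exp (potential E u) + exp (potential E u) * resistance (subtree E u) v"
proof (induction u arbitrary: E)
 case (Cons a u)
 show ?case
  by (simp add: Cons.IH resistance_Cons potential_Cons exp_add right_diff_distrib distrib_left mult.assoc)
qed simp

lemma resistance_ge_1: "resistance E x \<ge> 1"
proof (cases x)
 case (Cons i y)
 have "resistance (subtree E [i]) y \<ge> 0"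
  by (auto simp: resistance_def intro!: sum_nonneg)
 then show ?thesis
  by (simp add: Cons resistance_Cons)
qed simp

lemma resistance_pos [simp]: "resistance E x > 0"
 using resistance_ge_1[of E x] by linarith

lemma resistance_nonneg [simp]: "resistance E x \<ge> 0"
 by (rule less_imp_le) simp

lemma resistance_ge_exp: "j \<le> length x \<Longrightarrow> exp (potential E (take j x)) \<le> resistance E x"
 unfolding resistance_def by (rule member_le_sum) auto

lemma inverse_resistance_le: "1 / resistance E x \<le> exp (- potential E x)"
 using resistance_ge_exp[of "length x" x E] by (simp add: exp_minus inverse_eq_divide frac_le)

lemma resistance_measurable [measurable]: "(\<lambda>E. resistance E x) \<in> borel_measurable env_space"
 unfolding resistance_def by measurable

text \<open>
 \<open>hit_sum l b\<close> is the sum of the inverse resistances of the vertices of generation \<open>l\<close>, when an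
 extra resistance \<open>b\<close> is put in front of the root. For \<open>b = 0\<close> it is the quenched expected number
 of vertices of generation \<open>l\<close> visited in one excursion.
\<close>

definition hit_sum :: "nat \<Rightarrow> real \<Rightarrow> environment \<Rightarrow> real" where
 "hit_sum l b E = (\<Sum>x\<in>generation E l. 1 / (resistance E x + b))"

lemma hit_sum_nonneg: "b \<ge> 0 \<Longrightarrow> hit_sum l b E \<ge> 0"
 by (auto simp: hit_sum_def intro!: sum_nonneg divide_nonneg_nonneg add_nonneg_nonneg)

lemma hit_sum_measurable [measurable]: "hit_sum l b \<in> borel_measurable env_space"
 unfolding hit_sum_def by measurable

lemma hit_sum_joint_measurable:
 "(\<lambda>(a, E). ennreal (hit_sum l (exp (- a) * (1 + b)) E)) \<in> borel_measurable (borel \<Otimes>\<^sub>M env_space)"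
 unfolding hit_sum_def case_prod_beta
 by (rule measurable_compose_finite_set[where f = "\<lambda>S x. ennreal (\<Sum>y\<in>S. 1 / (resistance (snd x) y + exp (- fst x) * (1 + b)))"])
   measurable

lemma hit_sum_Suc:
 "hit_sum (Suc l) b E =
  (\<Sum>i<length (E []). exp (- (E [] ! i)) * hit_sum l (exp (- (E [] ! i)) * (1 + b)) (subtree E [i]))"
proof -
 have "1 / (resistance E (i # x) + b) =
   exp (- (E [] ! i)) * (1 / (resistance (subtree E [i]) x + exp (- (E [] ! i)) * (1 + b)))" for i x
 proof -
  have "resistance E (i # x) + b =
    exp (E [] ! i) * (resistance (subtree E [i]) x + exp (- (E [] ! i)) * (1 + b))"
   by (simp add: resistance_Cons distrib_left mult.assoc[symmetric] exp_add[symmetric])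
  then show ?thesis
   by (simp add: exp_minus inverse_eq_divide)
 qed
 then show ?thesis
  by (simp add: hit_sum_def sum_generation_Suc sum_distrib_left)
qed

lemma hit_sum_le_W: "hit_sum l 0 E \<le> W l E"
 unfolding hit_sum_def gen_sum_def using inverse_resistance_le by (auto intro!: sum_mono)

context branching_law
begin

text \<open>
 Seen from a child with mark \<open>a\<close>, whose conductances are measured relative to its own, a resistance
 \<open>b\<close> in front of the root becomes \<open>exp (- a) * (1 + b)\<close>; compare \<open>hit_sum_Suc\<close>.
\<close>

definition step_op :: "(real \<Rightarrow> ennreal) \<Rightarrow> real \<Rightarrow> ennreal" where
 "step_op \<phi> b = (\<integral>\<^sup>+a. \<phi> (exp (- a) * (1 + b)) \<partial>\<nu>)"

lemma step_op_measurable [measurable]: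
 assumes [measurable]: "\<phi> \<in> borel_measurable borel"
 shows "step_op \<phi> \<in> borel_measurable borel"
 unfolding step_op_def[abs_def] by measurable

lemma nn_integral_hit_sum:
 "b \<ge> 0 \<Longrightarrow> (\<bbbE>E. hit_sum l b E) = (step_op ^^ l) (\<lambda>b. ennreal (1 / (1 + b))) b"
proof (induction l arbitrary: b)
 case 0
 then show ?case
  by (simp add: hit_sum_def GW.emeasure_space_1[simplified])
next
 case (Suc l)
 have "(\<bbbE>E. hit_sum (Suc l) b E) =
   (\<bbbE>\<^sup>+E. (\<Sum>i<length (E []). ennreal (exp (- (E [] ! i))) * ennreal (hit_sum l (exp (- (E [] ! i)) * (1 + b)) (subtree E [i]))))"
  using Suc.prems unfolding hit_sum_Suc
  by (intro nn_integral_cong, subst sum_ennreal[symmetric]) (auto simp: hit_sum_nonneg ennreal_mult')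
 also have "\<dots> = (\<integral>\<^sup>+a. \<integral>\<^sup>+E. ennreal (hit_sum l (exp (- a) * (1 + b)) E) \<partial>GW \<partial>\<nu>)"
  by (rule nn_integral_children[OF hit_sum_joint_measurable])
 also have "\<dots> = step_op ((step_op ^^ l) (\<lambda>b. ennreal (1 / (1 + b)))) b"
  unfolding step_op_def[of "(step_op ^^ l) _"] using Suc.prems by (intro nn_integral_cong Suc.IH) auto
 finally show ?case
  by simp
qed

end

lemma ennreal_inverse_antimono: "a \<le> b \<Longrightarrow> inverse b \<le> inverse (a :: ennreal)"
proof (cases a rule: ennreal_cases)
 case (real r)
 assume le: "a \<le> b"
 show ?thesis
 proof (cases b rule: ennreal_cases)
  case b: (real t)
  show ?thesis
  proof (cases "r = 0")
   case False
   then show ?thesis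
    using real b le by (simp add: inverse_ennreal)
  qed (simp add: real)
 qed simp
qed (simp add: top_unique)

lemma tendsto_inverse_ennreal:
 "(f \<longlongrightarrow> l) F \<Longrightarrow> ((\<lambda>x. inverse (f x)) \<longlongrightarrow> inverse (l :: ennreal)) F"
 by (rule continuous_on_tendsto_compose[where s = UNIV and f = inverse])
   (auto intro: continuous_on_inverse_ennreal continuous_on_id)

locale spine_branching_law = L2_branching_law + Q: prob_space Q for Q :: "'s measure" +
 fixes S :: "nat \<Rightarrow> 's \<Rightarrow> real"
 assumes S_0: "\<And>w. w \<in> space Q \<Longrightarrow> S 0 w = 0"
  and S_indep: "Q.indep_vars (\<lambda>_. borel) (\<lambda>j w. S (Suc j) w - S j w) UNIV"
  and S_law: "\<And>j. distr Q borel (\<lambda>w. S (Suc j) w - S j w) = \<nu>"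
begin

definition tail_sum :: "nat \<Rightarrow> nat \<Rightarrow> 's \<Rightarrow> real" where
 "tail_sum n l w = (\<Sum>j<l. exp (- (S (n + Suc j) w - S n w)))"

lemma increment_measurable [measurable]: "(\<lambda>w. S (Suc j) w - S j w) \<in> borel_measurable Q"
 using S_indep by (auto simp: Q.indep_vars_def)

lemma increment_sum: "S (n + j) w - S n w = (\<Sum>i\<in>{n..<n+j}. S (Suc i) w - S i w)"
 by (induction j) auto

lemma tail_sum_measurable [measurable]: "tail_sum n l \<in> borel_measurable Q"
 unfolding tail_sum_def[abs_def] increment_sum by measurable

lemma tail_sum_Suc: "tail_sum n (Suc l) w = exp (- (S (Suc n) w - S n w)) * (1 + tail_sum (Suc n) l w)"
 by (simp add: tail_sum_def sum.lessThan_Suc_shift sum_distrib_left distrib_left exp_add[symmetric] del: sum.lessThan_Suc)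

lemma tail_sum_nonneg: "tail_sum n l w \<ge> 0"
 by (auto simp: tail_sum_def intro!: sum_nonneg)

text \<open>
 Conditioning on the first increment, the tail sums of the walk obey the same recursion as the
 inverse resistances in the tree, although the walk is read in the opposite direction; this is
 how the time reversal in the many-to-one formula enters.
\<close>

lemma nn_integral_tail_sum_Suc:
 assumes [measurable]: "\<phi> \<in> borel_measurable borel"
 shows "(\<integral>\<^sup>+w. \<phi> (tail_sum n (Suc l) w) \<partial>Q) = (\<integral>\<^sup>+w. step_op \<phi> (tail_sum (Suc n) l w) \<partial>Q)"
proof -
 let ?X = "\<lambda>j w. S (Suc j) w - S j w"
 have "Q.indep_var (Pi\<^sub>M {n} (\<lambda>_. borel)) (\<lambda>w. restrict (\<lambda>i. ?X i w) {n})
   (Pi\<^sub>M {Suc n..} (\<lambda>_. borel)) (\<lambda>w. restrict (\<lambda>i. ?X i w) {Suc n..})"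
  by (rule Q.indep_var_restrict[OF S_indep]) auto
 then have "Q.indep_var borel ((\<lambda>f. f n) \<circ> (\<lambda>w. restrict (\<lambda>i. ?X i w) {n}))
   borel ((\<lambda>f. \<Sum>j<l. exp (- (\<Sum>i\<in>{Suc n..<Suc n + Suc j}. f i))) \<circ> (\<lambda>w. restrict (\<lambda>i. ?X i w) {Suc n..}))"
  by (rule Q.indep_var_compose) measurable
 moreover have "(\<lambda>f. f n) \<circ> (\<lambda>w. restrict (\<lambda>i. ?X i w) {n}) = ?X n"
  by (simp add: fun_eq_iff)
 moreover have "(\<lambda>f. \<Sum>j<l. exp (- (\<Sum>i\<in>{Suc n..<Suc n + Suc j}. f i))) \<circ> (\<lambda>w. restrict (\<lambda>i. ?X i w) {Suc n..}) =
   tail_sum (Suc n) l"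
  unfolding tail_sum_def[abs_def] increment_sum by (auto simp: fun_eq_iff intro!: sum.cong)
 ultimately have ind: "Q.indep_var borel (?X n) borel (tail_sum (Suc n) l)"
  by simp
 have "(\<integral>\<^sup>+w. \<phi> (tail_sum n (Suc l) w) \<partial>Q) =
   (\<integral>\<^sup>+x. \<phi> (exp (- fst x) * (1 + snd x)) \<partial>distr Q (borel \<Otimes>\<^sub>M borel) (\<lambda>w. (?X n w, tail_sum (Suc n) l w)))"
  by (subst nn_integral_distr) (auto simp: tail_sum_Suc)
 also have "\<dots> = (\<integral>\<^sup>+x. \<phi> (exp (- fst x) * (1 + snd x)) \<partial>(\<nu> \<Otimes>\<^sub>M distr Q borel (tail_sum (Suc n) l)))"
  using ind S_law by (subst (asm) Q.indep_var_distribution_eq) simp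
 also have "\<dots> = (\<integral>\<^sup>+b. \<integral>\<^sup>+a. \<phi> (exp (- a) * (1 + b)) \<partial>\<nu> \<partial>distr Q borel (tail_sum (Suc n) l))"
 proof -
  interpret D: prob_space "distr Q borel (tail_sum (Suc n) l)"
   by (rule Q.prob_space_distr) simp
  interpret pair_prob_space \<nu> "distr Q borel (tail_sum (Suc n) l)" ..
  show ?thesis
   by (subst nn_integral_snd[symmetric]) auto
 qed
 also have "\<dots> = (\<integral>\<^sup>+w. step_op \<phi> (tail_sum (Suc n) l w) \<partial>Q)"
  unfolding step_op_def[symmetric] by (rule nn_integral_distr) auto
 finally show ?thesis .
qed

lemma nn_integral_tail_sum:
 "\<phi> \<in> borel_measurable borel \<Longrightarrow> (\<integral>\<^sup>+w. \<phi> (tail_sum n l w) \<partial>Q) = (step_op ^^ l) \<phi> 0"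
proof (induction l arbitrary: \<phi> n)
 case 0
 then show ?case
  by (simp add: tail_sum_def Q.emeasure_space_1)
next
 case (Suc l)
 then show ?case
  by (simp add: nn_integral_tail_sum_Suc funpow_swap1)
qed

lemma nn_integral_tail_sum_bounded:
 obtains B where "B \<ge> 0" "\<And>n l. (\<integral>\<^sup>+w. ennreal (tail_sum n l w) \<partial>Q) \<le> ennreal B"
proof -
 obtain r where r: "\<rho> = ennreal r" "0 \<le> r" "r < 1"
  using \<rho>_less_1 by (cases \<rho>) (auto simp: ennreal_less_one_iff)
 define B where "B = r / (1 - r)"
 have B: "B \<ge> 0" "B * (1 - r) = r"
  using r by (auto simp: B_def)
 then have step: "r * (1 + B) = B"
  by (simp add: algebra_simps)
 have "(\<integral>\<^sup>+w. ennreal (tail_sum n l w) \<partial>Q) \<le> ennreal B" for n l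
 proof (induction l arbitrary: n)
  case (Suc l)
  have "step_op ennreal b = \<rho> * ennreal (1 + b)" if "b \<ge> 0" for b
   using that by (simp add: step_op_def \<rho>_def ennreal_mult' nn_integral_multc del: ennreal_plus)
  then have "(\<integral>\<^sup>+w. ennreal (tail_sum n (Suc l) w) \<partial>Q) = (\<integral>\<^sup>+w. \<rho> * ennreal (1 + tail_sum (Suc n) l w) \<partial>Q)"
   by (simp add: nn_integral_tail_sum_Suc[where \<phi> = ennreal] tail_sum_nonneg del: ennreal_plus)
  also have "\<dots> = \<rho> * (1 + (\<integral>\<^sup>+w. ennreal (tail_sum (Suc n) l w) \<partial>Q))"
   by (simp add: nn_integral_cmult nn_integral_add ennreal_plus tail_sum_nonneg Q.emeasure_space_1)
  also have "\<dots> \<le> ennreal r * (1 + ennreal B)"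
   unfolding r(1) by (intro mult_left_mono add_left_mono Suc) simp
  also have "\<dots> = ennreal (r * (1 + B))"
   using r B by (simp add: ennreal_mult ennreal_plus)
  finally show ?case
   using step by simp
 qed (simp add: tail_sum_def)
 with B that show ?thesis
  by blast
qed

definition hit_mean :: "nat \<Rightarrow> real" where
 "hit_mean l = enn2real (\<bbbE>E. hit_sum l 0 E)"

lemma nn_integral_hit_sum_eq: "(\<bbbE>E. hit_sum l 0 E) = ennreal (hit_mean l)"
proof -
 have "(\<bbbE>E. hit_sum l 0 E) \<le> (\<bbbE>E. W l E)"
  by (intro nn_integral_mono ennreal_leI hit_sum_le_W)
 then have "(\<bbbE>E. hit_sum l 0 E) < top"
  using ennreal_one_less_top by (simp add: nn_integral_W del: ennreal_one_less_top)
 then show ?thesis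
  by (simp add: hit_mean_def)
qed

lemma hit_mean_eq: "ennreal (hit_mean l) = (\<integral>\<^sup>+w. inverse (\<Sum>j<Suc l. ennreal (exp (- S j w))) \<partial>Q)"
proof -
 have "ennreal (hit_mean l) = (\<integral>\<^sup>+w. ennreal (1 / (1 + tail_sum 0 l w)) \<partial>Q)"
  by (simp add: nn_integral_hit_sum_eq[symmetric] nn_integral_hit_sum
    nn_integral_tail_sum[where \<phi> = "\<lambda>b. ennreal (1 / (1 + b))"])
 also have "\<dots> = (\<integral>\<^sup>+w. inverse (\<Sum>j<Suc l. ennreal (exp (- S j w))) \<partial>Q)"
 proof (rule nn_integral_cong)
  fix w assume w: "w \<in> space Q"
  have "(\<Sum>j<Suc l. ennreal (exp (- S j w))) = ennreal (1 + tail_sum 0 l w)"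
   using S_0[OF w] by (subst sum_ennreal) (auto simp: tail_sum_def sum.lessThan_Suc_shift simp del: sum.lessThan_Suc)
  then show "ennreal (1 / (1 + tail_sum 0 l w)) = inverse (\<Sum>j<Suc l. ennreal (exp (- S j w)))"
   using tail_sum_nonneg[of 0 l w] by (simp add: inverse_ennreal inverse_eq_divide del: sum.lessThan_Suc ennreal_plus)
 qed
 finally show ?thesis .
qed

lemma S_measurable [measurable]: "S j \<in> borel_measurable Q"
proof -
 have "(\<lambda>w. \<Sum>i\<in>{0..<0+j}. S (Suc i) w - S i w) \<in> borel_measurable Q"
  by measurable
 then show ?thesis
  by (rule measurable_cong[THEN iffD1, rotated]) (use increment_sum[of 0 j, symmetric] S_0 in simp)
qed

text \<open>
 The inverses of the partial sums decrease and are at most one, which gives the limit. It is not zero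
 because the series of \<open>exp (- S\<^sub>j)\<close> has finite mean, the mean of \<open>exp (- S\<^sub>j)\<close> being \<open>\<rho> ^ j\<close> with \<open>\<rho> < 1\<close>.
\<close>

lemma c_inf_properties: "hit_mean \<longlonglongrightarrow> c_inf Q S" "c_inf Q S > 0" "c_inf Q S \<le> hit_mean l"
proof -
 let ?J = "\<lambda>l w. inverse (\<Sum>j<l. ennreal (exp (- S j w)))" and ?I = "\<lambda>w. inverse (\<Sum>j. ennreal (exp (- S j w)))"
 have [measurable]: "?I \<in> borel_measurable Q"
  by measurable
 have J_le_1: "?J (Suc l) w \<le> 1" if "w \<in> space Q" for l w
 proof -
  have "1 \<le> (\<Sum>j<Suc l. ennreal (exp (- S j w)))"
   using S_0[OF that] by (simp add: sum.lessThan_Suc_shift del: sum.lessThan_Suc)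
  then have "inverse (\<Sum>j<Suc l. ennreal (exp (- S j w))) \<le> inverse 1"
   by (rule ennreal_inverse_antimono)
  then show ?thesis by simp
 qed
 have "(\<lambda>l. \<integral>\<^sup>+w. ?J (Suc l) w \<partial>Q) \<longlonglongrightarrow> (\<integral>\<^sup>+w. ?I w \<partial>Q)"
 proof (rule nn_integral_dominated_convergence[where w = "\<lambda>_. 1"])
  show "AE w in Q. (\<lambda>l. ?J (Suc l) w) \<longlonglongrightarrow> ?I w"
  proof (rule AE_I2)
   fix w
   have "(\<lambda>l. \<Sum>j<l. ennreal (exp (- S j w))) \<longlonglongrightarrow> (\<Sum>j. ennreal (exp (- S j w)))"
    by (rule summable_LIMSEQ) simp
   then show "(\<lambda>l. ?J (Suc l) w) \<longlonglongrightarrow> ?I w"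
    by (intro tendsto_inverse_ennreal LIMSEQ_Suc)
  qed
 qed (use J_le_1 in \<open>auto simp: Q.emeasure_space_1 simp del: sum.lessThan_Suc\<close>)
 then have lim: "(\<lambda>l. ennreal (hit_mean l)) \<longlonglongrightarrow> (\<integral>\<^sup>+w. ?I w \<partial>Q)"
  by (simp only: hit_mean_eq)
 have le: "(\<integral>\<^sup>+w. ?I w \<partial>Q) \<le> ennreal (hit_mean l)" for l
  unfolding hit_mean_eq by (intro nn_integral_mono ennreal_inverse_antimono sum_le_suminf) auto
 have fin: "(\<integral>\<^sup>+w. ?I w \<partial>Q) < top"
  using le[of 0] by (simp add: le_less_trans[OF _ ennreal_less_top])
 then have c: "ennreal (c_inf Q S) = (\<integral>\<^sup>+w. ?I w \<partial>Q)" and c0: "c_inf Q S \<ge> 0"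
  by (simp_all add: c_inf_def)
 have h0: "hit_mean l \<ge> 0" for l
  by (simp add: hit_mean_def)
 show "hit_mean \<longlonglongrightarrow> c_inf Q S"
  using lim c0 h0 unfolding c[symmetric] by (subst (asm) tendsto_ennreal_iff) auto
 show "c_inf Q S \<le> hit_mean l"
  using le[of l] h0[of l] unfolding c[symmetric] by simp
 obtain B where B: "B \<ge> 0" "\<And>n l. (\<integral>\<^sup>+w. ennreal (tail_sum n l w) \<partial>Q) \<le> ennreal B"
  by (rule nn_integral_tail_sum_bounded) (rule that)
 have "(\<integral>\<^sup>+w. (\<Sum>j. ennreal (exp (- S (Suc j) w))) \<partial>Q) = (\<Sum>j. \<integral>\<^sup>+w. ennreal (exp (- S (Suc j) w)) \<partial>Q)"
  by (rule nn_integral_suminf) measurable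
 also have "\<dots> \<le> ennreal B"
 proof (rule suminf_le_const)
  fix l
  have "(\<Sum>j<l. \<integral>\<^sup>+w. ennreal (exp (- S (Suc j) w)) \<partial>Q) = (\<integral>\<^sup>+w. ennreal (tail_sum 0 l w) \<partial>Q)"
   by (subst nn_integral_sum[symmetric]) (auto simp: tail_sum_def S_0 intro!: nn_integral_cong)
  then show "(\<Sum>j<l. \<integral>\<^sup>+w. ennreal (exp (- S (Suc j) w)) \<partial>Q) \<le> ennreal B"
   using B(2)[of 0 l] by simp
 qed simp
 finally have "AE w in Q. (\<Sum>j. ennreal (exp (- S (Suc j) w))) \<noteq> \<infinity>"
  by (intro nn_integral_PInf_AE) (auto simp: top_unique)
 then have pos: "AE w in Q. ?I w \<noteq> 0"
 proof eventually_elim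
  case (elim w)
  have "(\<Sum>j. ennreal (exp (- S j w))) = (\<Sum>j. ennreal (exp (- S (j + 1) w))) + (\<Sum>j<1. ennreal (exp (- S j w)))"
   by (rule suminf_offset) simp
  then have "(\<Sum>j. ennreal (exp (- S j w))) \<noteq> top"
   using elim by simp
  then show ?case
   by simp
 qed
 have "(\<integral>\<^sup>+w. ?I w \<partial>Q) \<noteq> 0"
 proof
  assume "(\<integral>\<^sup>+w. ?I w \<partial>Q) = 0"
  then have "AE w in Q. ?I w = 0"
   by (subst (asm) nn_integral_0_iff_AE) auto
  with pos have "AE w in Q. False"
   by eventually_elim simp
  then show False
   by (simp add: Q.AE_False)
 qed
 then have "ennreal (c_inf Q S) \<noteq> 0"
  unfolding c .
 then show "c_inf Q S > 0"
  using c0 by (metis ennreal_0 order_le_less)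
qed

end


section \<open>Convergence of the expected number of visited descendants\<close>

definition hit_sum_below :: "vertex \<Rightarrow> nat \<Rightarrow> environment \<Rightarrow> real" where
 "hit_sum_below u l E = (\<Sum>x\<in>generation E l. if prefix u x then 1 / resistance E x else 0)"

definition mass_below :: "vertex \<Rightarrow> environment \<Rightarrow> real" where
 "mass_below u E = (if u \<in> tree E then exp (- potential E u) * W_inf (subtree E u) else 0)"

lemma hit_sum_below_measurable [measurable]: "hit_sum_below u l \<in> borel_measurable env_space"
 unfolding hit_sum_below_def by measurable

lemma mass_below_measurable [measurable]: "mass_below u \<in> borel_measurable env_space"
 unfolding mass_below_def[abs_def] by measurable

lemma hit_sum_below_nonneg: "hit_sum_below u l E \<ge> 0"
 by (auto simp: hit_sum_below_def intro!: sum_nonneg)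

lemma hit_sum_below_le: "hit_sum_below u l E \<le> hit_sum l 0 E"
 using resistance_pos unfolding hit_sum_below_def hit_sum_def
 by (intro sum_mono) (auto intro: less_imp_le)

lemma inverse_resistance_append_le:
 "1 / resistance E (y @ z) \<le> exp (- potential E y) * (1 / resistance (subtree E y) z)"
proof -
 have "exp (potential E y) * resistance (subtree E y) z \<le> resistance E (y @ z)"
  using resistance_ge_exp[of "length y" y E] by (simp add: resistance_append)
 then have "1 / resistance E (y @ z) \<le> 1 / (exp (potential E y) * resistance (subtree E y) z)"
  by (intro divide_left_mono) auto
 then show ?thesis
  by (simp add: exp_minus divide_inverse)
qed

lemma sum_generation_below:
 "(\<Sum>y\<in>generation E (length u + n). if prefix u y then f y else 0) =
   (if u \<in> tree E then \<Sum>z\<in>generation (subtree E u) n. f (u @ z) else 0)"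
proof -
 have "(\<Sum>y\<in>generation E (length u + n). if prefix u y then f y else 0) =
   (\<Sum>v\<in>generation E (length u). \<Sum>z\<in>generation (subtree E v) n. if prefix u (v @ z) then f (v @ z) else 0)"
  by (rule sum_generation_add)
 also have "\<dots> = (\<Sum>v\<in>generation E (length u). if v = u then \<Sum>z\<in>generation (subtree E u) n. f (u @ z) else 0)"
 proof (intro sum.cong refl)
  fix v assume "v \<in> generation E (length u)"
  then have "prefix u (v @ z) \<longleftrightarrow> v = u" for z
   by (auto simp: generation_def prefix_def)
  then show "(\<Sum>z\<in>generation (subtree E v) n. if prefix u (v @ z) then f (v @ z) else 0) =
    (if v = u then \<Sum>z\<in>generation (subtree E u) n. f (u @ z) else 0)"
   by simp
 qed
 also have "\<dots> = (if u \<in> tree E then \<Sum>z\<in>generation (subtree E u) n. f (u @ z) else 0)"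
 proof -
  have "u \<in> generation E (length u) \<longleftrightarrow> u \<in> tree E"
   by (simp add: generation_def)
  then show ?thesis
   by (simp add: sum.delta)
 qed
 finally show ?thesis .
qed

text \<open>
 Forgetting all but the last \<open>r\<close> generations of the resistance overestimates the hitting sums; the
 excess below \<open>u\<close> is at most the total excess, whose mean is a difference of two terms of a
 convergent sequence.
\<close>

lemma hit_sum_below_truncated:
 "\<bar>hit_sum_below u (length u + n + r) E -
   (if u \<in> tree E then exp (- potential E u) * gen_sum n (hit_sum r 0) (subtree E u) else 0)\<bar>
  \<le> gen_sum (length u + n) (hit_sum r 0) E - hit_sum (length u + n + r) 0 E"
proof -
 let ?d = "\<lambda>y z. exp (- potential E y) * (1 / resistance (subtree E y) z) - 1 / resistance E (y @ z)"
 have d: "?d y z \<ge> 0" for y z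
  using inverse_resistance_append_le[of E y z] by simp
 have full: "gen_sum (length u + n) (hit_sum r 0) E - hit_sum (length u + n + r) 0 E =
   (\<Sum>y\<in>generation E (length u + n). \<Sum>z\<in>generation (subtree E y) r. ?d y z)"
  unfolding gen_sum_def hit_sum_def sum_generation_add[of _ E "length u + n" r]
  by (simp add: sum_subtractf sum_distrib_left)
 have "gen_sum n (hit_sum r 0) (subtree E u) =
   (\<Sum>z\<in>generation (subtree E u) n. exp (- potential (subtree E u) z) * hit_sum r 0 (subtree E (u @ z)))"
  by (simp add: gen_sum_def)
 then have "(if u \<in> tree E then exp (- potential E u) * gen_sum n (hit_sum r 0) (subtree E u) else 0) =
   (\<Sum>y\<in>generation E (length u + n). if prefix u y then exp (- potential E y) * hit_sum r 0 (subtree E y) else 0)"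
  unfolding sum_generation_below by (simp add: sum_distrib_left potential_append exp_uminus_add mult.assoc del: minus_add_distrib)
 also have "\<dots> = (\<Sum>y\<in>generation E (length u + n). \<Sum>z\<in>generation (subtree E y) r.
   if prefix u y then exp (- potential E y) * (1 / resistance (subtree E y) z) else 0)"
  by (intro sum.cong) (auto simp: hit_sum_def sum_distrib_left)
 finally have trunc: "(if u \<in> tree E then exp (- potential E u) * gen_sum n (hit_sum r 0) (subtree E u) else 0) = \<dots>" .
 have below: "hit_sum_below u (length u + n + r) E =
   (\<Sum>y\<in>generation E (length u + n). \<Sum>z\<in>generation (subtree E y) r. if prefix u y then 1 / resistance E (y @ z) else 0)"
  unfolding hit_sum_below_def sum_generation_add[of _ E "length u + n" r]
 proof (intro sum.cong refl)
  fix y z assume "y \<in> generation E (length u + n)" "z \<in> generation (subtree E y) r"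
  then have "prefix u (y @ z) \<longleftrightarrow> prefix u y"
   by (auto simp: generation_def prefix_append)
  then show "(if prefix u (y @ z) then 1 / resistance E (y @ z) else 0) = (if prefix u y then 1 / resistance E (y @ z) else 0)"
   by simp
 qed
 have "(if u \<in> tree E then exp (- potential E u) * gen_sum n (hit_sum r 0) (subtree E u) else 0) -
   hit_sum_below u (length u + n + r) E =
   (\<Sum>y\<in>generation E (length u + n). \<Sum>z\<in>generation (subtree E y) r. if prefix u y then ?d y z else 0)"
  unfolding trunc below sum_subtractf[symmetric] by (intro sum.cong refl) auto
 moreover have "0 \<le> (\<Sum>y\<in>generation E (length u + n). \<Sum>z\<in>generation (subtree E y) r. if prefix u y then ?d y z else 0)"
  using d by (intro sum_nonneg) auto
 moreover have "(\<Sum>y\<in>generation E (length u + n). \<Sum>z\<in>generation (subtree E y) r. if prefix u y then ?d y z else 0) \<le>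
   (\<Sum>y\<in>generation E (length u + n). \<Sum>z\<in>generation (subtree E y) r. ?d y z)"
  using d by (intro sum_mono) auto
 ultimately show ?thesis
  unfolding full by linarith
qed

context spine_branching_law
begin

lemma hit_mean_nonneg: "hit_mean l \<ge> 0"
 by (simp add: hit_mean_def)

lemma nn_integral_W_inf_bounded: obtains B where "B \<ge> 0" "(\<bbbE>E. \<bar>W_inf E\<bar>) \<le> ennreal B"
proof -
 obtain r K where r: "\<rho> = ennreal r" "0 \<le> r" "r < 1" and K: "K \<ge> 0"
  and d: "\<And>l. (\<bbbE>E. (W_inf E - W l E)\<^sup>2) \<le> ennreal (K * r ^ l)"
  by (rule W_inf_L2) (rule that)
 have "(\<bbbE>E. \<bar>W_inf E\<bar>) \<le> (\<bbbE>\<^sup>+E. ennreal \<bar>W_inf E - W 0 E\<bar> + 1)"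
 proof (rule nn_integral_mono)
  fix E
  have "ennreal \<bar>W_inf E\<bar> \<le> ennreal (\<bar>W_inf E - W 0 E\<bar> + 1)"
   by (rule ennreal_leI) simp
  then show "ennreal \<bar>W_inf E\<bar> \<le> ennreal \<bar>W_inf E - W 0 E\<bar> + 1"
   by (simp add: ennreal_plus)
 qed
 also have "\<dots> = (\<bbbE>E. \<bar>W_inf E - W 0 E\<bar>) + 1"
  by (simp add: nn_integral_add GW.emeasure_space_1[simplified])
 also have "(\<bbbE>E. \<bar>W_inf E - W 0 E\<bar>) \<le> ennreal 1 + ennreal (1 / 1) * (\<bbbE>E. (W_inf E - W 0 E)\<^sup>2)"
  by (rule nn_integral_abs_le_square) auto
 also have "\<dots> \<le> ennreal 1 + ennreal (1 / 1) * ennreal (K * r ^ 0)"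
  by (intro add_left_mono mult_left_mono d) simp
 also have "ennreal 1 + ennreal (1 / 1) * ennreal (K * r ^ 0) + 1 = ennreal (2 + K)"
  using K by (simp add: ennreal_plus add_ac)
 finally show ?thesis
  using that[of "2 + K"] K by (simp add: add_mono)
qed

text \<open>
 The functionals \<open>hit_sum r 0\<close> and \<open>hit_mean r * W_inf\<close> have the same mean, so that
 \<open>nn_integral_gen_sum_diff\<close> applies to them, and summing the latter over a generation gives back
 \<open>hit_mean r * W_inf\<close>.
\<close>

lemma gen_sum_hit_sum_L1:
 "(\<lambda>n. \<integral>\<^sup>+E. ennreal \<bar>gen_sum n (hit_sum r 0) E - hit_mean r * W_inf E\<bar> \<partial>GW) \<longlonglongrightarrow> 0"
proof -
 obtain q K where q: "\<rho> = ennreal q" "0 \<le> q" "q < 1" and K: "K \<ge> 0"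
  and d: "\<And>l. (\<bbbE>E. (W_inf E - W l E)\<^sup>2) \<le> ennreal (K * q ^ l)"
  by (rule W_inf_L2) (rule that)
 let ?c = "hit_mean r"
 have fin: "(\<bbbE>E. (hit_sum r 0 E)\<^sup>2) < \<infinity>"
 proof -
  have "(\<bbbE>E. (hit_sum r 0 E)\<^sup>2) \<le> (\<bbbE>E. (W r E)\<^sup>2)"
   by (intro nn_integral_mono ennreal_leI power_mono hit_sum_le_W hit_sum_nonneg) simp
  then show ?thesis
   using W_square_finite[of r] by (rule le_less_trans)
 qed
 have fin2: "(\<bbbE>E. (hit_sum r 0 E - ?c)\<^sup>2) < \<infinity>"
 proof -
  have "(\<bbbE>E. (hit_sum r 0 E - ?c)\<^sup>2) \<le> (\<bbbE>\<^sup>+E. ennreal ((hit_sum r 0 E)\<^sup>2) + ennreal (?c\<^sup>2))"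
  proof (rule nn_integral_mono)
   fix E
   have "(hit_sum r 0 E - ?c)\<^sup>2 \<le> (hit_sum r 0 E)\<^sup>2 + ?c\<^sup>2"
    using mult_nonneg_nonneg[OF hit_mean_nonneg[of r] hit_sum_nonneg[of 0 r E]] by (simp add: power2_diff mult.commute)
   then show "ennreal ((hit_sum r 0 E - ?c)\<^sup>2) \<le> ennreal ((hit_sum r 0 E)\<^sup>2) + ennreal (?c\<^sup>2)"
    by (simp add: ennreal_plus[symmetric] ennreal_leI del: ennreal_plus)
  qed
  also have "\<dots> < \<infinity>"
   using fin by (simp add: nn_integral_add GW.emeasure_space_1[simplified])
  finally show ?thesis .
 qed
 obtain V where V: "V \<ge> 0" "(\<bbbE>E. (hit_sum r 0 E - ?c)\<^sup>2) = ennreal V"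
  using fin2 by (cases "\<integral>\<^sup>+E. ennreal ((hit_sum r 0 E - ?c)\<^sup>2) \<partial>GW") auto
 have const: "gen_sum n (\<lambda>_. ?c) E = ?c * W n E" for n E
  by (simp add: gen_sum_def sum_distrib_left mult.commute)
 have L2: "(\<bbbE>E. (gen_sum n (hit_sum r 0) E - ?c * W_inf E)\<^sup>2) \<le> ennreal ((2 * V + 2 * ?c\<^sup>2 * K) * q ^ n)" for n
 proof -
  have "(\<bbbE>E. (gen_sum n (hit_sum r 0) E - ?c * W_inf E)\<^sup>2) \<le>
   (\<bbbE>\<^sup>+E. ennreal 2 * ennreal ((gen_sum n (hit_sum r 0) E - gen_sum n (\<lambda>_. ?c) E)\<^sup>2) +
    ennreal (2 * ?c\<^sup>2) * ennreal ((W_inf E - W n E)\<^sup>2))"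
  proof (rule nn_integral_mono)
   fix E
   have sq: "(x + y)\<^sup>2 \<le> 2 * x\<^sup>2 + 2 * y\<^sup>2" for x y :: real
    using sum_squares_bound[of x y] by (simp add: power2_sum)
   have "(gen_sum n (hit_sum r 0) E - ?c * W_inf E)\<^sup>2 \<le>
     2 * (gen_sum n (hit_sum r 0) E - gen_sum n (\<lambda>_. ?c) E)\<^sup>2 + 2 * (?c * (W n E - W_inf E))\<^sup>2"
    using sq[of "gen_sum n (hit_sum r 0) E - ?c * W n E" "?c * (W n E - W_inf E)"] by (simp add: const algebra_simps)
   also have "\<dots> = 2 * (gen_sum n (hit_sum r 0) E - gen_sum n (\<lambda>_. ?c) E)\<^sup>2 + (2 * ?c\<^sup>2) * (W_inf E - W n E)\<^sup>2"
    by (simp add: power_mult_distrib power2_commute)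
   finally show "ennreal ((gen_sum n (hit_sum r 0) E - ?c * W_inf E)\<^sup>2) \<le>
     ennreal 2 * ennreal ((gen_sum n (hit_sum r 0) E - gen_sum n (\<lambda>_. ?c) E)\<^sup>2) +
     ennreal (2 * ?c\<^sup>2) * ennreal ((W_inf E - W n E)\<^sup>2)"
    by (simp add: ennreal_mult'[symmetric] ennreal_plus[symmetric] ennreal_leI del: ennreal_plus ennreal_numeral)
  qed
  also have "\<dots> = ennreal 2 * (\<bbbE>E. (gen_sum n (hit_sum r 0) E - gen_sum n (\<lambda>_. ?c) E)\<^sup>2) +
    ennreal (2 * ?c\<^sup>2) * (\<bbbE>E. (W_inf E - W n E)\<^sup>2)"
   by (simp add: nn_integral_add nn_integral_cmult)
  also have "(\<bbbE>E. (gen_sum n (hit_sum r 0) E - gen_sum n (\<lambda>_. ?c) E)\<^sup>2) = \<rho> ^ n * ennreal V"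
   unfolding V(2)[symmetric] using fin
   by (intro nn_integral_gen_sum_diff[where c = ?c])
     (auto simp: hit_sum_nonneg hit_mean_nonneg nn_integral_hit_sum_eq GW.emeasure_space_1[simplified])
  also have "\<rho> ^ n * ennreal V = ennreal (q ^ n * V)"
   using q V by (simp add: ennreal_power ennreal_mult)
  also have "ennreal 2 * ennreal (q ^ n * V) + ennreal (2 * ?c\<^sup>2) * (\<bbbE>E. (W_inf E - W n E)\<^sup>2) \<le>
    ennreal 2 * ennreal (q ^ n * V) + ennreal (2 * ?c\<^sup>2) * ennreal (K * q ^ n)"
   by (intro add_left_mono mult_left_mono d) simp
  also have "\<dots> = ennreal (2 * (q ^ n * V) + 2 * ?c\<^sup>2 * (K * q ^ n))"
   using q V K by (simp add: ennreal_plus ennreal_mult mult_ac)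
  also have "2 * (q ^ n * V) + 2 * ?c\<^sup>2 * (K * q ^ n) = (2 * V + 2 * ?c\<^sup>2 * K) * q ^ n"
   by (simp add: algebra_simps)
  finally show ?thesis .
 qed
 define C where "C = 2 * V + 2 * ?c\<^sup>2 * K"
 have C: "C \<ge> 0"
  using V K by (simp add: C_def)
 show ?thesis
 proof (rule tendsto_0_if_Limsup_eq_0_ennreal, rule antisym, rule ennreal_le_epsilon)
  fix e :: real assume e: "e > 0"
  have "(\<lambda>n. e / 2 + 1 / (e / 2) * (C * q ^ n)) \<longlonglongrightarrow> e / 2 + 1 / (e / 2) * (C * 0)"
   using q by (intro tendsto_intros LIMSEQ_power_zero) auto
  from order_tendstoD(2)[OF this, of e]
  have "eventually (\<lambda>n. e / 2 + 1 / (e / 2) * (C * q ^ n) < e) sequentially"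
   using e by simp
  then have "eventually (\<lambda>n. (\<bbbE>E. \<bar>gen_sum n (hit_sum r 0) E - ?c * W_inf E\<bar>) \<le> ennreal e) sequentially"
  proof eventually_elim
   case (elim n)
   have "(\<bbbE>E. \<bar>gen_sum n (hit_sum r 0) E - ?c * W_inf E\<bar>) \<le>
     ennreal (e / 2) + ennreal (1 / (e / 2)) * (\<bbbE>E. (gen_sum n (hit_sum r 0) E - ?c * W_inf E)\<^sup>2)"
    using e by (intro nn_integral_abs_le_square) auto
   also have "\<dots> \<le> ennreal (e / 2) + ennreal (1 / (e / 2)) * ennreal (C * q ^ n)"
    unfolding C_def by (intro add_left_mono mult_left_mono L2) simp
   also have "\<dots> = ennreal (e / 2 + 1 / (e / 2) * (C * q ^ n))"
    using e C q by (simp add: ennreal_mult[symmetric] ennreal_plus[symmetric] del: ennreal_plus)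
   also have "\<dots> \<le> ennreal e"
    using elim by (intro ennreal_leI) simp
   finally show ?case .
  qed
  then show "Limsup sequentially (\<lambda>n. \<integral>\<^sup>+E. ennreal \<bar>gen_sum n (hit_sum r 0) E - ?c * W_inf E\<bar> \<partial>GW) \<le> 0 + ennreal e"
   by (simp add: Limsup_bounded)
 qed simp
qed

lemma nn_integral_below_le:
 assumes [measurable]: "F \<in> borel_measurable env_space" and F: "\<And>E. F E \<ge> 0"
 shows "(\<bbbE>E. if u \<in> tree E then exp (- potential E u) * F (subtree E u) else 0) \<le> (\<bbbE>E. F E)"
proof -
 have "(\<bbbE>E. if u \<in> tree E then exp (- potential E u) * F (subtree E u) else 0) \<le>
   (\<bbbE>E. gen_sum (length u) F E)"
 proof (intro nn_integral_mono ennreal_leI)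
  fix E
  show "(if u \<in> tree E then exp (- potential E u) * F (subtree E u) else 0) \<le> gen_sum (length u) F E"
  proof (cases "u \<in> tree E")
   case True
   then show ?thesis
    using F unfolding gen_sum_def
    by (auto simp: generation_def intro!: member_le_sum[of u _ "\<lambda>x. exp (- potential E x) * F (subtree E x)"] finite_generation[unfolded generation_def])
  qed (simp add: gen_sum_nonneg F)
 qed
 also have "\<dots> = (\<bbbE>E. F E)"
  by (rule nn_integral_gen_sum) (auto simp: F)
 finally show ?thesis .
qed

text \<open>
 First the number \<open>n\<close> of generations between \<open>u\<close> and the truncation tends to infinity, then the
 truncation level \<open>r\<close>.
\<close>

lemma hit_sum_below_L1:
 "(\<lambda>l. \<integral>\<^sup>+E. ennreal \<bar>hit_sum_below u l E - c_inf Q S * mass_below u E\<bar> \<partial>GW) \<longlonglongrightarrow> 0"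
proof -
 obtain B where B: "B \<ge> 0" "(\<bbbE>E. \<bar>W_inf E\<bar>) \<le> ennreal B"
  by (rule nn_integral_W_inf_bounded) (rule that)
 let ?c = "c_inf Q S"
 let ?g = "\<lambda>n r E. \<bar>gen_sum n (hit_sum r 0) E - hit_mean r * W_inf E\<bar>"
 have bound: "(\<bbbE>E. \<bar>hit_sum_below u (length u + n + r) E - ?c * mass_below u E\<bar>) \<le>
   ennreal ((hit_mean r - ?c) * (1 + B)) + (\<bbbE>E. ?g n r E)" for n r
 proof -
  let ?l = "length u + n + r" and ?m = "length u + n"
  define t where "t E = gen_sum ?m (hit_sum r 0) E - hit_sum ?l 0 E" for E
  have [measurable]: "t \<in> borel_measurable env_space"
   unfolding t_def[abs_def] by measurable
  have t0: "t E \<ge> 0" for E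
   using hit_sum_below_truncated[of u n r E] unfolding t_def by linarith
  have "(\<bbbE>E. t E) + ennreal (hit_mean ?l) = (\<bbbE>\<^sup>+E. ennreal (t E) + ennreal (hit_sum ?l 0 E))"
   by (simp add: nn_integral_add nn_integral_hit_sum_eq)
  also have "\<dots> = (\<bbbE>E. gen_sum ?m (hit_sum r 0) E)"
   using t0 by (intro nn_integral_cong) (simp add: ennreal_plus[symmetric] hit_sum_nonneg t_def del: ennreal_plus)
  also have "\<dots> = ennreal (hit_mean r)"
   by (subst nn_integral_gen_sum) (auto simp: hit_sum_nonneg nn_integral_hit_sum_eq)
  finally have "(\<bbbE>E. t E) + ennreal (hit_mean ?l) = ennreal (hit_mean r)" .
  then have "(\<bbbE>E. t E) + ennreal ?c \<le> ennreal (hit_mean r)"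
   using add_left_mono[OF ennreal_leI[OF c_inf_properties(3)[of ?l]]] by metis
  then have tint: "(\<bbbE>E. t E) \<le> ennreal (hit_mean r - ?c)"
   using c_inf_properties(2) by (subst ennreal_minus[symmetric]) (auto simp: ennreal_le_minus_iff ennreal_minus_le_iff add.commute intro: ennreal_le_minus_iff[THEN iffD2])
  have pw: "\<bar>hit_sum_below u ?l E - ?c * mass_below u E\<bar> \<le>
    t E + (if u \<in> tree E then exp (- potential E u) * ?g n r (subtree E u) else 0) +
    (hit_mean r - ?c) * (if u \<in> tree E then exp (- potential E u) * \<bar>W_inf (subtree E u)\<bar> else 0)" for E
  proof (cases "u \<in> tree E")
   case True
   let ?e = "exp (- potential E u)"
   have "\<bar>?e * gen_sum n (hit_sum r 0) (subtree E u) - ?c * (?e * W_inf (subtree E u))\<bar> =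
     \<bar>?e * (gen_sum n (hit_sum r 0) (subtree E u) - hit_mean r * W_inf (subtree E u)) + (hit_mean r - ?c) * (?e * W_inf (subtree E u))\<bar>"
    by (simp add: algebra_simps)
   also have "\<dots> \<le> ?e * ?g n r (subtree E u) + (hit_mean r - ?c) * (?e * \<bar>W_inf (subtree E u)\<bar>)"
    using c_inf_properties(3)[of r] by (intro order_trans[OF abs_triangle_ineq]) (simp add: abs_mult)
   finally show ?thesis
    using hit_sum_below_truncated[of u n r E] True unfolding t_def mass_below_def by simp
  next
   case False
   then show ?thesis
    using hit_sum_below_truncated[of u n r E] unfolding t_def mass_below_def by simp
  qed
  have "(\<bbbE>E. \<bar>hit_sum_below u ?l E - ?c * mass_below u E\<bar>) \<le>
    (\<bbbE>\<^sup>+E. ennreal (t E) + ennreal (if u \<in> tree E then exp (- potential E u) * ?g n r (subtree E u) else 0) +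
    ennreal (hit_mean r - ?c) * ennreal (if u \<in> tree E then exp (- potential E u) * \<bar>W_inf (subtree E u)\<bar> else 0))"
  proof (rule nn_integral_mono)
   fix E
   show "ennreal \<bar>hit_sum_below u ?l E - ?c * mass_below u E\<bar> \<le>
    ennreal (t E) + ennreal (if u \<in> tree E then exp (- potential E u) * ?g n r (subtree E u) else 0) +
    ennreal (hit_mean r - ?c) * ennreal (if u \<in> tree E then exp (- potential E u) * \<bar>W_inf (subtree E u)\<bar> else 0)"
    using ennreal_leI[OF pw[of E]] t0[of E] c_inf_properties(3)[of r]
    by (subst (asm) ennreal_plus, simp, simp, subst (asm) ennreal_plus, simp, simp) (simp add: ennreal_mult')
  qed
  also have "\<dots> = (\<bbbE>E. t E) +
    (\<bbbE>E. if u \<in> tree E then exp (- potential E u) * ?g n r (subtree E u) else 0) +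
    ennreal (hit_mean r - ?c) * (\<bbbE>E. if u \<in> tree E then exp (- potential E u) * \<bar>W_inf (subtree E u)\<bar> else 0)"
   by (simp add: nn_integral_add nn_integral_cmult)
  also have "\<dots> \<le> ennreal (hit_mean r - ?c) + (\<bbbE>E. ?g n r E) + ennreal (hit_mean r - ?c) * ennreal B"
   by (intro add_mono mult_left_mono tint order_trans[OF nn_integral_below_le B(2)] nn_integral_below_le) auto
  also have "\<dots> = ennreal ((hit_mean r - ?c) * (1 + B)) + (\<bbbE>E. ?g n r E)"
   using c_inf_properties(3)[of r] B(1) by (simp add: distrib_left ennreal_mult[symmetric] add_ac)
  finally show ?thesis .
 qed
 show ?thesis
 proof (rule tendsto_0_if_Limsup_eq_0_ennreal, rule antisym, rule ennreal_le_epsilon)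
  fix e :: real assume e: "e > 0"
  have "(\<lambda>r. (hit_mean r - ?c) * (1 + B)) \<longlonglongrightarrow> (?c - ?c) * (1 + B)"
   by (intro tendsto_intros c_inf_properties(1))
  then have "eventually (\<lambda>r. (hit_mean r - ?c) * (1 + B) < e / 2) sequentially"
   using e by (intro order_tendstoD) auto
  then obtain r where r: "(hit_mean r - ?c) * (1 + B) < e / 2"
   by (auto simp: eventually_sequentially)
  have "eventually (\<lambda>n. (\<bbbE>E. ?g n r E) < ennreal (e / 2)) sequentially"
   using e by (intro order_tendstoD(2)[OF gen_sum_hit_sum_L1]) auto
  then obtain N where N: "\<And>n. n \<ge> N \<Longrightarrow> (\<bbbE>E. ?g n r E) < ennreal (e / 2)"
   by (auto simp: eventually_sequentially)
  have "eventually (\<lambda>l. (\<bbbE>E. \<bar>hit_sum_below u l E - ?c * mass_below u E\<bar>) \<le> ennreal e) sequentially"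
   using eventually_ge_at_top[of "length u + N + r"]
  proof eventually_elim
   case (elim l)
   define n where "n = l - length u - r"
   have l: "l = length u + n + r" and n: "n \<ge> N"
    using elim by (auto simp: n_def)
   have "(\<bbbE>E. \<bar>hit_sum_below u l E - ?c * mass_below u E\<bar>) \<le>
     ennreal ((hit_mean r - ?c) * (1 + B)) + (\<bbbE>E. ?g n r E)"
    unfolding l by (rule bound)
   also have "\<dots> \<le> ennreal (e / 2) + ennreal (e / 2)"
    using r N[OF n] by (intro add_mono ennreal_leI) auto
   also have "\<dots> = ennreal e"
    using e by (simp add: ennreal_plus[symmetric] del: ennreal_plus)
   finally show ?case .
  qed
  then show "Limsup sequentially (\<lambda>l. \<integral>\<^sup>+E. ennreal \<bar>hit_sum_below u l E - ?c * mass_below u E\<bar> \<partial>GW) \<le> 0 + ennreal e"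
   by (simp add: Limsup_bounded)
 qed simp
qed

end


section \<open>Pairs of vertices\<close>

text \<open>
 Up to constants this bounds the quenched mean number of pairs of vertices visited during the same
 excursion: the resistance of the common ancestor times two inverse resistances, the latter bounded
 by \<open>exp (- V)\<close>.
\<close>

definition pair_sum :: "nat \<Rightarrow> nat \<Rightarrow> environment \<Rightarrow> real" where
 "pair_sum a b E = (\<Sum>x\<in>generation E a. \<Sum>y\<in>generation E b.
   resistance E (longest_common_prefix x y) * (exp (- potential E x) * exp (- potential E y)))"

lemma pair_sum_nonneg: "pair_sum a b E \<ge> 0"
 by (auto simp: pair_sum_def intro!: sum_nonneg mult_nonneg_nonneg)

lemma pair_sum_measurable [measurable]: "pair_sum a b \<in> borel_measurable env_space"
 unfolding pair_sum_def by measurable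

lemma pair_sum_0: "pair_sum 0 b E = W 0 E * W b E" "pair_sum a 0 E = W a E * W 0 E"
 by (simp_all add: pair_sum_def gen_sum_def)

lemma pair_sum_Suc:
 "pair_sum (Suc a) (Suc b) E = W (Suc a) E * W (Suc b) E + branch_sum (pair_sum a b) E"
proof -
 let ?n = "length (E [])" and ?e = "\<lambda>i x. exp (- potential E (i # x))" and ?g = "\<lambda>i l. generation (subtree E [i]) l"
 have "pair_sum (Suc a) (Suc b) E = (\<Sum>i<?n. \<Sum>x\<in>?g i a. \<Sum>j<?n. \<Sum>y\<in>?g j b.
   resistance E (longest_common_prefix (i # x) (j # y)) * (?e i x * ?e j y))"
  by (simp add: pair_sum_def sum_generation_Suc)
 also have "\<dots> = (\<Sum>i<?n. \<Sum>x\<in>?g i a. \<Sum>j<?n. \<Sum>y\<in>?g j b. ?e i x * ?e j y +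
   (if i = j then exp (E [] ! i) * resistance (subtree E [i]) (longest_common_prefix x y) * (?e i x * ?e i y) else 0))"
  by (intro sum.cong refl) (auto simp: resistance_Cons algebra_simps)
 also have "\<dots> = (\<Sum>i<?n. \<Sum>x\<in>?g i a. \<Sum>j<?n. \<Sum>y\<in>?g j b. ?e i x * ?e j y) +
   (\<Sum>i<?n. \<Sum>x\<in>?g i a. \<Sum>j<?n. \<Sum>y\<in>?g j b.
    (if i = j then exp (E [] ! i) * resistance (subtree E [i]) (longest_common_prefix x y) * (?e i x * ?e i y) else 0))"
  by (simp add: sum.distrib)
 also have "(\<Sum>i<?n. \<Sum>x\<in>?g i a. \<Sum>j<?n. \<Sum>y\<in>?g j b. ?e i x * ?e j y) = W (Suc a) E * W (Suc b) E"
 proof -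
  have W: "W (Suc l) E = (\<Sum>i<?n. \<Sum>x\<in>?g i l. ?e i x)" for l
   by (simp add: gen_sum_def sum_generation_Suc)
  show ?thesis
   unfolding W by (simp only: sum_distrib_right) (simp only: sum_distrib_left)
 qed
 also have "(\<Sum>i<?n. \<Sum>x\<in>?g i a. \<Sum>j<?n. \<Sum>y\<in>?g j b.
    (if i = j then exp (E [] ! i) * resistance (subtree E [i]) (longest_common_prefix x y) * (?e i x * ?e i y) else 0)) =
   branch_sum (pair_sum a b) E"
  unfolding branch_sum_def pair_sum_def sum_distrib_left
 proof (intro sum.cong refl)
  fix i x assume i: "i \<in> {..<?n}"
  have "(\<Sum>j<?n. \<Sum>y\<in>?g j b.
    (if i = j then exp (E [] ! i) * resistance (subtree E [i]) (longest_common_prefix x y) * (?e i x * ?e i y) else 0)) =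
    (\<Sum>j<?n. if j = i then \<Sum>y\<in>?g i b. exp (E [] ! i) * resistance (subtree E [i]) (longest_common_prefix x y) * (?e i x * ?e i y) else 0)"
   by (intro sum.cong) auto
  also have "\<dots> = (\<Sum>y\<in>?g i b. exp (E [] ! i) * resistance (subtree E [i]) (longest_common_prefix x y) * (?e i x * ?e i y))"
   using i by simp
  also have "\<dots> = (\<Sum>y\<in>?g i b. exp (- (E [] ! i)) * (resistance (subtree E [i]) (longest_common_prefix x y) *
    (exp (- potential (subtree E [i]) x) * exp (- potential (subtree E [i]) y))))"
  proof (intro sum.cong refl)
   fix y
   have "exp (E [] ! i) * (?e i x * ?e i y) =
     exp (- (E [] ! i)) * (exp (- potential (subtree E [i]) x) * exp (- potential (subtree E [i]) y))"
    by (simp add: potential_Cons exp_add[symmetric])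
   then show "exp (E [] ! i) * resistance (subtree E [i]) (longest_common_prefix x y) * (?e i x * ?e i y) =
     exp (- (E [] ! i)) * (resistance (subtree E [i]) (longest_common_prefix x y) *
    (exp (- potential (subtree E [i]) x) * exp (- potential (subtree E [i]) y)))"
    by (simp add: mult_ac)
  qed
  finally show "(\<Sum>j<?n. \<Sum>y\<in>?g j b.
    (if i = j then exp (E [] ! i) * resistance (subtree E [i]) (longest_common_prefix x y) * (?e i x * ?e i y) else 0)) =
   (\<Sum>y\<in>?g i b. exp (- (E [] ! i)) * (resistance (subtree E [i]) (longest_common_prefix x y) *
    (exp (- potential (subtree E [i]) x) * exp (- potential (subtree E [i]) y))))" .
 qed
 finally show ?thesis .
qed

context L2_branching_law
begin

text \<open>
 Each generation at which a pair can split contributes a bounded amount, whence the growth is linear.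
\<close>

lemma nn_integral_pair_sum_bounded:
 obtains K where "K \<ge> 0" "\<And>a b. (\<bbbE>E. W a E * W b E) \<le> ennreal K"
  "\<And>a b. (\<bbbE>E. pair_sum a b E) \<le> ennreal (K * (real (min a b) + 1))"
proof -
 obtain K where K: "K \<ge> 0" "\<And>n. (\<bbbE>E. (W n E)\<^sup>2) \<le> ennreal K"
  using W_square_bounded by auto
 have prod: "(\<bbbE>E. W a E * W b E) \<le> ennreal (2 * K)" for a b
 proof -
  have "(\<bbbE>E. W a E * W b E) \<le> (\<bbbE>\<^sup>+E. ennreal ((W a E)\<^sup>2) + ennreal ((W b E)\<^sup>2))"
  proof (rule nn_integral_mono)
   fix E
   have "W a E * W b E \<le> (W a E)\<^sup>2 + (W b E)\<^sup>2"
    using sum_squares_bound[of "W a E" "W b E"] mult_nonneg_nonneg[OF W_nonneg[of a E] W_nonneg[of b E]] by (simp add: mult.assoc)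
   then show "ennreal (W a E * W b E) \<le> ennreal ((W a E)\<^sup>2) + ennreal ((W b E)\<^sup>2)"
    by (simp add: ennreal_plus[symmetric] ennreal_leI del: ennreal_plus)
  qed
  also have "\<dots> = (\<bbbE>E. (W a E)\<^sup>2) + (\<bbbE>E. (W b E)\<^sup>2)"
   by (rule nn_integral_add) measurable
  also have "\<dots> \<le> ennreal K + ennreal K"
   by (intro add_mono K)
  finally show ?thesis
   using K(1) by (simp add: ennreal_plus[symmetric] del: ennreal_plus)
 qed
 have "(\<bbbE>E. pair_sum a b E) \<le> ennreal (2 * K * (real (min a b) + 1))" for a b
 proof (induction a arbitrary: b)
  case 0
  then show ?case
   using prod[of 0 b] by (simp add: pair_sum_0)
 next
  case (Suc a)
  show ?case
  proof (cases b)
   case 0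
   then show ?thesis
    using prod[of "Suc a" 0] by (simp add: pair_sum_0)
  next
   case (Suc b')
   have "(\<bbbE>E. pair_sum (Suc a) b E) =
     (\<bbbE>\<^sup>+E. ennreal (W (Suc a) E * W (Suc b') E) + ennreal (branch_sum (pair_sum a b') E))"
    unfolding Suc pair_sum_Suc by (intro nn_integral_cong ennreal_plus mult_nonneg_nonneg W_nonneg branch_sum_nonneg pair_sum_nonneg)
   also have "\<dots> = (\<bbbE>E. W (Suc a) E * W (Suc b') E) + (\<bbbE>E. pair_sum a b' E)"
    by (simp add: nn_integral_add nn_integral_branch_sum pair_sum_nonneg)
   also have "\<dots> \<le> ennreal (2 * K) + ennreal (2 * K * (real (min a b') + 1))"
    by (intro add_mono prod Suc.IH)
   also have "\<dots> = ennreal (2 * K + 2 * K * (real (min a b') + 1))"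
    using K(1) by (intro ennreal_plus[symmetric]) auto
   also have "2 * K + 2 * K * (real (min a b') + 1) = 2 * K * (real (min (Suc a) b) + 1)"
    unfolding Suc by (simp add: algebra_simps min_def)
   finally show ?thesis .
  qed
 qed
 with prod K(1) that[of "2 * K"] show ?thesis
  by auto
qed

end


section \<open>The transition kernel and its superharmonic functions\<close>

lemma potential_snoc: "potential E (x @ [i]) = potential E x + E x ! i"
 by (simp add: potential_append potential_Cons)

text \<open>
 After cancellation of the conductance of the edge to the parent, only the marks of the children
 enter the transition probabilities.
\<close>

fun kernel :: "environment \<Rightarrow> (vertex option \<Rightarrow> real) \<Rightarrow> vertex option \<Rightarrow> real" where
 "kernel E F None = F (Some [])"
| "kernel E F (Some x) = (F (parent x) + (\<Sum>i<length (E x). exp (- (E x ! i)) * F (Some (x @ [i])))) /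
   (1 + (\<Sum>i<length (E x). exp (- (E x ! i))))"

lemma kernel_denom_pos: "1 + (\<Sum>i<length (E x). exp (- (E x ! i))) > (0::real)"
 by (rule add_pos_nonneg) (auto intro: sum_nonneg)

lemma kernel_mono: "(\<And>y. F y \<le> G y) \<Longrightarrow> kernel E F v \<le> kernel E G v"
 by (cases v) (auto intro!: divide_right_mono add_mono sum_mono mult_left_mono add_nonneg_nonneg sum_nonneg)

lemma kernel_add: "kernel E (\<lambda>y. F y + G y) v = kernel E F v + kernel E G v"
 by (cases v) (auto simp: sum.distrib distrib_left add_divide_distrib[symmetric])

lemma kernel_cmult: "kernel E (\<lambda>y. c * F y) v = c * kernel E F v"
proof (cases v)
 case (Some x)
 have "(\<Sum>i<length (E x). exp (- (E x ! i)) * (c * F (Some (x @ [i])))) =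
   c * (\<Sum>i<length (E x). exp (- (E x ! i)) * F (Some (x @ [i])))"
  by (simp add: sum_distrib_left mult_ac)
 then show ?thesis
  by (simp add: Some distrib_left)
qed simp

lemma kernel_const: "kernel E (\<lambda>y. c) v = c"
proof (cases v)
 case (Some x)
 have "c + (\<Sum>i<length (E x). exp (- (E x ! i)) * c) = c * (1 + (\<Sum>i<length (E x). exp (- (E x ! i))))"
  by (simp add: distrib_left sum_distrib_left mult.commute)
 then show ?thesis
  using kernel_denom_pos[of E x] by (simp add: Some)
qed simp

lemma kernel_nonneg: "(\<And>y. F y \<ge> 0) \<Longrightarrow> kernel E F v \<ge> 0"
 using kernel_mono[of "\<lambda>_. 0" F E v] by (simp add: kernel_const)

lemma kernel_measurable:
 assumes [measurable]: "\<And>y. (\<lambda>E. F E y) \<in> borel_measurable env_space"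
 shows "(\<lambda>E. kernel E (F E) v) \<in> borel_measurable env_space"
proof (cases v)
 case (Some x)
 have [measurable]: "(\<lambda>E. \<Sum>i<length (E x). exp (- (E x ! i)) * F E (Some (x @ [i]))) \<in> borel_measurable env_space"
   "(\<lambda>E. \<Sum>i<length (E x). exp (- (E x ! i))) \<in> borel_measurable env_space"
  by (rule sum_lessThan_measurable; measurable)+
 show ?thesis
  by (simp add: Some)
qed simp

lemma parent_not_child: "parent x \<noteq> Some (x @ [i])"
 by (cases x rule: rev_cases) (auto simp: parent_def)

lemma trans_prob_nonneg: "trans_prob E v y \<ge> 0"
 by (cases v) (auto simp: Let_def intro!: divide_nonneg_nonneg add_nonneg_nonneg sum_nonneg)

lemma nn_integral_trans_prob:
 assumes F: "\<And>y. F y \<ge> 0"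
 shows "(\<integral>\<^sup>+y. ennreal (trans_prob E v y) * ennreal (F y) \<partial>count_space UNIV) = ennreal (kernel E F v)"
proof (cases v)
 case None
 have "(\<integral>\<^sup>+y. ennreal (trans_prob E v y) * ennreal (F y) \<partial>count_space UNIV) =
   (\<Sum>y\<in>{Some []}. ennreal (trans_prob E v y) * ennreal (F y))"
  by (rule nn_integral_count_space') (auto simp: None)
 then show ?thesis
  by (simp add: None)
next
 case (Some x)
 let ?n = "length (E x)" and ?V = "exp (- potential E x)" and ?a = "\<lambda>i. exp (- (E x ! i))"
 define Z where "Z = 1 + (\<Sum>i<?n. ?a i)"
 have Z: "Z > 0"
  unfolding Z_def by (rule kernel_denom_pos)
 have child: "exp (- potential E (x @ [i])) = ?V * ?a i" for i
  by (simp add: potential_snoc exp_uminus_add del: minus_add_distrib)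
 have denom: "?V + (\<Sum>i<?n. exp (- potential E (x @ [i]))) = ?V * Z"
  by (simp add: child Z_def distrib_left sum_distrib_left)
 have tp: "trans_prob E v (parent x) = 1 / Z"
  using denom by (simp add: Some Let_def)
 have tc: "trans_prob E v (Some (x @ [i])) = ?a i / Z" if "i < ?n" for i
  using denom that parent_not_child[of x i] by (auto simp: Some Let_def child)
 let ?C = "(\<lambda>i. Some (x @ [i])) ` {..<?n}"
 have "(\<integral>\<^sup>+y. ennreal (trans_prob E v y) * ennreal (F y) \<partial>count_space UNIV) =
   (\<Sum>y\<in>insert (parent x) ?C. ennreal (trans_prob E v y) * ennreal (F y))"
  by (rule nn_integral_count_space') (auto simp: Some Let_def)
 also have "\<dots> = ennreal (trans_prob E v (parent x)) * ennreal (F (parent x)) +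
   (\<Sum>y\<in>?C. ennreal (trans_prob E v y) * ennreal (F y))"
  using parent_not_child[of x] by (subst sum.insert) auto
 also have "(\<Sum>y\<in>?C. ennreal (trans_prob E v y) * ennreal (F y)) =
   (\<Sum>i<?n. ennreal (trans_prob E v (Some (x @ [i]))) * ennreal (F (Some (x @ [i]))))"
  by (subst sum.reindex) (auto simp: inj_on_def)
 also have "\<dots> = (\<Sum>i<?n. ennreal (?a i / Z * F (Some (x @ [i]))))"
  using Z F by (intro sum.cong) (auto simp: tc ennreal_mult'[symmetric])
 also have "ennreal (trans_prob E v (parent x)) * ennreal (F (parent x)) = ennreal (1 / Z * F (parent x))"
  using Z F by (simp add: tp ennreal_mult'[symmetric])
 also have "ennreal (1 / Z * F (parent x)) + (\<Sum>i<?n. ennreal (?a i / Z * F (Some (x @ [i])))) =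
   ennreal (1 / Z * F (parent x) + (\<Sum>i<?n. ?a i / Z * F (Some (x @ [i]))))"
  using Z F by (subst sum_ennreal) (auto intro!: ennreal_plus[symmetric] sum_nonneg mult_nonneg_nonneg)
 also have "1 / Z * F (parent x) + (\<Sum>i<?n. ?a i / Z * F (Some (x @ [i]))) = kernel E F v"
  by (simp add: Some Z_def[symmetric] add_divide_distrib sum_divide_distrib)
 finally show ?thesis .
qed

text \<open>
 For vertices of the tree this is the probability to hit \<open>x\<close> before the extra parent of the root,
 starting from \<open>v\<close>.
\<close>

definition hit_prob :: "environment \<Rightarrow> vertex \<Rightarrow> vertex option \<Rightarrow> real" where
 "hit_prob E x v = (case v of None \<Rightarrow> 0 | Some z \<Rightarrow> resistance E (longest_common_prefix z x) / resistance E x)"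

lemma hit_prob_simps [simp]:
 "hit_prob E x None = 0" "hit_prob E x (Some []) = 1 / resistance E x" "hit_prob E x (Some x) = 1"
proof -
 have "longest_common_prefix x x = x"
  by (induction x) auto
 then show "hit_prob E x (Some x) = 1"
  using resistance_pos[of E x] by (simp add: hit_prob_def less_imp_neq[symmetric])
qed (simp_all add: hit_prob_def)

lemma hit_prob_nonneg: "hit_prob E x v \<ge> 0"
 by (auto simp: hit_prob_def split: option.split)

lemma resistance_mono: "prefix u v \<Longrightarrow> resistance E u \<le> resistance E v"
proof -
 assume "prefix u v"
 then obtain z where v: "v = u @ z"
  by (auto simp: prefix_def)
 have "(\<Sum>j\<le>length u. exp (potential E (take j u))) = (\<Sum>j\<le>length u. exp (potential E (take j v)))"
  unfolding v by (intro sum.cong) auto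
 also have "\<dots> \<le> resistance E v"
  unfolding resistance_def v by (intro sum_mono2) auto
 finally show ?thesis
  by (simp add: resistance_def)
qed

lemma hit_prob_le_1: "hit_prob E x v \<le> 1"
 using resistance_mono[OF longest_common_prefix_prefix2, of E _ x] by (auto simp: hit_prob_def split: option.split)

lemma lcp_append: "longest_common_prefix (z @ u) (z @ v) = z @ longest_common_prefix u v"
 by (induction z) auto

lemma lcp_not_prefix: "\<not> prefix z x \<Longrightarrow> longest_common_prefix (z @ u) x = longest_common_prefix z x"
 by (induction z x rule: longest_common_prefix.induct) auto

lemma lcp_butlast_not_prefix: "\<not> prefix z x \<Longrightarrow> longest_common_prefix (butlast z) x = longest_common_prefix z x"
 by (induction z x rule: longest_common_prefix.induct) (auto simp: neq_Nil_conv)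

text \<open>
 With unit resistance on the edge between the root and its extra parent, \<open>hit_prob E x v\<close> is the
 voltage at \<open>v\<close> when the extra parent is grounded and \<open>x\<close> is held at voltage one; it is harmonic
 off \<open>x\<close>. If \<open>x\<close> does not belong to the tree the current into \<open>x\<close> is missing, which only decreases
 the average over the neighbours.
\<close>

lemma kernel_hit_prob:
 assumes "z \<noteq> x"
 shows "kernel E (hit_prob E x) (Some z) \<le> hit_prob E x (Some z)"
  and "x \<in> tree E \<Longrightarrow> kernel E (hit_prob E x) (Some z) = hit_prob E x (Some z)"
proof -
 let ?n = "length (E z)" and ?a = "\<lambda>i. exp (- (E z ! i))" and ?r = "resistance E"
 define Z where "Z = 1 + (\<Sum>i<?n. ?a i)"
 have Z: "Z > 0"
  unfolding Z_def by (rule kernel_denom_pos)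
 have "kernel E (hit_prob E x) (Some z) \<le> hit_prob E x (Some z) \<and>
  (x \<in> tree E \<longrightarrow> kernel E (hit_prob E x) (Some z) = hit_prob E x (Some z))"
 proof (cases "prefix z x")
  case False
  have "hit_prob E x (parent z) = hit_prob E x (Some z)"
   using False lcp_butlast_not_prefix[OF False] by (cases "z = []") (auto simp: parent_def hit_prob_def)
  moreover have "hit_prob E x (Some (z @ [i])) = hit_prob E x (Some z)" for i
   using lcp_not_prefix[OF False] by (simp add: hit_prob_def)
  ultimately have "kernel E (hit_prob E x) (Some z) = kernel E (\<lambda>_. hit_prob E x (Some z)) (Some z)"
   by simp
  then show ?thesis
   by (simp only: kernel_const) simp
 next
  case True
  then obtain j y where x: "x = z @ j # y"
   using assms by (metis append_Nil2 list.exhaust prefix_def)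
  have h_z: "hit_prob E x (Some z) = ?r z / ?r x"
   using lcp_append[of z "[]" "j # y"] by (simp add: hit_prob_def x)
  have h_parent: "hit_prob E x (parent z) = (?r z - exp (potential E z)) / ?r x"
  proof (cases z rule: rev_cases)
   case (snoc z' i)
   have "longest_common_prefix z' x = z'"
    using lcp_append[of z' "[]" "i # j # y"] by (simp add: x snoc)
   then show ?thesis
    by (simp add: snoc parent_def hit_prob_def resistance_snoc)
  qed (simp add: parent_def)
  have h_child: "hit_prob E x (Some (z @ [i])) =
    ?r z / ?r x + (if i = j then exp (potential E z) * exp (E z ! j) / ?r x else 0)" for i
   using lcp_append[of z "[i]" "j # y"]
   by (auto simp: hit_prob_def x resistance_snoc potential_snoc exp_add add_divide_distrib)
  have "(\<Sum>i<?n. ?a i * hit_prob E x (Some (z @ [i]))) =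
    (\<Sum>i<?n. ?a i * (?r z / ?r x) + (if i = j then exp (potential E z) / ?r x else 0))"
   by (intro sum.cong refl) (auto simp: h_child distrib_left exp_minus)
  also have "\<dots> = (Z - 1) * (?r z / ?r x) + (if j < ?n then exp (potential E z) / ?r x else 0)"
   by (simp add: sum.distrib sum_distrib_right Z_def sum_divide_distrib)
  finally have "hit_prob E x (parent z) + (\<Sum>i<?n. ?a i * hit_prob E x (Some (z @ [i]))) =
    Z * (?r z / ?r x) + ((if j < ?n then exp (potential E z) / ?r x else 0) - exp (potential E z) / ?r x)"
   unfolding h_parent by (simp add: algebra_simps diff_divide_distrib)
  then have k: "kernel E (hit_prob E x) (Some z) =
    (Z * hit_prob E x (Some z) + ((if j < ?n then exp (potential E z) / ?r x else 0) - exp (potential E z) / ?r x)) / Z"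
   by (simp add: Z_def[symmetric] h_z)
  have "x \<in> tree E \<Longrightarrow> j < ?n"
   unfolding x by (simp add: tree_append tree_Cons)
  moreover have "j < ?n \<Longrightarrow> kernel E (hit_prob E x) (Some z) = hit_prob E x (Some z)"
   unfolding k using Z by simp
  moreover have "kernel E (hit_prob E x) (Some z) \<le> (Z * hit_prob E x (Some z)) / Z"
   unfolding k using Z by (intro divide_right_mono) (auto intro: divide_nonneg_nonneg)
  ultimately show ?thesis
   using Z by simp
 qed
 then show "kernel E (hit_prob E x) (Some z) \<le> hit_prob E x (Some z)"
  and "x \<in> tree E \<Longrightarrow> kernel E (hit_prob E x) (Some z) = hit_prob E x (Some z)"
  by auto
qed

lemma hit_prob_measurable [measurable]: "(\<lambda>E. hit_prob E x v) \<in> borel_measurable env_space"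
 by (cases v) (simp_all add: hit_prob_def)


section \<open>The annealed Markov property\<close>

context walk_in_random_environment
begin

abbreviation annealed :: "('w \<Rightarrow> ennreal) \<Rightarrow> ennreal" (binder "\<bbbA>\<^sup>+" 10) where
 "annealed F \<equiv> \<integral>\<^sup>+w. F w \<partial>M"

lemma env_measurable [measurable]: "env \<in> M \<rightarrow>\<^sub>M env_space"
 using env_indep by (intro into_env_spaceI) (simp add: indep_vars_def)

lemma X_measurable [measurable]: "X j \<in> M \<rightarrow>\<^sub>M count_space UNIV"
 by (rule walk_measurable)

end

lemma trans_prob_measurable [measurable]: "(\<lambda>E. trans_prob E v y) \<in> borel_measurable env_space"
proof (cases v)
 case (Some x)
 have [measurable]: "(\<lambda>E. \<Sum>i<length (E x). exp (- potential E (x @ [i]))) \<in> borel_measurable env_space"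
  by (rule sum_lessThan_measurable; measurable)
 have [measurable]: "Measurable.pred env_space (\<lambda>E. \<exists>i<length (E x). y = Some (x @ [i]))"
  by measurable
 show ?thesis
  by (simp add: Some Let_def)
qed simp

lemma trans_prob_le_1: "trans_prob E v y \<le> 1"
proof -
 have "ennreal (trans_prob E v y) \<le> (\<integral>\<^sup>+y'. ennreal (trans_prob E v y') * indicator {y} y' \<partial>count_space UNIV)"
  by (subst nn_integral_count_space'[where A = "{y}"]) auto
 also have "\<dots> \<le> (\<integral>\<^sup>+y'. ennreal (trans_prob E v y') * ennreal 1 \<partial>count_space UNIV)"
  by (intro nn_integral_mono mult_left_mono) (auto simp: indicator_def)
 also have "\<dots> = ennreal 1"
  by (subst nn_integral_trans_prob) (auto simp: kernel_const)
 finally show ?thesis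
  by simp
qed

lemma path_prob_measurable [measurable]: "(\<lambda>E. path_prob E n p) \<in> borel_measurable env_space"
 unfolding path_prob_def by measurable

lemma path_prob_bounds: "0 \<le> path_prob E n p" "path_prob E n p \<le> 1"
 by (auto simp: path_prob_def trans_prob_nonneg trans_prob_le_1 intro!: prod_nonneg prod_le_1)

lemma path_prob_Suc: "path_prob E (Suc n) p = path_prob E n p * trans_prob E (p n) (p (Suc n))"
 by (simp add: path_prob_def)

lemma path_prob_cong: "(\<And>i. i \<le> n \<Longrightarrow> p i = v' i) \<Longrightarrow> path_prob E n p = path_prob E n v'"
 by (auto simp: path_prob_def intro!: prod.cong)

context walk_in_random_environment
begin

lemma nn_integral_path:
 assumes [measurable]: "f \<in> borel_measurable env_space"
 shows "(\<bbbA>\<^sup>+w. f (env w) * indicator {w. \<forall>i\<le>n. X i w = p i} w) =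
  (\<bbbA>\<^sup>+w. f (env w) * ennreal (path_prob (env w) n p))"
proof -
 let ?A = "{w \<in> space M. \<forall>i\<le>n. X i w = p i}"
 have A [measurable]: "?A \<in> sets M"
  by measurable
 let ?N1 = "distr (density M (indicator ?A)) env_space env"
 let ?N2 = "distr (density M (\<lambda>w. ennreal (path_prob (env w) n p))) env_space env"
 have "?N1 = ?N2"
 proof (rule measure_eqI)
  fix B assume "B \<in> sets ?N1"
  then have B [measurable]: "B \<in> sets env_space"
   by simp
  have "emeasure ?N1 B = emeasure M {w \<in> space M. env w \<in> B \<and> (\<forall>i\<le>n. X i w = p i)}"
  proof -
   have "emeasure ?N1 B = (\<bbbA>\<^sup>+w. indicator ?A w * indicator (env -` B \<inter> space M) w)"
    by (subst emeasure_distr) (auto simp: emeasure_density)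
   also have "\<dots> = (\<bbbA>\<^sup>+w. indicator {w \<in> space M. env w \<in> B \<and> (\<forall>i\<le>n. X i w = p i)} w)"
    by (intro nn_integral_cong) (auto simp: indicator_def)
   also have "\<dots> = emeasure M {w \<in> space M. env w \<in> B \<and> (\<forall>i\<le>n. X i w = p i)}"
    by (rule nn_integral_indicator) measurable
   finally show ?thesis .
  qed
  also have "\<dots> = ennreal (\<integral>w. indicator B (env w) * path_prob (env w) n p \<partial>M)"
   unfolding emeasure_eq_measure
   by (rule arg_cong[where f = ennreal], rule walk_law) (use B in \<open>simp add: env_space_def\<close>)
  also have "\<dots> = (\<bbbA>\<^sup>+w. ennreal (indicator B (env w) * path_prob (env w) n p))"
   using path_prob_bounds
   by (intro nn_integral_eq_integral[symmetric] integrable_const_bound[where B = 1])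
     (auto simp: indicator_def)
  also have "\<dots> = (\<bbbA>\<^sup>+w. ennreal (path_prob (env w) n p) * indicator (env -` B \<inter> space M) w)"
   by (intro nn_integral_cong) (auto simp: indicator_def)
  also have "\<dots> = emeasure ?N2 B"
   by (subst emeasure_distr) (auto simp: emeasure_density)
  finally show "emeasure ?N1 B = emeasure ?N2 B" .
 qed simp
 then have "(\<integral>\<^sup>+E. f E \<partial>?N1) = (\<integral>\<^sup>+E. f E \<partial>?N2)"
  by simp
 then have "(\<bbbA>\<^sup>+w. indicator ?A w * f (env w)) = (\<bbbA>\<^sup>+w. ennreal (path_prob (env w) n p) * f (env w))"
  by (simp add: nn_integral_distr nn_integral_density)
 moreover have "(\<bbbA>\<^sup>+w. indicator ?A w * f (env w)) =
   (\<bbbA>\<^sup>+w. f (env w) * indicator {w. \<forall>i\<le>n. X i w = p i} w)"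
  by (intro nn_integral_cong) (auto simp: indicator_def)
 ultimately show ?thesis
  by (simp add: mult.commute)
qed

lemma nn_integral_split_countable:
 fixes p :: "'w \<Rightarrow> 'c :: countable"
 assumes [measurable]: "p \<in> M \<rightarrow>\<^sub>M count_space UNIV" "h \<in> borel_measurable M"
 shows "(\<bbbA>\<^sup>+w. h w) = (\<integral>\<^sup>+c. \<integral>\<^sup>+w. h w * indicator {w. p w = c} w \<partial>M \<partial>count_space UNIV)"
proof -
 have "(\<bbbA>\<^sup>+w. h w) = (\<bbbA>\<^sup>+w. \<integral>\<^sup>+c. h w * indicator {w. p w = c} w \<partial>count_space UNIV)"
 proof (rule nn_integral_cong)
  fix w
  have "(\<integral>\<^sup>+c. h w * indicator {w. p w = c} w \<partial>count_space UNIV) = (\<Sum>c\<in>{p w}. h w * indicator {w. p w = c} w)"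
   by (rule nn_integral_count_space') auto
  then show "h w = (\<integral>\<^sup>+c. h w * indicator {w. p w = c} w \<partial>count_space UNIV)"
   by simp
 qed
 also have "\<dots> = (\<integral>\<^sup>+c. \<integral>\<^sup>+w. h w * indicator {w. p w = c} w \<partial>M \<partial>count_space UNIV)"
  by (rule nn_integral_count_space_nn_integral) (auto intro!: borel_measurable_times borel_measurable_indicator')
 finally show ?thesis .
qed

lemma path_functional_measurable:
 fixes f :: "environment \<Rightarrow> (nat \<Rightarrow> vertex option) \<Rightarrow> 'b"
 assumes f: "\<And>v. (\<lambda>E. f E v) \<in> env_space \<rightarrow>\<^sub>M L"
  and adapted: "\<And>E v v'. (\<And>i. i \<le> t \<Longrightarrow> v i = v' i) \<Longrightarrow> f E v = f E v'"
 shows "(\<lambda>w. f (env w) (\<lambda>i. X i w)) \<in> M \<rightarrow>\<^sub>M L"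
proof -
 let ?p = "\<lambda>w. map (\<lambda>i. X i w) [0..<Suc t]" and ?w = "\<lambda>ps i. if i < length ps then ps ! i else None"
 have "{w \<in> space M. ?p w = ps} \<in> sets M" for ps
 proof -
  have *: "{w \<in> space M. ?p w = ps} = {w \<in> space M. length ps = Suc t \<and> (\<forall>i<Suc t. X i w = ps ! i)}"
   by (auto simp: list_eq_iff_nth_eq simp del: upt_Suc)
  show ?thesis
   unfolding * by measurable
 qed
 moreover have "?p -` {ps} \<inter> space M = {w \<in> space M. ?p w = ps}" for ps
  by auto
 ultimately have p: "?p \<in> M \<rightarrow>\<^sub>M count_space UNIV"
  by (intro measurable_count_space_eq2_countable[THEN iffD2]) auto
 have "(\<lambda>w. f (env w) (?w (?p w))) \<in> M \<rightarrow>\<^sub>M L"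
  by (rule measurable_compose_countable[where f = "\<lambda>ps w. f (env w) (?w ps)", OF _ p])
    (rule measurable_compose[OF env_measurable f])
 moreover have "f (env w) (?w (?p w)) = f (env w) (\<lambda>i. X i w)" for w
  by (rule adapted) (auto simp: nth_append simp del: upt_Suc)
 ultimately show ?thesis
  by simp
qed

text \<open>
 The law of the walk is given through cylinder sets of paths; summing over the countably many
 initial segments yields the Markov property for arbitrary functions of the environment and of the
 past.
\<close>

lemma markov_step:
 fixes f :: "environment \<Rightarrow> (nat \<Rightarrow> vertex option) \<Rightarrow> real"
 assumes f [measurable]: "\<And>v. (\<lambda>E. f E v) \<in> borel_measurable env_space"
  and f0: "\<And>E v. f E v \<ge> 0"
  and adapted: "\<And>E v v'. (\<And>i. i \<le> Suc t \<Longrightarrow> v i = v' i) \<Longrightarrow> f E v = f E v'"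
  and g [measurable]: "g \<in> borel_measurable env_space"
 shows "(\<bbbA>\<^sup>+w. g (env w) * ennreal (f (env w) (\<lambda>i. X i w))) =
  (\<bbbA>\<^sup>+w. g (env w) * ennreal (kernel (env w) (\<lambda>y. f (env w) ((\<lambda>i. X i w)(Suc t := y))) (X t w)))"
proof -
 let ?p = "\<lambda>w. map (\<lambda>i. X i w) [0..<Suc t]"
 have p: "?p \<in> M \<rightarrow>\<^sub>M count_space UNIV"
  by (rule path_functional_measurable[where f = "\<lambda>E v. map v [0..<Suc t]" and t = t]) (auto simp del: upt_Suc)
 have pm [measurable]: "Measurable.pred M (\<lambda>w. ?p w = ps)" for ps
  by (rule measurable_compose[OF p]) simp
 have km [measurable]: "(\<lambda>E. kernel E (\<lambda>y. f E (v(Suc t := y))) (v t)) \<in> borel_measurable env_space" for v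
  by (rule kernel_measurable) measurable
 have [measurable]: "(\<lambda>w. f (env w) (\<lambda>i. X i w)) \<in> borel_measurable M"
  by (rule path_functional_measurable[where t = "Suc t"]) (auto intro: adapted)
 have [measurable]: "(\<lambda>w. kernel (env w) (\<lambda>y. f (env w) ((\<lambda>i. X i w)(Suc t := y))) (X t w)) \<in> borel_measurable M"
 proof (rule path_functional_measurable[where t = t and f = "\<lambda>E v. kernel E (\<lambda>y. f E (v(Suc t := y))) (v t)"])
  fix E v v' assume "\<And>i. i \<le> t \<Longrightarrow> v i = (v' i :: vertex option)"
  then have "v t = v' t" and "(\<lambda>y. f E (v(Suc t := y))) = (\<lambda>y. f E (v'(Suc t := y)))"
   by (auto intro!: ext adapted)
  then show "kernel E (\<lambda>y. f E (v(Suc t := y))) (v t) = kernel E (\<lambda>y. f E (v'(Suc t := y))) (v' t)"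
   by simp
 qed (rule km)
 have fixed: "(\<bbbA>\<^sup>+w. g (env w) * ennreal (f (env w) (\<lambda>i. X i w)) * indicator {w. ?p w = ps} w) =
   (\<bbbA>\<^sup>+w. g (env w) * ennreal (kernel (env w) (\<lambda>y. f (env w) ((\<lambda>i. X i w)(Suc t := y))) (X t w)) * indicator {w. ?p w = ps} w)"
  (is "?L = ?R") for ps
 proof (cases "length ps = Suc t")
  case False
  then have "{w. ?p w = ps} = {}"
   by auto
  then show ?thesis
   by simp
 next
  case True
  define v where "v i = (if i < length ps then ps ! i else None)" for i
  have ev: "{w. ?p w = ps} = {w. \<forall>i\<le>t. X i w = v i}"
   using True by (auto simp: list_eq_iff_nth_eq v_def less_Suc_eq_le simp del: upt_Suc)
  have ev2: "{w. \<forall>i\<le>t. X i w = v i} \<inter> {w. X (Suc t) w = y} = {w. \<forall>i\<le>Suc t. X i w = (v(Suc t := y)) i}" for y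
   by (auto simp: le_Suc_eq)
  have "?L = (\<integral>\<^sup>+y. \<integral>\<^sup>+w. g (env w) * ennreal (f (env w) (\<lambda>i. X i w)) * indicator {w. ?p w = ps} w *
    indicator {w. X (Suc t) w = y} w \<partial>M \<partial>count_space UNIV)"
   by (rule nn_integral_split_countable) measurable
  also have "\<dots> = (\<integral>\<^sup>+y. \<integral>\<^sup>+w. g (env w) * ennreal (f (env w) (v(Suc t := y))) *
    indicator {w. \<forall>i\<le>Suc t. X i w = (v(Suc t := y)) i} w \<partial>M \<partial>count_space UNIV)"
  proof (intro nn_integral_cong)
   fix y w
   have "f (env w) (\<lambda>i. X i w) = f (env w) (v(Suc t := y))" if "\<forall>i\<le>Suc t. X i w = (v(Suc t := y)) i"
    using that by (intro adapted) auto
   then show "g (env w) * ennreal (f (env w) (\<lambda>i. X i w)) * indicator {w. ?p w = ps} w * indicator {w. X (Suc t) w = y} w =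
     g (env w) * ennreal (f (env w) (v(Suc t := y))) * indicator {w. \<forall>i\<le>Suc t. X i w = (v(Suc t := y)) i} w"
    unfolding ev ev2[symmetric] by (auto simp: indicator_def)
  qed
  also have "\<dots> = (\<integral>\<^sup>+y. \<integral>\<^sup>+w. g (env w) * ennreal (f (env w) (v(Suc t := y))) *
    ennreal (path_prob (env w) (Suc t) (v(Suc t := y))) \<partial>M \<partial>count_space UNIV)"
   by (intro nn_integral_cong nn_integral_path) measurable
  also have "\<dots> = (\<integral>\<^sup>+y. \<integral>\<^sup>+w. (g (env w) * ennreal (path_prob (env w) t v)) *
    (ennreal (trans_prob (env w) (v t) y) * ennreal (f (env w) (v(Suc t := y)))) \<partial>M \<partial>count_space UNIV)"
  proof (intro nn_integral_cong)
   fix y w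
   have "path_prob (env w) (Suc t) (v(Suc t := y)) = path_prob (env w) t v * trans_prob (env w) (v t) y"
    unfolding path_prob_Suc by (simp add: path_prob_cong[of t "v(Suc t := y)" v])
   then show "g (env w) * ennreal (f (env w) (v(Suc t := y))) * ennreal (path_prob (env w) (Suc t) (v(Suc t := y))) =
     (g (env w) * ennreal (path_prob (env w) t v)) * (ennreal (trans_prob (env w) (v t) y) * ennreal (f (env w) (v(Suc t := y))))"
    by (simp add: ennreal_mult path_prob_bounds trans_prob_nonneg mult_ac)
  qed
  also have "\<dots> = (\<bbbA>\<^sup>+w. \<integral>\<^sup>+y. (g (env w) * ennreal (path_prob (env w) t v)) *
    (ennreal (trans_prob (env w) (v t) y) * ennreal (f (env w) (v(Suc t := y)))) \<partial>count_space UNIV)"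
   by (rule nn_integral_count_space_nn_integral[symmetric]) auto
  also have "\<dots> = (\<bbbA>\<^sup>+w. g (env w) * ennreal (kernel (env w) (\<lambda>y. f (env w) (v(Suc t := y))) (v t)) *
    ennreal (path_prob (env w) t v))"
   by (intro nn_integral_cong) (simp add: nn_integral_cmult nn_integral_trans_prob f0 mult_ac)
  also have "\<dots> = (\<bbbA>\<^sup>+w. g (env w) * ennreal (kernel (env w) (\<lambda>y. f (env w) (v(Suc t := y))) (v t)) *
    indicator {w. \<forall>i\<le>t. X i w = v i} w)"
   by (rule nn_integral_path[symmetric]) measurable
  also have "\<dots> = ?R"
  proof (intro nn_integral_cong)
   fix w
   have "(\<lambda>y. f (env w) ((\<lambda>i. X i w)(Suc t := y))) = (\<lambda>y. f (env w) (v(Suc t := y)))" if "\<forall>i\<le>t. X i w = v i"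
    using that by (intro ext adapted) auto
   then show "g (env w) * ennreal (kernel (env w) (\<lambda>y. f (env w) (v(Suc t := y))) (v t)) * indicator {w. \<forall>i\<le>t. X i w = v i} w =
    g (env w) * ennreal (kernel (env w) (\<lambda>y. f (env w) ((\<lambda>i. X i w)(Suc t := y))) (X t w)) * indicator {w. ?p w = ps} w"
    unfolding ev by (auto simp: indicator_def)
  qed
  finally show ?thesis .
 qed
 have "(\<bbbA>\<^sup>+w. g (env w) * ennreal (f (env w) (\<lambda>i. X i w))) =
   (\<integral>\<^sup>+ps. \<integral>\<^sup>+w. g (env w) * ennreal (f (env w) (\<lambda>i. X i w)) * indicator {w. ?p w = ps} w \<partial>M \<partial>count_space UNIV)"
  by (rule nn_integral_split_countable[OF p]) measurable
 also have "\<dots> = (\<integral>\<^sup>+ps. \<integral>\<^sup>+w. g (env w) * ennreal (kernel (env w) (\<lambda>y. f (env w) ((\<lambda>i. X i w)(Suc t := y))) (X t w)) *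
   indicator {w. ?p w = ps} w \<partial>M \<partial>count_space UNIV)"
  by (simp only: fixed)
 also have "\<dots> = (\<bbbA>\<^sup>+w. g (env w) * ennreal (kernel (env w) (\<lambda>y. f (env w) ((\<lambda>i. X i w)(Suc t := y))) (X t w)))"
  by (rule nn_integral_split_countable[OF p, symmetric]) measurable
 finally show ?thesis .
qed

lemma AE_X_0: "AE w in M. X 0 w = Some []"
proof -
 have "(\<bbbA>\<^sup>+w. 1 * indicator {w. \<forall>i\<le>0. X i w = Some []} w) = (\<bbbA>\<^sup>+w. 1 * ennreal (path_prob (env w) 0 (\<lambda>_. Some [])))"
  by (rule nn_integral_path) simp
 also have "\<dots> = 1"
  by (simp add: path_prob_def emeasure_space_1)
 finally have "(\<bbbA>\<^sup>+w. indicator {w \<in> space M. X 0 w = Some []} w) = 1"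
  by (subst nn_integral_cong[where v = "\<lambda>w. 1 * indicator {w. \<forall>i\<le>0. X i w = Some []} w"]) (auto simp: indicator_def)
 then have "emeasure M {w \<in> space M. X 0 w = Some []} = 1"
  by simp
 then show ?thesis
  by (intro AE_I_eq_1) auto
qed

text \<open>
 Quenched estimates are obtained from functions of the environment and of the past of the walk
 which decrease in mean under the kernel: weighting with an arbitrary function of the environment
 and integrating turns them into annealed inequalities.
\<close>

lemma supermartingale:
 fixes f :: "nat \<Rightarrow> environment \<Rightarrow> (nat \<Rightarrow> vertex option) \<Rightarrow> real"
 assumes f: "\<And>t p. (\<lambda>E. f t E p) \<in> borel_measurable env_space"
  and f0: "\<And>t E p. f t E p \<ge> 0"
  and adapted: "\<And>t E p v'. (\<And>i. i \<le> t \<Longrightarrow> p i = v' i) \<Longrightarrow> f t E p = f t E v'"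
  and g: "g \<in> borel_measurable env_space"
  and step: "\<And>t E p. j \<le> t \<Longrightarrow> p 0 = Some [] \<Longrightarrow> kernel E (\<lambda>y. f (Suc t) E (p(Suc t := y))) (p t) \<le> f t E p"
 shows "(\<bbbA>\<^sup>+w. g (env w) * ennreal (f (j + n) (env w) (\<lambda>i. X i w))) \<le>
  (\<bbbA>\<^sup>+w. g (env w) * ennreal (f j (env w) (\<lambda>i. X i w)))"
proof (induction n)
 case (Suc n)
 have "(\<bbbA>\<^sup>+w. g (env w) * ennreal (f (Suc (j + n)) (env w) (\<lambda>i. X i w))) =
   (\<bbbA>\<^sup>+w. g (env w) * ennreal (kernel (env w) (\<lambda>y. f (Suc (j + n)) (env w) ((\<lambda>i. X i w)(Suc (j + n) := y))) (X (j + n) w)))"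
 proof (rule markov_step)
  show "f (Suc (j + n)) E p = f (Suc (j + n)) E v'" if "\<And>i. i \<le> Suc (j + n) \<Longrightarrow> p i = v' i" for E p v'
   using that by (rule adapted)
 qed (rule f f0 g)+
 also have "\<dots> \<le> (\<bbbA>\<^sup>+w. g (env w) * ennreal (f (j + n) (env w) (\<lambda>i. X i w)))"
 proof (rule nn_integral_mono_AE, use AE_X_0 in eventually_elim)
  case (elim w)
  then show ?case
   by (intro mult_left_mono ennreal_leI step) auto
 qed
 finally show ?case
  using Suc by simp
qed simp

end


section \<open>Visits during a fixed number of excursions\<close>

primrec returns :: "(nat \<Rightarrow> vertex option) \<Rightarrow> nat \<Rightarrow> nat" where
 "returns p 0 = 0"
| "returns p (Suc t) = returns p t + (if p (Suc t) = None then 1 else 0)"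

text \<open>
 The event that \<open>x\<close> has been visited by time \<open>t\<close> during the first \<open>s\<close> excursions. The recursion exhibits
 it as a function of the past, which stopping at \<open>return_time\<close> would hide.
\<close>

primrec hits :: "nat \<Rightarrow> vertex \<Rightarrow> (nat \<Rightarrow> vertex option) \<Rightarrow> nat \<Rightarrow> bool" where
 "hits s x p 0 = False"
| "hits s x p (Suc t) = (hits s x p t \<or> p (Suc t) = Some x \<and> returns p t < s)"

text \<open>The number of excursions which have not yet begun.\<close>

definition pending :: "nat \<Rightarrow> (nat \<Rightarrow> vertex option) \<Rightarrow> nat \<Rightarrow> nat" where
 "pending s p t = s - returns p t - (if p t = None then 0 else 1)"

lemma returns_cong: "(\<And>i. i \<le> t \<Longrightarrow> p i = v' i) \<Longrightarrow> returns p t = returns v' t"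
 by (induction t) auto

lemma hits_cong: "(\<And>i. i \<le> t \<Longrightarrow> p i = v' i) \<Longrightarrow> hits s x p t = hits s x v' t"
 by (induction t) (auto simp: returns_cong[of _ p v'])

lemma pending_cong: "(\<And>i. i \<le> t \<Longrightarrow> p i = v' i) \<Longrightarrow> pending s p t = pending s v' t"
 by (simp add: pending_def returns_cong[of t p v'])

lemma returns_upd [simp]: "returns (p(Suc t := y)) t = returns p t"
 by (rule returns_cong) simp

lemma hits_upd [simp]: "hits s x (p(Suc t := y)) t = hits s x p t"
 by (rule hits_cong) simp

lemma hits_current:
 assumes "p 0 = Some []" "x \<noteq> []" "p t = Some x" "returns p t < s"
 shows "hits s x p t"
 using assms by (cases t) auto

context walk_in_random_environment
begin

text \<open>
 A walk which hits both \<open>x\<close> and \<open>y\<close> in one excursion first hits one of them, with probability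
 \<open>1 / resistance x\<close>, say, and then, starting afresh from there, the other one. The function
 \<open>joint\<close> below adds the two possible orders and the contributions of pairs of excursions.
\<close>

lemma joint_hit_bound:
 assumes g: "g \<in> borel_measurable env_space" and s: "s \<ge> 1" and x: "x \<noteq> []" and y: "y \<noteq> []"
 shows "(\<bbbA>\<^sup>+w. g (env w) * indicator {w. hits s x (\<lambda>i. X i w) t \<and> hits s y (\<lambda>i. X i w) t} w) \<le>
  (\<bbbA>\<^sup>+w. g (env w) * ennreal ((2 * real s * resistance (env w) (longest_common_prefix x y) + (real s)\<^sup>2) /
    (resistance (env w) x * resistance (env w) y)))"
proof -
 define z where "z = longest_common_prefix x y"
 let ?r = "resistance"
 define kx where "kx E v \<rho> = hit_prob E x v + \<rho> / ?r E x" for E v and \<rho> :: real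
 define ky where "ky E v \<rho> = hit_prob E y v + \<rho> / ?r E y" for E v and \<rho> :: real
 define J where "J E v \<rho> = (?r E z + \<rho>) / ?r E y * hit_prob E x v + (?r E z + \<rho>) / ?r E x * hit_prob E y v +
   (2 * \<rho> * ?r E z + \<rho> * (\<rho> - 1)) / (?r E x * ?r E y)" for E v and \<rho> :: real
 define f where "f t E q = (if hits s x q t \<and> hits s y q t then 1
   else if returns q t \<ge> s then 0
   else if hits s x q t then ky E (q t) (real (pending s q t))
   else if hits s y q t then kx E (q t) (real (pending s q t))
   else J E (q t) (real (pending s q t)))" for t E q
 have rz: "?r E z \<le> ?r E x" "?r E z \<le> ?r E y" for E
  unfolding z_def by (intro resistance_mono longest_common_prefix_prefix1 longest_common_prefix_prefix2)+
 have lcp_sym: "longest_common_prefix y x = z"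
  unfolding z_def by (induction x y rule: longest_common_prefix.induct) auto
 have hxy: "hit_prob E x (Some y) = ?r E z / ?r E x" "hit_prob E y (Some x) = ?r E z / ?r E y" for E
  by (simp_all add: hit_prob_def lcp_sym z_def[symmetric])
 have k0: "kx E v \<rho> \<ge> 0" "ky E v \<rho> \<ge> 0" if "\<rho> \<ge> 0" for E v \<rho>
  using that by (auto simp: kx_def ky_def hit_prob_nonneg intro!: add_nonneg_nonneg)
 have J0: "J E v (real m) \<ge> 0" for E v m
 proof -
  have "real m * (real m - 1) \<ge> 0"
   by (cases m) auto
  then show ?thesis
   by (auto simp: J_def hit_prob_nonneg intro!: add_nonneg_nonneg mult_nonneg_nonneg divide_nonneg_nonneg)
 qed
 have Jx: "ky E (Some x) (real m) \<le> J E (Some x) (real m)" and Jy: "kx E (Some y) (real m) \<le> J E (Some y) (real m)" for E m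
 proof -
  have "real m * (real m - 1) \<ge> 0"
   by (cases m) auto
  then have nn: "(2 * real m * ?r E z + real m * (real m - 1)) / (?r E x * ?r E y) \<ge> 0"
    "(?r E z + real m) / ?r E x * hit_prob E y v \<ge> 0" "(?r E z + real m) / ?r E y * hit_prob E x v \<ge> 0" for v
   by (auto intro!: divide_nonneg_nonneg add_nonneg_nonneg mult_nonneg_nonneg simp: hit_prob_nonneg)
  show "ky E (Some x) (real m) \<le> J E (Some x) (real m)"
   using nn(1) nn(2)[of "Some x"] by (simp add: ky_def J_def hxy add_divide_distrib)
  show "kx E (Some y) (real m) \<le> J E (Some y) (real m)"
   using nn(1) nn(3)[of "Some y"] by (simp add: kx_def J_def hxy add_divide_distrib)
 qed
 have k1: "1 \<le> kx E (Some x) (real m)" "1 \<le> ky E (Some y) (real m)" for E m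
  by (simp_all add: kx_def ky_def)
 have kernel_k: "kernel E (\<lambda>v. kx E v \<rho>) (Some u) \<le> kx E (Some u) \<rho>" if "u \<noteq> x" for E u \<rho>
  using kernel_hit_prob(1)[OF that, of E] by (simp only: kx_def kernel_add kernel_const add_le_cancel_right)
 have kernel_k': "kernel E (\<lambda>v. ky E v \<rho>) (Some u) \<le> ky E (Some u) \<rho>" if "u \<noteq> y" for E u \<rho>
  using kernel_hit_prob(1)[OF that, of E] by (simp only: ky_def kernel_add kernel_const add_le_cancel_right)
 have kernel_J: "kernel E (\<lambda>v. J E v (real m)) (Some u) \<le> J E (Some u) (real m)" if "u \<noteq> x" "u \<noteq> y" for E u m
  unfolding J_def kernel_add kernel_const kernel_cmult
  using kernel_hit_prob(1)[OF that(1), of E] kernel_hit_prob(1)[OF that(2), of E]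
  by (intro add_mono mult_left_mono order_refl divide_nonneg_nonneg add_nonneg_nonneg) auto
 have [measurable]: "(\<lambda>E. kx E v \<rho>) \<in> borel_measurable env_space" "(\<lambda>E. ky E v \<rho>) \<in> borel_measurable env_space"
   "(\<lambda>E. J E v \<rho>) \<in> borel_measurable env_space" for v \<rho>
  unfolding kx_def ky_def J_def by measurable
 have start: "kx E (Some []) (\<rho> - 1) = kx E None \<rho>" "ky E (Some []) (\<rho> - 1) = ky E None \<rho>"
   "J E (Some []) (\<rho> - 1) = J E None \<rho>" for E \<rho>
 proof -
  have "?r E x \<noteq> 0" "?r E y \<noteq> 0"
   using resistance_pos[of E x] resistance_pos[of E y] by linarith+
  then show "kx E (Some []) (\<rho> - 1) = kx E None \<rho>" "ky E (Some []) (\<rho> - 1) = ky E None \<rho>"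
   "J E (Some []) (\<rho> - 1) = J E None \<rho>"
   unfolding kx_def ky_def J_def hit_prob_simps by (simp_all add: divide_simps) (simp add: algebra_simps)
 qed
 have "(\<bbbA>\<^sup>+w. g (env w) * ennreal (f (0 + t) (env w) (\<lambda>i. X i w))) \<le>
  (\<bbbA>\<^sup>+w. g (env w) * ennreal (f 0 (env w) (\<lambda>i. X i w)))"
 proof (rule supermartingale)
  show "(\<lambda>E. f t E q) \<in> borel_measurable env_space" for t q
   unfolding f_def by measurable
  show "f t E q \<ge> 0" for t E q
   using k0 J0 by (auto simp: f_def)
  show "f t E q = f t E v'" if "\<And>i. i \<le> t \<Longrightarrow> q i = v' i" for t E q v'
   using that hits_cong[of t q v'] returns_cong[of t q v'] pending_cong[of t q v'] by (simp add: f_def)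
  show "g \<in> borel_measurable env_space"
   by (rule g)
  fix t E and q :: "nat \<Rightarrow> vertex option"
  assume w0: "q 0 = Some []"
  show "kernel E (\<lambda>v. f (Suc t) E (q(Suc t := v))) (q t) \<le> f t E q"
  proof (cases "returns q t \<ge> s")
   case True
   then have "f (Suc t) E (q(Suc t := v)) = f t E q" for v
    by (auto simp: f_def)
   then show ?thesis
    by (simp only: kernel_const order_refl)
  next
   case alive: False
   define m where "m = pending s q t"
   show ?thesis
   proof (cases "q t")
    case None
    have p: "pending s (q(Suc t := Some [])) (Suc t) = m - 1" and m: "m \<ge> 1"
     using None alive by (auto simp: pending_def m_def)
    have rm: "real (m - Suc 0) = real m - 1"
     using m by simp
    show ?thesis
     using None alive x y by (simp add: f_def p m_def[symmetric] rm start)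
   next
    case (Some u)
    have p: "pending s (q(Suc t := v)) (Suc t) = m" for v
     using Some alive by (auto simp: pending_def m_def)
    have ret: "returns (q(Suc t := v)) (Suc t) \<ge> s \<longleftrightarrow> v = None \<and> m = 0" for v
     using Some alive by (auto simp: pending_def m_def)
    have hx: "u \<noteq> x" if "\<not> hits s x q t"
     using hits_current[of q x t s] w0 x Some alive that by auto
    have hy: "u \<noteq> y" if "\<not> hits s y q t"
     using hits_current[of q y t s] w0 y Some alive that by auto
    have hits': "hits s a (q(Suc t := v)) (Suc t) \<longleftrightarrow> hits s a q t \<or> v = Some a" for a v
     using alive by simp
    have f': "f (Suc t) E (q(Suc t := v)) =
      (if (hits s x q t \<or> v = Some x) \<and> (hits s y q t \<or> v = Some y) then 1
       else if v = None \<and> m = 0 then 0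
       else if hits s x q t \<or> v = Some x then ky E v (real m)
       else if hits s y q t \<or> v = Some y then kx E v (real m)
       else J E v (real m))" for v
     unfolding f_def hits' ret p by simp
    have f: "f t E q = (if hits s x q t \<and> hits s y q t then 1
       else if hits s x q t then ky E (Some u) (real m)
       else if hits s y q t then kx E (Some u) (real m)
       else J E (Some u) (real m))"
     using alive by (simp add: f_def m_def Some)
    consider "hits s x q t" "hits s y q t" | "hits s x q t" "\<not> hits s y q t"
     | "\<not> hits s x q t" "hits s y q t" | "\<not> hits s x q t" "\<not> hits s y q t"
     by blast
    then show ?thesis
    proof cases
     case 1
     then have "f (Suc t) E (q(Suc t := v)) = 1" for v
      by (simp add: f')
     then show ?thesis
      using 1 f by (simp only: kernel_const) simp
    next
     case 2
     have "f (Suc t) E (q(Suc t := v)) \<le> ky E v (real m)" for v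
      using 2 k0(2)[of "real m" E v] k1(2)[of E m] by (auto simp: f')
     then have "kernel E (\<lambda>v. f (Suc t) E (q(Suc t := v))) (q t) \<le> kernel E (\<lambda>v. ky E v (real m)) (Some u)"
      unfolding Some by (rule kernel_mono)
     also have "\<dots> \<le> ky E (Some u) (real m)"
      by (rule kernel_k'[OF hy[OF 2(2)]])
     finally show ?thesis
      using 2 f by simp
    next
     case 3
     have "f (Suc t) E (q(Suc t := v)) \<le> kx E v (real m)" for v
      using 3 k0(1)[of "real m" E v] k1(1)[of E m] by (auto simp: f')
     then have "kernel E (\<lambda>v. f (Suc t) E (q(Suc t := v))) (q t) \<le> kernel E (\<lambda>v. kx E v (real m)) (Some u)"
      unfolding Some by (rule kernel_mono)
     also have "\<dots> \<le> kx E (Some u) (real m)"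
      by (rule kernel_k[OF hx[OF 3(1)]])
     finally show ?thesis
      using 3 f by simp
    next
     case 4
     have "f (Suc t) E (q(Suc t := v)) \<le> J E v (real m)" for v
     proof -
      consider "v = Some x" "x = y" | "v = Some x" "x \<noteq> y" | "v = Some y" "x \<noteq> y"
       | "v \<noteq> Some x" "v \<noteq> Some y"
       by blast
      then show ?thesis
      proof cases
       case 1
       have "1 \<le> ky E (Some x) (real m)"
        using 1 by (simp add: ky_def)
       also note Jx
       finally show ?thesis
        using 1 4 by (simp add: f')
      next
       case 2
       then show ?thesis
        using 4 Jx[of E m] by (simp add: f')
      next
       case 3
       then show ?thesis
        using 4 Jy[of E m] by (simp add: f')
      next
       case neither: 4
       then show ?thesis
        using 4 J0[of E v m] by (auto simp: f')
      qed
     qed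
     then have "kernel E (\<lambda>v. f (Suc t) E (q(Suc t := v))) (q t) \<le> kernel E (\<lambda>v. J E v (real m)) (Some u)"
      unfolding Some by (rule kernel_mono)
     also have "\<dots> \<le> J E (Some u) (real m)"
      by (rule kernel_J[OF hx[OF 4(1)] hy[OF 4(2)]])
     finally show ?thesis
      using 4 f by simp
    qed
   qed
  qed
 qed
 also have "(\<bbbA>\<^sup>+w. g (env w) * ennreal (f 0 (env w) (\<lambda>i. X i w))) \<le>
   (\<bbbA>\<^sup>+w. g (env w) * ennreal ((2 * real s * ?r (env w) z + (real s)\<^sup>2) / (?r (env w) x * ?r (env w) y)))"
 proof (rule nn_integral_mono_AE, use AE_X_0 in eventually_elim)
  case (elim w)
  have "f 0 (env w) (\<lambda>i. X i w) = J (env w) (Some []) (real s - 1)"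
   using elim s by (simp add: f_def pending_def of_nat_diff)
  also have "\<dots> = (2 * real s * ?r (env w) z + real s * (real s - 1)) / (?r (env w) x * ?r (env w) y)"
   using start(3) by (simp add: J_def)
  also have "\<dots> \<le> (2 * real s * ?r (env w) z + (real s)\<^sup>2) / (?r (env w) x * ?r (env w) y)"
   by (intro divide_right_mono) (auto simp: power2_eq_square algebra_simps)
  finally show ?case
   by (intro mult_left_mono ennreal_leI) auto
 qed
 finally have le: "(\<bbbA>\<^sup>+w. g (env w) * ennreal (f (0 + t) (env w) (\<lambda>i. X i w))) \<le>
  (\<bbbA>\<^sup>+w. g (env w) * ennreal ((2 * real s * ?r (env w) z + (real s)\<^sup>2) / (?r (env w) x * ?r (env w) y)))" .
 have "(\<bbbA>\<^sup>+w. g (env w) * indicator {w. hits s x (\<lambda>i. X i w) t \<and> hits s y (\<lambda>i. X i w) t} w) \<le>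
   (\<bbbA>\<^sup>+w. g (env w) * ennreal (f (0 + t) (env w) (\<lambda>i. X i w)))"
  by (intro nn_integral_mono mult_left_mono) (auto simp: indicator_def f_def)
 with le show ?thesis
  unfolding z_def by simp
qed

text \<open>
 The probability of missing \<open>x\<close> in what remains of the current excursion, times the probabilities of
 missing it in the pending ones, is a supermartingale.
\<close>

lemma not_hit_bound:
 assumes g: "g \<in> borel_measurable env_space" and s: "s \<ge> 1" and x: "x \<noteq> []"
 shows "(\<bbbA>\<^sup>+w. g (env w) * indicator {w. x \<in> tree (env w) \<and> \<not> hits s x (\<lambda>i. X i w) t \<and> returns (\<lambda>i. X i w) t \<ge> s} w) \<le>
  (\<bbbA>\<^sup>+w. g (env w) * ennreal (if x \<in> tree (env w) then (1 - 1 / resistance (env w) x) ^ s else 0))"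
proof -
 let ?r = "resistance"
 define c where "c E = 1 - 1 / ?r E x" for E
 have c0: "c E \<ge> 0" for E
  using resistance_ge_1[of E x] by (simp add: c_def)
 define f where "f t E q = (if x \<notin> tree E \<or> hits s x q t then 0
   else if returns q t \<ge> s then 1
   else (1 - hit_prob E x (q t)) * c E ^ pending s q t)" for t E q
 have "(\<bbbA>\<^sup>+w. g (env w) * ennreal (f (0 + t) (env w) (\<lambda>i. X i w))) \<le>
  (\<bbbA>\<^sup>+w. g (env w) * ennreal (f 0 (env w) (\<lambda>i. X i w)))"
 proof (rule supermartingale)
  show "(\<lambda>E. f t E q) \<in> borel_measurable env_space" for t q
   unfolding f_def c_def by measurable
  show "f t E q \<ge> 0" for t E q
   using c0 hit_prob_le_1 by (auto simp: f_def)
  show "f t E q = f t E v'" if "\<And>i. i \<le> t \<Longrightarrow> q i = v' i" for t E q v'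
   using that hits_cong[of t q v'] returns_cong[of t q v'] pending_cong[of t q v'] by (simp add: f_def)
  show "g \<in> borel_measurable env_space"
   by (rule g)
  fix t E and q :: "nat \<Rightarrow> vertex option"
  assume w0: "q 0 = Some []"
  show "kernel E (\<lambda>v. f (Suc t) E (q(Suc t := v))) (q t) \<le> f t E q"
  proof (cases "x \<notin> tree E \<or> hits s x q t \<or> returns q t \<ge> s")
   case True
   then have "f (Suc t) E (q(Suc t := v)) = f t E q" for v
    by (auto simp: f_def)
   then show ?thesis
    by (simp only: kernel_const order_refl)
  next
   case False
   define m where "m = pending s q t"
   show ?thesis
   proof (cases "q t")
    case None
    have p: "pending s (q(Suc t := Some [])) (Suc t) = m - 1" and m: "m \<ge> 1"
     using None False by (auto simp: pending_def m_def)
    have "c E * c E ^ (m - 1) = c E ^ m"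
     using m by (cases m) auto
    then show ?thesis
     using None False x by (simp add: f_def p m_def[symmetric]) (simp add: c_def)
   next
    case (Some u)
    have ux: "u \<noteq> x"
     using hits_current[of q x t s] w0 x Some False by auto
    have "f (Suc t) E (q(Suc t := v)) \<le> (1 - hit_prob E x v) * c E ^ m" for v
    proof (cases v)
     case None
     then show ?thesis
      using Some False by (auto simp: f_def pending_def m_def)
    next
     case (Some v')
     have "pending s (q(Suc t := v)) (Suc t) = m"
      using \<open>q t = Some u\<close> Some by (simp add: pending_def m_def)
     then show ?thesis
      using Some False by (auto simp: f_def)
    qed
    then have "kernel E (\<lambda>v. f (Suc t) E (q(Suc t := v))) (q t) \<le> kernel E (\<lambda>v. c E ^ m + (- (c E ^ m)) * hit_prob E x v) (Some u)"
     unfolding Some by (intro kernel_mono) (simp add: algebra_simps)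
    also have "\<dots> = c E ^ m + (- (c E ^ m)) * hit_prob E x (Some u)"
     unfolding kernel_add kernel_const kernel_cmult using kernel_hit_prob(2)[OF ux, of E] False by simp
    also have "\<dots> = f t E q"
     using False by (simp add: f_def Some m_def algebra_simps)
    finally show ?thesis .
   qed
  qed
 qed
 also have "(\<bbbA>\<^sup>+w. g (env w) * ennreal (f 0 (env w) (\<lambda>i. X i w))) =
   (\<bbbA>\<^sup>+w. g (env w) * ennreal (if x \<in> tree (env w) then (1 - 1 / ?r (env w) x) ^ s else 0))"
 proof (rule nn_integral_cong_AE, use AE_X_0 in eventually_elim)
  case (elim w)
  have "c (env w) * c (env w) ^ (s - 1) = c (env w) ^ s"
   using s by (cases s) auto
  then show ?case
   using elim s by (auto simp: f_def pending_def c_def)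
 qed
 finally have le: "(\<bbbA>\<^sup>+w. g (env w) * ennreal (f (0 + t) (env w) (\<lambda>i. X i w))) \<le>
   (\<bbbA>\<^sup>+w. g (env w) * ennreal (if x \<in> tree (env w) then (1 - 1 / ?r (env w) x) ^ s else 0))" .
 have "(\<bbbA>\<^sup>+w. g (env w) * indicator {w. x \<in> tree (env w) \<and> \<not> hits s x (\<lambda>i. X i w) t \<and> returns (\<lambda>i. X i w) t \<ge> s} w) \<le>
   (\<bbbA>\<^sup>+w. g (env w) * ennreal (f (0 + t) (env w) (\<lambda>i. X i w)))"
  by (intro nn_integral_mono mult_left_mono) (auto simp: indicator_def f_def)
 with le show ?thesis
  by (rule order_trans[rotated])
qed

end


section \<open>Recurrence\<close>

primrec no_return :: "nat \<Rightarrow> environment \<Rightarrow> vertex option \<Rightarrow> real" where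
 "no_return 0 E = (\<lambda>v. if v = None then 0 else 1)"
| "no_return (Suc t) E = (\<lambda>v. if v = None then 0 else kernel E (no_return t E) v)"

lemma no_return_None [simp]: "no_return t E None = 0"
 by (cases t) auto

lemma no_return_Some: "no_return (Suc t) E (Some x) = kernel E (no_return t E) (Some x)"
 by simp

lemma no_return_bounds: "0 \<le> no_return t E v" "no_return t E v \<le> 1"
proof -
 have "0 \<le> no_return t E v \<and> no_return t E v \<le> 1" for v
 proof (induction t arbitrary: v)
  case (Suc t)
  have "kernel E (no_return t E) v \<le> kernel E (\<lambda>_. 1) v"
   using Suc by (intro kernel_mono) auto
  then show ?case
   using Suc by (auto simp: kernel_const kernel_nonneg simp del: kernel.simps)
 qed auto
 then show "0 \<le> no_return t E v" "no_return t E v \<le> 1"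
  by auto
qed

lemma no_return_measurable [measurable]: "(\<lambda>E. no_return t E v) \<in> borel_measurable env_space"
proof (induction t arbitrary: v)
 case (Suc t)
 have "(\<lambda>E. kernel E (no_return t E) v) \<in> borel_measurable env_space"
  by (rule kernel_measurable[OF Suc])
 then show ?case
  by (cases v) (auto simp del: kernel.simps)
qed simp

lemma no_return_decseq: "decseq (\<lambda>t. no_return t E v)"
proof -
 have "no_return (Suc t) E v \<le> no_return t E v" for t v
 proof (induction t arbitrary: v)
  case 0
  then show ?case
   using no_return_bounds(2)[of "Suc 0" E v] by (cases v) (auto simp del: no_return.simps simp: no_return.simps(1))
 next
  case (Suc t)
  then show ?case
   by (cases v) (auto simp: no_return_Some simp del: no_return.simps kernel.simps intro!: kernel_mono)
 qed
 then show ?thesis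
  by (rule decseq_SucI)
qed

text \<open>
 The quenched probability never to reach the extra parent of the root.
\<close>

definition escape :: "environment \<Rightarrow> vertex option \<Rightarrow> real" where
 "escape E v = lim (\<lambda>t. no_return t E v)"

lemma no_return_tendsto: "(\<lambda>t. no_return t E v) \<longlonglongrightarrow> escape E v"
 using decseq_convergent[OF no_return_decseq, of 0 E v] no_return_bounds(1)
 unfolding escape_def by (metis limI)

lemma escape_measurable [measurable]: "(\<lambda>E. escape E v) \<in> borel_measurable env_space"
 unfolding escape_def by measurable

lemma escape_bounds: "0 \<le> escape E v" "escape E v \<le> 1"
 using no_return_tendsto[of E v] no_return_bounds
 by (auto intro: LIMSEQ_le_const LIMSEQ_le_const2)

lemma escape_None [simp]: "escape E None = 0"
 using no_return_tendsto[of E None] by (simp add: LIMSEQ_const_iff)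

lemma escape_harmonic: "escape E (Some x) = kernel E (escape E) (Some x)"
proof (rule LIMSEQ_unique)
 show "(\<lambda>t. no_return (Suc t) E (Some x)) \<longlonglongrightarrow> escape E (Some x)"
  by (rule LIMSEQ_Suc[OF no_return_tendsto])
 show "(\<lambda>t. no_return (Suc t) E (Some x)) \<longlonglongrightarrow> kernel E (escape E) (Some x)"
  unfolding no_return_Some kernel.simps using kernel_denom_pos[of E x]
  by (intro tendsto_intros no_return_tendsto) auto
qed

text \<open>
 To escape from a child of the root the walk must escape within the subtree of the child, or else
 return to the root and escape from there.
\<close>

lemma escape_child:
 "escape E (Some [i]) \<le> escape (subtree E [i]) (Some []) + (1 - escape (subtree E [i]) (Some [])) * escape E (Some [])"
proof -
 let ?E = "subtree E [i]" and ?b = "escape E (Some [])"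
 have b: "0 \<le> ?b" "?b \<le> 1"
  by (rule escape_bounds)+
 have *: "escape E (Some (i # v)) \<le> ?b + (1 - ?b) * no_return t ?E (Some v)" for t v
 proof (induction t arbitrary: v)
  case 0
  then show ?case
   using escape_bounds(2)[of E "Some (i # v)"] by simp
 next
  case (Suc t)
  define F where "F y = (case y of None \<Rightarrow> ?b | Some v \<Rightarrow> escape E (Some (i # v)))" for y
  have "escape E (Some (i # v)) = kernel ?E F (Some v)"
   unfolding escape_harmonic[of E "i # v"] by (simp add: F_def subtree_apply parent_def)
  also have "\<dots> \<le> kernel ?E (\<lambda>y. ?b + (1 - ?b) * no_return t ?E y) (Some v)"
   by (rule kernel_mono) (use Suc in \<open>auto simp: F_def split: option.split\<close>)
  also have "\<dots> = ?b + (1 - ?b) * no_return (Suc t) ?E (Some v)"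
   by (simp only: kernel_add kernel_const kernel_cmult no_return_Some)
  finally show ?case .
 qed
 have "(\<lambda>t. ?b + (1 - ?b) * no_return t ?E (Some [])) \<longlonglongrightarrow> ?b + (1 - ?b) * escape ?E (Some [])"
  by (intro tendsto_intros no_return_tendsto)
 then have "escape E (Some [i]) \<le> ?b + (1 - ?b) * escape ?E (Some [])"
  by (rule LIMSEQ_le_const) (use * in auto)
 then show ?thesis
  by (simp add: algebra_simps)
qed

lemma escape_root_le:
 "escape E (Some []) * (1 + branch_sum (\<lambda>E. escape E (Some [])) E) \<le> branch_sum (\<lambda>E. escape E (Some [])) E"
proof -
 let ?b = "escape E (Some [])" and ?n = "length (E [])" and ?a = "\<lambda>i. exp (- (E [] ! i))"
 let ?c = "\<lambda>i. escape (subtree E [i]) (Some [])"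
 have "?b * (1 + (\<Sum>i<?n. ?a i)) = (\<Sum>i<?n. ?a i * escape E (Some [i]))"
  using kernel_denom_pos[of E "[]"] by (subst escape_harmonic) (simp add: parent_def)
 also have "\<dots> \<le> (\<Sum>i<?n. ?a i * (?c i + (1 - ?c i) * ?b))"
  by (intro sum_mono mult_left_mono escape_child) simp
 also have "\<dots> = (\<Sum>i<?n. ?a i * ?c i) + ?b * (\<Sum>i<?n. ?a i) - ?b * (\<Sum>i<?n. ?a i * ?c i)"
  by (simp add: sum.distrib sum_subtractf sum_distrib_left algebra_simps)
 finally show ?thesis
  by (simp add: branch_sum_def algebra_simps)
qed

context branching_law
begin

text \<open>
 The escape probability \<open>b\<close> satisfies \<open>b \<le> x / (1 + x)\<close>, where \<open>x\<close> is the branching sum of the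
 escape probabilities of the subtrees and has the same mean as \<open>b\<close>. This leaves no room for
 anything but zero.
\<close>

lemma AE_escape_zero: "AE E in GW. escape E (Some []) = 0"
proof -
 let ?b = "\<lambda>E. escape E (Some [])"
 let ?x = "branch_sum ?b"
 have x0: "?x E \<ge> 0" for E
  by (rule branch_sum_nonneg) (rule escape_bounds)
 have le: "?b E + ?b E * ?x E \<le> ?x E" for E
  using escape_root_le[of E] by (simp add: algebra_simps)
 have "(\<bbbE>E. ?b E) + (\<bbbE>E. ?b E * ?x E) = (\<bbbE>\<^sup>+E. ennreal (?b E) + ennreal (?b E * ?x E))"
  by (rule nn_integral_add[symmetric]) measurable
 also have "\<dots> \<le> (\<bbbE>E. ?x E)"
  using le by (intro nn_integral_mono) (simp add: ennreal_plus[symmetric] escape_bounds x0 ennreal_leI del: ennreal_plus)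
 also have "\<dots> = (\<bbbE>E. ?b E)"
  by (rule nn_integral_branch_sum) (auto simp: escape_bounds)
 finally have "(\<bbbE>E. ?b E) + (\<bbbE>E. ?b E * ?x E) \<le> (\<bbbE>E. ?b E) + 0"
  by simp
 moreover have "(\<bbbE>E. ?b E) < top"
 proof -
  have "(\<bbbE>E. ?b E) \<le> (\<bbbE>\<^sup>+E. 1)"
   by (intro nn_integral_mono) (simp add: escape_bounds)
  also have "\<dots> < top"
   by (simp add: GW.emeasure_space_1[simplified])
  finally show ?thesis .
 qed
 ultimately have "(\<bbbE>E. ?b E * ?x E) = 0"
  by (subst (asm) ennreal_add_left_cancel_le) auto
 then have "AE E in GW. ennreal (?b E * ?x E) = 0"
  by (subst (asm) nn_integral_0_iff_AE) auto
 then show ?thesis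
 proof eventually_elim
  case (elim E)
  then have "?b E * ?x E \<le> 0"
   by (simp add: ennreal_eq_0_iff)
  then have "?b E * ?x E = 0"
   using mult_nonneg_nonneg[OF escape_bounds(1)[of E "Some []"] x0[of E]] by simp
  then show ?case
   using le[of E] escape_bounds(1)[of E "Some []"] by auto
 qed
qed

end

context walk_in_random_environment
begin

lemma no_return_bound:
 "(\<bbbA>\<^sup>+w. indicator {w. X j w = Some [] \<and> (\<forall>i\<in>{j<..j + t}. X i w \<noteq> None)} w) \<le>
  (\<bbbA>\<^sup>+w. ennreal (no_return t (env w) (Some [])))"
proof -
 define ok where "ok i p \<longleftrightarrow> p j = Some [] \<and> (\<forall>i'\<in>{j<..i}. p i' \<noteq> None)" for i and p :: "nat \<Rightarrow> vertex option"
 define f where "f i E p = (if i < j \<or> j + t < i then 0 else if ok i p then no_return (j + t - i) E (p i) else 0)" for i E p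
 have "(\<bbbA>\<^sup>+w. 1 * ennreal (f (j + t) (env w) (\<lambda>i. X i w))) \<le> (\<bbbA>\<^sup>+w. 1 * ennreal (f j (env w) (\<lambda>i. X i w)))"
 proof (rule supermartingale)
  show "(\<lambda>E. f i E p) \<in> borel_measurable env_space" for i p
   unfolding f_def by measurable
  show "0 \<le> f i E p" for i E p
   by (simp add: f_def no_return_bounds)
  show "f i E p = f i E v'" if "\<And>k. k \<le> i \<Longrightarrow> p k = v' k" for i E p v'
  proof -
   have "ok i p = ok i v'" if "\<not> i < j"
    using that \<open>\<And>k. k \<le> i \<Longrightarrow> p k = v' k\<close> by (auto simp: ok_def)
   then show ?thesis
    using that by (simp add: f_def)
  qed
 next
  fix i E and p :: "nat \<Rightarrow> vertex option"
  assume i: "j \<le> i"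
  have "{j<..Suc i} = insert (Suc i) {j<..i}"
   using i by auto
  then have ok_Suc: "ok (Suc i) (p(Suc i := y)) \<longleftrightarrow> ok i p \<and> y \<noteq> None" for y
   using i by (auto simp: ok_def)
  show "kernel E (\<lambda>y. f (Suc i) E (p(Suc i := y))) (p i) \<le> f i E p"
  proof (cases "Suc i \<le> j + t \<and> ok i p")
   case False
   have "f (Suc i) E (p(Suc i := y)) = 0" for y
    using False i by (auto simp: f_def ok_Suc)
   then show ?thesis
    by (simp only: kernel_const) (simp add: f_def no_return_bounds)
  next
   case True
   have "p i \<noteq> None"
   proof (cases "i = j")
    case False
    then have "i \<in> {j<..i}"
     using i by simp
    then show ?thesis
     using True unfolding ok_def by blast
   qed (use True in \<open>simp add: ok_def\<close>)
   then obtain x where x: "p i = Some x"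
    by blast
   have "f (Suc i) E (p(Suc i := y)) \<le> no_return (j + t - Suc i) E y" for y
    using True i by (auto simp: f_def ok_Suc no_return_bounds)
   then have "kernel E (\<lambda>y. f (Suc i) E (p(Suc i := y))) (p i) \<le> kernel E (no_return (j + t - Suc i) E) (Some x)"
    unfolding x by (rule kernel_mono)
   also have "\<dots> = no_return (Suc (j + t - Suc i)) E (Some x)"
    by (rule no_return_Some[symmetric])
   also have "Suc (j + t - Suc i) = j + t - i"
    using conjunct1[OF True] by arith
   also have "no_return (j + t - i) E (Some x) = f i E p"
    using True i by (simp add: f_def x)
   finally show ?thesis .
  qed
 qed simp
 also have "\<dots> \<le> (\<bbbA>\<^sup>+w. ennreal (no_return t (env w) (Some [])))"
  by (intro nn_integral_mono) (auto simp: f_def ok_def no_return_bounds intro!: ennreal_leI)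
 finally have "(\<bbbA>\<^sup>+w. 1 * ennreal (f (j + t) (env w) (\<lambda>i. X i w))) \<le> (\<bbbA>\<^sup>+w. ennreal (no_return t (env w) (Some [])))" .
 moreover have "(\<bbbA>\<^sup>+w. indicator {w. X j w = Some [] \<and> (\<forall>i\<in>{j<..j + t}. X i w \<noteq> None)} w) \<le>
   (\<bbbA>\<^sup>+w. 1 * ennreal (f (j + t) (env w) (\<lambda>i. X i w)))"
 proof (intro nn_integral_mono)
  fix w
  show "indicator {w. X j w = Some [] \<and> (\<forall>i\<in>{j<..j + t}. X i w \<noteq> None)} w \<le> 1 * ennreal (f (j + t) (env w) (\<lambda>i. X i w))"
  proof (cases "X j w = Some [] \<and> (\<forall>i\<in>{j<..j + t}. X i w \<noteq> None)")
   case True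
   have "X (j + t) w \<noteq> None"
   proof (cases "t = 0")
    case False
    then have "j + t \<in> {j<..j + t}"
     by simp
    then show ?thesis
     using True by blast
   qed (use True in simp)
   then show ?thesis
    using True by (simp add: indicator_def f_def ok_def)
  qed (auto simp: indicator_def)
 qed
 ultimately show ?thesis
  by (rule order_trans[rotated])
qed

lemma AE_leave_None: "AE w in M. \<forall>j. X j w = None \<longrightarrow> X (Suc j) w = Some []"
proof -
 have "AE w in M. X j w = None \<longrightarrow> X (Suc j) w = Some []" for j
 proof -
  let ?f = "\<lambda>E p. if p j = None \<and> p (Suc j) \<noteq> Some [] then 1 else 0 :: real"
  have "(\<bbbA>\<^sup>+w. 1 * ennreal (?f (env w) (\<lambda>i. X i w))) =
    (\<bbbA>\<^sup>+w. 1 * ennreal (kernel (env w) (\<lambda>y. ?f (env w) ((\<lambda>i. X i w)(Suc j := y))) (X j w)))"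
   by (rule markov_step[where f = ?f]) auto
  also have "\<dots> = (\<bbbA>\<^sup>+w. 0)"
  proof (intro nn_integral_cong)
   fix w
   show "1 * ennreal (kernel (env w) (\<lambda>y. ?f (env w) ((\<lambda>i. X i w)(Suc j := y))) (X j w)) = 0"
   proof (cases "X j w")
    case (Some x)
    then have "(\<lambda>y. ?f (env w) ((\<lambda>i. X i w)(Suc j := y))) = (\<lambda>_. 0)"
     by auto
    then show ?thesis
     by (simp only: kernel_const) simp
   qed simp
  qed
  finally have "(\<bbbA>\<^sup>+w. ennreal (?f (env w) (\<lambda>i. X i w))) = 0"
   by simp
  then have "AE w in M. ennreal (?f (env w) (\<lambda>i. X i w)) = 0"
   by (subst (asm) nn_integral_0_iff_AE) auto
  then show ?thesis
   by eventually_elim (auto split: if_splits)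
 qed
 then show ?thesis
  by (simp add: AE_all_countable)
qed

end


section \<open>The walk in a branching environment\<close>

lemma returns_mono: "i \<le> j \<Longrightarrow> returns p i \<le> returns p j"
 by (rule lift_Suc_mono_le[of "returns p"]) auto

lemma hits_mono: "i \<le> j \<Longrightarrow> hits s x p i \<Longrightarrow> hits s x p j"
 by (induction j) (auto simp: le_Suc_eq)

lemma hits_iff: "hits s x p t \<longleftrightarrow> (\<exists>i. 1 \<le> i \<and> i \<le> t \<and> p i = Some x \<and> returns p i < s)"
proof (induction t)
 case (Suc t)
 then show ?case
  by (auto simp: le_Suc_eq)
qed simp

lemma return_time_le_iff: "return_time p s \<le> enat i \<longleftrightarrow> s \<le> returns p i"
proof (induction s arbitrary: i)
 case (Suc s)
 let ?A = "{enat i' | i'. return_time p s < enat i' \<and> p i' = None}"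
 have lt: "return_time p s < enat i' \<longleftrightarrow> i' \<ge> 1 \<and> s \<le> returns p (i' - 1)" for i'
 proof (cases i')
  case (Suc k)
  have "return_time p s < enat (Suc k) \<longleftrightarrow> return_time p s \<le> enat k"
   by (cases "return_time p s") auto
  then show ?thesis
   using Suc Suc.IH by simp
 qed (simp add: zero_enat_def[symmetric])
 have "return_time p (Suc s) \<le> enat i \<longleftrightarrow> (\<exists>i'\<le>i. return_time p s < enat i' \<and> p i' = None)"
 proof
  assume le: "return_time p (Suc s) \<le> enat i"
  then have "?A \<noteq> {}"
   by (auto simp: Inf_enat_def split: if_splits)
  then have "Inf ?A \<in> ?A"
   unfolding Inf_enat_def by (auto intro: LeastI)
  then show "\<exists>i'\<le>i. return_time p s < enat i' \<and> p i' = None"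
   using le by auto
 next
  assume "\<exists>i'\<le>i. return_time p s < enat i' \<and> p i' = None"
  then obtain i' where "i' \<le> i" "return_time p s < enat i'" "p i' = None"
   by blast
  then have "Inf ?A \<le> enat i'" "enat i' \<le> enat i"
   by (auto intro: Inf_lower)
  then show "return_time p (Suc s) \<le> enat i"
   unfolding return_time.simps by (rule order_trans)
 qed
 also have "\<dots> \<longleftrightarrow> (\<exists>i'\<le>i. i' \<ge> 1 \<and> s \<le> returns p (i' - 1) \<and> p i' = None)"
  by (simp add: lt conj_ac)
 also have "\<dots> \<longleftrightarrow> Suc s \<le> returns p i"
 proof
  assume "\<exists>i'\<le>i. i' \<ge> 1 \<and> s \<le> returns p (i' - 1) \<and> p i' = None"
  then obtain k where "Suc k \<le> i" "s \<le> returns p k" "p (Suc k) = None"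
   by (metis Suc_pred' less_eq_Suc_le One_nat_def)
  then show "Suc s \<le> returns p i"
   using returns_mono[of "Suc k" i p] by simp
 next
  assume "Suc s \<le> returns p i"
  then show "\<exists>i'\<le>i. i' \<ge> 1 \<and> s \<le> returns p (i' - 1) \<and> p i' = None"
  proof (induction i)
   case (Suc i)
   show ?case
   proof (cases "Suc s \<le> returns p i")
    case True
    then show ?thesis
     using Suc.IH le_SucI by blast
   next
    case False
    then show ?thesis
     using Suc.prems by (intro exI[of _ "Suc i"]) (auto split: if_splits)
   qed
  qed simp
 qed
 finally show ?case .
qed simp

lemma visited_iff: "x \<in> visited E p (return_time p s) \<longleftrightarrow> x \<in> tree E \<and> (\<exists>t. hits s x p t)"
proof -
 have "enat i \<le> return_time p s \<longleftrightarrow> returns p i < s" if "i \<ge> 1" "p i = Some x" for i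
 proof
  assume le: "enat i \<le> return_time p s"
  show "returns p i < s"
  proof (rule ccontr)
   assume "\<not> returns p i < s"
   then have "s \<le> returns p (i - 1)"
    using that by (cases i) auto
   then have "return_time p s \<le> enat (i - 1)"
    by (simp add: return_time_le_iff)
   with le have "enat i \<le> enat (i - 1)"
    by (rule order_trans)
   then show False
    using that by simp
  qed
 next
  assume "returns p i < s"
  then have "\<not> return_time p s \<le> enat i"
   by (simp add: return_time_le_iff)
  then show "enat i \<le> return_time p s"
   by simp
 qed
 then show ?thesis
  unfolding visited_def hits_iff by auto
qed

lemma (in walk_in_random_environment) distr_env_PiM: "distr M env_space env = (\<Pi>\<^sub>M u\<in>UNIV. \<mu>)"
proof -
 have "distr M (\<Pi>\<^sub>M u\<in>(UNIV :: vertex set). real_seqs) (\<lambda>w. \<lambda>u\<in>UNIV. env w u) = (\<Pi>\<^sub>M u\<in>UNIV. distr M real_seqs (\<lambda>w. env w u))"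
  using env_indep by (subst (asm) indep_vars_iff_distr_eq_PiM) (auto simp: indep_vars_def)
 moreover have "(\<lambda>w. \<lambda>u\<in>UNIV. env w u) = env"
  by (simp add: fun_eq_iff)
 ultimately show ?thesis
  by (simp only: env_law env_space_def)
qed

text \<open>
 The offspring law of the environment of the walk is the one of the spine; integrating over the
 environment is then integrating over the branching environment of that law.
\<close>

locale branching_walk = walk_in_random_environment M \<mu> env X + B: spine_branching_law \<mu> \<nu> Q S
 for M :: "'w measure" and \<mu> and env :: "'w \<Rightarrow> environment" and X and \<nu> :: "real measure"
  and Q :: "'s measure" and S :: "nat \<Rightarrow> 's \<Rightarrow> real"
begin

lemma distr_env: "distr M env_space env = B.GW"
 by (simp add: distr_env_PiM B.GW_def)

lemma nn_integral_env:
 "F \<in> borel_measurable env_space \<Longrightarrow> (\<bbbA>\<^sup>+w. F (env w)) = (\<bbbE>\<^sup>+E. F E)"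
 unfolding distr_env[symmetric] by (rule nn_integral_distr[symmetric]) auto

lemma AE_env: "AE E in B.GW. P E \<Longrightarrow> AE w in M. P (env w)"
 unfolding distr_env[symmetric] by (rule AE_distrD[OF env_measurable])

text \<open>
 By recurrence every excursion ends, so that the first \<open>s\<close> excursions are complete after finitely many
 steps and the bounds for a fixed number of steps pass to the limit.
\<close>

lemma AE_returns_unbounded: "AE w in M. \<forall>s. \<exists>t. s \<le> returns (\<lambda>i. X i w) t"
proof -
 have null: "AE w in M. X j w = Some [] \<longrightarrow> (\<exists>i>j. X i w = None)" for j
 proof -
  let ?A = "{w \<in> space M. X j w = Some [] \<and> (\<forall>i>j. X i w \<noteq> None)}"
  have "(\<lambda>t. \<integral>\<^sup>+w. ennreal (no_return t (env w) (Some [])) \<partial>M) \<longlonglongrightarrow> (\<bbbA>\<^sup>+w. 0)"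
  proof (rule nn_integral_dominated_convergence[where w = "\<lambda>_. 1"])
   show "AE w in M. (\<lambda>t. ennreal (no_return t (env w) (Some []))) \<longlonglongrightarrow> 0"
    using AE_env[OF B.AE_escape_zero]
   proof eventually_elim
    case (elim w)
    then show ?case
     using no_return_tendsto[of "env w" "Some []"] by (auto intro: tendsto_ennrealI[of _ 0, simplified])
   qed
  qed (auto simp: no_return_bounds emeasure_space_1)
  moreover have "emeasure M ?A \<le> (\<bbbA>\<^sup>+w. ennreal (no_return t (env w) (Some [])))" for t
  proof -
   have "emeasure M ?A = (\<bbbA>\<^sup>+w. indicator ?A w)"
    by (rule nn_integral_indicator[symmetric]) measurable
   also have "\<dots> \<le> (\<bbbA>\<^sup>+w. indicator {w. X j w = Some [] \<and> (\<forall>i\<in>{j<..j + t}. X i w \<noteq> None)} w)"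
    by (intro nn_integral_mono) (auto simp: indicator_def)
   finally show ?thesis
    using no_return_bound[of j t] by (rule order_trans)
  qed
  ultimately have "emeasure M ?A \<le> 0"
   by (intro LIMSEQ_le_const) auto
  then have "AE w in M. w \<notin> ?A"
   by (intro AE_not_in) (auto simp: null_sets_def)
  then show ?thesis
   using AE_space by eventually_elim auto
 qed
 then have "AE w in M. \<forall>j. X j w = Some [] \<longrightarrow> (\<exists>i>j. X i w = None)"
  by (simp add: AE_all_countable)
 then show ?thesis
  using AE_leave_None AE_X_0
 proof eventually_elim
  case (elim w)
  let ?w = "\<lambda>i. X i w"
  have "\<exists>t. s \<le> returns ?w t \<and> (t = 0 \<or> ?w t = None)" for s
  proof (induction s)
   case (Suc s)
   then obtain t where t: "s \<le> returns ?w t" "t = 0 \<or> ?w t = None"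
    by blast
   then obtain j where j: "t \<le> j" "?w j = Some []"
    using elim(2,3) by (metis le_SucI order_refl)
   then obtain i where i: "i > j" "?w i = None"
    using elim(1) by blast
   then obtain k where k: "i = Suc k" "t \<le> k"
    using j by (cases i) auto
   have "Suc s \<le> returns ?w i"
    using returns_mono[OF k(2), of ?w] t(1) i(2) k(1) by simp
   then show ?case
    using i by blast
  qed auto
  then show ?case by blast
 qed
qed

definition visits :: "nat \<Rightarrow> vertex \<Rightarrow> 'w \<Rightarrow> bool" where
 "visits s x w \<longleftrightarrow> x \<in> tree (env w) \<and> (\<exists>t. hits s x (\<lambda>i. X i w) t)"

lemma hits_measurable [measurable]: "Measurable.pred M (\<lambda>w. hits s x (\<lambda>i. X i w) t)"
 by (rule path_functional_measurable[where f = "\<lambda>E p. hits s x p t" and t = t]) (simp, rule hits_cong, simp)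

lemma returns_measurable [measurable]: "(\<lambda>w. returns (\<lambda>i. X i w) t) \<in> M \<rightarrow>\<^sub>M count_space UNIV"
 by (rule path_functional_measurable[where f = "\<lambda>E p. returns p t" and t = t]) (auto intro: returns_cong)

lemma visits_measurable [measurable]: "Measurable.pred M (visits s x)"
 unfolding visits_def[abs_def] by measurable

lemma joint_visit_bound:
 assumes g [measurable]: "g \<in> borel_measurable env_space" and s: "s \<ge> 1" and x: "x \<noteq> []" and y: "y \<noteq> []"
 shows "(\<bbbA>\<^sup>+w. g (env w) * indicator {w. visits s x w \<and> visits s y w} w) \<le>
  (\<bbbE>\<^sup>+E. g E * ennreal (if x \<in> tree E \<and> y \<in> tree E then
    (2 * real s * resistance E (longest_common_prefix x y) + (real s)\<^sup>2) / (resistance E x * resistance E y) else 0))"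
proof -
 let ?g = "\<lambda>E. g E * indicator {E. x \<in> tree E \<and> y \<in> tree E} E"
 have [measurable]: "?g \<in> borel_measurable env_space"
  by measurable
 let ?h = "\<lambda>t w. ?g (env w) * indicator {w. hits s x (\<lambda>i. X i w) t \<and> hits s y (\<lambda>i. X i w) t} w"
 have lim: "(\<lambda>t. ?h t w) \<longlonglongrightarrow> g (env w) * indicator {w. visits s x w \<and> visits s y w} w" for w
 proof (cases "\<exists>t. hits s x (\<lambda>i. X i w) t \<and> hits s y (\<lambda>i. X i w) t")
  case True
  then obtain t0 where t0: "hits s x (\<lambda>i. X i w) t0" "hits s y (\<lambda>i. X i w) t0"
   by blast
  have "eventually (\<lambda>t. ?h t w = g (env w) * indicator {w. visits s x w \<and> visits s y w} w) sequentially"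
   using eventually_ge_at_top[of t0]
  proof eventually_elim
   case (elim t)
   then show ?case
    using t0 hits_mono[OF elim] by (auto simp: indicator_def visits_def)
  qed
  then show ?thesis
   by (rule tendsto_eventually)
 next
  case False
  have "\<not> (visits s x w \<and> visits s y w)"
  proof
   assume "visits s x w \<and> visits s y w"
   then obtain t t' where "hits s x (\<lambda>i. X i w) t" "hits s y (\<lambda>i. X i w) t'"
    by (auto simp: visits_def)
   then have "hits s x (\<lambda>i. X i w) (max t t') \<and> hits s y (\<lambda>i. X i w) (max t t')"
    using hits_mono[of t "max t t'"] hits_mono[of t' "max t t'"] by simp
   then show False
    using False by blast
  qed
  then have zero: "g (env w) * indicator {w. visits s x w \<and> visits s y w} w = 0"
   by auto
  have "(\<lambda>t. ?h t w) = (\<lambda>_. 0)"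
   using False by (auto simp: fun_eq_iff)
  then show ?thesis
   unfolding zero by (simp only: tendsto_const)
 qed
 have "(\<bbbA>\<^sup>+w. g (env w) * indicator {w. visits s x w \<and> visits s y w} w) = (\<bbbA>\<^sup>+w. liminf (\<lambda>t. ?h t w))"
  by (intro nn_integral_cong lim_imp_Liminf[symmetric] lim) simp
 also have "\<dots> \<le> liminf (\<lambda>t. \<integral>\<^sup>+w. ?h t w \<partial>M)"
  by (rule nn_integral_liminf) measurable
 also have "\<dots> \<le> (\<bbbA>\<^sup>+w. ?g (env w) * ennreal ((2 * real s * resistance (env w) (longest_common_prefix x y) + (real s)\<^sup>2) /
    (resistance (env w) x * resistance (env w) y)))"
 proof (rule Liminf_le)
  show "\<forall>\<^sub>F t in sequentially. (\<bbbA>\<^sup>+w. ?h t w) \<le> (\<bbbA>\<^sup>+w. ?g (env w) * ennreal ((2 * real s * resistance (env w) (longest_common_prefix x y) + (real s)\<^sup>2) /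
    (resistance (env w) x * resistance (env w) y)))"
   by (intro always_eventually allI joint_hit_bound s x y) measurable
 qed simp
 also have "\<dots> = (\<bbbE>\<^sup>+E. ?g E * ennreal ((2 * real s * resistance E (longest_common_prefix x y) + (real s)\<^sup>2) /
    (resistance E x * resistance E y)))"
  by (rule nn_integral_env[where F = "\<lambda>E. ?g E * ennreal ((2 * real s * resistance E (longest_common_prefix x y) + (real s)\<^sup>2) /
    (resistance E x * resistance E y))"]) measurable
 also have "\<dots> = (\<bbbE>\<^sup>+E. g E * ennreal (if x \<in> tree E \<and> y \<in> tree E then
    (2 * real s * resistance E (longest_common_prefix x y) + (real s)\<^sup>2) / (resistance E x * resistance E y) else 0))"
  by (intro nn_integral_cong) (auto simp: indicator_def)
 finally show ?thesis .
qed

lemma not_visit_bound: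
 assumes g [measurable]: "g \<in> borel_measurable env_space" and s: "s \<ge> 1" and x: "x \<noteq> []"
 shows "(\<bbbA>\<^sup>+w. g (env w) * indicator {w. x \<in> tree (env w) \<and> \<not> visits s x w} w) \<le>
  (\<bbbE>\<^sup>+E. g E * ennreal (if x \<in> tree E then (1 - 1 / resistance E x) ^ s else 0))"
proof -
 let ?A = "\<lambda>t. {w. x \<in> tree (env w) \<and> \<not> hits s x (\<lambda>i. X i w) t \<and> s \<le> returns (\<lambda>i. X i w) t}"
 have "(\<bbbA>\<^sup>+w. g (env w) * indicator {w. x \<in> tree (env w) \<and> \<not> visits s x w} w) \<le>
   (\<bbbA>\<^sup>+w. liminf (\<lambda>t. g (env w) * indicator (?A t) w))"
 proof (rule nn_integral_mono_AE, use AE_returns_unbounded in eventually_elim)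
  case (elim w)
  then obtain t0 where t0: "s \<le> returns (\<lambda>i. X i w) t0"
   by blast
  show ?case
  proof (rule Liminf_bounded, rule eventually_mono[OF eventually_ge_at_top[of t0]])
   fix t assume "t0 \<le> t"
   then have "s \<le> returns (\<lambda>i. X i w) t"
    using t0 returns_mono order_trans by blast
   then show "g (env w) * indicator {w. x \<in> tree (env w) \<and> \<not> visits s x w} w \<le> g (env w) * indicator (?A t) w"
    by (intro mult_left_mono) (auto simp: indicator_def visits_def)
  qed
 qed
 also have "\<dots> \<le> liminf (\<lambda>t. \<integral>\<^sup>+w. g (env w) * indicator (?A t) w \<partial>M)"
  by (rule nn_integral_liminf) measurable
 also have "\<dots> \<le> (\<bbbA>\<^sup>+w. g (env w) * ennreal (if x \<in> tree (env w) then (1 - 1 / resistance (env w) x) ^ s else 0))"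
 proof (rule Liminf_le)
  show "\<forall>\<^sub>F t in sequentially. (\<bbbA>\<^sup>+w. g (env w) * indicator (?A t) w) \<le>
    (\<bbbA>\<^sup>+w. g (env w) * ennreal (if x \<in> tree (env w) then (1 - 1 / resistance (env w) x) ^ s else 0))"
   by (intro always_eventually allI not_hit_bound s x) measurable
 qed simp
 also have "\<dots> = (\<bbbE>\<^sup>+E. g E * ennreal (if x \<in> tree E then (1 - 1 / resistance E x) ^ s else 0))"
  by (rule nn_integral_env[where F = "\<lambda>E. g E * ennreal (if x \<in> tree E then (1 - 1 / resistance E x) ^ s else 0)"]) measurable
 finally show ?thesis .
qed

end


section \<open>The second moment estimate\<close>

text \<open>Words rather than vertices of the tree, so that the set does not depend on the environment.\<close>

definition window :: "vertex \<Rightarrow> nat \<Rightarrow> nat \<Rightarrow> vertex set" where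
 "window u a b = {x. prefix u x \<and> a \<le> length x \<and> length x \<le> b}"

lemma finite_tree_window: "finite {x \<in> tree E. x \<in> window u a b}"
proof (rule finite_subset)
 show "{x \<in> tree E. x \<in> window u a b} \<subseteq> (\<Union>l\<le>b. generation E l)"
  by (auto simp: window_def generation_def)
qed simp

lemma one_minus_power_le:
 fixes a :: real assumes "0 \<le> a" "a \<le> 1"
 shows "(1 - a) ^ n \<le> 1 - real n * a + (real n * a)\<^sup>2"
proof (induction n)
 case (Suc n)
 have "(1 - a) ^ Suc n \<le> (1 - a) * (1 - real n * a + (real n * a)\<^sup>2)"
  using mult_left_mono[OF Suc, of "1 - a"] assms by simp
 also have "\<dots> = 1 - real (Suc n) * a + (real (Suc n) * a)\<^sup>2 - (a\<^sup>2 + real n * a\<^sup>2 + a * (real n * a)\<^sup>2)"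
  by (simp add: power2_eq_square algebra_simps)
 also have "\<dots> \<le> 1 - real (Suc n) * a + (real (Suc n) * a)\<^sup>2"
 proof -
  have "0 \<le> a\<^sup>2 + real n * a\<^sup>2 + a * (real n * a)\<^sup>2"
   using assms by (intro add_nonneg_nonneg mult_nonneg_nonneg) auto
  then show ?thesis
   by linarith
 qed
 finally show ?case .
qed simp

definition hit_total :: "vertex \<Rightarrow> nat \<Rightarrow> nat \<Rightarrow> environment \<Rightarrow> real" where
 "hit_total u a b E = (\<Sum>l=a..b. hit_sum_below u l E)"

lemma hit_total_measurable [measurable]: "hit_total u a b \<in> borel_measurable env_space"
 unfolding hit_total_def[abs_def] by measurable

lemma hit_total_nonneg: "hit_total u a b E \<ge> 0"
 by (auto simp: hit_total_def intro!: sum_nonneg hit_sum_below_nonneg)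

lemma sum_generations_window:
 "(\<Sum>l=a..b. \<Sum>x\<in>generation E l. if prefix u x then f x else 0) = (\<Sum>x\<in>{x \<in> tree E. x \<in> window u a b}. f x)"
proof -
 have eq: "{x \<in> tree E. x \<in> window u a b} = (\<Union>l\<in>{a..b}. {x \<in> generation E l. prefix u x})"
  by (auto simp: window_def generation_def)
 have "(\<Sum>x\<in>{x \<in> tree E. x \<in> window u a b}. f x) = (\<Sum>l=a..b. \<Sum>x\<in>{x \<in> generation E l. prefix u x}. f x)"
  unfolding eq by (rule sum.UNION_disjoint) (auto simp: generation_def intro: finite_subset[OF _ finite_generation[unfolded generation_def]])
 then show ?thesis
  by (simp add: sum.inter_filter)
qed

lemma hit_total_eq: "hit_total u a b E = (\<Sum>x\<in>{x \<in> tree E. x \<in> window u a b}. 1 / resistance E x)"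
 unfolding hit_total_def hit_sum_below_def by (rule sum_generations_window)

lemma nn_integral_count_finite_support:
 assumes "finite A" "\<And>x. x \<notin> A \<Longrightarrow> f x = (0::ennreal)"
 shows "(\<integral>\<^sup>+x. f x \<partial>count_space UNIV) = (\<Sum>x\<in>A. f x)"
 by (rule nn_integral_count_space') (use assms in auto)

context branching_walk
begin

definition visit_count :: "nat \<Rightarrow> vertex \<Rightarrow> nat \<Rightarrow> nat \<Rightarrow> 'w \<Rightarrow> real" where
 "visit_count s u a b w = real (card {x \<in> window u a b. visits s x w})"

lemma finite_visits: "finite {x \<in> window u a b. visits s x w}"
 by (rule finite_subset[OF _ finite_tree_window[of "env w" u a b]]) (auto simp: visits_def)

lemma visit_count_measurable [measurable]: "visit_count s u a b \<in> borel_measurable M"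
 unfolding visit_count_def[abs_def]
 by (rule measurable_compose_finite_set[where f = "\<lambda>A w. real (card A)" and A = "\<lambda>w. {x \<in> window u a b. visits s x w}"])
   (auto simp: finite_visits)

lemma visit_count_nonneg: "visit_count s u a b w \<ge> 0"
 by (simp add: visit_count_def)

lemma visit_count_eq:
 "ennreal (visit_count s u a b w) = (\<integral>\<^sup>+x. indicator {x \<in> window u a b. visits s x w} x \<partial>count_space UNIV)"
 by (subst nn_integral_indicator) (auto simp: visit_count_def finite_visits emeasure_count_space ennreal_of_nat_eq_real_of_nat)

lemma visit_count_mult:
 "ennreal (visit_count s u a b w) * c = (\<integral>\<^sup>+x. c * indicator {x \<in> window u a b. visits s x w} x \<partial>count_space UNIV)"
 by (simp add: visit_count_eq nn_integral_cmult mult.commute)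

text \<open>
 The square of the count is expanded into pairs. Pairs visited in different excursions produce the
 square of the quenched mean, pairs visited in the same excursion the pair sums.
\<close>

lemma visit_count_second_moment:
 assumes g [measurable]: "g \<in> borel_measurable env_space" and s: "s \<ge> 1" and a: "a \<ge> 1"
 shows "(\<bbbA>\<^sup>+w. g (env w) * ennreal ((visit_count s u a b w)\<^sup>2)) \<le>
  (\<bbbE>\<^sup>+E. g E * ennreal ((real s)\<^sup>2 * (hit_total u a b E)\<^sup>2 + 2 * real s * (\<Sum>l=a..b. \<Sum>l'=a..b. pair_sum l l' E)))"
proof -
 let ?W = "window u a b" and ?r = resistance and ?C = "count_space UNIV :: vertex measure"
 let ?P = "\<lambda>E. \<Sum>l=a..b. \<Sum>l'=a..b. pair_sum l l' E"
 let ?R = "\<lambda>E x y. (2 * real s * ?r E (longest_common_prefix x y) + (real s)\<^sup>2) / (?r E x * ?r E y)"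
 let ?v = "\<lambda>x w. indicator {x \<in> ?W. visits s x w} x :: ennreal"
 let ?k = "\<lambda>x y E. if x \<in> ?W \<and> y \<in> ?W \<and> x \<in> tree E \<and> y \<in> tree E then
   ennreal (?R E x y) else 0"
 have vm [measurable]: "(\<lambda>w. ?v x w) \<in> borel_measurable M" for x
 proof (cases "x \<in> ?W")
  case True
  then have "(\<lambda>w. ?v x w) = (\<lambda>w. indicator {w. visits s x w} w)"
   by (auto simp: indicator_def)
  then show ?thesis by simp
 qed simp
 have "(\<bbbA>\<^sup>+w. g (env w) * ennreal ((visit_count s u a b w)\<^sup>2)) =
   (\<bbbA>\<^sup>+w. \<integral>\<^sup>+x. \<integral>\<^sup>+y. g (env w) * (?v x w * ?v y w) \<partial>?C \<partial>?C)"
 proof (intro nn_integral_cong)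
  fix w
  have "ennreal ((visit_count s u a b w)\<^sup>2) = ennreal (visit_count s u a b w) * ennreal (visit_count s u a b w)"
   by (simp add: power2_eq_square ennreal_mult visit_count_nonneg)
  then show "g (env w) * ennreal ((visit_count s u a b w)\<^sup>2) =
    (\<integral>\<^sup>+x. \<integral>\<^sup>+y. g (env w) * (?v x w * ?v y w) \<partial>?C \<partial>?C)"
   by (simp add: visit_count_eq nn_integral_cmult nn_integral_multc mult_ac)
 qed
 also have "\<dots> = (\<integral>\<^sup>+x. \<integral>\<^sup>+y. \<integral>\<^sup>+w. g (env w) * (?v x w * ?v y w) \<partial>M \<partial>?C \<partial>?C)"
 proof -
  have "(\<bbbA>\<^sup>+w. \<integral>\<^sup>+x. \<integral>\<^sup>+y. g (env w) * (?v x w * ?v y w) \<partial>?C \<partial>?C) =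
    (\<integral>\<^sup>+x. \<integral>\<^sup>+w. \<integral>\<^sup>+y. g (env w) * (?v x w * ?v y w) \<partial>?C \<partial>M \<partial>?C)"
   by (rule nn_integral_count_space_nn_integral)
     (simp_all add: nn_integral_cmult visit_count_eq[symmetric])
  also have "\<dots> = (\<integral>\<^sup>+x. \<integral>\<^sup>+y. \<integral>\<^sup>+w. g (env w) * (?v x w * ?v y w) \<partial>M \<partial>?C \<partial>?C)"
   by (intro nn_integral_cong nn_integral_count_space_nn_integral) auto
  finally show ?thesis .
 qed
 also have "\<dots> \<le> (\<integral>\<^sup>+x. \<integral>\<^sup>+y. \<integral>\<^sup>+E. g E * ?k x y E \<partial>B.GW \<partial>?C \<partial>?C)"
 proof (intro nn_integral_mono)
  fix x y
  show "(\<bbbA>\<^sup>+w. g (env w) * (?v x w * ?v y w)) \<le> (\<bbbE>\<^sup>+E. g E * ?k x y E)"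
  proof (cases "x \<in> ?W \<and> y \<in> ?W")
   case True
   then have xy: "x \<noteq> []" "y \<noteq> []"
    using a by (auto simp: window_def)
   have "(\<bbbA>\<^sup>+w. g (env w) * (?v x w * ?v y w)) =
     (\<bbbA>\<^sup>+w. g (env w) * indicator {w. visits s x w \<and> visits s y w} w)"
    using True by (intro nn_integral_cong) (auto simp: indicator_def)
   also note joint_visit_bound[OF g s xy]
   also have "(\<bbbE>\<^sup>+E. g E * ennreal (if x \<in> tree E \<and> y \<in> tree E then
     ?R E x y else 0)) =
     (\<bbbE>\<^sup>+E. g E * ?k x y E)"
    using True by (intro nn_integral_cong) auto
   finally show ?thesis .
  qed (auto simp: indicator_def)
 qed
 also have "\<dots> = (\<bbbE>\<^sup>+E. \<integral>\<^sup>+x. \<integral>\<^sup>+y. g E * ?k x y E \<partial>?C \<partial>?C)"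
 proof -
  have km: "(\<lambda>E. g E * ?k x y E) \<in> borel_measurable B.GW" for x y
   by measurable
  have "(\<integral>\<^sup>+x. \<integral>\<^sup>+y. \<integral>\<^sup>+E. g E * ?k x y E \<partial>B.GW \<partial>?C \<partial>?C) =
    (\<integral>\<^sup>+x. \<integral>\<^sup>+E. \<integral>\<^sup>+y. g E * ?k x y E \<partial>?C \<partial>B.GW \<partial>?C)"
   by (intro nn_integral_cong nn_integral_count_space_nn_integral[symmetric] km) auto
  also have "\<dots> = (\<bbbE>\<^sup>+E. \<integral>\<^sup>+x. \<integral>\<^sup>+y. g E * ?k x y E \<partial>?C \<partial>?C)"
  proof (rule nn_integral_count_space_nn_integral[symmetric])
   fix x
   have "(\<lambda>E. \<integral>\<^sup>+y. g E * ?k x y E \<partial>?C) = (\<lambda>E. \<Sum>y\<in>{y \<in> tree E. y \<in> ?W}. g E * ?k x y E)"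
    by (intro ext nn_integral_count_finite_support[OF finite_tree_window]) auto
   also have "\<dots> \<in> borel_measurable B.GW"
    by (rule measurable_compose_finite_set[where A = "\<lambda>E. {y \<in> tree E. y \<in> ?W}" and f = "\<lambda>A E. \<Sum>y\<in>A. g E * ?k x y E"])
      (auto intro!: borel_measurable_sum km finite_tree_window)
   finally show "(\<lambda>E. \<integral>\<^sup>+y. g E * ?k x y E \<partial>?C) \<in> borel_measurable B.GW" .
  qed simp
  finally show ?thesis .
 qed
 also have "\<dots> \<le> (\<bbbE>\<^sup>+E. g E * ennreal ((real s)\<^sup>2 * (hit_total u a b E)\<^sup>2 + 2 * real s * ?P E))"
 proof (intro nn_integral_mono)
  fix E
  let ?T = "{x \<in> tree E. x \<in> ?W}"
  have "(\<integral>\<^sup>+x. \<integral>\<^sup>+y. g E * ?k x y E \<partial>?C \<partial>?C) = (\<integral>\<^sup>+x. (\<Sum>y\<in>?T. g E * ?k x y E) \<partial>?C)"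
   by (intro nn_integral_cong nn_integral_count_finite_support[OF finite_tree_window]) auto
  also have "\<dots> = (\<Sum>x\<in>?T. \<Sum>y\<in>?T. g E * ?k x y E)"
   by (rule nn_integral_count_finite_support[OF finite_tree_window]) auto
  also have "\<dots> = (\<Sum>x\<in>?T. \<Sum>y\<in>?T. g E * ennreal (?R E x y))"
   by (intro sum.cong) auto
  also have "\<dots> = g E * ennreal (\<Sum>x\<in>?T. \<Sum>y\<in>?T. ?R E x y)"
  proof -
   have "0 \<le> ?R E x y" for x y
    by simp
   then show ?thesis
    by (simp add: sum_distrib_left[symmetric] sum_nonneg)
  qed
  also have "\<dots> \<le> g E * ennreal ((real s)\<^sup>2 * (hit_total u a b E)\<^sup>2 + 2 * real s * ?P E)"
  proof (intro mult_left_mono ennreal_leI)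
   let ?q = "\<lambda>x y. ?r E (longest_common_prefix x y) * (exp (- potential E x) * exp (- potential E y))"
   let ?S = "\<Sum>x\<in>?T. \<Sum>y\<in>?T. ?r E (longest_common_prefix x y) * ((1 / ?r E x) * (1 / ?r E y))"
   have "?S \<le> (\<Sum>x\<in>?T. \<Sum>y\<in>?T. ?q x y)"
    by (intro sum_mono mult_left_mono mult_mono inverse_resistance_le) auto
   also have "\<dots> = (\<Sum>l=a..b. \<Sum>x\<in>generation E l. if prefix u x then
     (\<Sum>l'=a..b. \<Sum>y\<in>generation E l'. if prefix u y then ?q x y else 0) else 0)"
    by (simp only: sum_generations_window)
   also have "\<dots> \<le> (\<Sum>l=a..b. \<Sum>x\<in>generation E l. \<Sum>l'=a..b. \<Sum>y\<in>generation E l'. ?q x y)"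
    by (intro sum_mono) (auto intro!: sum_nonneg sum_mono)
   also have "\<dots> = ?P E"
    unfolding pair_sum_def by (intro sum.cong[OF refl] sum.swap)
   finally have pairs: "?S \<le> ?P E" .
   have square: "(\<Sum>x\<in>?T. \<Sum>y\<in>?T. (1 / ?r E x) * (1 / ?r E y)) = (hit_total u a b E)\<^sup>2"
    by (simp add: hit_total_eq power2_eq_square sum_product)
   have "(\<Sum>x\<in>?T. \<Sum>y\<in>?T. ?R E x y) =
     (\<Sum>x\<in>?T. \<Sum>y\<in>?T. (real s)\<^sup>2 * ((1 / ?r E x) * (1 / ?r E y)) +
      2 * real s * (?r E (longest_common_prefix x y) * ((1 / ?r E x) * (1 / ?r E y))))"
    by (intro sum.cong refl) (simp add: add_divide_distrib)
   also have "\<dots> = (real s)\<^sup>2 * (\<Sum>x\<in>?T. \<Sum>y\<in>?T. (1 / ?r E x) * (1 / ?r E y)) + 2 * real s * ?S"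
    by (simp add: sum.distrib sum_distrib_left)
   finally show "(\<Sum>x\<in>?T. \<Sum>y\<in>?T. ?R E x y) \<le>
     (real s)\<^sup>2 * (hit_total u a b E)\<^sup>2 + 2 * real s * ?P E"
    unfolding square using mult_left_mono[OF pairs, of "2 * real s"] by simp
  qed simp
  finally show "(\<integral>\<^sup>+x. \<integral>\<^sup>+y. g E * ?k x y E \<partial>?C \<partial>?C) \<le> \<dots>" .
 qed
 finally show ?thesis .
qed

text \<open>
 The chance \<open>1 - (1 - 1 / r) ^ s\<close> to be visited falls short of \<open>s / r\<close> by a small fraction if
 \<open>s / r\<close> is small, as it is for remote vertices.
\<close>

lemma visit_count_first_moment:
 assumes g [measurable]: "g \<in> borel_measurable env_space" and s: "s \<ge> 1" and a: "a \<ge> 1"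
  and eps: "0 \<le> \<epsilon>" "\<epsilon> \<le> 1"
  and far: "\<And>E x. g E \<noteq> 0 \<Longrightarrow> x \<in> tree E \<Longrightarrow> a \<le> length x \<Longrightarrow> real s / resistance E x \<le> \<epsilon>"
  and fin: "(\<bbbE>\<^sup>+E. g E) < \<infinity>"
 shows "(\<bbbE>\<^sup>+E. g E * ennreal (real s * (1 - \<epsilon>) * hit_total u a b E)) \<le>
  (\<bbbA>\<^sup>+w. g (env w) * ennreal (visit_count s u a b w))"
proof -
 let ?W = "window u a b" and ?r = resistance and ?C = "count_space UNIV :: vertex measure"
 let ?v = "\<lambda>x w. indicator {w. visits s x w} w :: ennreal"
 let ?u = "\<lambda>x w. g (env w) * indicator {x \<in> ?W. visits s x w} x"
 let ?c = "\<lambda>E x. real s * (1 - \<epsilon>) / ?r E x"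
 let ?f = "\<lambda>x E. g E * ennreal (if x \<in> tree E \<and> x \<in> ?W then ?c E x else 0)"
 have single: "(\<bbbE>\<^sup>+E. g E * ennreal (if x \<in> tree E then ?c E x else 0)) \<le>
   (\<bbbA>\<^sup>+w. g (env w) * ?v x w)" if x: "x \<in> ?W" for x
 proof -
  have x0: "x \<noteq> []"
   using x a by (auto simp: window_def)
  let ?p = "\<lambda>E. g E * ennreal (if x \<in> tree E then ?c E x else 0)"
  let ?q = "\<lambda>E. g E * ennreal (if x \<in> tree E then 1 - ?c E x else 0)"
  let ?i = "\<lambda>E. g E * indicator {E. x \<in> tree E} E"
  have bounds: "0 \<le> ?c E x \<and> ?c E x \<le> 1 \<and> (1 - 1 / ?r E x) ^ s \<le> 1 - ?c E x" if "g E \<noteq> 0" "x \<in> tree E" for E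
  proof -
   have sr: "real s / ?r E x \<le> \<epsilon>"
    using far[OF that] x by (simp add: window_def)
   have sr0: "0 \<le> real s / ?r E x"
    by simp
   have "(1 - 1 / ?r E x) ^ s \<le> 1 - real s * (1 / ?r E x) + (real s * (1 / ?r E x))\<^sup>2"
    by (rule one_minus_power_le) (use resistance_ge_1[of E x] in auto)
   also have "(real s * (1 / ?r E x))\<^sup>2 \<le> \<epsilon> * (real s / ?r E x)"
    using mult_right_mono[OF sr sr0] by (simp add: power2_eq_square)
   finally have "(1 - 1 / ?r E x) ^ s \<le> 1 - ?c E x"
    by (simp add: algebra_simps diff_divide_distrib)
   moreover have "?c E x \<le> 1"
   proof -
    have "?c E x = (real s / ?r E x) * (1 - \<epsilon>)"
     by simp
    also have "\<dots> \<le> 1 * 1"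
     by (intro mult_mono) (use sr sr0 eps in linarith)+
    finally show ?thesis by simp
   qed
   ultimately show ?thesis
    using eps by simp
  qed
  have "(\<bbbE>\<^sup>+E. ?p E) + (\<bbbE>\<^sup>+E. ?q E) = (\<bbbE>\<^sup>+E. ?p E + ?q E)"
   by (rule nn_integral_add[symmetric]) measurable
  also have "\<dots> = (\<bbbE>\<^sup>+E. ?i E)"
  proof (intro nn_integral_cong)
   fix E
   show "?p E + ?q E = ?i E"
    using bounds[of E] by (cases "g E = 0"; cases "x \<in> tree E")
     (auto simp: distrib_left[symmetric] ennreal_plus[symmetric] simp del: ennreal_plus)
  qed
  also have "\<dots> = (\<bbbA>\<^sup>+w. ?i (env w))"
   by (rule nn_integral_env[symmetric]) measurable
  also have "\<dots> = (\<bbbA>\<^sup>+w. g (env w) * ?v x w + g (env w) * indicator {w. x \<in> tree (env w) \<and> \<not> visits s x w} w)"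
   by (intro nn_integral_cong) (auto simp: indicator_def visits_def)
  also have "\<dots> = (\<bbbA>\<^sup>+w. g (env w) * ?v x w) +
    (\<bbbA>\<^sup>+w. g (env w) * indicator {w. x \<in> tree (env w) \<and> \<not> visits s x w} w)"
   by (rule nn_integral_add) measurable
  also have "\<dots> \<le> (\<bbbA>\<^sup>+w. g (env w) * ?v x w) + (\<bbbE>\<^sup>+E. ?q E)"
  proof (intro add_left_mono order_trans[OF not_visit_bound[OF g s x0]] nn_integral_mono)
   fix E
   show "g E * ennreal (if x \<in> tree E then (1 - 1 / ?r E x) ^ s else 0) \<le> ?q E"
    using bounds[of E] by (cases "g E = 0") (auto intro!: mult_left_mono ennreal_leI)
  qed
  finally have "(\<bbbE>\<^sup>+E. ?q E) + (\<bbbE>\<^sup>+E. ?p E) \<le>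
    (\<bbbE>\<^sup>+E. ?q E) + (\<bbbA>\<^sup>+w. g (env w) * ?v x w)"
   by (simp only: add.commute)
  moreover have "(\<bbbE>\<^sup>+E. ?q E) < top"
  proof -
   have "(\<bbbE>\<^sup>+E. ?q E) \<le> (\<bbbE>\<^sup>+E. g E * 1)"
   proof (intro nn_integral_mono)
    fix E
    have "(if x \<in> tree E then 1 - ?c E x else 0) \<le> 1" if "g E \<noteq> 0"
     using bounds[OF that] by auto
    then have "?q E \<le> g E * ennreal 1" if "g E \<noteq> 0"
     using that by (intro mult_left_mono ennreal_leI) auto
    then show "?q E \<le> g E * 1"
     by (cases "g E = 0") (simp_all only: ennreal_1 mult_zero_left order_refl not_False_eq_True)
   qed
   then show ?thesis
    using fin by (simp add: le_less_trans)
  qed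
  ultimately show ?thesis
   by (subst (asm) ennreal_add_left_cancel_le) auto
 qed
 have "(\<bbbE>\<^sup>+E. g E * ennreal (real s * (1 - \<epsilon>) * hit_total u a b E)) =
   (\<bbbE>\<^sup>+E. \<integral>\<^sup>+x. ?f x E \<partial>?C)"
 proof (intro nn_integral_cong)
  fix E
  let ?T = "{x \<in> tree E. x \<in> ?W}"
  have "(\<integral>\<^sup>+x. ?f x E \<partial>?C) =
    (\<Sum>x\<in>?T. ?f x E)"
   by (rule nn_integral_count_finite_support[OF finite_tree_window]) auto
  also have "\<dots> = (\<Sum>x\<in>?T. g E * ennreal (?c E x))"
   by (intro sum.cong) auto
  also have "\<dots> = g E * ennreal (\<Sum>x\<in>?T. ?c E x)"
   using eps by (simp add: sum_distrib_left[symmetric])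
  also have "(\<Sum>x\<in>?T. ?c E x) = real s * (1 - \<epsilon>) * hit_total u a b E"
   by (simp add: hit_total_eq sum_distrib_left)
  finally show "g E * ennreal (real s * (1 - \<epsilon>) * hit_total u a b E) =
    (\<integral>\<^sup>+x. ?f x E \<partial>?C)" ..
 qed
 also have "\<dots> = (\<integral>\<^sup>+x. \<integral>\<^sup>+E. ?f x E \<partial>B.GW \<partial>?C)"
  by (rule nn_integral_count_space_nn_integral) auto
 also have "\<dots> \<le> (\<integral>\<^sup>+x. \<integral>\<^sup>+w. ?u x w \<partial>M \<partial>?C)"
 proof (intro nn_integral_mono)
  fix x
  show "(\<bbbE>\<^sup>+E. ?f x E) \<le>
    (\<bbbA>\<^sup>+w. ?u x w)"
  proof (cases "x \<in> ?W")
   case True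
   then show ?thesis
    using single[OF True] by (simp add: indicator_def)
  qed simp
 qed
 also have "\<dots> = (\<bbbA>\<^sup>+w. \<integral>\<^sup>+x. ?u x w \<partial>?C)"
 proof (rule nn_integral_count_space_nn_integral[symmetric])
  fix x
  show "(\<lambda>w. ?u x w) \<in> borel_measurable M"
  proof (cases "x \<in> ?W")
   case True
   then have "(\<lambda>w. ?u x w) = (\<lambda>w. g (env w) * ?v x w)"
    by (auto simp: indicator_def)
   then show ?thesis by simp
  qed simp
 qed simp
 also have "\<dots> = (\<bbbA>\<^sup>+w. g (env w) * ennreal (visit_count s u a b w))"
  by (simp add: visit_count_mult[symmetric] mult.commute)
 finally show ?thesis .
qed

text \<open>
 The quenched variance: on the good environments the number of visited vertices concentrates
 around \<open>s * hit_total\<close>. The first error comes from vertices visited in several excursions, the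
 second one from the dependence within one excursion.
\<close>

lemma visit_count_concentration:
 obtains K where "K \<ge> 0"
  "\<And>u a b s \<theta> G. \<lbrakk>s \<ge> 1; a \<ge> 1; a \<le> b; real s \<le> \<theta>; G \<in> sets env_space;
    \<And>E x. E \<in> G \<Longrightarrow> x \<in> tree E \<Longrightarrow> a \<le> length x \<Longrightarrow> \<theta> \<le> resistance E x\<rbrakk> \<Longrightarrow>
   (\<bbbA>\<^sup>+w. indicator G (env w) * ennreal ((visit_count s u a b w - real s * hit_total u a b (env w))\<^sup>2)) \<le>
    ennreal (K * (real b - real a + 1)\<^sup>2 * ((real s)\<^sup>2 * (real s / \<theta>) + real s * (real b + 1)))"
  "\<And>u a b. a \<le> b \<Longrightarrow> (\<bbbE>E. hit_total u a b E) \<le> ennreal (real b - real a + 1)"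
proof -
 obtain K where K: "K \<ge> 0" "\<And>a b. (\<bbbE>E. W a E * W b E) \<le> ennreal K"
  "\<And>a b. (\<bbbE>E. pair_sum a b E) \<le> ennreal (K * (real (min a b) + 1))"
  by (rule B.nn_integral_pair_sum_bounded) (rule that)
 have tot_le: "hit_total u a b E \<le> (\<Sum>l=a..b. W l E)" for u a b E
  unfolding hit_total_def by (intro sum_mono order_trans[OF hit_sum_below_le hit_sum_le_W])
 have mean: "(\<bbbE>E. hit_total u a b E) \<le> ennreal (real b - real a + 1)" if ab: "a \<le> b" for u a b
 proof -
  have "(\<bbbE>E. hit_total u a b E) \<le> (\<bbbE>\<^sup>+E. (\<Sum>l=a..b. ennreal (W l E)))"
   using tot_le[of u a b] by (intro nn_integral_mono) (simp add: W_nonneg ennreal_leI)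
  also have "\<dots> = ennreal (real b - real a + 1)"
  proof -
   have "real (card {a..b}) = real b - real a + 1"
    using ab by (simp add: of_nat_diff)
   moreover have "(\<Sum>l=a..b. \<integral>\<^sup>+E. ennreal (W l E) \<partial>B.GW) = ennreal (real (card {a..b}))"
    by (simp only: B.nn_integral_W sum_constant ennreal_of_nat_eq_real_of_nat mult_1_right)
   ultimately show ?thesis
    by (subst nn_integral_sum) auto
  qed
  finally show ?thesis .
 qed
 have main: "(\<bbbA>\<^sup>+w. indicator G (env w) * ennreal ((visit_count s u a b w - real s * hit_total u a b (env w))\<^sup>2)) \<le>
    ennreal (2 * K * (real b - real a + 1)\<^sup>2 * ((real s)\<^sup>2 * (real s / \<theta>) + real s * (real b + 1)))"
  if s: "s \<ge> 1" and a: "a \<ge> 1" and ab: "a \<le> b" and s\<theta>: "real s \<le> \<theta>" and G: "G \<in> sets env_space"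
   and far: "\<And>E x. E \<in> G \<Longrightarrow> x \<in> tree E \<Longrightarrow> a \<le> length x \<Longrightarrow> \<theta> \<le> resistance E x" for u a b s \<theta> G
 proof -
  note [measurable] = G
  define L where "L = real b - real a + 1"
  define \<epsilon> where "\<epsilon> = real s / \<theta>"
  have \<theta>: "\<theta> > 0"
   using s s\<theta> by linarith
  have eps: "0 \<le> \<epsilon>" "\<epsilon> \<le> 1"
   using \<theta> s\<theta> by (auto simp: \<epsilon>_def)
  have L: "L \<ge> 1" "real (card {a..b}) = L"
   using ab by (auto simp: L_def of_nat_diff)
  let ?Y = "hit_total u a b" and ?N = "visit_count s u a b"
  let ?P = "\<lambda>E. \<Sum>l=a..b. \<Sum>l'=a..b. pair_sum l l' E"
  let ?g = "\<lambda>E. indicator G E :: ennreal"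
  let ?YN = "\<integral>\<^sup>+w. ?g (env w) * ennreal (?Y (env w)) * ennreal (?N w) \<partial>M"
  have P0: "?P E \<ge> 0" for E
   by (intro sum_nonneg pair_sum_nonneg)
  have Y2: "(\<bbbE>E. (?Y E)\<^sup>2) \<le> ennreal (K * L\<^sup>2)"
  proof -
   have "(\<bbbE>E. (?Y E)\<^sup>2) \<le> (\<bbbE>\<^sup>+E. (\<Sum>l=a..b. \<Sum>l'=a..b. ennreal (W l E * W l' E)))"
   proof (intro nn_integral_mono)
    fix E
    have "(?Y E)\<^sup>2 \<le> (\<Sum>l=a..b. W l E)\<^sup>2"
     by (intro power_mono tot_le hit_total_nonneg)
    also have "\<dots> = (\<Sum>l=a..b. \<Sum>l'=a..b. W l E * W l' E)"
     by (simp add: power2_eq_square sum_product)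
    finally show "ennreal ((?Y E)\<^sup>2) \<le> (\<Sum>l=a..b. \<Sum>l'=a..b. ennreal (W l E * W l' E))"
     by (simp add: W_nonneg sum_nonneg ennreal_leI)
   qed
   also have "\<dots> = (\<Sum>l=a..b. \<Sum>l'=a..b. \<integral>\<^sup>+E. ennreal (W l E * W l' E) \<partial>B.GW)"
    by (simp add: nn_integral_sum)
   also have "\<dots> \<le> (\<Sum>l=a..b. \<Sum>l'=a..b. ennreal K)"
    by (intro sum_mono K)
   also have "\<dots> = ennreal (\<Sum>l=a..b. \<Sum>l'=a..b. K)"
    using K(1) by (simp add: sum_nonneg del: sum_constant)
   also have "(\<Sum>l=a..b. \<Sum>l'=a..b. K) = K * L\<^sup>2"
    using L by (simp add: power2_eq_square del: card_atLeastAtMost)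
   finally show ?thesis .
  qed
  have PP: "(\<bbbE>E. ?P E) \<le> ennreal (K * (real b + 1) * L\<^sup>2)"
  proof -
   have "(\<bbbE>E. ?P E) = (\<bbbE>\<^sup>+E. (\<Sum>l=a..b. \<Sum>l'=a..b. ennreal (pair_sum l l' E)))"
    by (simp add: pair_sum_nonneg sum_nonneg)
   also have "\<dots> = (\<Sum>l=a..b. \<Sum>l'=a..b. \<integral>\<^sup>+E. ennreal (pair_sum l l' E) \<partial>B.GW)"
    by (simp add: nn_integral_sum)
   also have "\<dots> \<le> (\<Sum>l=a..b. \<Sum>l'=a..b. ennreal (K * (real b + 1)))"
    using K(1) by (intro sum_mono order_trans[OF K(3)] ennreal_leI mult_left_mono) auto
   also have "\<dots> = ennreal (\<Sum>l=a..b. \<Sum>l'=a..b. K * (real b + 1))"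
    using K(1) by (simp add: sum_nonneg del: sum_constant)
   also have "(\<Sum>l=a..b. \<Sum>l'=a..b. K * (real b + 1)) = K * (real b + 1) * L\<^sup>2"
    using L by (simp add: power2_eq_square del: card_atLeastAtMost)
   finally show ?thesis .
  qed
  define y where "y = (\<bbbE>\<^sup>+E. ?g E * ennreal ((?Y E)\<^sup>2))"
  define p where "p = (\<bbbE>\<^sup>+E. ?g E * ennreal (?P E))"
  define d where "d = (\<bbbA>\<^sup>+w. ?g (env w) * ennreal ((?N w - real s * ?Y (env w))\<^sup>2))"
  have y_le: "y \<le> ennreal (K * L\<^sup>2)" and p_le: "p \<le> ennreal (K * (real b + 1) * L\<^sup>2)"
   unfolding y_def p_def
   by (rule order_trans[OF nn_integral_mono Y2], simp add: indicator_def,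
     rule order_trans[OF nn_integral_mono PP], simp add: indicator_def)
  have first: "ennreal (real s * (1 - \<epsilon>)) * y \<le> ?YN"
  proof -
   have "ennreal (real s * (1 - \<epsilon>)) * y = (\<bbbE>\<^sup>+E. (?g E * ennreal (?Y E)) * ennreal (real s * (1 - \<epsilon>) * ?Y E))"
    unfolding y_def using eps hit_total_nonneg[of u a b]
    by (subst nn_integral_cmult[symmetric]) (auto intro!: nn_integral_cong simp: power2_eq_square ennreal_mult mult_ac)
   also have "\<dots> \<le> (\<bbbA>\<^sup>+w. (?g (env w) * ennreal (?Y (env w))) * ennreal (?N w))"
   proof (rule visit_count_first_moment[OF _ s a eps])
    fix E x assume "?g E * ennreal (?Y E) \<noteq> 0" "x \<in> tree E" "a \<le> length x"
    then have "\<theta> \<le> resistance E x"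
     by (intro far) (auto simp: indicator_def split: if_splits)
    then show "real s / resistance E x \<le> \<epsilon>"
     unfolding \<epsilon>_def using \<theta> by (intro divide_left_mono) auto
   next
    have "(\<bbbE>\<^sup>+E. ?g E * ennreal (?Y E)) \<le> (\<bbbE>E. ?Y E)"
     by (intro nn_integral_mono) (simp add: indicator_def)
    also have "\<dots> \<le> ennreal (real b - real a + 1)"
     by (rule mean[OF ab])
    finally show "(\<bbbE>\<^sup>+E. ?g E * ennreal (?Y E)) < \<infinity>"
     by (simp add: le_less_trans[OF _ ennreal_less_top])
   qed measurable
   finally show ?thesis .
  qed
  have env_y: "(\<bbbA>\<^sup>+w. ?g (env w) * ennreal ((?Y (env w))\<^sup>2)) = y"
   unfolding y_def by (rule nn_integral_env[where F = "\<lambda>E. ?g E * ennreal ((?Y E)\<^sup>2)"]) measurable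
  have second: "(\<bbbA>\<^sup>+w. ?g (env w) * ennreal ((?N w)\<^sup>2)) \<le> ennreal ((real s)\<^sup>2) * y + ennreal (2 * real s) * p"
  proof -
   have "(\<bbbA>\<^sup>+w. ?g (env w) * ennreal ((?N w)\<^sup>2)) \<le>
     (\<bbbE>\<^sup>+E. ?g E * ennreal ((real s)\<^sup>2 * (?Y E)\<^sup>2 + 2 * real s * ?P E))"
    by (rule visit_count_second_moment[OF _ s a]) measurable
   also have "\<dots> = (\<bbbE>\<^sup>+E. ennreal ((real s)\<^sup>2) * (?g E * ennreal ((?Y E)\<^sup>2)) + ennreal (2 * real s) * (?g E * ennreal (?P E)))"
    using P0 by (intro nn_integral_cong) (simp add: ennreal_plus ennreal_mult distrib_left mult_ac)
   also have "\<dots> = ennreal ((real s)\<^sup>2) * y + ennreal (2 * real s) * p"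
    unfolding y_def p_def by (simp add: nn_integral_add nn_integral_cmult)
   finally show ?thesis .
  qed
  \<comment> \<open>the square is expanded with the mixed term moved to the other side, so that all terms are nonnegative\<close>
  have "d + ennreal (2 * real s) * ?YN =
    (\<bbbA>\<^sup>+w. ?g (env w) * ennreal ((?N w - real s * ?Y (env w))\<^sup>2) +
     ennreal (2 * real s) * (?g (env w) * ennreal (?Y (env w)) * ennreal (?N w)))"
   unfolding d_def by (simp add: nn_integral_add nn_integral_cmult)
  also have "\<dots> = (\<bbbA>\<^sup>+w. ?g (env w) * ennreal ((?N w)\<^sup>2) + ennreal ((real s)\<^sup>2) * (?g (env w) * ennreal ((?Y (env w))\<^sup>2)))"
  proof (intro nn_integral_cong)
   fix w
   let ?n = "?N w" and ?x = "?Y (env w)"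
   have nx: "?n \<ge> 0" "?x \<ge> 0"
    by (rule visit_count_nonneg, rule hit_total_nonneg)
   have "ennreal ((?n - real s * ?x)\<^sup>2) + ennreal (2 * real s) * (ennreal ?x * ennreal ?n) =
     ennreal ((?n - real s * ?x)\<^sup>2 + 2 * real s * (?x * ?n))"
    using nx by (simp add: ennreal_plus ennreal_mult)
   also have "(?n - real s * ?x)\<^sup>2 + 2 * real s * (?x * ?n) = ?n\<^sup>2 + (real s)\<^sup>2 * ?x\<^sup>2"
    by (simp add: power2_eq_square algebra_simps)
   also have "ennreal \<dots> = ennreal (?n\<^sup>2) + ennreal ((real s)\<^sup>2) * ennreal (?x\<^sup>2)"
    by (simp add: ennreal_plus ennreal_mult)
   finally show "?g (env w) * ennreal ((?n - real s * ?x)\<^sup>2) + ennreal (2 * real s) * (?g (env w) * ennreal ?x * ennreal ?n) =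
     ?g (env w) * ennreal (?n\<^sup>2) + ennreal ((real s)\<^sup>2) * (?g (env w) * ennreal (?x\<^sup>2))"
    by (simp add: indicator_def)
  qed
  also have "\<dots> = (\<bbbA>\<^sup>+w. ?g (env w) * ennreal ((?N w)\<^sup>2)) + ennreal ((real s)\<^sup>2) * y"
   by (simp add: nn_integral_add nn_integral_cmult env_y)
  also have "\<dots> \<le> (ennreal ((real s)\<^sup>2) * y + ennreal (2 * real s) * p) + ennreal ((real s)\<^sup>2) * y"
   by (intro add_right_mono second)
  finally have 1: "d + ennreal (2 * real s) * ?YN \<le>
    (ennreal ((real s)\<^sup>2) * y + ennreal (2 * real s) * p) + ennreal ((real s)\<^sup>2) * y" .
  have y_fin: "y < top" and p_fin: "p < top"
   using y_le p_le by (auto intro: le_less_trans[OF _ ennreal_less_top])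
  then obtain y' p' where y': "y = ennreal y'" "y' \<ge> 0" and p': "p = ennreal p'" "p' \<ge> 0"
   by (cases y; cases p) auto
  have 2: "d + ennreal (2 * real s) * (ennreal (real s * (1 - \<epsilon>)) * y) \<le>
    (ennreal ((real s)\<^sup>2) * y + ennreal (2 * real s) * p) + ennreal ((real s)\<^sup>2) * y"
   by (rule order_trans[OF add_left_mono[OF mult_left_mono[OF first]] 1]) simp
  have "d + ennreal (2 * real s * (real s * (1 - \<epsilon>) * y')) \<le> ennreal (((real s)\<^sup>2 * y' + 2 * real s * p') + (real s)\<^sup>2 * y')"
  proof -
   have "ennreal (2 * real s) * (ennreal (real s * (1 - \<epsilon>)) * y) = ennreal (2 * real s * (real s * (1 - \<epsilon>) * y'))"
    unfolding y'(1) using eps y'(2) by (simp only: ennreal_mult[symmetric] mult_nonneg_nonneg of_nat_0_le_iff zero_le_numeral diff_ge_0_iff_ge)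
   moreover have "(ennreal ((real s)\<^sup>2) * y + ennreal (2 * real s) * p) + ennreal ((real s)\<^sup>2) * y =
     ennreal (((real s)\<^sup>2 * y' + 2 * real s * p') + (real s)\<^sup>2 * y')"
    unfolding y'(1) p'(1) using y'(2) p'(2)
    by (simp only: ennreal_mult[symmetric] ennreal_plus[symmetric] mult_nonneg_nonneg add_nonneg_nonneg of_nat_0_le_iff zero_le_numeral zero_le_power2)
   ultimately show ?thesis
    using 2 by simp
  qed
  also have "((real s)\<^sup>2 * y' + 2 * real s * p') + (real s)\<^sup>2 * y' =
    (2 * \<epsilon> * (real s)\<^sup>2 * y' + 2 * real s * p') + 2 * real s * (real s * (1 - \<epsilon>) * y')"
   by (simp add: power2_eq_square algebra_simps)
  also have "ennreal \<dots> = ennreal (2 * \<epsilon> * (real s)\<^sup>2 * y' + 2 * real s * p') + ennreal (2 * real s * (real s * (1 - \<epsilon>) * y'))"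
   using eps y' p' by (intro ennreal_plus) auto
  finally have "d \<le> ennreal (2 * \<epsilon> * (real s)\<^sup>2 * y' + 2 * real s * p')"
   by (simp add: add.commute[of _ "ennreal (2 * real s * (real s * (1 - \<epsilon>) * y'))"] ennreal_add_left_cancel_le)
  also have "\<dots> \<le> ennreal (2 * K * L\<^sup>2 * ((real s)\<^sup>2 * \<epsilon> + real s * (real b + 1)))"
  proof (rule ennreal_leI)
   have "y' \<le> K * L\<^sup>2" "p' \<le> K * (real b + 1) * L\<^sup>2"
    using y_le p_le y' p' K(1) by (auto simp: ennreal_le_iff)
   then have "2 * \<epsilon> * (real s)\<^sup>2 * y' + 2 * real s * p' \<le> 2 * \<epsilon> * (real s)\<^sup>2 * (K * L\<^sup>2) + 2 * real s * (K * (real b + 1) * L\<^sup>2)"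
    using eps by (intro add_mono mult_left_mono) auto
   also have "\<dots> = 2 * K * L\<^sup>2 * ((real s)\<^sup>2 * \<epsilon> + real s * (real b + 1))"
    by (simp add: algebra_simps)
   finally show "2 * \<epsilon> * (real s)\<^sup>2 * y' + 2 * real s * p' \<le> 2 * K * L\<^sup>2 * ((real s)\<^sup>2 * \<epsilon> + real s * (real b + 1))" .
  qed
  finally show ?thesis
   unfolding d_def L_def \<epsilon>_def .
 qed
 show thesis
  by (rule that[of "2 * K"]) (use K(1) main mean in auto)
qed

end


section \<open>Sums over tuples\<close>

definition weight :: "('a \<Rightarrow> real) \<Rightarrow> 'a list \<Rightarrow> real" where
 "weight h xs = prod_list (map h xs)"

lemma weight_simps [simp]: "weight h [] = 1" "weight h (x # xs) = h x * weight h xs"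
 by (simp_all add: weight_def)

lemma weight_nonneg: "(\<And>x. x \<in> set xs \<Longrightarrow> h x \<ge> 0) \<Longrightarrow> weight h xs \<ge> 0"
 by (induction xs) auto

lemma weight_cong: "(\<And>x. x \<in> set xs \<Longrightarrow> h x = h' x) \<Longrightarrow> weight h xs = weight h' xs"
 by (induction xs) auto

lemma weight_const_1 [simp]: "weight (\<lambda>_. 1) xs = 1"
 by (induction xs) auto

lemma weight_divide: "weight (\<lambda>x. h x / a) xs = weight h xs / a ^ length xs"
 by (induction xs) auto

lemma weight_cmult: "weight (\<lambda>x. a * h x) xs = a ^ length xs * weight h xs"
 by (induction xs) (auto simp: mult_ac)

lemma tendsto_weight:
 "(\<And>x. x \<in> set xs \<Longrightarrow> ((\<lambda>n. h n x) \<longlongrightarrow> g x) F) \<Longrightarrow> ((\<lambda>n. weight (h n) xs) \<longlongrightarrow> weight g xs) F"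
 by (induction xs) (auto intro!: tendsto_mult)

lemma exp_sum_nth: "exp (- (\<Sum>i<length xs. f (xs ! i))) = weight (\<lambda>x. exp (- f x)) xs"
 by (induction xs) (simp_all add: sum.lessThan_Suc_shift exp_uminus_add del: sum.lessThan_Suc minus_add_distrib)

lemma listset_iff: "xs \<in> listset As \<longleftrightarrow> list_all2 (\<lambda>x A. x \<in> A) xs As"
 by (induction As arbitrary: xs) (auto simp: set_Cons_def list_all2_Cons2)

lemma listset_Cons_image: "listset (A # As) = (\<lambda>(x, xs). x # xs) ` (A \<times> listset As)"
 by (auto simp: set_Cons_def)

lemma sum_weight_listset:
 "(\<Sum>xs\<in>listset (map A us). weight h xs) = weight (\<lambda>u. \<Sum>x\<in>A u. h x) us"
proof (induction us)
 case (Cons u us)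
 have "(\<Sum>xs\<in>listset (map A (u # us)). weight h xs) = (\<Sum>(x, xs)\<in>A u \<times> listset (map A us). weight h (x # xs))"
  unfolding list.map listset_Cons_image by (subst sum.reindex) (auto simp: inj_on_def case_prod_beta)
 also have "\<dots> = (\<Sum>x\<in>A u. \<Sum>xs\<in>listset (map A us). h x * weight h xs)"
  by (simp add: sum.cartesian_product)
 also have "\<dots> = weight (\<lambda>u. \<Sum>x\<in>A u. h x) (u # us)"
  by (simp add: Cons.IH[symmetric] sum_product)
 finally show ?case .
qed simp

lemma finite_incomparable_tuples: "finite D \<Longrightarrow> finite (incomparable_tuples k D)"
 by (rule finite_subset[OF _ finite_lists_length_eq[of D k]]) (auto simp: incomparable_tuples_def)

lemma sum_weight_le_power:
 assumes D: "finite D" and h: "\<And>x. x \<in> D \<Longrightarrow> h x \<ge> 0"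
  and T: "T \<subseteq> {xs. length xs = k \<and> set xs \<subseteq> D}"
 shows "(\<Sum>xs\<in>T. weight h xs) \<le> (\<Sum>x\<in>D. h x) ^ k"
proof -
 have eq: "{xs. length xs = k \<and> set xs \<subseteq> D} = listset (map (\<lambda>_. D) (replicate k ()))"
  by (auto simp: listset_iff list_all2_conv_all_nth set_conv_nth subset_iff) blast
 have fin: "finite {xs. length xs = k \<and> set xs \<subseteq> D}"
  using finite_lists_length_eq[OF D, of k] by (simp add: conj_commute)
 have "(\<Sum>xs\<in>T. weight h xs) \<le> (\<Sum>xs\<in>{xs. length xs = k \<and> set xs \<subseteq> D}. weight h xs)"
  by (intro sum_mono2[OF fin T] weight_nonneg h) auto
 also have "\<dots> = weight (\<lambda>_. \<Sum>x\<in>D. h x) (replicate k ())"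
  unfolding eq by (rule sum_weight_listset)
 also have "\<dots> = (\<Sum>x\<in>D. h x) ^ k"
  by (induction k) auto
 finally show ?thesis .
qed

lemma split_generation_exists:
 "\<exists>m\<ge>1. \<forall>i<length xs. \<forall>j<length xs. i \<noteq> j \<longrightarrow> length (longest_common_prefix (xs ! i) (xs ! j)) < m"
proof (intro exI[of _ "Suc (\<Sum>x\<leftarrow>xs. length x)"] conjI allI impI)
 fix i j assume "i < length xs" "j < length xs"
 have "length (longest_common_prefix (xs ! i) (xs ! j)) \<le> length (xs ! i)"
  by (rule prefix_length_le[OF longest_common_prefix_prefix1])
 also have "\<dots> \<le> (\<Sum>x\<leftarrow>xs. length x)"
  using \<open>i < length xs\<close> by (intro member_le_sum_list) auto
 finally show "length (longest_common_prefix (xs ! i) (xs ! j)) < Suc (\<Sum>x\<leftarrow>xs. length x)"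
  by simp
qed simp

lemma split_generation_ge_1: "split_generation xs \<ge> 1"
 unfolding split_generation_def using LeastI_ex[OF split_generation_exists[of xs]] by blast

lemma split_generation_le_iff:
 assumes "m \<ge> 1"
 shows "split_generation xs \<le> m \<longleftrightarrow>
  (\<forall>i<length xs. \<forall>j<length xs. i \<noteq> j \<longrightarrow> length (longest_common_prefix (xs ! i) (xs ! j)) < m)"
proof
 assume "split_generation xs \<le> m"
 moreover have "\<forall>i<length xs. \<forall>j<length xs. i \<noteq> j \<longrightarrow>
   length (longest_common_prefix (xs ! i) (xs ! j)) < split_generation xs"
  unfolding split_generation_def using LeastI_ex[OF split_generation_exists[of xs]] by blast
 ultimately show "\<forall>i<length xs. \<forall>j<length xs. i \<noteq> j \<longrightarrow> length (longest_common_prefix (xs ! i) (xs ! j)) < m"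
  by (meson less_le_trans)
next
 assume "\<forall>i<length xs. \<forall>j<length xs. i \<noteq> j \<longrightarrow> length (longest_common_prefix (xs ! i) (xs ! j)) < m"
 then show "split_generation xs \<le> m"
  unfolding split_generation_def using assms by (intro Least_le) auto
qed

lemma split_indicator_0: "split_indicator 0 xs = 0"
 using split_generation_ge_1[of xs] by (simp add: split_indicator_def)

lemma lcp_length_less_iff:
 assumes "m \<le> length x" "m \<le> length y"
 shows "length (longest_common_prefix x y) < m \<longleftrightarrow> take m x \<noteq> take m y"
proof -
 have "m \<le> length (longest_common_prefix x y) \<longleftrightarrow> take m x = take m y"
 proof
  assume m: "m \<le> length (longest_common_prefix x y)"
  obtain x' y' where "x = longest_common_prefix x y @ x'" "y = longest_common_prefix x y @ y'"
   using longest_common_prefix_prefix1[of x y] longest_common_prefix_prefix2[of x y] unfolding prefix_def by blast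
  then have "take m x = take m (longest_common_prefix x y)" "take m y = take m (longest_common_prefix x y)"
   using m by (metis append_take_drop_id min.absorb1 take_append take_take append_Nil2 diff_is_0_eq take_0)+
  then show "take m x = take m y"
   by simp
 next
  assume eq: "take m x = take m y"
  have "prefix (take m x) x" "prefix (take m x) y"
   using take_is_prefix[of m x] take_is_prefix[of m y] eq by simp_all
  then have "prefix (take m x) (longest_common_prefix x y)"
   by (rule longest_common_prefix_max_prefix)
  then have "length (take m x) \<le> length (longest_common_prefix x y)"
   by (rule prefix_length_le)
  then show "m \<le> length (longest_common_prefix x y)"
   using assms by simp
 qed
 then show ?thesis
  by linarith
qed

lemma incomparable_tuples_generation:
 "incomparable_tuples k (generation E m) = {us. length us = k \<and> distinct us \<and> set us \<subseteq> generation E m}"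
proof -
 have "prefix (us ! i) (us ! j) \<longleftrightarrow> us ! i = us ! j"
  if "set us \<subseteq> generation E m" "i < length us" "j < length us" for us i j
 proof -
  have "length (us ! i) = length (us ! j)"
   using subsetD[OF that(1) nth_mem[OF that(2)]] subsetD[OF that(1) nth_mem[OF that(3)]]
   by (simp add: generation_def)
  then show ?thesis
   by (auto simp: prefix_def)
 qed
 then show ?thesis
  by (auto simp: incomparable_tuples_def distinct_conv_nth)
qed

text \<open>
 A tuple of vertices below generation \<open>m\<close> has split by generation \<open>m\<close> iff its ancestors in that
 generation are distinct. Choosing the ancestors first, the remaining choices are independent,
 and the sum over such tuples becomes a polynomial in the sums below single vertices.
\<close>

lemma tuple_sum_split:
 assumes D: "finite D" "D \<subseteq> tree E" and long: "\<And>x. x \<in> D \<Longrightarrow> m \<le> length x" and m: "m \<ge> 1"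
 shows "tuple_sum k D (\<lambda>xs. split_indicator m xs * weight h xs) =
  tuple_sum k (generation E m) (weight (\<lambda>u. \<Sum>x\<in>{x \<in> D. prefix u x}. h x))"
proof -
 let ?S = "{xs. length xs = k \<and> set xs \<subseteq> D \<and> distinct (map (take m) xs)}"
 let ?U = "incomparable_tuples k (generation E m)"
 have fin: "finite {xs. length xs = k \<and> set xs \<subseteq> D}"
  by (rule finite_subset[OF _ finite_lists_length_eq[OF D(1), of k]]) auto
 have S: "?S = {xs \<in> incomparable_tuples k D. split_generation xs \<le> m}"
 proof -
  have "distinct (map (take m) xs) \<longleftrightarrow> split_generation xs \<le> m \<and>
    (\<forall>i<k. \<forall>j<k. i \<noteq> j \<longrightarrow> \<not> prefix (xs ! i) (xs ! j))"
   if xs: "length xs = k" "set xs \<subseteq> D" for xs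
  proof -
   have lcp: "length (longest_common_prefix (xs ! i) (xs ! j)) < m \<longleftrightarrow> take m (xs ! i) \<noteq> take m (xs ! j)"
    if "i < k" "j < k" for i j
    using that xs by (intro lcp_length_less_iff long) (auto simp: subset_iff)
   have "\<not> prefix (xs ! i) (xs ! j)" if ij: "i < k" "j < k" "take m (xs ! i) \<noteq> take m (xs ! j)" for i j
   proof
    assume "prefix (xs ! i) (xs ! j)"
    then obtain z where "xs ! j = xs ! i @ z"
     by (auto simp: prefix_def)
    moreover have "m \<le> length (xs ! i)"
     using ij xs by (intro long) (auto simp: subset_iff)
    ultimately show False
     using ij by simp
   qed
   then show ?thesis
    unfolding split_generation_le_iff[OF m] distinct_conv_nth using xs lcp by auto
  qed
  then show ?thesis
   by (auto simp: incomparable_tuples_def)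
 qed
 have "tuple_sum k D (\<lambda>xs. split_indicator m xs * weight h xs) =
   (\<Sum>xs\<in>incomparable_tuples k D. if split_generation xs \<le> m then weight h xs else 0)"
  unfolding tuple_sum_def split_indicator_def by (intro sum.cong) auto
 also have "\<dots> = (\<Sum>xs\<in>?S. weight h xs)"
  unfolding S by (rule sum.inter_filter[symmetric, OF finite_incomparable_tuples[OF D(1)]])
 also have "\<dots> = (\<Sum>us\<in>?U. \<Sum>xs\<in>{xs \<in> ?S. map (take m) xs = us}. weight h xs)"
 proof (rule sum.group[symmetric])
  show "finite ?S"
   by (rule finite_subset[OF _ fin]) auto
  show "finite ?U"
   by (rule finite_incomparable_tuples) simp
  have "take m x \<in> generation E m" if "x \<in> D" for x
   using long[OF that] D(2) that tree_append[of "take m x" "drop m x" E] by (auto simp: generation_def)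
  then show "map (take m) ` ?S \<subseteq> ?U"
   unfolding incomparable_tuples_generation by (auto simp: subset_iff)
 qed
 also have "\<dots> = (\<Sum>us\<in>?U. \<Sum>xs\<in>listset (map (\<lambda>u. {x \<in> D. prefix u x}) us). weight h xs)"
 proof (intro sum.cong refl)
  fix us assume "us \<in> ?U"
  then have us: "length us = k" "distinct us" "set us \<subseteq> generation E m"
   unfolding incomparable_tuples_generation by auto
  have pre: "prefix u x \<longleftrightarrow> take m x = u" if "u \<in> set us" "x \<in> D" for u x
  proof -
   have "length u = m"
    using us that by (auto simp: generation_def)
   show ?thesis
   proof
    assume "prefix u x"
    then show "take m x = u"
     using \<open>length u = m\<close> by (auto elim: prefixE)
   qed (use take_is_prefix[of m x] in simp)
  qed
  show "{xs \<in> ?S. map (take m) xs = us} = listset (map (\<lambda>u. {x \<in> D. prefix u x}) us)"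
  proof (intro set_eqI iffI)
   fix xs assume xs: "xs \<in> {xs \<in> ?S. map (take m) xs = us}"
   have "xs ! i \<in> D \<and> prefix (us ! i) (xs ! i)" if "i < k" for i
   proof -
    have i: "i < length xs" "i < length us"
     using xs that us(1) by simp_all
    have "xs ! i \<in> D"
     using xs nth_mem[OF i(1)] by blast
    moreover have "take m (xs ! i) = us ! i"
     using xs nth_map[OF i(1), of "take m"] by simp
    ultimately show ?thesis
     using pre[OF nth_mem[OF i(2)]] by simp
   qed
   then show "xs \<in> listset (map (\<lambda>u. {x \<in> D. prefix u x}) us)"
    using xs us(1) by (auto simp: listset_iff list_all2_conv_all_nth)
  next
   fix xs assume "xs \<in> listset (map (\<lambda>u. {x \<in> D. prefix u x}) us)"
   then have xs: "length xs = k" "\<And>i. i < k \<Longrightarrow> xs ! i \<in> D \<and> prefix (us ! i) (xs ! i)"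
    using us(1) by (auto simp: listset_iff list_all2_conv_all_nth)
   have "map (take m) xs = us"
   proof (rule nth_equalityI)
    fix i assume "i < length (map (take m) xs)"
    then show "map (take m) xs ! i = us ! i"
     using pre[of "us ! i" "xs ! i"] xs us(1) by simp
   qed (use xs us(1) in simp)
   then show "xs \<in> {xs \<in> ?S. map (take m) xs = us}"
    using xs us by (auto simp: in_set_conv_nth)
  qed
 qed
 also have "\<dots> = tuple_sum k (generation E m) (weight (\<lambda>u. \<Sum>x\<in>{x \<in> D. prefix u x}. h x))"
  unfolding tuple_sum_def sum_weight_listset ..
 finally show ?thesis .
qed

lemma distinct_lists_Suc:
 "{us. length us = Suc k \<and> distinct us \<and> set us \<subseteq> U} =
   (\<Union>us\<in>{us. length us = k \<and> distinct us \<and> set us \<subseteq> U}. (\<lambda>u. u # us) ` (U - set us))"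
proof (intro set_eqI iffI)
 fix vs assume "vs \<in> {us. length us = Suc k \<and> distinct us \<and> set us \<subseteq> U}"
 then obtain u us where "vs = u # us" "length us = k" "distinct us" "set us \<subseteq> U" "u \<in> U - set us"
  by (auto simp: length_Suc_conv)
 then show "vs \<in> (\<Union>us\<in>{us. length us = k \<and> distinct us \<and> set us \<subseteq> U}. (\<lambda>u. u # us) ` (U - set us))"
  by blast
qed auto

text \<open>
 Appending an entry different from all \<open>k\<close> previous ones loses at most \<open>k * \<beta>\<close> of the total mass.
\<close>

lemma distinct_sum_bounds:
 fixes b :: "'a \<Rightarrow> real"
 assumes U: "finite U" and b: "\<And>u. u \<in> U \<Longrightarrow> 0 \<le> b u \<and> b u \<le> \<beta>" and beta: "\<beta> \<ge> 0"
 defines "e \<equiv> \<lambda>k. \<Sum>us\<in>{us. length us = k \<and> distinct us \<and> set us \<subseteq> U}. weight b us"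
 shows "e k * ((\<Sum>u\<in>U. b u) - real k * \<beta>) \<le> e (Suc k)" "0 \<le> e k" "e k \<le> (\<Sum>u\<in>U. b u) ^ k"
proof -
 let ?T = "{us. length us = k \<and> distinct us \<and> set us \<subseteq> U}"
 have fin: "finite ?T"
  by (rule finite_subset[OF _ finite_lists_length_eq[OF U, of k]]) auto
 have wn: "weight b us \<ge> 0" if "us \<in> ?T" for us
  using that b by (auto intro!: weight_nonneg simp: subset_iff)
 show "0 \<le> e k"
  unfolding e_def by (intro sum_nonneg wn)
 show "e k \<le> (\<Sum>u\<in>U. b u) ^ k"
  unfolding e_def using b by (intro sum_weight_le_power U) auto
 have "e k * ((\<Sum>u\<in>U. b u) - real k * \<beta>) = (\<Sum>us\<in>?T. weight b us * ((\<Sum>u\<in>U. b u) - real k * \<beta>))"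
  by (simp add: e_def sum_distrib_right)
 also have "\<dots> \<le> (\<Sum>us\<in>?T. weight b us * (\<Sum>u\<in>U - set us. b u))"
 proof (intro sum_mono mult_left_mono wn)
  fix us assume us: "us \<in> ?T"
  have "(\<Sum>u\<in>set us. b u) \<le> (\<Sum>u\<in>set us. \<beta>)"
   using us b by (intro sum_mono) auto
  also have "\<dots> = real k * \<beta>"
   using us by (auto simp: distinct_card)
  finally show "(\<Sum>u\<in>U. b u) - real k * \<beta> \<le> (\<Sum>u\<in>U - set us. b u)"
   using us U by (simp add: sum_diff)
 qed
 also have "\<dots> = (\<Sum>us\<in>?T. \<Sum>vs\<in>(\<lambda>u. u # us) ` (U - set us). weight b vs)"
  by (intro sum.cong refl, subst sum.reindex) (auto simp: inj_on_def sum_distrib_left mult.commute)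
 also have "\<dots> = e (Suc k)"
  unfolding e_def distinct_lists_Suc using fin U by (subst sum.UNION_disjoint) auto
 finally show "e k * ((\<Sum>u\<in>U. b u) - real k * \<beta>) \<le> e (Suc k)" .
qed

text \<open>
 If a fixed mass is split into ever smaller pieces, tuples with a repeated entry become
 negligible.
\<close>

lemma distinct_sum_limit:
 fixes b :: "nat \<Rightarrow> 'a \<Rightarrow> real"
 assumes U: "\<And>m. finite (U m)" and b: "\<And>m u. u \<in> U m \<Longrightarrow> 0 \<le> b m u"
  and total: "\<And>m. (\<Sum>u\<in>U m. b m u) = w"
  and small: "(\<lambda>m. \<Sum>u\<in>U m. (b m u)\<^sup>2) \<longlonglongrightarrow> 0"
 shows "(\<lambda>m. \<Sum>us\<in>{us. length us = k \<and> distinct us \<and> set us \<subseteq> U m}. weight (b m) us) \<longlonglongrightarrow> w ^ k"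
proof -
 define \<beta> where "\<beta> m = sqrt (\<Sum>u\<in>U m. (b m u)\<^sup>2)" for m
 let ?e = "\<lambda>k m. \<Sum>us\<in>{us. length us = k \<and> distinct us \<and> set us \<subseteq> U m}. weight (b m) us"
 have beta: "\<beta> m \<ge> 0" "u \<in> U m \<Longrightarrow> 0 \<le> b m u \<and> b m u \<le> \<beta> m" for m u
 proof -
  show "\<beta> m \<ge> 0"
   by (simp add: \<beta>_def sum_nonneg)
  assume u: "u \<in> U m"
  have "(b m u)\<^sup>2 \<le> (\<Sum>u\<in>U m. (b m u)\<^sup>2)"
   using u U by (intro member_le_sum) auto
  then have "b m u \<le> \<beta> m"
   unfolding \<beta>_def by (rule real_le_rsqrt)
  then show "0 \<le> b m u \<and> b m u \<le> \<beta> m"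
   using b[OF u] by simp
 qed
 have lim: "\<beta> \<longlonglongrightarrow> 0"
  unfolding \<beta>_def using tendsto_real_sqrt[OF small] by simp
 have bounds: "?e k m * (w - real k * \<beta> m) \<le> ?e (Suc k) m" "?e k m \<le> w ^ k" for k m
  using distinct_sum_bounds(1,3)[where U = "U m" and b = "b m" and \<beta> = "\<beta> m" and k = k, OF U beta(2) beta(1)]
  by (simp_all only: total)
 show ?thesis
 proof (induction k)
  case 0
  have "{us. length us = 0 \<and> distinct us \<and> set us \<subseteq> U m} = {[]}" for m
   by auto
  then show ?case
   by simp
 next
  case (Suc k)
  show ?case
  proof (rule tendsto_sandwich)
   show "eventually (\<lambda>m. ?e k m * (w - real k * \<beta> m) \<le> ?e (Suc k) m) sequentially"
    by (intro always_eventually allI bounds(1))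
   show "eventually (\<lambda>m. ?e (Suc k) m \<le> w ^ Suc k) sequentially"
    by (intro always_eventually allI bounds(2))
   have "(\<lambda>m. ?e k m * (w - real k * \<beta> m)) \<longlonglongrightarrow> w ^ k * (w - real k * 0)"
    by (intro tendsto_intros Suc lim)
   then show "(\<lambda>m. ?e k m * (w - real k * \<beta> m)) \<longlonglongrightarrow> w ^ Suc k"
    by (simp add: mult.commute)
  qed simp
 qed
qed


section \<open>Limits of tuple sums\<close>

text \<open>
 An explicit version of the limit of the weighted sums over tuples which have split by generation \<open>m\<close>:
 the entries of the tuple below \<open>u\<close> contribute \<open>mass_below u\<close> in the limit.
\<close>

definition tuple_limit :: "nat \<Rightarrow> nat \<Rightarrow> environment \<Rightarrow> real" where
 "tuple_limit k m E = tuple_sum k (generation E m) (weight (\<lambda>u. mass_below u E))"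

lemma weight_measurable:
 "(\<And>x. (\<lambda>E. h x E) \<in> borel_measurable N) \<Longrightarrow> (\<lambda>E. weight (\<lambda>x. h x E) xs) \<in> borel_measurable N"
 by (induction xs) auto

lemma tuple_limit_measurable [measurable]: "tuple_limit k m \<in> borel_measurable env_space"
 unfolding tuple_limit_def[abs_def] tuple_sum_def
 by (rule measurable_compose_finite_set[where f = "\<lambda>S E. \<Sum>us\<in>incomparable_tuples k S. weight (\<lambda>u. mass_below u E) us" and A = "\<lambda>E. generation E m"])
   (auto intro!: borel_measurable_sum weight_measurable)

lemma weighted_tuple_sum_measurable [measurable]: "weighted_tuple_sum k l f \<in> borel_measurable env_space"
 unfolding weighted_tuple_sum_def[abs_def] tuple_sum_def
 by (rule measurable_compose_finite_set[where A = "\<lambda>E. generation E l" and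
    f = "\<lambda>S E. \<Sum>xs\<in>incomparable_tuples k S. f xs * exp (- (\<Sum>i<k. potential E (xs ! i)))"])
   (auto intro!: borel_measurable_sum)

lemma weighted_tuple_sum_eq:
 "weighted_tuple_sum k l f E = tuple_sum k (generation E l) (\<lambda>xs. f xs * weight (\<lambda>x. exp (- potential E x)) xs)"
 unfolding weighted_tuple_sum_def tuple_sum_def
 by (intro sum.cong refl) (auto simp: incomparable_tuples_def exp_sum_nth[symmetric])

lemma weighted_tuple_sum_bounds:
 "0 \<le> weighted_tuple_sum k l (split_indicator m) E" "weighted_tuple_sum k l (split_indicator m) E \<le> W l E ^ k"
proof -
 let ?w = "weight (\<lambda>x. exp (- potential E x))"
 have w: "?w xs \<ge> 0" for xs
  by (rule weight_nonneg) simp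
 show "0 \<le> weighted_tuple_sum k l (split_indicator m) E"
  unfolding weighted_tuple_sum_eq tuple_sum_def using w by (intro sum_nonneg) (auto simp: split_indicator_def)
 have "weighted_tuple_sum k l (split_indicator m) E \<le> (\<Sum>xs\<in>incomparable_tuples k (generation E l). ?w xs)"
  unfolding weighted_tuple_sum_eq tuple_sum_def using w by (intro sum_mono) (auto simp: split_indicator_def)
 also have "\<dots> \<le> (\<Sum>x\<in>generation E l. exp (- potential E x)) ^ k"
  by (rule sum_weight_le_power) (auto simp: incomparable_tuples_def)
 finally show "weighted_tuple_sum k l (split_indicator m) E \<le> W l E ^ k"
  by (simp add: gen_sum_def)
qed

text \<open>
 The two almost sure properties of the environment from which the statements on tuple sums follow
 deterministically. The second one says that no single vertex carries the mass.
\<close>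

definition regular_env :: "environment \<Rightarrow> bool" where
 "regular_env E \<longleftrightarrow> (\<forall>u\<in>tree E. (\<lambda>n. W n (subtree E u)) \<longlonglongrightarrow> W_inf (subtree E u)) \<and>
   (\<lambda>m. \<Sum>u\<in>generation E m. (mass_below u E)\<^sup>2) \<longlonglongrightarrow> 0"

lemma regular_env_nonneg: "regular_env E \<Longrightarrow> mass_below u E \<ge> 0"
 unfolding regular_env_def mass_below_def
 using LIMSEQ_le_const[where a = 0 and X = "\<lambda>n. W n (subtree E u)"] W_nonneg by auto

lemma regular_env_W: "regular_env E \<Longrightarrow> (\<lambda>n. W n E) \<longlonglongrightarrow> W_inf E"
 unfolding regular_env_def by (metis subtree_Nil tree_Nil)

context L2_branching_law
begin

lemma regular_env_total: "regular_env E \<Longrightarrow> (\<Sum>u\<in>generation E m. mass_below u E) = W_inf E"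
 using W_inf_gen_sum[of E m]
 by (auto simp: regular_env_def gen_sum_def mass_below_def generation_def intro!: sum.cong)

text \<open>
 The sum of the squared masses in generation \<open>m\<close> has mean of order \<open>\<rho> ^ m\<close> and is thus summable in
 \<open>m\<close>.
\<close>

lemma AE_regular_env: "AE E in GW. regular_env E"
proof -
 define q where "q m E = (\<Sum>u\<in>generation E m. (exp (- potential E u) * W_inf (subtree E u))\<^sup>2)" for m E
 have qm [measurable]: "q m \<in> borel_measurable env_space" for m
  unfolding q_def[abs_def] by measurable
 have q0: "q m E \<ge> 0" for m E
  by (simp add: q_def sum_nonneg)
 have q_Suc: "q (Suc m) E = (\<Sum>i<length (E []). exp (- (E [] ! i)) * (exp (- (E [] ! i)) * q m (subtree E [i])))" for m E
  unfolding q_def sum_generation_Suc sum_distrib_left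
  by (intro sum.cong refl) (simp add: potential_Cons exp_uminus_add power2_eq_square mult_ac del: minus_add_distrib)
 obtain r K where r: "\<rho> = ennreal r" "0 \<le> r" "r < 1" and K: "K \<ge> 0"
  and d: "\<And>l. (\<bbbE>E. (W_inf E - W l E)\<^sup>2) \<le> ennreal (K * r ^ l)"
  by (rule W_inf_L2) (rule that)
 have q_int: "(\<bbbE>E. q m E) \<le> ennreal ((2 * K + 2) * r ^ m)" for m
 proof (induction m)
  case 0
  have "(\<bbbE>E. q 0 E) \<le> (\<bbbE>\<^sup>+E. ennreal 2 * ennreal ((W_inf E - W 0 E)\<^sup>2) + ennreal 2)"
  proof (rule nn_integral_mono)
   fix E
   have "q 0 E \<le> 2 * (W_inf E - W 0 E)\<^sup>2 + 2"
    using zero_le_power2[of "W_inf E - 2"] by (simp add: q_def power2_eq_square algebra_simps)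
   then have "ennreal (q 0 E) \<le> ennreal (2 * (W_inf E - W 0 E)\<^sup>2 + 2)"
    by (rule ennreal_leI)
   also have "\<dots> = ennreal 2 * ennreal ((W_inf E - W 0 E)\<^sup>2) + ennreal 2"
    by (subst ennreal_plus) (simp_all add: ennreal_mult)
   finally show "ennreal (q 0 E) \<le> ennreal 2 * ennreal ((W_inf E - W 0 E)\<^sup>2) + ennreal 2" .
  qed
  also have "\<dots> = ennreal 2 * (\<bbbE>E. (W_inf E - W 0 E)\<^sup>2) + ennreal 2"
   by (subst nn_integral_add) (simp_all add: nn_integral_cmult GW.emeasure_space_1[simplified])
  also have "\<dots> \<le> ennreal 2 * ennreal (K * r ^ 0) + ennreal 2"
   by (intro add_right_mono mult_left_mono d) simp
  also have "\<dots> = ennreal ((2 * K + 2) * r ^ 0)"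
   using K by (subst ennreal_mult[symmetric], simp, simp, subst ennreal_plus[symmetric]) (simp_all del: ennreal_plus)
  finally show ?case .
 next
  case (Suc m)
  have "(\<bbbE>E. q (Suc m) E) =
    (\<bbbE>\<^sup>+E. (\<Sum>i<length (E []). ennreal (exp (- (E [] ! i))) * ennreal (exp (- (E [] ! i)) * q m (subtree E [i]))))"
   unfolding q_Suc using q0
   by (intro nn_integral_cong, subst sum_ennreal[symmetric]) (auto simp: ennreal_mult'[symmetric])
  also have "\<dots> = (\<integral>\<^sup>+a. \<integral>\<^sup>+E. ennreal (exp (- a) * q m E) \<partial>GW \<partial>\<nu>)"
   by (rule nn_integral_children) measurable
  also have "\<dots> = \<rho> * (\<bbbE>E. q m E)"
   unfolding \<rho>_def by (simp add: ennreal_mult' nn_integral_cmult nn_integral_multc)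
  also have "\<dots> \<le> ennreal r * ennreal ((2 * K + 2) * r ^ m)"
   unfolding r(1) by (intro mult_left_mono Suc) simp
  also have "\<dots> = ennreal ((2 * K + 2) * r ^ Suc m)"
   using r K by (subst ennreal_mult[symmetric]) (simp_all add: mult_ac)
  finally show ?case .
 qed
 have "(\<bbbE>\<^sup>+E. (\<Sum>m. ennreal (q m E))) = (\<Sum>m. \<integral>\<^sup>+E. ennreal (q m E) \<partial>GW)"
  by (rule nn_integral_suminf) measurable
 also have "\<dots> \<le> (\<Sum>m. ennreal ((2 * K + 2) * r ^ m))"
  by (intro suminf_le q_int) auto
 also have "\<dots> = ennreal (\<Sum>m. (2 * K + 2) * r ^ m)"
  using r K by (intro suminf_ennreal2 summable_mult) auto
 finally have "(\<bbbE>\<^sup>+E. (\<Sum>m. ennreal (q m E))) \<noteq> \<infinity>"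
  by (auto simp: top_unique)
 then have "AE E in GW. (\<Sum>m. ennreal (q m E)) \<noteq> \<infinity>"
  by (intro nn_integral_PInf_AE) auto
 then show ?thesis
  using AE_W_tendsto
 proof eventually_elim
  case (elim E)
  have "summable (\<lambda>m. q m E)"
   using elim(1) by (intro summable_suminf_not_top) (auto simp: q0)
  then have "(\<lambda>m. q m E) \<longlonglongrightarrow> 0"
   by (rule summable_LIMSEQ_zero)
  moreover have "q m E = (\<Sum>u\<in>generation E m. (mass_below u E)\<^sup>2)" for m
   unfolding q_def by (intro sum.cong) (auto simp: mass_below_def generation_def)
  ultimately show ?case
   using elim(2) by (simp add: regular_env_def)
 qed
qed

lemma tuple_limit_bounds:
 assumes "regular_env E"
 shows "0 \<le> tuple_limit k m E" "tuple_limit k m E \<le> W_inf E ^ k"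
proof -
 show "0 \<le> tuple_limit k m E"
  unfolding tuple_limit_def tuple_sum_def using regular_env_nonneg[OF assms] by (intro sum_nonneg weight_nonneg)
 have "tuple_limit k m E \<le> (\<Sum>u\<in>generation E m. mass_below u E) ^ k"
  unfolding tuple_limit_def tuple_sum_def using regular_env_nonneg[OF assms]
  by (intro sum_weight_le_power) (auto simp: incomparable_tuples_def)
 then show "tuple_limit k m E \<le> W_inf E ^ k"
  by (simp add: regular_env_total[OF assms])
qed

lemma tuple_limit_tendsto:
 assumes "regular_env E"
 shows "(\<lambda>m. tuple_limit k m E) \<longlonglongrightarrow> W_inf E ^ k"
 unfolding tuple_limit_def tuple_sum_def incomparable_tuples_generation
 by (rule distinct_sum_limit)
   (use assms regular_env_nonneg[OF assms] regular_env_total[OF assms] in \<open>auto simp: regular_env_def\<close>)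

lemma weighted_tuple_sum_tendsto:
 assumes E: "regular_env E" and m: "m \<ge> 1"
 shows "(\<lambda>l. weighted_tuple_sum k l (split_indicator m) E) \<longlonglongrightarrow> tuple_limit k m E"
proof -
 have "weighted_tuple_sum k (n + m) (split_indicator m) E =
   tuple_sum k (generation E m) (weight (\<lambda>u. exp (- potential E u) * W n (subtree E u)))" for n
 proof -
  have "weighted_tuple_sum k (n + m) (split_indicator m) E =
    tuple_sum k (generation E m) (weight (\<lambda>u. \<Sum>x\<in>{x \<in> generation E (n + m). prefix u x}. exp (- potential E x)))"
   unfolding weighted_tuple_sum_eq using finite_generation[of E "n + m"]
   by (intro tuple_sum_split m) (auto simp: generation_def)
  also have "\<dots> = tuple_sum k (generation E m) (weight (\<lambda>u. exp (- potential E u) * W n (subtree E u)))"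
   unfolding tuple_sum_def
  proof (intro sum.cong refl weight_cong)
   fix us u assume "us \<in> incomparable_tuples k (generation E m)" "u \<in> set us"
   then have u: "u \<in> tree E" "length u = m"
    by (auto simp: incomparable_tuples_def generation_def)
   have "(\<Sum>x\<in>{x \<in> generation E (n + m). prefix u x}. exp (- potential E x)) =
     (\<Sum>x\<in>generation E (length u + n). if prefix u x then exp (- potential E x) else 0)"
    using u(2) by (simp add: sum.inter_filter add.commute)
   also have "\<dots> = exp (- potential E u) * W n (subtree E u)"
    unfolding sum_generation_below using u(1)
    by (simp add: gen_sum_def sum_distrib_left potential_append exp_uminus_add del: minus_add_distrib)
   finally show "(\<Sum>x\<in>{x \<in> generation E (n + m). prefix u x}. exp (- potential E x)) = exp (- potential E u) * W n (subtree E u)" .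
  qed
  finally show ?thesis .
 qed
 moreover have "(\<lambda>n. tuple_sum k (generation E m) (weight (\<lambda>u. exp (- potential E u) * W n (subtree E u)))) \<longlonglongrightarrow>
   tuple_sum k (generation E m) (weight (\<lambda>u. mass_below u E))"
  unfolding tuple_sum_def
 proof (intro tendsto_sum tendsto_weight)
  fix us u assume "us \<in> incomparable_tuples k (generation E m)" "u \<in> set us"
  then have u: "u \<in> tree E"
   by (auto simp: incomparable_tuples_def generation_def)
  then show "(\<lambda>n. exp (- potential E u) * W n (subtree E u)) \<longlonglongrightarrow> mass_below u E"
   using E by (auto simp: mass_below_def regular_env_def intro!: tendsto_mult)
 qed
 ultimately have "(\<lambda>n. weighted_tuple_sum k (n + m) (split_indicator m) E) \<longlonglongrightarrow> tuple_limit k m E"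
  by (simp add: tuple_limit_def)
 then show ?thesis
  by (rule LIMSEQ_offset)
qed

text \<open>
 Convergence of the numbers of visited descendants of each single vertex determines the limits of
 all tuple sums. Tuples which have not split by generation \<open>m\<close> are controlled from above by the
 number of all tuples, which has the right order.
\<close>

lemma tuple_counts_tendsto:
 assumes E: "regular_env E" and D: "\<And>n. finite (D n)" "\<And>n. D n \<subseteq> tree E"
  and long: "\<And>n x. x \<in> D n \<Longrightarrow> a n \<le> length x" and a: "filterlim a at_top sequentially"
  and c: "c \<ge> 0" and norm: "\<And>n. d n \<ge> 0"
  and counts: "\<And>u. (\<lambda>n. real (card {x \<in> D n. prefix u x}) / d n) \<longlonglongrightarrow> c * mass_below u E"
 shows "m \<ge> 1 \<Longrightarrow> (\<lambda>n. tuple_sum k (D n) (split_indicator m) / d n ^ k) \<longlonglongrightarrow> c ^ k * tuple_limit k m E"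
  and "(\<lambda>n. tuple_sum k (D n) (\<lambda>_. 1) / d n ^ k) \<longlonglongrightarrow> c ^ k * W_inf E ^ k"
proof -
 have split: "(\<lambda>n. tuple_sum k (D n) (split_indicator m) / d n ^ k) \<longlonglongrightarrow> c ^ k * tuple_limit k m E" if m: "m \<ge> 1" for m
 proof -
  have "eventually (\<lambda>n. a n \<ge> m) sequentially"
   using a by (simp add: filterlim_at_top)
  then have "eventually (\<lambda>n. tuple_sum k (generation E m) (weight (\<lambda>u. real (card {x \<in> D n. prefix u x}) / d n)) =
    tuple_sum k (D n) (split_indicator m) / d n ^ k) sequentially"
  proof eventually_elim
   case (elim n)
   have "tuple_sum k (D n) (split_indicator m) = tuple_sum k (D n) (\<lambda>xs. split_indicator m xs * weight (\<lambda>_. 1) xs)"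
    by simp
   also have "\<dots> = tuple_sum k (generation E m) (weight (\<lambda>u. \<Sum>x\<in>{x \<in> D n. prefix u x}. 1))"
    using long elim by (intro tuple_sum_split D m) (auto intro: order_trans)
   finally show ?case
    by (simp add: tuple_sum_def weight_divide sum_divide_distrib incomparable_tuples_def)
  qed
  moreover have "(\<lambda>n. tuple_sum k (generation E m) (weight (\<lambda>u. real (card {x \<in> D n. prefix u x}) / d n))) \<longlonglongrightarrow>
    tuple_sum k (generation E m) (weight (\<lambda>u. c * mass_below u E))"
   unfolding tuple_sum_def by (intro tendsto_sum tendsto_weight counts)
  moreover have "tuple_sum k (generation E m) (weight (\<lambda>u. c * mass_below u E)) = c ^ k * tuple_limit k m E"
   by (simp add: tuple_sum_def tuple_limit_def weight_cmult sum_distrib_left incomparable_tuples_def)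
  ultimately show ?thesis
   using Lim_transform_eventually by fastforce
 qed
 then show "m \<ge> 1 \<Longrightarrow> (\<lambda>n. tuple_sum k (D n) (split_indicator m) / d n ^ k) \<longlonglongrightarrow> c ^ k * tuple_limit k m E" .
 let ?t = "\<lambda>n. tuple_sum k (D n) (\<lambda>_. 1) / d n ^ k"
 have mass_root: "mass_below [] E = W_inf E"
  by (simp add: mass_below_def)
 have lower: "tuple_sum k (D n) (split_indicator m) / d n ^ k \<le> ?t n" for m n
  unfolding tuple_sum_def using norm[of n] by (intro divide_right_mono sum_mono) (auto simp: split_indicator_def)
 have upper: "?t n \<le> (real (card {x \<in> D n. prefix [] x}) / d n) ^ k" for n
 proof -
  have "tuple_sum k (D n) (\<lambda>_. 1) \<le> (\<Sum>x\<in>D n. 1) ^ k"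
   using sum_weight_le_power[where D = "D n" and h = "\<lambda>_. 1" and T = "incomparable_tuples k (D n)" and k = k] D(1)[of n]
   by (auto simp: tuple_sum_def incomparable_tuples_def)
  then show ?thesis
   using norm[of n] by (simp add: power_divide divide_right_mono)
 qed
 show "?t \<longlonglongrightarrow> c ^ k * W_inf E ^ k"
 proof (rule order_tendstoI)
  fix y assume "y < c ^ k * W_inf E ^ k"
  moreover have "(\<lambda>m. c ^ k * tuple_limit k m E) \<longlonglongrightarrow> c ^ k * W_inf E ^ k"
   by (intro tendsto_intros tuple_limit_tendsto E)
  ultimately have "eventually (\<lambda>m. y < c ^ k * tuple_limit k m E \<and> m \<ge> 1) sequentially"
   by (intro eventually_conj order_tendstoD(1) eventually_ge_at_top)
  then obtain m where m: "y < c ^ k * tuple_limit k m E" "m \<ge> 1"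
   by (auto simp: eventually_sequentially)
  have "eventually (\<lambda>n. y < tuple_sum k (D n) (split_indicator m) / d n ^ k) sequentially"
   by (rule order_tendstoD(1)[OF split[OF m(2)] m(1)])
  then show "eventually (\<lambda>n. y < ?t n) sequentially"
   by eventually_elim (use lower in \<open>auto intro: less_le_trans\<close>)
 next
  fix y assume y: "c ^ k * W_inf E ^ k < y"
  have "(\<lambda>n. (real (card {x \<in> D n. prefix [] x}) / d n) ^ k) \<longlonglongrightarrow> (c * mass_below [] E) ^ k"
   by (intro tendsto_intros counts)
  then have "eventually (\<lambda>n. (real (card {x \<in> D n. prefix [] x}) / d n) ^ k < y) sequentially"
   using y by (intro order_tendstoD(2)) (auto simp: mass_root power_mult_distrib)
  then show "eventually (\<lambda>n. ?t n < y) sequentially"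
   by eventually_elim (use upper in \<open>auto intro: le_less_trans\<close>)
 qed
qed

end


section \<open>Modes of convergence\<close>

text \<open>A bound on moments of order larger than two upgrades almost sure convergence to \<open>L\<^sup>2\<close>.\<close>

lemma (in prob_space) tendsto_L2_of_bounded_moments:
 fixes f :: "nat \<Rightarrow> 'a \<Rightarrow> real"
 assumes q: "q > 2" and f [measurable]: "\<And>n. f n \<in> borel_measurable M" and g [measurable]: "g \<in> borel_measurable M"
  and lim: "AE x in M. (\<lambda>n. f n x) \<longlonglongrightarrow> g x"
  and C: "\<And>n. (\<integral>\<^sup>+x. ennreal (\<bar>f n x\<bar> powr q) \<partial>M) \<le> ennreal C"
 shows "tendsto_L2 M f g"
proof -
 have C0: "C \<ge> 0 \<or> C < 0" by linarith
 have gC: "(\<integral>\<^sup>+x. ennreal (\<bar>g x\<bar> powr q) \<partial>M) \<le> ennreal C"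
 proof -
  have "(\<integral>\<^sup>+x. ennreal (\<bar>g x\<bar> powr q) \<partial>M) = (\<integral>\<^sup>+x. liminf (\<lambda>n. ennreal (\<bar>f n x\<bar> powr q)) \<partial>M)"
  proof (rule nn_integral_cong_AE, use lim in eventually_elim)
   case (elim x)
   have "(\<lambda>n. \<bar>f n x\<bar> powr q) \<longlonglongrightarrow> \<bar>g x\<bar> powr q"
    using q elim by (intro tendsto_powr' tendsto_intros) auto
   then show ?case
    by (intro lim_imp_Liminf[symmetric] tendsto_ennrealI) auto
  qed
  also have "\<dots> \<le> liminf (\<lambda>n. \<integral>\<^sup>+x. ennreal (\<bar>f n x\<bar> powr q) \<partial>M)"
   by (rule nn_integral_liminf) measurable
  also have "\<dots> \<le> ennreal C"
   by (rule Liminf_le) (auto simp: C)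
  finally show ?thesis .
 qed
 have square_le: "x\<^sup>2 \<le> 1 + \<bar>x\<bar> powr q" for x :: real
 proof (cases "\<bar>x\<bar> \<le> 1")
  case True
  then have "x\<^sup>2 \<le> 1"
   by (simp add: abs_square_le_1)
  then show ?thesis
   using powr_ge_zero[of "\<bar>x\<bar>" q] by linarith
 next
  case False
  then have "\<bar>x\<bar> powr 2 \<le> \<bar>x\<bar> powr q"
   using q by (intro powr_mono) auto
  then show ?thesis
   using False by (simp add: powr_numeral)
 qed
 have L2: "in_L2 M h" if [measurable]: "h \<in> borel_measurable M" and h: "(\<integral>\<^sup>+x. ennreal (\<bar>h x\<bar> powr q) \<partial>M) \<le> ennreal C" for h
 proof -
  have "(\<integral>\<^sup>+x. ennreal ((h x)\<^sup>2) \<partial>M) \<le> (\<integral>\<^sup>+x. ennreal 1 + ennreal (\<bar>h x\<bar> powr q) \<partial>M)"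
   using square_le by (intro nn_integral_mono) (simp add: ennreal_plus[symmetric] ennreal_leI del: ennreal_plus ennreal_1)
  also have "\<dots> = 1 + (\<integral>\<^sup>+x. ennreal (\<bar>h x\<bar> powr q) \<partial>M)"
   by (subst nn_integral_add) (simp_all add: emeasure_space_1)
  also have "\<dots> < \<infinity>"
   using h by (auto simp: le_less_trans[OF _ ennreal_less_top])
  finally show ?thesis
   by (auto simp: in_L2_def integrable_iff_bounded)
 qed
 let ?d = "\<lambda>n x. \<bar>f n x - g x\<bar>"
 define B where "B = 2 powr q * (2 * \<bar>C\<bar>)"
 have dB: "(\<integral>\<^sup>+x. ennreal (?d n x powr q) \<partial>M) \<le> ennreal B" for n
 proof -
  have pw: "?d n x powr q \<le> 2 powr q * (\<bar>f n x\<bar> powr q + \<bar>g x\<bar> powr q)" for x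
  proof -
   let ?m = "max \<bar>f n x\<bar> \<bar>g x\<bar>"
   have "?d n x powr q \<le> (2 * ?m) powr q"
    using q by (intro powr_mono2) auto
   also have "\<dots> = 2 powr q * ?m powr q"
    by (rule powr_mult)
   also have "?m powr q \<le> \<bar>f n x\<bar> powr q + \<bar>g x\<bar> powr q"
    by (auto simp: max_def)
   finally show ?thesis
    by simp
  qed
  have "(\<integral>\<^sup>+x. ennreal (?d n x powr q) \<partial>M) \<le> (\<integral>\<^sup>+x. ennreal (2 powr q) * (ennreal (\<bar>f n x\<bar> powr q) + ennreal (\<bar>g x\<bar> powr q)) \<partial>M)"
   using pw by (intro nn_integral_mono) (simp add: ennreal_plus[symmetric] ennreal_mult[symmetric] ennreal_leI del: ennreal_plus)
  also have "\<dots> = ennreal (2 powr q) * ((\<integral>\<^sup>+x. ennreal (\<bar>f n x\<bar> powr q) \<partial>M) + (\<integral>\<^sup>+x. ennreal (\<bar>g x\<bar> powr q) \<partial>M))"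
   by (simp add: nn_integral_cmult nn_integral_add)
  also have "\<dots> \<le> ennreal (2 powr q) * (ennreal \<bar>C\<bar> + ennreal \<bar>C\<bar>)"
   by (intro mult_left_mono add_mono order_trans[OF C] order_trans[OF gC] ennreal_leI) auto
  also have "\<dots> = ennreal B"
   by (simp add: B_def ennreal_mult ennreal_plus[symmetric] del: ennreal_plus)
  finally show ?thesis .
 qed
 have main: "(\<lambda>n. \<integral>\<^sup>+x. ennreal ((f n x - g x)\<^sup>2) \<partial>M) \<longlonglongrightarrow> 0"
 proof (rule tendsto_0_if_Limsup_eq_0_ennreal, rule antisym, rule ennreal_le_epsilon)
  fix e :: real assume e: "e > 0"
  \<comment> \<open>beyond the level \<open>R\<close> the square is at most \<open>R powr (2 - q)\<close> times the moment of order \<open>q\<close>\<close>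
  have "((\<lambda>R. R powr (2 - q) * B) \<longlongrightarrow> 0 * B) at_top"
   using q by (intro tendsto_intros tendsto_neg_powr filterlim_ident) auto
  then have "eventually (\<lambda>R. R powr (2 - q) * B < e / 2 \<and> R > 0) at_top"
   using e by (intro eventually_conj order_tendstoD(2) eventually_gt_at_top) auto
  then obtain R where R: "R powr (2 - q) * B < e / 2" "R > 0"
   by (auto simp: eventually_at_top_linorder)
  have "(\<lambda>n. \<integral>\<^sup>+x. ennreal ((min (?d n x) R)\<^sup>2) \<partial>M) \<longlonglongrightarrow> (\<integral>\<^sup>+x. 0 \<partial>M)"
  proof (rule nn_integral_dominated_convergence[where w = "\<lambda>_. ennreal (R\<^sup>2)"])
   show "AE x in M. (\<lambda>n. ennreal ((min (?d n x) R)\<^sup>2)) \<longlonglongrightarrow> 0"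
    using lim
   proof eventually_elim
    case (elim x)
    have "(\<lambda>n. (min (?d n x) R)\<^sup>2) \<longlonglongrightarrow> (min \<bar>g x - g x\<bar> R)\<^sup>2"
     by (intro tendsto_intros elim)
    then have "(\<lambda>n. (min (?d n x) R)\<^sup>2) \<longlonglongrightarrow> 0"
     using R by simp
    then show ?case
     using tendsto_ennrealI by fastforce
   qed
   show "AE x in M. ennreal ((min (?d n x) R)\<^sup>2) \<le> ennreal (R\<^sup>2)" for n
    using R by (intro AE_I2 ennreal_leI power_mono) auto
  qed (auto simp: emeasure_space_1)
  then have "(\<lambda>n. \<integral>\<^sup>+x. ennreal ((min (?d n x) R)\<^sup>2) \<partial>M) \<longlonglongrightarrow> 0"
   by simp
  then have "eventually (\<lambda>n. (\<integral>\<^sup>+x. ennreal ((min (?d n x) R)\<^sup>2) \<partial>M) < ennreal (e / 2)) sequentially"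
   using e by (intro order_tendstoD(2)) auto
  then have "eventually (\<lambda>n. (\<integral>\<^sup>+x. ennreal ((f n x - g x)\<^sup>2) \<partial>M) \<le> ennreal e) sequentially"
  proof eventually_elim
   case (elim n)
   have pw: "(f n x - g x)\<^sup>2 \<le> (min (?d n x) R)\<^sup>2 + R powr (2 - q) * ?d n x powr q" for x
   proof (cases "?d n x \<le> R")
    case True
    then show ?thesis
     using R by (simp add: min_absorb1)
   next
    case False
    then have d: "?d n x > 0" "R < ?d n x"
     using R by auto
    have "(f n x - g x)\<^sup>2 = ?d n x powr (2 - q) * ?d n x powr q"
     using d by (subst powr_add[symmetric]) (simp add: powr_numeral)
    also have "?d n x powr (2 - q) \<le> R powr (2 - q)"
     using d R q by (intro powr_mono2') auto
    finally show ?thesis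
     by (simp add: mult_right_mono add_increasing)
   qed
   have "(\<integral>\<^sup>+x. ennreal ((f n x - g x)\<^sup>2) \<partial>M) \<le>
     (\<integral>\<^sup>+x. ennreal ((min (?d n x) R)\<^sup>2) + ennreal (R powr (2 - q)) * ennreal (?d n x powr q) \<partial>M)"
    using pw by (intro nn_integral_mono) (simp add: ennreal_plus[symmetric] ennreal_mult[symmetric] ennreal_leI del: ennreal_plus)
   also have "\<dots> = (\<integral>\<^sup>+x. ennreal ((min (?d n x) R)\<^sup>2) \<partial>M) + ennreal (R powr (2 - q)) * (\<integral>\<^sup>+x. ennreal (?d n x powr q) \<partial>M)"
    by (simp add: nn_integral_add nn_integral_cmult)
   also have "\<dots> \<le> ennreal (e / 2) + ennreal (R powr (2 - q)) * ennreal B"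
    using elim by (intro add_mono mult_left_mono dB) auto
   also have "ennreal (R powr (2 - q)) * ennreal B = ennreal (R powr (2 - q) * B)"
    by (rule ennreal_mult[symmetric]) (auto simp: B_def)
   also have "ennreal (e / 2) + ennreal (R powr (2 - q) * B) \<le> ennreal (e / 2) + ennreal (e / 2)"
    using R by (intro add_left_mono ennreal_leI) auto
   also have "\<dots> = ennreal e"
    using e by (simp add: ennreal_plus[symmetric] del: ennreal_plus)
   finally show ?case .
  qed
  then show "Limsup sequentially (\<lambda>n. \<integral>\<^sup>+x. ennreal ((f n x - g x)\<^sup>2) \<partial>M) \<le> 0 + ennreal e"
   by (simp add: Limsup_bounded)
 qed simp
 have "(\<lambda>n. enn2real (\<integral>\<^sup>+x. ennreal ((f n x - g x)\<^sup>2) \<partial>M)) \<longlonglongrightarrow> enn2real 0"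
  using main by (intro tendsto_enn2real) auto
 then have "(\<lambda>n. \<integral>x. (f n x - g x)\<^sup>2 \<partial>M) \<longlonglongrightarrow> 0"
  by (subst integral_eq_nn_integral) auto
 then show ?thesis
  unfolding tendsto_L2_def using L2[OF f C] L2[OF g gC] by blast
qed

text \<open>
 Convergence in probability of countably many sequences is almost sure convergence of all of them
 along suitable subsequences.
\<close>

lemma (in prob_space) common_AE_subsequence:
 fixes Z :: "'i :: countable \<Rightarrow> nat \<Rightarrow> 'a \<Rightarrow> real"
 assumes Z [measurable]: "\<And>i n. Z i n \<in> borel_measurable M" and Y [measurable]: "\<And>i. Y i \<in> borel_measurable M"
  and conv: "\<And>i. (\<lambda>n. \<integral>\<^sup>+x. ennreal (min 1 \<bar>Z i n x - Y i x\<bar>) \<partial>M) \<longlonglongrightarrow> 0"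
  and r: "strict_mono (r :: nat \<Rightarrow> nat)"
 obtains r' :: "nat \<Rightarrow> nat" where "strict_mono r'" "AE x in M. \<forall>i. (\<lambda>n. Z i (r (r' n)) x) \<longlonglongrightarrow> Y i x"
proof -
 let ?e = "\<lambda>i n. \<integral>\<^sup>+x. ennreal (min 1 \<bar>Z i (r n) x - Y i x\<bar>) \<partial>M"
 have ev: "eventually (\<lambda>n. ?e i n \<le> ennreal ((1/2) ^ j)) sequentially" for i j
 proof -
  have "?e i \<longlonglongrightarrow> 0"
   using LIMSEQ_subseq_LIMSEQ[OF conv r, of i] by (simp add: comp_def)
  then have "eventually (\<lambda>n. ?e i n < ennreal ((1/2) ^ j)) sequentially"
   by (rule order_tendstoD(2)) simp
  then show ?thesis
   by eventually_elim simp
 qed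
 let ?good = "\<lambda>n j. \<forall>i\<in>{i. to_nat i \<le> j}. ?e i n \<le> ennreal ((1/2) ^ j)"
 have fin: "finite {i :: 'i. to_nat i \<le> j}" for j
  by (rule finite_imageD[where f = to_nat]) (auto intro: finite_subset[of _ "{..j}"])
 have "\<exists>f. \<forall>j. ?good (f j) j \<and> f j < f (Suc j)"
 proof (rule dependent_nat_choice)
  show "\<exists>x. ?good x 0"
   by (intro eventually_happens'[OF sequentially_bot] eventually_ball_finite[OF fin] ballI ev)
 next
  fix x j
  have "eventually (\<lambda>n. ?good n (Suc j) \<and> n > x) sequentially"
   by (intro eventually_conj eventually_ball_finite[OF fin] ballI ev eventually_gt_at_top)
  then show "\<exists>y. ?good y (Suc j) \<and> x < y"
   by (auto simp: eventually_sequentially)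
 qed
 then obtain f where f: "\<And>j. ?good (f j) j" "\<And>j. f j < f (Suc j)"
  by auto
 have mono: "strict_mono f"
  using f(2) by (simp add: strict_mono_Suc_iff)
 have "AE x in M. (\<lambda>n. Z i (r (f n)) x) \<longlonglongrightarrow> Y i x" for i
 proof -
  let ?k = "to_nat i"
  have "(\<integral>\<^sup>+x. (\<Sum>j. ennreal (min 1 \<bar>Z i (r (f (j + ?k))) x - Y i x\<bar>)) \<partial>M) = (\<Sum>j. ?e i (f (j + ?k)))"
   by (rule nn_integral_suminf) measurable
  also have "\<dots> \<le> (\<Sum>j. ennreal ((1/2) ^ (j + ?k)))"
   using f(1)[of "_ + ?k"] by (intro suminf_le) auto
  also have "\<dots> \<le> (\<Sum>j. ennreal ((1/2) ^ j))"
   by (intro suminf_le ennreal_leI power_decreasing) auto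
  also have "\<dots> = ennreal (\<Sum>j. (1/2) ^ j)"
   by (intro suminf_ennreal2) (auto intro: summable_geometric)
  finally have "(\<integral>\<^sup>+x. (\<Sum>j. ennreal (min 1 \<bar>Z i (r (f (j + ?k))) x - Y i x\<bar>)) \<partial>M) \<noteq> \<infinity>"
   by (auto simp: top_unique)
  then have "AE x in M. (\<Sum>j. ennreal (min 1 \<bar>Z i (r (f (j + ?k))) x - Y i x\<bar>)) \<noteq> \<infinity>"
   by (intro nn_integral_PInf_AE) auto
  then show ?thesis
  proof eventually_elim
   case (elim x)
   have "summable (\<lambda>j. min 1 \<bar>Z i (r (f (j + ?k))) x - Y i x\<bar>)"
    using elim by (intro summable_suminf_not_top) auto
   then have "(\<lambda>j. min 1 \<bar>Z i (r (f (j + ?k))) x - Y i x\<bar>) \<longlonglongrightarrow> 0"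
    by (rule summable_LIMSEQ_zero)
   then have lim: "(\<lambda>j. min 1 \<bar>Z i (r (f j)) x - Y i x\<bar>) \<longlonglongrightarrow> 0"
    by (rule LIMSEQ_offset)
   have "(\<lambda>j. \<bar>Z i (r (f j)) x - Y i x\<bar>) \<longlonglongrightarrow> 0"
   proof (rule Lim_transform_eventually[OF lim])
    show "eventually (\<lambda>j. min 1 \<bar>Z i (r (f j)) x - Y i x\<bar> = \<bar>Z i (r (f j)) x - Y i x\<bar>) sequentially"
     using order_tendstoD(2)[OF lim, of 1] by (auto elim!: eventually_mono simp: min_def)
   qed
   then show ?case
    by (simp add: tendsto_rabs_zero_iff LIM_zero_iff)
  qed
 qed
 then have "AE x in M. \<forall>i. (\<lambda>n. Z i (r (f n)) x) \<longlonglongrightarrow> Y i x"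
  by (simp add: AE_all_countable)
 with mono show thesis
  by (rule that)
qed

lemma LIMSEQ_by_subsequences:
 fixes a :: "nat \<Rightarrow> real"
 assumes "\<And>r :: nat \<Rightarrow> nat. strict_mono r \<Longrightarrow> \<exists>r' :: nat \<Rightarrow> nat. strict_mono r' \<and> (\<lambda>n. a (r (r' n))) \<longlonglongrightarrow> l"
 shows "a \<longlonglongrightarrow> l"
proof (rule ccontr)
 assume "\<not> a \<longlonglongrightarrow> l"
 then obtain e where e: "e > 0" "\<not> eventually (\<lambda>n. dist (a n) l < e) sequentially"
  by (auto simp: tendsto_iff)
 then have inf: "infinite {n. dist (a n) l \<ge> e}"
  by (auto simp: frequently_def[symmetric] not_eventually not_less cofinite_eq_sequentially[symmetric] frequently_cofinite)
 define r where "r = enumerate {n. dist (a n) l \<ge> e}"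
 have r: "strict_mono r" "\<And>n. dist (a (r n)) l \<ge> e"
  using strict_mono_enumerate[OF inf] enumerate_in_set[OF inf] by (auto simp: r_def)
 then obtain r' :: "nat \<Rightarrow> nat" where "(\<lambda>n. a (r (r' n))) \<longlonglongrightarrow> l"
  using assms by blast
 then have "eventually (\<lambda>n. dist (a (r (r' n))) l < e) sequentially"
  using e(1) by (auto simp: tendsto_iff)
 then show False
  using r(2) by (auto simp: eventually_sequentially not_less[symmetric])
qed

lemma (in prob_space) AE_tendsto_imp_tendsto_measure:
 fixes Y :: "nat \<Rightarrow> 'a \<Rightarrow> real"
 assumes [measurable]: "\<And>n. Y n \<in> borel_measurable M" "Z \<in> borel_measurable M"
  and lim: "AE x in M. (\<lambda>n. Y n x) \<longlonglongrightarrow> Z x" and e: "e > 0"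
 shows "(\<lambda>n. measure M {x \<in> space M. \<bar>Y n x - Z x\<bar> > e}) \<longlonglongrightarrow> 0"
proof -
 have "(\<lambda>n. \<integral>x. indicator {x \<in> space M. \<bar>Y n x - Z x\<bar> > e} x \<partial>M) \<longlonglongrightarrow> (\<integral>x. (0::real) \<partial>M)"
 proof (rule integral_dominated_convergence[where w = "\<lambda>_. 1"])
  show "AE x in M. (\<lambda>n. indicator {x \<in> space M. \<bar>Y n x - Z x\<bar> > e} x :: real) \<longlonglongrightarrow> 0"
   using lim
  proof eventually_elim
   case (elim x)
   then have "eventually (\<lambda>n. dist (Y n x) (Z x) < e) sequentially"
    using e by (auto simp: tendsto_iff)
   then show ?case
    by (intro tendsto_eventually) (auto elim!: eventually_mono simp: dist_real_def)
  qed
 qed (auto simp: indicator_def)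
 then show ?thesis
  by simp
qed


section \<open>Visited vertices below a fixed vertex\<close>

lemma ennreal_tendsto_0I:
 fixes f :: "nat \<Rightarrow> ennreal"
 assumes "\<And>e. e > 0 \<Longrightarrow> eventually (\<lambda>n. f n \<le> ennreal e) sequentially"
 shows "f \<longlonglongrightarrow> 0"
proof (rule tendsto_0_if_Limsup_eq_0_ennreal, rule antisym, rule ennreal_le_epsilon)
 fix e :: real assume "e > 0"
 then show "Limsup sequentially f \<le> 0 + ennreal e"
  using assms[of e] by (simp add: Limsup_bounded)
qed simp

lemma abs_le_square_div:
 fixes y r :: real
 assumes "r > 0"
 shows "\<bar>y\<bar> \<le> r + 1 / r * y\<^sup>2"
proof -
 have "0 \<le> (\<bar>y\<bar> - r)\<^sup>2"
  by simp
 then have "2 * (r * \<bar>y\<bar>) \<le> r\<^sup>2 + y\<^sup>2"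
  by (simp add: power2_diff algebra_simps)
 moreover have "0 \<le> r * \<bar>y\<bar>"
  using assms by simp
 ultimately have "r * \<bar>y\<bar> \<le> r\<^sup>2 + y\<^sup>2"
  by linarith
 also have "\<dots> = r * (r + 1 / r * y\<^sup>2)"
  using assms by (simp add: distrib_left power2_eq_square)
 finally have "r * \<bar>y\<bar> \<le> r * (r + 1 / r * y\<^sup>2)" .
 then show ?thesis
  using assms by simp
qed

text \<open>
 The window moves to infinity, so that the average is eventually over small terms only.
\<close>

lemma Cesaro_window:
 fixes e :: "nat \<Rightarrow> ennreal"
 assumes e: "e \<longlonglongrightarrow> 0" and a: "filterlim a at_top sequentially" and ab: "eventually (\<lambda>n. a n \<le> b n) sequentially"
 shows "(\<lambda>n. ennreal (1 / (real (b n) - real (a n) + 1)) * (\<Sum>l=a n..b n. e l)) \<longlonglongrightarrow> 0"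
proof (rule ennreal_tendsto_0I)
 fix r :: real assume r: "r > 0"
 have "eventually (\<lambda>l. e l < ennreal r) sequentially"
  using e r by (intro order_tendstoD(2)) auto
 then obtain N where N: "\<And>l. l \<ge> N \<Longrightarrow> e l \<le> ennreal r"
  by (auto simp: eventually_sequentially intro: less_imp_le)
 have "eventually (\<lambda>n. a n \<ge> N) sequentially"
  using a by (simp add: filterlim_at_top)
 then show "eventually (\<lambda>n. ennreal (1 / (real (b n) - real (a n) + 1)) * (\<Sum>l=a n..b n. e l) \<le> ennreal r) sequentially"
  using ab
 proof eventually_elim
  case (elim n)
  have "(\<Sum>l=a n..b n. e l) \<le> (\<Sum>l=a n..b n. ennreal r)"
   using elim by (intro sum_mono N) auto
  also have "\<dots> = ennreal ((real (b n) - real (a n) + 1) * r)"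
  proof -
   have "real (card {a n..b n}) = real (b n) - real (a n) + 1"
    using elim by (simp add: of_nat_diff)
   then show ?thesis
    using r by (simp only: sum_constant ennreal_of_nat_eq_real_of_nat) (metis ennreal_mult' of_nat_0_le_iff)
  qed
  finally have "ennreal (1 / (real (b n) - real (a n) + 1)) * (\<Sum>l=a n..b n. e l) \<le>
    ennreal (1 / (real (b n) - real (a n) + 1)) * ennreal ((real (b n) - real (a n) + 1) * r)"
   by (intro mult_left_mono) auto
  also have "\<dots> = ennreal r"
   using elim r by (subst ennreal_mult[symmetric]) auto
  finally show ?case .
 qed
qed

lemma lower_bound_at_top:
 fixes lo :: "nat \<Rightarrow> nat"
 assumes \<delta>: "\<delta> > 0" and lo: "\<And>n. n \<ge> 1 \<Longrightarrow> ln (real n) / \<delta> \<le> real (lo n)"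
 shows "filterlim lo at_top sequentially"
proof -
 have "filterlim (\<lambda>n. ln (real n)) at_top sequentially"
  by (rule filterlim_compose[OF ln_at_top filterlim_real_sequentially])
 then have "filterlim (\<lambda>n. 1 / \<delta> * ln (real n)) at_top sequentially"
  using \<delta> by (intro filterlim_tendsto_pos_mult_at_top[OF tendsto_const]) auto
 then have "filterlim (\<lambda>n. real (lo n)) at_top sequentially"
  by (rule filterlim_at_top_mono) (use lo in \<open>auto intro!: eventually_sequentiallyI[of 1]\<close>)
 then show ?thesis
  unfolding filterlim_at_top
  by (intro allI, erule_tac x = "real _" in allE) simp
qed

context branching_walk
begin

text \<open>
 With large probability the potential is at least of order \<open>3 ln n\<close> throughout a generation of order
 \<open>ln n\<close> above the window, so that the resistances of the vertices of the window are at least of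
 order \<open>n ^ 3\<close>, while the walk makes only \<open>sqrt n\<close> excursions. On this event the count of visited
 vertices concentrates around its quenched mean, which is asymptotically the limiting mass by
 \<open>hit_sum_below_L1\<close>.
\<close>

lemma visit_count_tendsto:
 fixes lo hi :: "nat \<Rightarrow> nat"
 assumes \<delta>: "\<delta> > 0" and \<rho>1: "\<rho>1 > 0"
  and high: "\<And>\<zeta>::nat. \<zeta> \<ge> 1 \<Longrightarrow> prob {w \<in> space M. \<forall>z\<in>generation (env w) (nat \<lceil>real \<zeta> / \<delta>\<rceil>). potential (env w) z \<ge> 3 * real \<zeta>} \<ge> 1 - exp (- \<rho>1 * real \<zeta>)"
  and window: "\<And>n. n \<ge> 1 \<Longrightarrow> 1 \<le> lo n \<and> ln (real n) / \<delta> \<le> real (lo n) \<and> lo n \<le> hi n"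
  and small: "(\<lambda>n. real (hi n) / sqrt (real n)) \<longlonglongrightarrow> 0"
 shows "(\<lambda>n. \<integral>\<^sup>+w. ennreal (min 1 \<bar>visit_count (nat \<lfloor>sqrt (real n)\<rfloor>) u (lo n) (hi n) w / (sqrt (real n) * (real (hi n) - real (lo n) + 1)) - c_inf Q S * mass_below u (env w)\<bar>) \<partial>M) \<longlonglongrightarrow> 0"
  (is "(\<lambda>n. ?I n) \<longlonglongrightarrow> 0")
proof (rule ennreal_tendsto_0I)
 fix e :: real assume e: "e > 0"
 obtain K where K: "K \<ge> 0" and conc: "\<And>u a b s \<theta> G. \<lbrakk>s \<ge> 1; a \<ge> 1; a \<le> b; real s \<le> \<theta>; G \<in> sets env_space;
    \<And>E x. E \<in> G \<Longrightarrow> x \<in> tree E \<Longrightarrow> a \<le> length x \<Longrightarrow> \<theta> \<le> resistance E x\<rbrakk> \<Longrightarrow>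
   (\<bbbA>\<^sup>+w. indicator G (env w) * ennreal ((visit_count s u a b w - real s * hit_total u a b (env w))\<^sup>2)) \<le>
    ennreal (K * (real b - real a + 1)\<^sup>2 * ((real s)\<^sup>2 * (real s / \<theta>) + real s * (real b + 1)))"
  and mean: "\<And>u a b. a \<le> b \<Longrightarrow> (\<bbbE>E. hit_total u a b E) \<le> ennreal (real b - real a + 1)"
  by (rule visit_count_concentration, rule that) blast+
 let ?c = "c_inf Q S"
 \<comment> \<open>with \<open>n\<close> of order \<open>exp \<zeta>\<close>, the resistance \<open>\<theta>\<close> of order \<open>n ^ 3\<close> beats the \<open>sqrt n\<close> excursions\<close>
 define \<zeta> where "\<zeta> n = nat \<lfloor>ln (real n)\<rfloor>" for n
 define \<theta> where "\<theta> n = exp (3 * real (\<zeta> n))" for n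
 define L where "L n = real (hi n) - real (lo n) + 1" for n
 define C where "C n = ennreal (1 / L n) * (\<Sum>l=lo n..hi n. \<integral>\<^sup>+E. ennreal \<bar>hit_sum_below u l E - ?c * mass_below u E\<bar> \<partial>B.GW)" for n
 define r where "r n = exp (- \<rho>1 * real (\<zeta> n)) + 3 / e * (K * (sqrt (real n) / \<theta> n + (real (hi n) + 1) / sqrt (real n))) + 1 / sqrt (real n)" for n
 have \<zeta>_ge: "ln (real n) - 1 \<le> real (\<zeta> n)" for n
  unfolding \<zeta>_def by linarith
 have ratio: "(\<lambda>n. sqrt (real n) / \<theta> n) \<longlonglongrightarrow> 0"
 proof (rule tendsto_sandwich[OF _ _ tendsto_const])
  show "eventually (\<lambda>n. sqrt (real n) / \<theta> n \<le> exp 3 / real n) sequentially"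
   using eventually_ge_at_top[of 1]
  proof eventually_elim
   case (elim n)
   have "exp (3 * ln (real n) - 3) \<le> \<theta> n"
    unfolding \<theta>_def using \<zeta>_ge[of n] by simp
   moreover have "exp (3 * ln (real n)) = real n ^ 3"
    using elim by (simp add: exp_of_nat_mult[of 3, simplified])
   ultimately have th: "real n ^ 3 / exp 3 \<le> \<theta> n"
    by (simp add: exp_diff)
   have "sqrt (real n) \<le> real n"
    using elim by (intro real_le_lsqrt) (auto simp: power2_eq_square)
   also have "real n * 1 \<le> real n * real n"
    using elim by (intro mult_left_mono) auto
   finally have "sqrt (real n) * real n \<le> real n ^ 3"
    by (simp add: power3_eq_cube mult_right_mono)
   then have "sqrt (real n) * real n \<le> exp 3 * \<theta> n"
    using th by (simp add: field_simps)
   then show ?case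
    using elim by (simp add: \<theta>_def field_simps)
  qed
  show "(\<lambda>n. exp 3 / real n) \<longlonglongrightarrow> (0::real)"
   by (rule lim_const_over_n)
  show "eventually (\<lambda>n. 0 \<le> sqrt (real n) / \<theta> n) sequentially"
   by (simp add: \<theta>_def)
 qed
 have inv_sqrt: "(\<lambda>n. 1 / sqrt (real n)) \<longlonglongrightarrow> 0"
  by (intro tendsto_divide_0[OF tendsto_const] filterlim_at_top_imp_at_infinity
    filterlim_compose[OF sqrt_at_top filterlim_real_sequentially])
 have lnn: "filterlim (\<lambda>n. ln (real n)) at_top sequentially"
  by (rule filterlim_compose[OF ln_at_top filterlim_real_sequentially])
 have \<zeta>_lim: "filterlim (\<lambda>n. real (\<zeta> n)) at_top sequentially"
 proof (rule filterlim_at_top_mono)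
  show "filterlim (\<lambda>n. - 1 + ln (real n)) at_top sequentially"
   by (rule filterlim_tendsto_add_at_top[OF tendsto_const lnn])
  show "eventually (\<lambda>n. - 1 + ln (real n) \<le> real (\<zeta> n)) sequentially"
   using \<zeta>_ge by (simp add: algebra_simps)
 qed
 have exp_lim: "(\<lambda>n. exp (- \<rho>1 * real (\<zeta> n))) \<longlonglongrightarrow> 0"
  using \<rho>1 by (intro filterlim_compose[OF exp_at_bot] filterlim_tendsto_neg_mult_at_bot[OF tendsto_const _ \<zeta>_lim]) auto
 have r_lim: "r \<longlonglongrightarrow> 0"
 proof -
  have "(\<lambda>n. real (hi n) / sqrt (real n) + 1 / sqrt (real n)) \<longlonglongrightarrow> 0 + 0"
   by (intro tendsto_add small inv_sqrt)
  then have "(\<lambda>n. (real (hi n) + 1) / sqrt (real n)) \<longlonglongrightarrow> 0"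
   by (simp add: add_divide_distrib)
  then have "r \<longlonglongrightarrow> 0 + 3 / e * (K * (0 + 0)) + 0"
   unfolding r_def[abs_def] by (intro tendsto_intros exp_lim ratio inv_sqrt)
  then show ?thesis
   by simp
 qed
 have lo_lim: "filterlim lo at_top sequentially"
  using window by (intro lower_bound_at_top[OF \<delta>]) blast
 have C_lim: "C \<longlonglongrightarrow> 0"
  unfolding C_def[abs_def] L_def
  using window by (intro Cesaro_window B.hit_sum_below_L1 lo_lim eventually_sequentiallyI[of 1]) blast
 have main: "?I n \<le> ennreal (e / 3 + r n) + C n"
  if n: "n \<ge> 1" and \<zeta>: "\<zeta> n \<ge> 1" and s\<theta>: "sqrt (real n) / \<theta> n \<le> 1" for n
 proof -
  define s where "s = nat \<lfloor>sqrt (real n)\<rfloor>"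
  define G where "G = {E \<in> space env_space. \<forall>z. z \<in> tree E \<longrightarrow> length z = nat \<lceil>real (\<zeta> n) / \<delta>\<rceil> \<longrightarrow> potential E z \<ge> 3 * real (\<zeta> n)}"
  have G [measurable]: "G \<in> sets env_space"
   unfolding G_def by measurable
  let ?H = "hit_total u (lo n) (hi n)" and ?Y = "visit_count s u (lo n) (hi n)" and ?N = "sqrt (real n)"
  let ?dev = "\<lambda>w. ?Y w - real s * ?H (env w)" and ?B = "{w \<in> space M. env w \<notin> G}"
  let ?min = "\<lambda>w. min 1 \<bar>?Y w / (?N * L n) - ?c * mass_below u (env w)\<bar>"
  let ?A = "(real s)\<^sup>2 * (real s / \<theta> n) + real s * (real (hi n) + 1)"
  let ?h = "\<lambda>l E. hit_sum_below u l E - ?c * mass_below u E"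
  have N1: "?N \<ge> 1"
   using n by simp
  have s: "s \<ge> 1" "real s \<le> ?N" "?N - 1 \<le> real s"
   using N1 by (auto simp: s_def le_nat_floor)
  have L1: "L n \<ge> 1"
   using window[OF n] by (simp add: L_def)
  have far: "\<theta> n \<le> resistance E x" if E: "E \<in> G" "x \<in> tree E" "lo n \<le> length x" for E x
  proof -
   let ?r = "nat \<lceil>real (\<zeta> n) / \<delta>\<rceil>"
   have "real (\<zeta> n) \<le> ln (real n)"
    using n by (simp add: \<zeta>_def)
   then have "real (\<zeta> n) / \<delta> \<le> real (lo n)"
    using window[OF n] \<delta> by (meson divide_right_mono less_imp_le order_trans)
   then have r_le: "?r \<le> length x"
    using E(3) by linarith
   then have "take ?r x \<in> tree E"
    using E(2) tree_append[of "take ?r x" "drop ?r x" E] by simp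
   then have "3 * real (\<zeta> n) \<le> potential E (take ?r x)"
    using E(1) r_le by (auto simp: G_def)
   then have "\<theta> n \<le> exp (potential E (take ?r x))"
    by (simp add: \<theta>_def)
   also have "\<dots> \<le> resistance E x"
    by (rule resistance_ge_exp[OF r_le])
   finally show ?thesis .
  qed
  have s_le: "real s \<le> \<theta> n"
   using s s\<theta> by (simp add: \<theta>_def)
  have sq: "(\<bbbA>\<^sup>+w. indicator G (env w) * ennreal ((?dev w)\<^sup>2)) \<le>
    ennreal (K * (L n)\<^sup>2 * ?A)"
   unfolding L_def using window[OF n] by (intro conc s G s_le far) auto
  define D where "D E = \<bar>?H E / L n - ?c * mass_below u E\<bar>" for E
  have D [measurable]: "D \<in> borel_measurable env_space"
   unfolding D_def[abs_def] by measurable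
  have D_int: "(\<bbbE>E. D E) \<le> C n"
  proof -
   have "D E \<le> 1 / L n * (\<Sum>l=lo n..hi n. \<bar>?h l E\<bar>)" for E
   proof -
    have "real (card {lo n..hi n}) = L n"
     using window[OF n] by (simp add: L_def of_nat_diff)
    then have "?H E / L n - ?c * mass_below u E = 1 / L n * (\<Sum>l=lo n..hi n. ?h l E)"
     using L1 by (simp only: sum_subtractf sum_constant hit_total_def) (simp add: field_simps)
    then have "D E = 1 / L n * \<bar>\<Sum>l=lo n..hi n. ?h l E\<bar>"
     using L1 by (simp add: D_def abs_mult)
    also have "\<dots> \<le> 1 / L n * (\<Sum>l=lo n..hi n. \<bar>?h l E\<bar>)"
     using L1 by (intro mult_left_mono sum_abs) auto
    finally show ?thesis .
   qed
   then have "(\<bbbE>E. D E) \<le> (\<bbbE>\<^sup>+E. ennreal (1 / L n) * (\<Sum>l=lo n..hi n. ennreal \<bar>?h l E\<bar>))"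
    using L1 by (intro nn_integral_mono) (simp add: ennreal_mult'[symmetric] ennreal_leI)
   also have "\<dots> = C n"
    unfolding C_def by (subst nn_integral_cmult, measurable, subst nn_integral_sum) auto
   finally show ?thesis .
  qed
  have pw: "ennreal (?min w) \<le>
    indicator ?B w + ennreal (e / 3) +
    ennreal (3 / e / (?N * L n)\<^sup>2) * (indicator G (env w) * ennreal ((?dev w)\<^sup>2)) +
    (ennreal (1 / (?N * L n)) * ennreal (?H (env w)) + ennreal (D (env w)))"
   if w: "w \<in> space M" for w
  proof (cases "env w \<in> G")
   case False
   have "ennreal (?min w) \<le> 1"
    by (simp add: ennreal_le_1)
   then show ?thesis
    using False w by (simp add: add.assoc add_increasing2)
  next
   case True
   let ?y = "?dev w / (?N * L n)"
   have H0: "?H (env w) \<ge> 0"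
    by (rule hit_total_nonneg)
   have "\<bar>?y\<bar> \<le> e / 3 + 3 / e * ?y\<^sup>2"
    using abs_le_square_div[of "e / 3" ?y] e by simp
   moreover have "\<bar>real s * ?H (env w) / (?N * L n) - ?H (env w) / L n\<bar> \<le> 1 / (?N * L n) * ?H (env w)"
   proof -
    have "real s * ?H (env w) / (?N * L n) - ?H (env w) / L n = - ((?N - real s) * ?H (env w) / (?N * L n))"
     using N1 L1 by (simp add: field_simps)
    then have "\<bar>real s * ?H (env w) / (?N * L n) - ?H (env w) / L n\<bar> = (?N - real s) * ?H (env w) / (?N * L n)"
     using s N1 L1 H0 by (simp add: abs_mult)
    also have "\<dots> \<le> 1 * ?H (env w) / (?N * L n)"
     using s N1 L1 H0 by (intro divide_right_mono mult_right_mono) auto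
    finally show ?thesis
     by simp
   qed
   moreover have "?Y w / (?N * L n) - ?c * mass_below u (env w) = ?y +
     (real s * ?H (env w) / (?N * L n) - ?H (env w) / L n) + (?H (env w) / L n - ?c * mass_below u (env w))"
    by (simp add: diff_divide_distrib)
   moreover have "min 1 \<bar>x\<bar> \<le> a + (b + \<bar>p\<bar>)" if "\<bar>y\<bar> \<le> a" "\<bar>z\<bar> \<le> b" "x = y + z + p" for x y z p a b :: real
    using that by linarith
   ultimately have "?min w \<le>
     e / 3 + 3 / e * ?y\<^sup>2 + (1 / (?N * L n) * ?H (env w) + D (env w))"
    unfolding D_def by blast
   then have "ennreal (?min w) \<le>
     ennreal (e / 3 + 3 / e * ?y\<^sup>2 + (1 / (?N * L n) * ?H (env w) + D (env w)))"
    by (rule ennreal_leI)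
   also have "\<dots> = ennreal (e / 3) + ennreal (3 / e * ?y\<^sup>2) + (ennreal (1 / (?N * L n) * ?H (env w)) + ennreal (D (env w)))"
    using e H0 N1 L1 by (subst ennreal_plus; simp add: D_def)+
   also have "3 / e * ?y\<^sup>2 = 3 / e / (?N * L n)\<^sup>2 * (?dev w)\<^sup>2"
    by (simp add: power_divide)
   also have "ennreal (\<dots>) = ennreal (3 / e / (?N * L n)\<^sup>2) * ennreal ((?dev w)\<^sup>2)"
    by (rule ennreal_mult) (use e in auto)
   also have "ennreal (1 / (?N * L n) * ?H (env w)) = ennreal (1 / (?N * L n)) * ennreal (?H (env w))"
    by (rule ennreal_mult) (use N1 L1 H0 in auto)
   finally show ?thesis
    using True by simp
  qed
  have bad: "emeasure M ?B \<le> ennreal (exp (- \<rho>1 * real (\<zeta> n)))"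
  proof -
   have "{w \<in> space M. env w \<in> G} = {w \<in> space M. \<forall>z\<in>generation (env w) (nat \<lceil>real (\<zeta> n) / \<delta>\<rceil>). potential (env w) z \<ge> 3 * real (\<zeta> n)}"
    using measurable_space[OF env_measurable] by (auto simp: G_def generation_def)
   then have "prob {w \<in> space M. env w \<in> G} \<ge> 1 - exp (- \<rho>1 * real (\<zeta> n))"
    using high[OF \<zeta>] by simp
   moreover have "prob ?B = 1 - prob {w \<in> space M. env w \<in> G}"
    by (rule prob_neg) measurable
   ultimately show ?thesis
    by (simp add: emeasure_eq_measure ennreal_leI)
  qed
  have "?I n \<le> (\<bbbA>\<^sup>+w. indicator ?B w + ennreal (e / 3) +
    ennreal (3 / e / (?N * L n)\<^sup>2) * (indicator G (env w) * ennreal ((?dev w)\<^sup>2)) +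
    (ennreal (1 / (?N * L n)) * ennreal (?H (env w)) + ennreal (D (env w))))"
   unfolding s_def[symmetric] L_def[symmetric] by (rule nn_integral_mono) (rule pw)
  also have "\<dots> = emeasure M ?B + ennreal (e / 3) +
    ennreal (3 / e / (?N * L n)\<^sup>2) * (\<bbbA>\<^sup>+w. indicator G (env w) * ennreal ((?dev w)\<^sup>2)) +
    (ennreal (1 / (?N * L n)) * (\<bbbE>E. ?H E) + (\<bbbE>E. D E))"
   by (simp add: nn_integral_add nn_integral_cmult emeasure_space_1 nn_integral_env[symmetric])
  also have "\<dots> \<le> ennreal (exp (- \<rho>1 * real (\<zeta> n))) + ennreal (e / 3) +
    ennreal (3 / e / (?N * L n)\<^sup>2) * ennreal (K * (L n)\<^sup>2 * ?A) +
    (ennreal (1 / (?N * L n)) * ennreal (L n) + C n)"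
   using window[OF n] unfolding L_def by (intro add_mono mult_left_mono bad order_refl sq[unfolded L_def] mean D_int) auto
  also have "\<dots> = ennreal (exp (- \<rho>1 * real (\<zeta> n)) + e / 3 +
    3 / e / (?N * L n)\<^sup>2 * (K * (L n)\<^sup>2 * ?A) +
    1 / (?N * L n) * L n) + C n"
  proof -
   have "0 \<le> K * (L n)\<^sup>2 * ?A"
    using K by (simp add: \<theta>_def)
   then show ?thesis
    using e N1 L1 by (simp only: add.assoc[symmetric]) (subst ennreal_mult[symmetric], simp, simp, subst ennreal_mult[symmetric], simp, simp, subst ennreal_plus[symmetric]; simp add: ennreal_plus[symmetric] del: ennreal_plus)
  qed
  also have "\<dots> \<le> ennreal (e / 3 + r n) + C n"
  proof (intro add_right_mono ennreal_leI)
   have scale: "3 / e / (x * l)\<^sup>2 * (K * l\<^sup>2 * A) = 3 / e * (K * (A / x\<^sup>2))" if "l \<noteq> 0" for x l A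
    using that by (cases "x = 0") (simp_all add: power_mult_distrib)
   have "3 / e / (?N * L n)\<^sup>2 * (K * (L n)\<^sup>2 * ?A) =
     3 / e * (K * (?A / ?N\<^sup>2))"
    using L1 by (intro scale) simp
   also have "\<dots> \<le> 3 / e * (K * (?N / \<theta> n + (real (hi n) + 1) / ?N))"
   proof (intro mult_left_mono K)
    have "?A \<le> ?N\<^sup>2 * (?N / \<theta> n) + ?N * (real (hi n) + 1)"
     using s by (intro add_mono mult_mono power_mono divide_right_mono) (auto simp: \<theta>_def)
    also have "\<dots> = ?N\<^sup>2 * (?N / \<theta> n + (real (hi n) + 1) / ?N)"
     using N1 by (simp add: power2_eq_square field_simps del: real_sqrt_mult_self)
    finally show "?A / ?N\<^sup>2 \<le> ?N / \<theta> n + (real (hi n) + 1) / ?N"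
     using N1 by (subst pos_divide_le_eq) (auto simp: mult.commute)
   qed (use e in auto)
   finally show "exp (- \<rho>1 * real (\<zeta> n)) + e / 3 +
     3 / e / (?N * L n)\<^sup>2 * (K * (L n)\<^sup>2 * ?A) +
     1 / (?N * L n) * L n \<le> e / 3 + r n"
    using L1 by (simp add: r_def)
  qed
  finally show ?thesis .
 qed
 have "eventually (\<lambda>n. r n < e / 3) sequentially" "eventually (\<lambda>n. C n < ennreal (e / 3)) sequentially"
  using e by (intro order_tendstoD(2)[OF r_lim] order_tendstoD(2)[OF C_lim]; simp)+
 moreover have "eventually (\<lambda>n. real (\<zeta> n) \<ge> 1) sequentially"
  using \<zeta>_lim unfolding filterlim_at_top by blast
 moreover have "eventually (\<lambda>n. sqrt (real n) / \<theta> n < 1) sequentially"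
  by (rule order_tendstoD(2)[OF ratio]) simp
 ultimately show "eventually (\<lambda>n. ?I n \<le> ennreal e) sequentially"
  using eventually_ge_at_top[of 1]
 proof eventually_elim
  case (elim n)
  have "?I n \<le> ennreal (e / 3 + r n) + C n"
   using elim by (intro main) auto
  also have "\<dots> \<le> ennreal (2 * e / 3) + ennreal (e / 3)"
   using elim by (intro add_mono ennreal_leI) auto
  also have "\<dots> = ennreal e"
   using e by (subst ennreal_plus[symmetric]) auto
  finally show ?case .
 qed
qed

end


section \<open>Uniform tuples of visited vertices\<close>

lemma (in prob_space) tendsto_L2_AE_unique:
 assumes g: "tendsto_L2 M f g" and h: "tendsto_L2 M f h"
 shows "AE x in M. g x = h x"
proof -
 have [measurable]: "f n \<in> borel_measurable M" "g \<in> borel_measurable M" "h \<in> borel_measurable M" for n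
  using g h by (auto simp: tendsto_L2_def in_L2_def)
 have int: "integrable M (\<lambda>x. (f n x - z x)\<^sup>2)" if z: "tendsto_L2 M f z" for n z
 proof (rule Bochner_Integration.integrable_bound)
  show "integrable M (\<lambda>x. 2 * (f n x)\<^sup>2 + 2 * (z x)\<^sup>2)"
   using z by (auto simp: tendsto_L2_def in_L2_def)
  show "(\<lambda>x. (f n x - z x)\<^sup>2) \<in> borel_measurable M"
   using z by (auto simp: tendsto_L2_def in_L2_def)
  have "(a - b)\<^sup>2 \<le> 2 * a\<^sup>2 + 2 * b\<^sup>2" for a b :: real
   using zero_le_power2[of "a + b"] by (simp add: power2_eq_square algebra_simps)
  then show "AE x in M. norm ((f n x - z x)\<^sup>2) \<le> norm (2 * (f n x)\<^sup>2 + 2 * (z x)\<^sup>2)"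
   by (simp add: abs_of_nonneg)
 qed
 have le: "(\<integral>x. (g x - h x)\<^sup>2 \<partial>M) \<le> 2 * (\<integral>x. (f n x - g x)\<^sup>2 \<partial>M) + 2 * (\<integral>x. (f n x - h x)\<^sup>2 \<partial>M)"
  and gh: "integrable M (\<lambda>x. (g x - h x)\<^sup>2)" for n
 proof -
  have pw: "(g x - h x)\<^sup>2 \<le> 2 * (f n x - g x)\<^sup>2 + 2 * (f n x - h x)\<^sup>2" for x
   using zero_le_power2[of "(f n x - g x) + (f n x - h x)"] by (simp add: power2_eq_square algebra_simps)
  have i: "integrable M (\<lambda>x. 2 * (f n x - g x)\<^sup>2 + 2 * (f n x - h x)\<^sup>2)"
   by (intro Bochner_Integration.integrable_add integrable_mult_right int g h)
  then show gh: "integrable M (\<lambda>x. (g x - h x)\<^sup>2)"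
   by (rule Bochner_Integration.integrable_bound) (auto intro: order_trans[OF pw])
  have "(\<integral>x. (g x - h x)\<^sup>2 \<partial>M) \<le> (\<integral>x. 2 * (f n x - g x)\<^sup>2 + 2 * (f n x - h x)\<^sup>2 \<partial>M)"
   by (rule integral_mono[OF gh i pw])
  then show "(\<integral>x. (g x - h x)\<^sup>2 \<partial>M) \<le> 2 * (\<integral>x. (f n x - g x)\<^sup>2 \<partial>M) + 2 * (\<integral>x. (f n x - h x)\<^sup>2 \<partial>M)"
   by (simp add: int g h)
 qed
 have "(\<lambda>n. 2 * (\<integral>x. (f n x - g x)\<^sup>2 \<partial>M) + 2 * (\<integral>x. (f n x - h x)\<^sup>2 \<partial>M)) \<longlonglongrightarrow> 2 * 0 + 2 * 0"
  using g h by (intro tendsto_intros) (auto simp: tendsto_L2_def)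
 then have "(\<integral>x. (g x - h x)\<^sup>2 \<partial>M) \<le> 0"
  using le by (intro LIMSEQ_le_const) auto
 moreover have "(\<integral>x. (g x - h x)\<^sup>2 \<partial>M) \<ge> 0"
  by simp
 ultimately have "AE x in M. (g x - h x)\<^sup>2 = 0"
  using integral_nonneg_eq_0_iff_AE[OF gh] by simp
 then show ?thesis
  by eventually_elim simp
qed

lemma (in prob_space) tendsto_in_prob_by_subsequences:
 assumes Y: "\<And>n. Y n \<in> borel_measurable M" and Z: "Z \<in> borel_measurable M"
  and sub: "\<And>r :: nat \<Rightarrow> nat. strict_mono r \<Longrightarrow> \<exists>r' :: nat \<Rightarrow> nat. strict_mono r' \<and> (AE x in M. (\<lambda>n. Y (r (r' n)) x) \<longlonglongrightarrow> Z x)"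
 shows "tendsto_in_prob M Y Z"
 unfolding tendsto_in_prob_def
proof (intro conjI allI impI Y Z)
 fix e :: real assume e: "e > 0"
 show "(\<lambda>n. measure M {w \<in> space M. \<bar>Y n w - Z w\<bar> > e}) \<longlonglongrightarrow> 0"
 proof (rule LIMSEQ_by_subsequences)
  fix r :: "nat \<Rightarrow> nat" assume "strict_mono r"
  then obtain r' where "strict_mono r'" "AE x in M. (\<lambda>n. Y (r (r' n)) x) \<longlonglongrightarrow> Z x"
   using sub by blast
  then show "\<exists>r'. strict_mono r' \<and> (\<lambda>n. measure M {w \<in> space M. \<bar>Y (r (r' n)) w - Z w\<bar> > e}) \<longlonglongrightarrow> 0"
   using AE_tendsto_imp_tendsto_measure[of "\<lambda>n. Y (r (r' n))" Z e] Y Z e by blast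
 qed
qed

text \<open>
 The limit law is the law on the integers whose cumulative probabilities are the limits \<open>F\<close>;
 it has total mass one because \<open>F\<close> tends to one.
\<close>

lemma weak_conv_of_nat_valued:
 fixes f :: "'b \<Rightarrow> nat" and U :: "nat \<Rightarrow> 'b measure"
 assumes U: "eventually (\<lambda>n. sets (U n) = UNIV) sequentially"
  and F: "mono F" "F 0 \<ge> 0" "F \<longlonglongrightarrow> 1"
  and conv: "\<And>m. (\<lambda>n. measure (U n) {x. f x \<le> m}) \<longlonglongrightarrow> F m"
 shows "\<exists>\<nu>. real_distribution \<nu> \<and> weak_conv_m (\<lambda>n. distr (U n) borel (\<lambda>x. real (f x))) \<nu>"
proof -
 define w where "w m = (if m = 0 then F 0 else F m - F (m - 1))" for m
 have w0: "w m \<ge> 0" for m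
  using F(2) monoD[OF F(1), of "m - 1" m] by (simp add: w_def)
 have sum_w: "(\<Sum>j\<le>m. w j) = F m" for m
  by (induction m) (simp_all add: w_def)
 have "w sums 1"
  unfolding sums_def_le using F(3) by (simp add: sum_w)
 then have "(\<integral>\<^sup>+m. ennreal (w m) \<partial>count_space UNIV) = 1"
  using w0 by (subst nn_integral_count_space_nat) (simp add: suminf_ennreal2 sums_iff)
 then have pmf_w: "pmf (embed_pmf w) m = w m" for m
  using w0 by (intro pmf_embed_pmf)
 let ?p = "embed_pmf w"
 have real_le: "real m \<le> x \<longleftrightarrow> 0 \<le> x \<and> m \<le> nat \<lfloor>x\<rfloor>" for m x
  by (cases "0 \<le> x") (auto simp: le_nat_floor le_nat_iff le_floor_iff)
 have "real_distribution (distr ?p borel real)"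
  by (auto simp: real_distribution_def real_distribution_axioms_def intro!: measure_pmf.prob_space_distr)
 moreover have "weak_conv_m (\<lambda>n. distr (U n) borel (\<lambda>x. real (f x))) (distr ?p borel real)"
  unfolding weak_conv_m_def weak_conv_def
 proof (intro allI impI)
  fix x :: real
  have lim: "cdf (distr ?p borel real) x = (if 0 \<le> x then F (nat \<lfloor>x\<rfloor>) else 0)"
  proof -
   have "cdf (distr ?p borel real) x = measure ?p (if 0 \<le> x then {..nat \<lfloor>x\<rfloor>} else {})"
    by (auto simp: cdf_def measure_distr vimage_def real_le intro!: arg_cong[where f = "measure ?p"])
   then show ?thesis
    by (simp add: measure_measure_pmf_finite pmf_w sum_w)
  qed
  have "eventually (\<lambda>n. (if 0 \<le> x then measure (U n) {y. f y \<le> nat \<lfloor>x\<rfloor>} else 0) = cdf (distr (U n) borel (\<lambda>x. real (f x))) x) sequentially"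
   using U
  proof eventually_elim
   case (elim n)
   have sp: "space (U n) = UNIV"
    using elim sets.top[of "U n"] sets.sets_into_space[of UNIV "U n"] by auto
   have "(\<lambda>x. real (f x)) \<in> borel_measurable (U n)"
    using elim sp by (auto simp: measurable_def)
   then show ?case
    by (auto simp: cdf_def measure_distr vimage_def real_le sp)
  qed
  moreover have "(\<lambda>n. if 0 \<le> x then measure (U n) {y. f y \<le> nat \<lfloor>x\<rfloor>} else 0) \<longlonglongrightarrow> cdf (distr ?p borel real) x"
   using conv by (simp add: lim)
  ultimately show "(\<lambda>n. cdf (distr (U n) borel (\<lambda>x. real (f x))) x) \<longlonglongrightarrow> cdf (distr ?p borel real) x"
   by (rule Lim_transform_eventually[rotated])
 qed
 ultimately show ?thesis
  by blast
qed

text \<open>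
 What remains of the setting once the law of large numbers for the descendants of single vertices
 and the moments of the martingale are known.
\<close>

locale tuples_of_visited_vertices = branching_walk M \<mu> env X \<nu> Q S
 for M :: "'w measure" and \<mu> and env :: "'w \<Rightarrow> environment" and X and \<nu> :: "real measure"
  and Q :: "'s measure" and S :: "nat \<Rightarrow> 's \<Rightarrow> real" +
 fixes k :: nat and p C :: real and lo hi :: "nat \<Rightarrow> nat"
 assumes k: "k \<ge> 1" and p: "p > 2 * real k"
  and W_moments: "\<And>n. (\<bbbE>E. W n E powr p) \<le> ennreal C"
  and lo_at_top: "filterlim lo at_top sequentially"
  and counts: "\<And>u. (\<lambda>n. \<integral>\<^sup>+w. ennreal (min 1 \<bar>visit_count (nat \<lfloor>sqrt (real n)\<rfloor>) u (lo n) (hi n) w /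
    (sqrt (real n) * (real (hi n) - real (lo n) + 1)) - c_inf Q S * mass_below u (env w)\<bar>) \<partial>M) \<longlonglongrightarrow> 0"
  and scale_nonneg: "\<And>n. sqrt (real n) * (real (hi n) - real (lo n) + 1) \<ge> 0"
begin

abbreviation "P \<equiv> survival_cond M env"
abbreviation "D n w \<equiv> visited_between (env w) (\<lambda>j. X j w) lo hi n"
abbreviation "d n \<equiv> sqrt (real n) * (real (hi n) - real (lo n) + 1)"
abbreviation "alive \<equiv> {w \<in> space M. env w \<in> survival}"
abbreviation "A_lim m \<equiv> A_inf M env k (split_indicator m)"

lemma alive_eq: "P = uniform_measure M alive"
 by (simp add: survival_cond_def survival_def)

lemma alive_measurable [measurable]: "alive \<in> sets M"
 by measurable

lemma emeasure_alive: "emeasure M alive > 0"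
proof -
 have "emeasure M alive = emeasure B.GW survival"
  unfolding distr_env[symmetric] by (subst emeasure_distr) (auto intro!: arg_cong[where f = "emeasure M"])
 then show ?thesis
  using B.W_inf_positive(1)[OF supercritical] by simp
qed

lemma sets_P [measurable_cong]: "sets P = sets M" and space_P [simp]: "space P = space M"
 by (simp_all add: alive_eq)

sublocale P: prob_space P
 unfolding alive_eq using emeasure_alive by (intro prob_space_uniform_measure) auto

lemma prob_space_P [simp]: "measure P (space M) = 1"
 using P.prob_space by simp

lemma AE_P: "AE w in M. R w \<Longrightarrow> AE w in P. R w"
 unfolding alive_eq by (rule AE_uniform_measureI) auto

lemma nn_integral_P_le:
 assumes [measurable]: "f \<in> borel_measurable M"
 shows "(\<integral>\<^sup>+w. f w \<partial>P) \<le> ennreal (1 / prob alive) * (\<bbbA>\<^sup>+w. f w)"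
proof -
 have pos: "prob alive > 0"
  using emeasure_alive by (simp add: emeasure_eq_measure)
 have "(\<integral>\<^sup>+w. f w \<partial>P) = (\<bbbA>\<^sup>+w. f w * indicator alive w) / ennreal (prob alive)"
  unfolding alive_eq by (subst nn_integral_uniform_measure) (auto simp: emeasure_eq_measure)
 also have "\<dots> = ennreal (1 / prob alive) * (\<bbbA>\<^sup>+w. f w * indicator alive w)"
  using pos by (simp add: divide_ennreal_def inverse_ennreal mult.commute inverse_eq_divide)
 also have "\<dots> \<le> ennreal (1 / prob alive) * (\<bbbA>\<^sup>+w. f w)"
  by (intro mult_left_mono nn_integral_mono) (auto simp: indicator_def)
 finally show ?thesis .
qed

lemma AE_regular: "AE w in P. regular_env (env w) \<and> W_inf (env w) > 0"
proof -
 have "AE w in M. env w \<in> survival \<longrightarrow> W_inf (env w) > 0"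
  by (rule AE_env) (rule B.W_inf_positive(2)[OF supercritical])
 then have "AE w in P. W_inf (env w) > 0"
  unfolding alive_eq by (intro AE_uniform_measureI alive_measurable) auto
 moreover have "AE w in P. regular_env (env w)"
  by (intro AE_P AE_env B.AE_regular_env)
 ultimately show ?thesis
  by eventually_elim simp
qed

lemma moments_P: "(\<integral>\<^sup>+w. ennreal (W l (env w) powr p) \<partial>P) \<le> ennreal (1 / prob alive * \<bar>C\<bar>)"
proof -
 have "(\<integral>\<^sup>+w. ennreal (W l (env w) powr p) \<partial>P) \<le> ennreal (1 / prob alive) * (\<bbbA>\<^sup>+w. ennreal (W l (env w) powr p))"
  by (rule nn_integral_P_le) measurable
 also have "(\<bbbA>\<^sup>+w. ennreal (W l (env w) powr p)) = (\<bbbE>E. W l E powr p)"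
  by (rule nn_integral_env) measurable
 also have "ennreal (1 / prob alive) * \<dots> \<le> ennreal (1 / prob alive) * ennreal \<bar>C\<bar>"
  by (intro mult_left_mono order_trans[OF W_moments] ennreal_leI) auto
 also have "\<dots> = ennreal (1 / prob alive * \<bar>C\<bar>)"
  by (rule ennreal_mult[symmetric]) auto
 finally show ?thesis .
qed

lemma W_inf_moments_P: "(\<integral>\<^sup>+w. ennreal (\<bar>W_inf (env w)\<bar> powr p) \<partial>P) \<le> ennreal (1 / prob alive * \<bar>C\<bar>)"
proof -
 have "(\<integral>\<^sup>+w. ennreal (\<bar>W_inf (env w)\<bar> powr p) \<partial>P) = (\<integral>\<^sup>+w. liminf (\<lambda>l. ennreal (W l (env w) powr p)) \<partial>P)"
 proof (rule nn_integral_cong_AE, use AE_regular in eventually_elim)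
  case (elim w)
  then have "(\<lambda>l. W l (env w) powr p) \<longlonglongrightarrow> W_inf (env w) powr p"
   by (intro tendsto_powr tendsto_const regular_env_W) auto
  then show ?case
   using elim by (intro lim_imp_Liminf[symmetric] tendsto_ennrealI) auto
 qed
 also have "\<dots> \<le> liminf (\<lambda>l. \<integral>\<^sup>+w. ennreal (W l (env w) powr p) \<partial>P)"
  by (rule nn_integral_liminf) measurable
 also have "\<dots> \<le> ennreal (1 / prob alive * \<bar>C\<bar>)"
  by (intro Liminf_le always_eventually allI moments_P) simp
 finally show ?thesis .
qed

text \<open>
 Tuple sums are bounded by \<open>w ^ k\<close>, so that moments of order \<open>p > 2 k\<close> of the martingale control
 moments of order \<open>p / k > 2\<close> of tuple sums.
\<close>

lemma powr_exponent:
 assumes "0 \<le> x" "x \<le> w ^ k" "0 \<le> w"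
 shows "\<bar>x\<bar> powr (p / real k) \<le> \<bar>w\<bar> powr p"
proof -
 have "\<bar>x\<bar> powr (p / real k) \<le> (w ^ k) powr (p / real k)"
  using assms p by (intro powr_mono2) auto
 also have "w ^ k = w powr real k"
  using assms k by (cases "w = 0") (simp_all add: powr_realpow)
 finally show ?thesis
  using assms k by (simp add: powr_powr)
qed

text \<open>
 The explicit version of the limit. The index zero is degenerate, as a split generation is at least
 one.
\<close>

definition A_version :: "nat \<Rightarrow> 'w \<Rightarrow> real" where
 "A_version m w = (if m = 0 then 0 else tuple_limit k m (env w))"

lemma A_version_measurable [measurable]: "A_version m \<in> borel_measurable M"
 unfolding A_version_def[abs_def] by measurable

lemma A_version_L2: "tendsto_L2 P (\<lambda>l w. weighted_tuple_sum k l (split_indicator m) (env w)) (A_version m)"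
proof (rule P.tendsto_L2_of_bounded_moments)
 show "2 < p / real k"
  using p k by (simp add: field_simps)
 show "AE w in P. (\<lambda>l. weighted_tuple_sum k l (split_indicator m) (env w)) \<longlonglongrightarrow> A_version m w"
 proof (cases "m = 0")
  case True
  then show ?thesis
   by (simp add: A_version_def weighted_tuple_sum_def tuple_sum_def split_indicator_0)
 next
  case False
  show ?thesis
   using AE_regular by eventually_elim (use False in \<open>auto simp: A_version_def intro!: B.weighted_tuple_sum_tendsto\<close>)
 qed
 fix l
 have "(\<integral>\<^sup>+w. ennreal (\<bar>weighted_tuple_sum k l (split_indicator m) (env w)\<bar> powr (p / real k)) \<partial>P) \<le>
   (\<integral>\<^sup>+w. ennreal (W l (env w) powr p) \<partial>P)"
 proof (intro nn_integral_mono ennreal_leI)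
  fix w
  show "\<bar>weighted_tuple_sum k l (split_indicator m) (env w)\<bar> powr (p / real k) \<le> W l (env w) powr p"
   using powr_exponent[OF weighted_tuple_sum_bounds[of k l m "env w"] W_nonneg] W_nonneg[of l "env w"] by simp
 qed
 then show "(\<integral>\<^sup>+w. ennreal (\<bar>weighted_tuple_sum k l (split_indicator m) (env w)\<bar> powr (p / real k)) \<partial>P) \<le> ennreal (1 / prob alive * \<bar>C\<bar>)"
  using moments_P by (rule order_trans)
qed measurable

lemma A_lim_L2: "tendsto_L2 P (\<lambda>l w. weighted_tuple_sum k l (split_indicator m) (env w)) (A_lim m)"
 unfolding A_inf_def
 using someI[of "tendsto_L2 P (\<lambda>l w. weighted_tuple_sum k l (split_indicator m) (env w))", OF A_version_L2] .

lemma A_lim_measurable [measurable]: "A_lim m \<in> borel_measurable P"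
 using A_lim_L2[of m] by (simp add: tendsto_L2_def in_L2_def)

lemma AE_A_lim: "AE w in P. \<forall>m. A_lim m w = A_version m w"
 unfolding AE_all_countable using P.tendsto_L2_AE_unique[OF A_lim_L2 A_version_L2] by blast

lemma AE_A_lim_properties:
 "AE w in P. regular_env (env w) \<and> W_inf (env w) > 0 \<and> (\<forall>m. A_lim m w = A_version m w) \<and>
   (\<forall>m. 0 \<le> A_lim m w \<and> A_lim m w \<le> W_inf (env w) ^ k) \<and> (\<lambda>m. A_lim m w) \<longlonglongrightarrow> W_inf (env w) ^ k"
 using AE_A_lim AE_regular
proof eventually_elim
 case (elim w)
 then have reg: "regular_env (env w)" and W: "W_inf (env w) > 0"
  by auto
 have "(\<lambda>m. A_version m w) \<longlonglongrightarrow> W_inf (env w) ^ k"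
 proof (rule Lim_transform_eventually)
  show "(\<lambda>m. tuple_limit k m (env w)) \<longlonglongrightarrow> W_inf (env w) ^ k"
   by (rule B.tuple_limit_tendsto[OF reg])
  show "eventually (\<lambda>m. tuple_limit k m (env w) = A_version m w) sequentially"
   using eventually_ge_at_top[of 1] by eventually_elim (simp add: A_version_def)
 qed
 then show ?case
  using elim reg W B.tuple_limit_bounds[OF reg, of k] by (auto simp: A_version_def)
qed

lemma A_lim_tendsto_W: "tendsto_L2 P A_lim (\<lambda>w. W_inf (env w) ^ k)"
proof (rule P.tendsto_L2_of_bounded_moments)
 show "2 < p / real k"
  using p k by (simp add: field_simps)
 show "AE w in P. (\<lambda>m. A_lim m w) \<longlonglongrightarrow> W_inf (env w) ^ k"
  using AE_A_lim_properties by eventually_elim blast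
 fix m
 have "(\<integral>\<^sup>+w. ennreal (\<bar>A_lim m w\<bar> powr (p / real k)) \<partial>P) \<le> (\<integral>\<^sup>+w. ennreal (\<bar>W_inf (env w)\<bar> powr p) \<partial>P)"
 proof (rule nn_integral_mono_AE, use AE_A_lim_properties in eventually_elim)
  case (elim w)
  then have "0 \<le> A_lim m w" "A_lim m w \<le> W_inf (env w) ^ k" "0 \<le> W_inf (env w)"
   by auto
  then show ?case
   by (intro ennreal_leI powr_exponent)
 qed
 then show "(\<integral>\<^sup>+w. ennreal (\<bar>A_lim m w\<bar> powr (p / real k)) \<partial>P) \<le> ennreal (1 / prob alive * \<bar>C\<bar>)"
  using W_inf_moments_P by (rule order_trans)
qed measurable

lemma D_eq: "D n w = {x \<in> window [] (lo n) (hi n). visits (nat \<lfloor>sqrt (real n)\<rfloor>) x w}"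
 by (auto simp: visited_between_def visited_iff visits_def window_def)

lemma D_below: "{x \<in> D n w. prefix u x} = {x \<in> window u (lo n) (hi n). visits (nat \<lfloor>sqrt (real n)\<rfloor>) x w}"
 unfolding D_eq by (auto simp: window_def)

lemma finite_D: "finite (D n w)"
 unfolding D_eq by (rule finite_visits)

lemma D_measurable [measurable]: "Measurable.pred M (\<lambda>w. x \<in> D n w)"
 unfolding D_eq by measurable

lemma tuple_sum_D_measurable [measurable]: "(\<lambda>w. tuple_sum k (D n w) f) \<in> borel_measurable M"
 by (rule measurable_compose_finite_set[where A = "D n" and f = "\<lambda>T w. tuple_sum k T f"]) (auto simp: finite_D)

abbreviation "scaled_split m n w \<equiv> tuple_sum k (D n w) (split_indicator m) / d n ^ k"
abbreviation "scaled_all n w \<equiv> tuple_sum k (D n w) (\<lambda>_. 1) / d n ^ k"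

definition converges_along :: "(nat \<Rightarrow> nat) \<Rightarrow> 'w \<Rightarrow> bool" where
 "converges_along r w \<longleftrightarrow> W_inf (env w) > 0 \<and>
   (\<forall>m\<ge>1. (\<lambda>n. scaled_split m (r n) w) \<longlonglongrightarrow> c_inf Q S ^ k * A_lim m w) \<and>
   (\<lambda>n. scaled_all (r n) w) \<longlonglongrightarrow> c_inf Q S ^ k * W_inf (env w) ^ k"

text \<open>
 Along a subsequence the counts below all vertices converge almost surely, which determines the
 limits of all tuple sums pathwise.
\<close>

lemma subsequence_tendsto:
 assumes r: "strict_mono (r :: nat \<Rightarrow> nat)"
 obtains r' :: "nat \<Rightarrow> nat" where "strict_mono r'"
  "AE w in P. converges_along (\<lambda>n. r (r' n)) w"
proof -
 let ?Z = "\<lambda>u n w. visit_count (nat \<lfloor>sqrt (real n)\<rfloor>) u (lo n) (hi n) w / d n"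
 let ?Y = "\<lambda>u w. c_inf Q S * mass_below u (env w)"
 obtain r' where r': "strict_mono r'" and lim: "AE w in M. \<forall>u. (\<lambda>n. ?Z u (r (r' n)) w) \<longlonglongrightarrow> ?Y u w"
  by (rule common_AE_subsequence[where Z = ?Z and Y = ?Y, OF _ _ counts r]) measurable
 have "filterlim (\<lambda>n. lo (r (r' n))) at_top sequentially"
  using r r' by (intro filterlim_compose[OF lo_at_top] filterlim_compose[OF filterlim_subseq[OF r] filterlim_subseq[OF r']])
 note tendsto = B.tuple_counts_tendsto[where a = "\<lambda>n. lo (r (r' n))" and d = "\<lambda>n. d (r (r' n))" and c = "c_inf Q S", OF _ _ _ _ this]
 have "AE w in P. converges_along (\<lambda>n. r (r' n)) w"
  using AE_P[OF lim] AE_A_lim_properties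
 proof eventually_elim
  case (elim w)
  have counts: "(\<lambda>n. real (card {x \<in> D (r (r' n)) w. prefix u x}) / d (r (r' n))) \<longlonglongrightarrow> ?Y u w" for u
   using elim(1) by (simp add: D_below visit_count_def)
  have reg: "regular_env (env w)"
   using elim by simp
  have sub: "D n w \<subseteq> tree (env w)" "x \<in> D n w \<Longrightarrow> lo n \<le> length x" for n x
   by (auto simp: D_eq visits_def window_def)
  have lim: "m \<ge> 1 \<Longrightarrow> (\<lambda>n. scaled_split m (r (r' n)) w) \<longlonglongrightarrow> c_inf Q S ^ k * tuple_limit k m (env w)"
   "(\<lambda>n. scaled_all (r (r' n)) w) \<longlonglongrightarrow> c_inf Q S ^ k * W_inf (env w) ^ k" for m
   using tendsto[where D = "\<lambda>n. D (r (r' n)) w", OF reg finite_D sub less_imp_le[OF B.c_inf_properties(2)] scale_nonneg counts]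
   by blast+
  have "(\<lambda>n. scaled_split m (r (r' n)) w) \<longlonglongrightarrow> c_inf Q S ^ k * A_lim m w" if "m \<ge> 1" for m
   using lim(1)[OF that] elim(2) that by (simp add: A_version_def)
  then show ?case
   unfolding converges_along_def using lim(2) elim(2) by blast
 qed
 with r' show thesis
  by (rule that)
qed

lemma tuple_sums_in_prob:
 assumes m: "m \<ge> 1"
 shows "tendsto_in_prob P (\<lambda>n w. scaled_split m n w) (\<lambda>w. c_inf Q S ^ k * A_lim m w)"
proof (rule P.tendsto_in_prob_by_subsequences)
 fix r :: "nat \<Rightarrow> nat" assume "strict_mono r"
 then obtain r' where r': "strict_mono r'"
  "AE w in P. converges_along (\<lambda>n. r (r' n)) w"
  by (rule subsequence_tendsto) (rule that)
 from r'(2) have "AE w in P. (\<lambda>n. scaled_split m (r (r' n)) w) \<longlonglongrightarrow> c_inf Q S ^ k * A_lim m w"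
  unfolding converges_along_def by eventually_elim (use m in blast)
 with r'(1) show "\<exists>r'. strict_mono r' \<and> (AE w in P. (\<lambda>n. scaled_split m (r (r' n)) w) \<longlonglongrightarrow> c_inf Q S ^ k * A_lim m w)"
  by blast
qed measurable

abbreviation "has_tuples n \<equiv> {w \<in> space M. incomparable_tuples k (D n w) \<noteq> {}}"

lemma has_tuples_iff: "w \<in> space M \<Longrightarrow> w \<in> has_tuples n \<longleftrightarrow> tuple_sum k (D n w) (\<lambda>_. 1) > 0"
 by (simp add: tuple_sum_def card_gt_0_iff finite_incomparable_tuples finite_D)

lemma has_tuples_measurable [measurable]: "has_tuples n \<in> sets M"
proof -
 have "has_tuples n = {w \<in> space M. tuple_sum k (D n w) (\<lambda>_. 1) > 0}"
  using has_tuples_iff by blast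
 then show ?thesis
  by simp
qed

text \<open>
 The conditional probability that a uniform tuple has split by generation \<open>m\<close>; it is zero if there are
 no tuples.
\<close>

definition ratio :: "nat \<Rightarrow> nat \<Rightarrow> 'w \<Rightarrow> real" where
 "ratio m n w = tuple_sum k (D n w) (split_indicator m) / tuple_sum k (D n w) (\<lambda>_. 1)"

lemma ratio_measurable [measurable]: "ratio m n \<in> borel_measurable M"
 unfolding ratio_def[abs_def] by measurable

lemma ratio_bounds: "0 \<le> ratio m n w" "ratio m n w \<le> 1"
proof -
 have "0 \<le> tuple_sum k (D n w) (split_indicator m)" "tuple_sum k (D n w) (split_indicator m) \<le> tuple_sum k (D n w) (\<lambda>_. 1)"
  unfolding tuple_sum_def by (intro sum_nonneg sum_mono; simp add: split_indicator_def)+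
 then show "0 \<le> ratio m n w" "ratio m n w \<le> 1"
  unfolding ratio_def by (auto simp: divide_le_eq_1 intro!: divide_nonneg_nonneg)
qed

lemma uniform_tuple_law_properties:
 assumes pos: "P.prob (has_tuples n) > 0"
 shows "sets (uniform_tuple_law P k (D n)) = UNIV"
  and "measure (uniform_tuple_law P k (D n)) {xs. split_generation xs \<le> m} = (\<integral>w. ratio m n w \<partial>P) / P.prob (has_tuples n)"
proof -
 let ?U = "uniform_measure P (has_tuples n)" and ?K = "\<lambda>w. measure_pmf (pmf_of_set (incomparable_tuples k (D n w)))"
 let ?A = "{xs. split_generation xs \<le> m}"
 have law: "uniform_tuple_law P k (D n) = ?U \<bind> ?K"
  by (simp add: uniform_tuple_law_def)
 have nonempty: "space ?U \<noteq> {}"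
  using P.not_empty by simp
 have K [measurable]: "?K \<in> M \<rightarrow>\<^sub>M subprob_algebra (count_space UNIV)"
  by (rule measurable_compose_finite_set[where A = "D n" and f = "\<lambda>T w. measure_pmf (pmf_of_set (incomparable_tuples k T))"]) (auto simp: finite_D)
 have KU: "?K \<in> ?U \<rightarrow>\<^sub>M subprob_algebra (count_space UNIV)"
  using K by (simp cong: measurable_cong_sets)
 show "sets (uniform_tuple_law P k (D n)) = UNIV"
  unfolding law by (subst sets_bind_measurable[OF KU nonempty]) simp
 have "emeasure (uniform_tuple_law P k (D n)) ?A = (\<integral>\<^sup>+w. emeasure (?K w) ?A \<partial>?U)"
  unfolding law by (rule emeasure_bind[OF nonempty KU]) simp
 also have "\<dots> = (\<integral>\<^sup>+w. emeasure (?K w) ?A * indicator (has_tuples n) w \<partial>P) / emeasure P (has_tuples n)"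
  by (rule nn_integral_uniform_measure) measurable
 also have "(\<integral>\<^sup>+w. emeasure (?K w) ?A * indicator (has_tuples n) w \<partial>P) = (\<integral>\<^sup>+w. ennreal (ratio m n w) \<partial>P)"
 proof (rule nn_integral_cong)
  fix w assume "w \<in> space P"
  then have w: "w \<in> space M" by simp
  let ?T = "incomparable_tuples k (D n w)"
  have fin: "finite ?T"
   by (intro finite_incomparable_tuples finite_D)
  show "emeasure (?K w) ?A * indicator (has_tuples n) w = ennreal (ratio m n w)"
  proof (cases "?T = {}")
   case True
   then show ?thesis
    by (simp add: ratio_def tuple_sum_def)
  next
   case False
   have "tuple_sum k (D n w) (split_indicator m) = real (card (?T \<inter> ?A))"
    unfolding tuple_sum_def split_indicator_def using fin by (simp add: sum.If_cases Int_def)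
   then show ?thesis
    using False fin w by (simp add: measure_pmf.emeasure_eq_measure measure_pmf_of_set ratio_def tuple_sum_def)
  qed
 qed
 also have "\<dots> = ennreal (\<integral>w. ratio m n w \<partial>P)"
  by (intro nn_integral_eq_integral P.integrable_const_bound[where B = 1]) (auto simp: ratio_bounds abs_of_nonneg)
 also have "\<dots> / emeasure P (has_tuples n) = ennreal ((\<integral>w. ratio m n w \<partial>P) / P.prob (has_tuples n))"
  using pos by (simp add: P.emeasure_eq_measure divide_ennreal ratio_bounds)
 finally show "measure (uniform_tuple_law P k (D n)) ?A = (\<integral>w. ratio m n w \<partial>P) / P.prob (has_tuples n)"
  using pos by (simp add: measure_def ratio_bounds)
qed

definition split_cdf :: "nat \<Rightarrow> real" where
 "split_cdf m = (\<integral>w. A_lim m w / W_inf (env w) ^ k \<partial>P)"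

lemma subsequence_ratio:
 assumes r: "strict_mono (r :: nat \<Rightarrow> nat)"
 obtains r' :: "nat \<Rightarrow> nat" where "strict_mono r'"
  "(\<lambda>n. P.prob (has_tuples (r (r' n)))) \<longlonglongrightarrow> 1"
  "\<And>m. m \<ge> 1 \<Longrightarrow> (\<lambda>n. \<integral>w. ratio m (r (r' n)) w \<partial>P) \<longlonglongrightarrow> split_cdf m"
proof -
 obtain r' where r': "strict_mono r'" and lim:
  "AE w in P. converges_along (\<lambda>n. r (r' n)) w"
  by (rule subsequence_tendsto[OF r]) (rule that)
 note lim = lim[unfolded converges_along_def]
 let ?T = "\<lambda>n w. scaled_all (r (r' n)) w"
 let ?Y = "\<lambda>m n w. scaled_split m (r (r' n)) w"
 have c: "c_inf Q S > 0"
  by (rule B.c_inf_properties)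
 have nonzero: "eventually (\<lambda>n. ?T n w > 0) sequentially"
  if "W_inf (env w) > 0" "(\<lambda>n. ?T n w) \<longlonglongrightarrow> c_inf Q S ^ k * W_inf (env w) ^ k" for w
  using that c by (intro order_tendstoD(1)[OF that(2)]) simp
 have "(\<lambda>n. \<integral>w. indicator (has_tuples (r (r' n))) w \<partial>P) \<longlonglongrightarrow> (\<integral>w. (1::real) \<partial>P)"
 proof (rule integral_dominated_convergence[where w = "\<lambda>_. 1"])
  show "AE w in P. (\<lambda>n. indicator (has_tuples (r (r' n))) w :: real) \<longlonglongrightarrow> 1"
   using lim AE_space
  proof eventually_elim
   case (elim w)
   have "eventually (\<lambda>n. ?T n w > 0) sequentially"
    using elim by (intro nonzero) auto
   then have "eventually (\<lambda>n. w \<in> has_tuples (r (r' n))) sequentially"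
   proof eventually_elim
    case (elim n)
    then have "tuple_sum k (D (r (r' n)) w) (\<lambda>_. 1) \<noteq> 0"
     by auto
    moreover have "tuple_sum k (D (r (r' n)) w) (\<lambda>_. 1) \<ge> 0"
     by (simp add: tuple_sum_def)
    ultimately show ?case
     using has_tuples_iff \<open>w \<in> space P\<close> by simp
   qed
   then show ?case
    by (rule tendsto_eventually[OF eventually_mono]) (simp only: indicator_simps)
  qed
 qed (auto simp: indicator_def)
 moreover have "(\<integral>w. (indicator (has_tuples n) w :: real) \<partial>P) = P.prob (has_tuples n)" for n
  by (subst Bochner_Integration.integral_indicator) (auto intro!: arg_cong[where f = "P.prob"])
 ultimately have prob: "(\<lambda>n. P.prob (has_tuples (r (r' n)))) \<longlonglongrightarrow> 1"
  by (simp add: P.prob_space)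
 have "(\<lambda>n. \<integral>w. ratio m (r (r' n)) w \<partial>P) \<longlonglongrightarrow> split_cdf m" if m: "m \<ge> 1" for m
  unfolding split_cdf_def
 proof (rule integral_dominated_convergence[where w = "\<lambda>_. 1"])
  show "AE w in P. (\<lambda>n. ratio m (r (r' n)) w) \<longlonglongrightarrow> A_lim m w / W_inf (env w) ^ k"
   using lim
  proof eventually_elim
   case (elim w)
   have cancel: "y / e / (t / e) = y / t" if "t / e > 0" for y t e :: real
    using that by (cases "e = 0") auto
   have "(\<lambda>n. ?Y m n w / ?T n w) \<longlonglongrightarrow> (c_inf Q S ^ k * A_lim m w) / (c_inf Q S ^ k * W_inf (env w) ^ k)"
    using elim m c by (intro tendsto_divide) auto
   then have "(\<lambda>n. ?Y m n w / ?T n w) \<longlonglongrightarrow> A_lim m w / W_inf (env w) ^ k"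
    using c by simp
   moreover have "eventually (\<lambda>n. ?T n w > 0) sequentially"
    using elim by (intro nonzero) auto
   then have "eventually (\<lambda>n. ?Y m n w / ?T n w = ratio m (r (r' n)) w) sequentially"
    by eventually_elim (simp only: cancel ratio_def)
   ultimately show ?case
    by (rule Lim_transform_eventually)
  qed
 qed (auto simp: ratio_bounds abs_of_nonneg)
 with r' prob show thesis
  by (rule that)
qed

lemma prob_has_tuples: "(\<lambda>n. P.prob (has_tuples n)) \<longlonglongrightarrow> 1"
proof (rule LIMSEQ_by_subsequences)
 fix r :: "nat \<Rightarrow> nat" assume "strict_mono r"
 then show "\<exists>r'. strict_mono r' \<and> (\<lambda>n. P.prob (has_tuples (r (r' n)))) \<longlonglongrightarrow> 1"
  by (rule subsequence_ratio) blast
qed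

lemma ratio_tendsto: "m \<ge> 1 \<Longrightarrow> (\<lambda>n. \<integral>w. ratio m n w \<partial>P) \<longlonglongrightarrow> split_cdf m"
proof (rule LIMSEQ_by_subsequences)
 fix r :: "nat \<Rightarrow> nat" assume "m \<ge> 1" "strict_mono r"
 then show "\<exists>r'. strict_mono r' \<and> (\<lambda>n. \<integral>w. ratio m (r (r' n)) w \<partial>P) \<longlonglongrightarrow> split_cdf m"
  by (rule_tac subsequence_ratio) blast+
qed

lemma split_law_tendsto:
 assumes m: "m \<ge> 1"
 shows "(\<lambda>n. measure (uniform_tuple_law P k (D n)) {xs. split_generation xs \<le> m}) \<longlonglongrightarrow> split_cdf m"
proof -
 have "(\<lambda>n. (\<integral>w. ratio m n w \<partial>P) / P.prob (has_tuples n)) \<longlonglongrightarrow> split_cdf m / 1"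
  using m by (intro tendsto_divide prob_has_tuples ratio_tendsto) auto
 moreover have "eventually (\<lambda>n. P.prob (has_tuples n) > 0) sequentially"
  by (rule order_tendstoD(1)[OF prob_has_tuples]) simp
 then have "eventually (\<lambda>n. (\<integral>w. ratio m n w \<partial>P) / P.prob (has_tuples n) = measure (uniform_tuple_law P k (D n)) {xs. split_generation xs \<le> m}) sequentially"
  by eventually_elim (simp add: uniform_tuple_law_properties)
 ultimately show ?thesis
  by (auto intro: Lim_transform_eventually)
qed

text \<open>
 No mass escapes to infinity, because \<open>A_lim m\<close> tends to \<open>W_inf ^ k\<close>.
\<close>

lemma split_weak_conv:
 "\<exists>\<nu>. real_distribution \<nu> \<and> weak_conv_m (\<lambda>n. distr (uniform_tuple_law P k (D n)) borel (\<lambda>xs. real (split_generation xs))) \<nu>"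
proof (rule weak_conv_of_nat_valued)
 have "eventually (\<lambda>n. P.prob (has_tuples n) > 0) sequentially"
  by (rule order_tendstoD(1)[OF prob_has_tuples]) simp
 then show "eventually (\<lambda>n. sets (uniform_tuple_law P k (D n)) = UNIV) sequentially"
  by eventually_elim (rule uniform_tuple_law_properties)
 have bound: "AE w in P. 0 \<le> A_lim m w / W_inf (env w) ^ k \<and> A_lim m w / W_inf (env w) ^ k \<le> 1" for m
  using AE_A_lim_properties by eventually_elim (auto simp: divide_le_eq_1)
 have zero: "(\<integral>w. A_lim 0 w / W_inf (env w) ^ k \<partial>P) = 0"
  by (rule integral_eq_zero_AE, use AE_A_lim in eventually_elim) (simp add: A_version_def)
 have law: "(\<lambda>n. measure (uniform_tuple_law P k (D n)) {xs. split_generation xs \<le> m}) \<longlonglongrightarrow> split_cdf m" for m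
 proof (cases "m = 0")
  case True
  have "\<not> split_generation xs \<le> 0" for xs
   using split_generation_ge_1[of xs] by linarith
  then have none: "{xs. split_generation xs \<le> 0} = {}"
   by blast
  show ?thesis
   unfolding True none using zero by (simp add: split_cdf_def)
 qed (simp add: split_law_tendsto)
 then show "(\<lambda>n. measure (uniform_tuple_law P k (D n)) {xs. split_generation xs \<le> m}) \<longlonglongrightarrow> split_cdf m" for m .
 show "split_cdf 0 \<ge> 0"
  using zero by (simp add: split_cdf_def)
 show "mono split_cdf"
 proof (rule monoI)
  fix a b :: nat assume ab: "a \<le> b"
  show "split_cdf a \<le> split_cdf b"
  proof (cases "a = 0")
   case True
   have "0 \<le> split_cdf b"
    unfolding split_cdf_def using bound[of b] by (intro integral_nonneg_AE) (auto elim: eventually_mono)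
   then show ?thesis
    using True zero by (simp add: split_cdf_def)
  next
   case False
   have le: "(\<integral>w. ratio a n w \<partial>P) \<le> (\<integral>w. ratio b n w \<partial>P)" for n
   proof (intro integral_mono P.integrable_const_bound[where B = 1])
    fix w
    have "tuple_sum k (D n w) (split_indicator a) \<le> tuple_sum k (D n w) (split_indicator b)"
     unfolding tuple_sum_def using ab by (intro sum_mono) (auto simp: split_indicator_def)
    then show "ratio a n w \<le> ratio b n w"
     unfolding ratio_def by (rule divide_right_mono) (simp add: tuple_sum_def)
   qed (auto simp: ratio_bounds abs_of_nonneg)
   show ?thesis
    using False ab le by (intro LIMSEQ_le[OF ratio_tendsto ratio_tendsto]) auto
  qed
 qed
 have "(\<lambda>m. \<integral>w. A_lim m w / W_inf (env w) ^ k \<partial>P) \<longlonglongrightarrow> (\<integral>w. 1 \<partial>P)"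
 proof (rule integral_dominated_convergence[where w = "\<lambda>_. 1"])
  show "AE w in P. (\<lambda>m. A_lim m w / W_inf (env w) ^ k) \<longlonglongrightarrow> 1"
   using AE_A_lim_properties
  proof eventually_elim
   case (elim w)
   then have "(\<lambda>m. A_lim m w / W_inf (env w) ^ k) \<longlonglongrightarrow> W_inf (env w) ^ k / W_inf (env w) ^ k"
    by (intro tendsto_divide tendsto_const) auto
   then show ?case
    using elim by simp
  qed
  show "AE w in P. norm (A_lim m w / W_inf (env w) ^ k) \<le> 1" for m
   using bound[of m] by eventually_elim (simp only: real_norm_def abs_of_nonneg)
 qed auto
 then show "split_cdf \<longlonglongrightarrow> 1"
  by (simp add: split_cdf_def[abs_def] P.prob_space)
qed

end


section \<open>The branching law of the environment\<close>

lemma sum_generation_1: "(\<Sum>x\<in>generation E 1. f x) = (\<Sum>i<length (E []). f [i])"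
 using sum_generation_Suc[of f E 0] by simp

lemma log_ennreal_eq_0_iff: "log_ennreal x = 0 \<longleftrightarrow> x = 1"
proof (cases x)
 case (real r)
 then show ?thesis
  by (auto simp: log_ennreal_def ennreal_eq_1 zero_ereal_def ennreal_eq_0_iff)
qed (simp add: log_ennreal_def)

lemma less_1_of_log_ennreal: "real_of_ereal (log_ennreal x) < 0 \<Longrightarrow> x < 1"
 by (cases x) (auto simp: log_ennreal_def ennreal_less_one_iff split: if_splits)

context walk_in_random_environment
begin

lemma sets_offspring: "sets \<mu> = sets real_seqs"
 unfolding env_law[of "[]", symmetric] by simp

lemma prob_space_offspring: "prob_space \<mu>"
 unfolding env_law[of "[]", symmetric]
 by (rule prob_space_distr) (rule measurable_compose[OF env_measurable env_component_measurable])

lemma nn_integral_offspring: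
 assumes "F \<in> borel_measurable real_seqs"
 shows "(\<integral>\<^sup>+xs. F xs \<partial>\<mu>) = (\<bbbA>\<^sup>+w. F (env w []))"
 unfolding env_law[of "[]", symmetric]
 by (rule nn_integral_distr) (use assms in \<open>auto intro: measurable_compose[OF env_measurable env_component_measurable]\<close>)

lemma nn_integral_distr_env:
 assumes "F \<in> borel_measurable env_space"
 shows "(\<integral>\<^sup>+E. F E \<partial>(\<Pi>\<^sub>M u\<in>UNIV. \<mu>)) = (\<bbbA>\<^sup>+w. F (env w))"
 unfolding distr_env_PiM[symmetric] by (rule nn_integral_distr) (use assms in auto)

text \<open>
 The size-biased step law of the spine is the intensity of the offspring process weighted by
 \<open>exp (- V)\<close>. It is a probability measure because \<open>\<psi>(1) = 0\<close>, and knowing it on bounded functions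
 determines it.
\<close>

lemma branching_law_of_spine:
 assumes spine: "spine_walk Q M env S" and \<psi>1: "\<psi> M env 1 = 0"
 shows "branching_law \<mu> (distr Q borel (S 1))"
proof -
 interpret Sp: spine_walk Q M env S by (rule spine)
 have "(\<lambda>w. S (Suc 0) w - S 0 w) \<in> borel_measurable Q"
  using Sp.increments_indep by (simp add: Sp.indep_vars_def)
 then have S1 [measurable]: "S 1 \<in> borel_measurable Q"
  by (rule measurable_cong[THEN iffD1, rotated]) (simp add: Sp.start)
 note [measurable] = S1[unfolded One_nat_def]
 have total: "(\<bbbA>\<^sup>+w. ennreal (\<Sum>x\<in>generation (env w) 1. exp (- potential (env w) x))) = 1"
  using \<psi>1 by (simp add: \<psi>_def log_ennreal_eq_0_iff)
 have indicator: "(\<integral>\<^sup>+a. indicator B a \<partial>distr Q borel (S 1)) =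
   (\<integral>\<^sup>+xs. (\<Sum>i<length xs. ennreal (exp (- (xs ! i))) * indicator B (xs ! i)) \<partial>\<mu>)" if B [measurable]: "B \<in> sets borel" for B
 proof -
  let ?f = "\<lambda>w. \<Sum>x\<in>generation (env w) 1. indicator B (potential (env w) x) * exp (- potential (env w) x) :: real"
  have f_le: "?f w \<le> (\<Sum>x\<in>generation (env w) 1. exp (- potential (env w) x))" for w
   by (intro sum_mono) (auto simp: indicator_def)
  have f0: "?f w \<ge> 0" for w
   by (intro sum_nonneg) auto
  have "(\<lambda>E. \<Sum>x\<in>generation E 1. indicator B (potential E x) * exp (- potential E x) :: real) \<in> borel_measurable env_space"
   by measurable
  from measurable_compose[OF env_measurable this] have f [measurable]: "?f \<in> borel_measurable M" .
  have "(\<integral>\<^sup>+a. indicator B a \<partial>distr Q borel (S 1)) = (\<integral>\<^sup>+w. ennreal (indicator B (S 1 w)) \<partial>Q)"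
   by (subst nn_integral_distr) (auto simp: ennreal_indicator)
  also have "\<dots> = ennreal (Sp.expectation (\<lambda>w. indicator B (S 1 w)))"
   by (intro nn_integral_eq_integral Sp.integrable_const_bound[where B = 1]) auto
  also have "Sp.expectation (\<lambda>w. indicator B (S 1 w)) = (\<integral>w. ?f w \<partial>M)"
   by (rule Sp.step_law) (auto intro!: boundedI[where B = 1] simp: indicator_def)
  also have "\<dots> = enn2real (\<bbbA>\<^sup>+w. ennreal (?f w))"
   by (rule integral_eq_nn_integral[OF f]) (intro AE_I2 f0)
  also have "ennreal \<dots> = (\<bbbA>\<^sup>+w. ennreal (?f w))"
  proof (rule ennreal_enn2real)
   have "(\<bbbA>\<^sup>+w. ennreal (?f w)) \<le> 1"
    unfolding total[symmetric] by (intro nn_integral_mono ennreal_leI f_le)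
   then show "(\<bbbA>\<^sup>+w. ennreal (?f w)) < top"
    by (rule le_less_trans) simp
  qed
  also have "\<dots> = (\<bbbA>\<^sup>+w. (\<Sum>i<length (env w []). ennreal (exp (- (env w [] ! i))) * indicator B (env w [] ! i)))"
   unfolding sum_generation_1
   by (intro nn_integral_cong, subst sum_ennreal[symmetric]) (auto simp: potential_Cons indicator_def intro!: sum.cong)
  also have "\<dots> = (\<integral>\<^sup>+xs. (\<Sum>i<length xs. ennreal (exp (- (xs ! i))) * indicator B (xs ! i)) \<partial>\<mu>)"
   by (rule nn_integral_offspring[symmetric]) (intro sum_lessThan_measurable, measurable)
  finally show ?thesis .
 qed
 have sum_measurable: "(\<lambda>xs. \<Sum>i<length xs. ennreal (exp (- (xs ! i))) * h (xs ! i)) \<in> borel_measurable real_seqs"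
  if [measurable]: "h \<in> borel_measurable borel" for h :: "real \<Rightarrow> ennreal"
  by (intro sum_lessThan_measurable) measurable
 have R_measurable [measurable]: "(\<lambda>xs. \<Sum>i<length xs. ennreal (exp (- (xs ! i))) * h (xs ! i)) \<in> borel_measurable \<mu>"
  if [measurable]: "h \<in> borel_measurable borel" for h :: "real \<Rightarrow> ennreal"
  using sum_measurable[OF that] by (simp cong: measurable_cong_sets add: sets_offspring)
 have "(\<integral>\<^sup>+a. h a \<partial>distr Q borel (S 1)) = (\<integral>\<^sup>+xs. (\<Sum>i<length xs. ennreal (exp (- (xs ! i))) * h (xs ! i)) \<partial>\<mu>)"
  if "h \<in> borel_measurable borel" for h :: "real \<Rightarrow> ennreal"
  using that
 proof (induction rule: borel_measurable_induct)
  case (cong f g)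
  then have "f = g"
   by (auto simp: fun_eq_iff)
  with cong show ?case by simp
 next
  case (set A)
  then show ?case by (rule indicator)
 next
  case (mult u c)
  note [measurable] = mult(2)
  have "(\<integral>\<^sup>+xs. (\<Sum>i<length xs. ennreal (exp (- (xs ! i))) * (c * u (xs ! i))) \<partial>\<mu>) =
    (\<integral>\<^sup>+xs. c * (\<Sum>i<length xs. ennreal (exp (- (xs ! i))) * u (xs ! i)) \<partial>\<mu>)"
   by (simp add: sum_distrib_left mult_ac)
  also have "\<dots> = c * (\<integral>\<^sup>+a. u a \<partial>distr Q borel (S 1))"
   unfolding mult by (rule nn_integral_cmult) measurable
  finally show ?case
   by (simp add: nn_integral_cmult)
 next
  case (add u v)
  note [measurable] = add(1,3)
  have "(\<integral>\<^sup>+xs. (\<Sum>i<length xs. ennreal (exp (- (xs ! i))) * (v (xs ! i) + u (xs ! i))) \<partial>\<mu>) =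
    (\<integral>\<^sup>+xs. (\<Sum>i<length xs. ennreal (exp (- (xs ! i))) * v (xs ! i)) + (\<Sum>i<length xs. ennreal (exp (- (xs ! i))) * u (xs ! i)) \<partial>\<mu>)"
   by (simp add: sum.distrib distrib_left)
  also have "\<dots> = (\<integral>\<^sup>+a. v a \<partial>distr Q borel (S 1)) + (\<integral>\<^sup>+a. u a \<partial>distr Q borel (S 1))"
   unfolding add by (rule nn_integral_add) measurable
  finally show ?case
   by (simp add: nn_integral_add)
 next
  case (seq U)
  note [measurable] = seq(1)
  have "(\<integral>\<^sup>+a. (SUP i. U i) a \<partial>distr Q borel (S 1)) = (SUP j. \<integral>\<^sup>+a. U j a \<partial>distr Q borel (S 1))"
   unfolding SUP_apply using seq by (intro nn_integral_monotone_convergence_SUP) auto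
  also have "\<dots> = (SUP j. \<integral>\<^sup>+xs. (\<Sum>i<length xs. ennreal (exp (- (xs ! i))) * U j (xs ! i)) \<partial>\<mu>)"
   using seq by simp
  also have "\<dots> = (\<integral>\<^sup>+xs. (SUP j. \<Sum>i<length xs. ennreal (exp (- (xs ! i))) * U j (xs ! i)) \<partial>\<mu>)"
   using seq(3) by (intro nn_integral_monotone_convergence_SUP[symmetric] monoI)
    (auto intro!: incseq_SucI sum_mono mult_left_mono simp: le_fun_def incseq_def)
  also have "\<dots> = (\<integral>\<^sup>+xs. (\<Sum>i<length xs. ennreal (exp (- (xs ! i))) * (SUP j. U j) (xs ! i)) \<partial>\<mu>)"
  proof (intro nn_integral_cong)
   fix xs
   have "(SUP j. \<Sum>i<length xs. ennreal (exp (- (xs ! i))) * U j (xs ! i)) = (\<Sum>i<length xs. SUP j. ennreal (exp (- (xs ! i))) * U j (xs ! i))"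
    using seq(3) by (intro ennreal_SUP_sum) (auto simp: incseq_def le_fun_def intro!: mult_left_mono)
   then show "(SUP j. \<Sum>i<length xs. ennreal (exp (- (xs ! i))) * U j (xs ! i)) = (\<Sum>i<length xs. ennreal (exp (- (xs ! i))) * (SUP j. U j) (xs ! i))"
    by (simp only: SUP_apply SUP_mult_left_ennreal)
  qed
  finally show ?case .
 qed
 then show ?thesis
  by (intro branching_law.intro branching_law_axioms.intro prob_space_offspring sets_offspring Sp.prob_space_distr S1) auto
qed

end

lemma (in branching_law) nn_integral_exp_convex:
 assumes l: "0 \<le> l" "l \<le> 1"
 shows "(\<integral>\<^sup>+a. ennreal (exp (- (((1 - l) * s + l * t) * a))) \<partial>\<nu>) \<le>
  ennreal (1 - l) * (\<integral>\<^sup>+a. ennreal (exp (- (s * a))) \<partial>\<nu>) + ennreal l * (\<integral>\<^sup>+a. ennreal (exp (- (t * a))) \<partial>\<nu>)"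
proof -
 have "exp (- (((1 - l) * s + l * t) * a)) \<le> (1 - l) * exp (- (s * a)) + l * exp (- (t * a))" for a
  using convex_onD[OF exp_convex, of l "- (s * a)" "- (t * a)"] l by (simp add: algebra_simps)
 then have "(\<integral>\<^sup>+a. ennreal (exp (- (((1 - l) * s + l * t) * a))) \<partial>\<nu>) \<le>
   (\<integral>\<^sup>+a. ennreal (1 - l) * ennreal (exp (- (s * a))) + ennreal l * ennreal (exp (- (t * a))) \<partial>\<nu>)"
  using l by (intro nn_integral_mono) (simp add: ennreal_mult[symmetric] ennreal_plus[symmetric] ennreal_leI del: ennreal_plus)
 also have "\<dots> = ennreal (1 - l) * (\<integral>\<^sup>+a. ennreal (exp (- (s * a))) \<partial>\<nu>) + ennreal l * (\<integral>\<^sup>+a. ennreal (exp (- (t * a))) \<partial>\<nu>)"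
  by (subst nn_integral_add) (simp_all add: nn_integral_cmult)
 finally show ?thesis .
qed

text \<open>
 By convexity, a Laplace transform equal to one at \<open>0\<close> and at \<open>b\<close> and smaller than one somewhere
 in between is smaller than one everywhere in between.
\<close>

lemma (in branching_law) nn_integral_exp_less_1:
 assumes s: "0 < s" "s < b" and s1: "(\<integral>\<^sup>+a. ennreal (exp (- (s * a))) \<partial>\<nu>) < 1"
  and b1: "(\<integral>\<^sup>+a. ennreal (exp (- (b * a))) \<partial>\<nu>) = 1" and t: "0 < t" "t < b"
 shows "(\<integral>\<^sup>+a. ennreal (exp (- (t * a))) \<partial>\<nu>) < 1"
proof -
 have mix: "ennreal (1 - l) * x + ennreal l * y < 1" if l: "0 \<le> l" "l < 1" and x: "x < 1" and y: "y \<le> 1" for l x y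
 proof -
  obtain r where r: "x = ennreal r" "0 \<le> r" "r < 1"
   using x by (cases x) (auto simp: ennreal_less_one_iff)
  have "ennreal (1 - l) * x + ennreal l * y \<le> ennreal (1 - l) * ennreal r + ennreal l * 1"
   unfolding r(1) by (intro add_left_mono mult_left_mono y) auto
  also have "\<dots> = ennreal ((1 - l) * r + l)"
   using l r by (simp add: ennreal_mult[symmetric] ennreal_plus[symmetric] del: ennreal_plus)
  also have "\<dots> < 1"
  proof -
   have "(1 - l) * r < (1 - l) * 1"
    using l r by (intro mult_strict_left_mono) auto
   then show ?thesis
    by (simp add: ennreal_less_one_iff)
  qed
  finally show ?thesis .
 qed
 show ?thesis
 proof (cases "t \<le> s")
  case True
  have "(\<integral>\<^sup>+a. ennreal (exp (- (t * a))) \<partial>\<nu>) \<le>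
    ennreal (1 - (1 - t / s)) * (\<integral>\<^sup>+a. ennreal (exp (- (s * a))) \<partial>\<nu>) + ennreal (1 - t / s) * (\<integral>\<^sup>+a. ennreal (exp (- (0 * a))) \<partial>\<nu>)"
   using nn_integral_exp_convex[of "1 - t / s" s 0] True s t by simp
  also have "\<dots> < 1"
   using True s t by (intro mix s1) (auto simp: nu.emeasure_space_1)
  finally show ?thesis .
 next
  case False
  define l where "l = (t - s) / (b - s)"
  have l: "0 \<le> l" "l < 1"
   using False s t by (auto simp: l_def)
  have "(1 - l) * s + l * b = s + l * (b - s)"
   by (simp add: algebra_simps)
  also have "\<dots> = t"
   using s by (simp add: l_def)
  finally have "(\<integral>\<^sup>+a. ennreal (exp (- (t * a))) \<partial>\<nu>) \<le>
    ennreal (1 - l) * (\<integral>\<^sup>+a. ennreal (exp (- (s * a))) \<partial>\<nu>) + ennreal l * (\<integral>\<^sup>+a. ennreal (exp (- (b * a))) \<partial>\<nu>)"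
   using nn_integral_exp_convex[of l s b] l by simp
  also have "\<dots> < 1"
   using b1 by (intro mix l s1) auto
  finally show ?thesis .
 qed
qed


section \<open>Moments of the first generation\<close>

text \<open>
 With \<open>v = exp (- V)\<close> on the children of the root, the sums of these monomials over tuples of distinct
 children are the integrands of \<open>tuple_moment\<close>.
\<close>

definition power_weight :: "('a \<Rightarrow> real) \<Rightarrow> nat list \<Rightarrow> 'a list \<Rightarrow> real" where
 "power_weight v \<beta> us = (\<Prod>i<length us. v (us ! i) ^ (\<beta> ! i))"

lemma power_weight_Cons: "power_weight v (b # \<beta>) (u # us) = v u ^ b * power_weight v \<beta> us"
 by (simp add: power_weight_def prod.lessThan_Suc_shift del: prod.lessThan_Suc)

lemma power_weight_update:
 assumes "m < length us" "length \<beta> = length us"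
 shows "power_weight v (\<beta>[m := Suc (\<beta> ! m)]) us = v (us ! m) * power_weight v \<beta> us"
proof -
 have "power_weight v (\<beta>[m := Suc (\<beta> ! m)]) us = (\<Prod>i<length us. (if i = m then v (us ! m) else 1) * v (us ! i) ^ (\<beta> ! i))"
  unfolding power_weight_def using assms by (intro prod.cong) (auto simp: nth_list_update)
 then show ?thesis
  using assms by (simp add: prod.distrib power_weight_def)
qed

text \<open>Multiplying by a sum either raises one exponent by one or adds a new entry to the tuple.\<close>

lemma sum_mult_power_weight:
 assumes U: "finite U" and \<beta>: "length \<beta> = k"
 defines "T \<equiv> \<lambda>k. {us. length us = k \<and> distinct us \<and> set us \<subseteq> U}"
 shows "(\<Sum>u\<in>U. v u) * (\<Sum>us\<in>T k. power_weight v \<beta> us) =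
  (\<Sum>m<k. \<Sum>us\<in>T k. power_weight v (\<beta>[m := Suc (\<beta> ! m)]) us) + (\<Sum>us\<in>T (Suc k). power_weight v (1 # \<beta>) us)"
proof -
 have fin: "finite (T k)"
  unfolding T_def by (rule finite_subset[OF _ finite_lists_length_eq[OF U, of k]]) auto
 have "(\<Sum>u\<in>U. v u) * (\<Sum>us\<in>T k. power_weight v \<beta> us) = (\<Sum>us\<in>T k. (\<Sum>u\<in>U. v u) * power_weight v \<beta> us)"
  by (rule sum_distrib_left)
 also have "\<dots> = (\<Sum>us\<in>T k. (\<Sum>m<k. v (us ! m) * power_weight v \<beta> us) + (\<Sum>u\<in>U - set us. v u * power_weight v \<beta> us))"
 proof (intro sum.cong refl)
  fix us assume "us \<in> T k"
  then have us: "length us = k" "distinct us" "set us \<subseteq> U"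
   by (auto simp: T_def)
  have "(\<Sum>u\<in>U. v u) = (\<Sum>u\<in>set us. v u) + (\<Sum>u\<in>U - set us. v u)"
   using sum.subset_diff[OF us(3) U, of v] by (simp add: add.commute)
  also have "(\<Sum>u\<in>set us. v u) = (\<Sum>m<k. v (us ! m))"
   using sum.reindex_bij_betw[OF bij_betw_nth[OF us(2) _ refl], of "{..<k}" v] us(1) by simp
  finally show "(\<Sum>u\<in>U. v u) * power_weight v \<beta> us =
    (\<Sum>m<k. v (us ! m) * power_weight v \<beta> us) + (\<Sum>u\<in>U - set us. v u * power_weight v \<beta> us)"
   by (simp add: distrib_right sum_distrib_right)
 qed
 also have "\<dots> = (\<Sum>us\<in>T k. \<Sum>m<k. power_weight v (\<beta>[m := Suc (\<beta> ! m)]) us) + (\<Sum>us\<in>T k. \<Sum>u\<in>U - set us. power_weight v (1 # \<beta>) (u # us))"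
  unfolding sum.distrib using \<beta> by (intro arg_cong2[where f = "(+)"] sum.cong refl) (auto simp: T_def power_weight_update power_weight_Cons)
 also have "(\<Sum>us\<in>T k. \<Sum>u\<in>U - set us. power_weight v (1 # \<beta>) (u # us)) = (\<Sum>us\<in>T k. \<Sum>vs\<in>(\<lambda>u. u # us) ` (U - set us). power_weight v (1 # \<beta>) vs)"
  by (intro sum.cong refl, subst sum.reindex) (auto simp: inj_on_def)
 also have "\<dots> = (\<Sum>us\<in>T (Suc k). power_weight v (1 # \<beta>) us)"
  using fin U unfolding T_def distinct_lists_Suc by (subst sum.UNION_disjoint) auto
 finally show ?thesis
  by (simp add: sum.swap[of _ "{..<k}"])
qed

context walk_in_random_environment
begin

definition first_sum :: "nat list \<Rightarrow> environment \<Rightarrow> real" where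
 "first_sum \<beta> E = tuple_sum (length \<beta>) (generation E 1) (power_weight (\<lambda>u. exp (- potential E u)) \<beta>)"

lemma first_sum_nonneg: "first_sum \<beta> E \<ge> 0"
 unfolding first_sum_def tuple_sum_def power_weight_def by (intro sum_nonneg prod_nonneg) auto

lemma first_sum_measurable [measurable]: "first_sum \<beta> \<in> borel_measurable env_space"
 unfolding first_sum_def[abs_def] tuple_sum_def power_weight_def
 by (rule measurable_compose_finite_set[where A = "\<lambda>E. generation E 1" and
    f = "\<lambda>S E. \<Sum>us\<in>incomparable_tuples (length \<beta>) S. \<Prod>i<length us. exp (- potential E (us ! i)) ^ (\<beta> ! i)"]) auto

lemma tuple_moment_eq: "tuple_moment M env (length \<beta>) \<beta> = (\<bbbA>\<^sup>+w. ennreal (first_sum \<beta> (env w)))"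
proof -
 have "exp (- (\<Sum>i<length \<beta>. real (\<beta> ! i) * f (us ! i))) = power_weight (\<lambda>u. exp (- f u)) \<beta> us"
  if "length us = length \<beta>" for f :: "vertex \<Rightarrow> real" and us
  using that by (simp add: power_weight_def exp_sum[symmetric] sum_negf exp_of_nat_mult[symmetric])
 then show ?thesis
  unfolding tuple_moment_def first_sum_def tuple_sum_def
  by (intro nn_integral_cong arg_cong[where f = ennreal] sum.cong) (auto simp: incomparable_tuples_def)
qed

lemma W_1_mult_first_sum:
 "W 1 E * first_sum \<beta> E = (\<Sum>m<length \<beta>. first_sum (\<beta>[m := Suc (\<beta> ! m)]) E) + first_sum (1 # \<beta>) E"
 using sum_mult_power_weight[OF finite_generation[of E 1] refl, of "\<lambda>u. exp (- potential E u)" \<beta>]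
 by (simp add: first_sum_def tuple_sum_def incomparable_tuples_generation gen_sum_def)

text \<open>
 A power of \<open>W 1\<close> expands into sums over tuples of distinct children, whose mixed moments are
 finite by assumption.
\<close>

lemma W_1_moment_finite:
 assumes fin: "\<And>\<beta>. \<beta> \<noteq> [] \<Longrightarrow> (\<forall>b\<in>set \<beta>. 1 \<le> b) \<Longrightarrow> sum_list \<beta> \<le> N \<Longrightarrow> tuple_moment M env (length \<beta>) \<beta> < \<infinity>"
  and n: "n \<le> N"
 shows "(\<bbbA>\<^sup>+w. ennreal (W 1 (env w) ^ n)) < \<infinity>"
proof -
 have main: "(\<bbbA>\<^sup>+w. ennreal (W 1 (env w) ^ n * first_sum \<beta> (env w))) < \<infinity>"
  if "\<beta> \<noteq> []" "\<forall>b\<in>set \<beta>. 1 \<le> b" "n + sum_list \<beta> \<le> N" for n \<beta>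
  using that
 proof (induction n arbitrary: \<beta>)
  case 0
  then show ?case
   using fin[of \<beta>] by (simp add: tuple_moment_eq)
 next
  case (Suc n)
  have up: "(\<bbbA>\<^sup>+w. ennreal (W 1 (env w) ^ n * first_sum (\<beta>[m := Suc (\<beta> ! m)]) (env w))) < \<infinity>" if "m < length \<beta>" for m
  proof (rule Suc.IH)
   show "\<forall>b\<in>set (\<beta>[m := Suc (\<beta> ! m)]). 1 \<le> b"
    using Suc.prems(2) set_update_subset_insert[of \<beta> m "Suc (\<beta> ! m)"] by auto
   show "n + sum_list (\<beta>[m := Suc (\<beta> ! m)]) \<le> N"
    using Suc.prems(3) that elem_le_sum_list[OF that] by (simp add: sum_list_update)
  qed (use Suc.prems in simp)
  have new: "(\<bbbA>\<^sup>+w. ennreal (W 1 (env w) ^ n * first_sum (1 # \<beta>) (env w))) < \<infinity>"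
   by (rule Suc.IH) (use Suc.prems in auto)
  have "(\<bbbA>\<^sup>+w. ennreal (W 1 (env w) ^ Suc n * first_sum \<beta> (env w))) =
    (\<bbbA>\<^sup>+w. (\<Sum>m<length \<beta>. ennreal (W 1 (env w) ^ n * first_sum (\<beta>[m := Suc (\<beta> ! m)]) (env w))) + ennreal (W 1 (env w) ^ n * first_sum (1 # \<beta>) (env w)))"
  proof (intro nn_integral_cong)
   fix w
   have "W 1 (env w) ^ Suc n * first_sum \<beta> (env w) = W 1 (env w) ^ n * (W 1 (env w) * first_sum \<beta> (env w))"
    by simp
   also have "\<dots> = (\<Sum>m<length \<beta>. W 1 (env w) ^ n * first_sum (\<beta>[m := Suc (\<beta> ! m)]) (env w)) + W 1 (env w) ^ n * first_sum (1 # \<beta>) (env w)"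
    unfolding W_1_mult_first_sum by (simp add: distrib_left sum_distrib_left)
   finally show "ennreal (W 1 (env w) ^ Suc n * first_sum \<beta> (env w)) =
     (\<Sum>m<length \<beta>. ennreal (W 1 (env w) ^ n * first_sum (\<beta>[m := Suc (\<beta> ! m)]) (env w))) + ennreal (W 1 (env w) ^ n * first_sum (1 # \<beta>) (env w))"
    by (simp add: sum_ennreal first_sum_nonneg W_nonneg sum_nonneg)
  qed
  also have "\<dots> = (\<Sum>m<length \<beta>. \<integral>\<^sup>+w. ennreal (W 1 (env w) ^ n * first_sum (\<beta>[m := Suc (\<beta> ! m)]) (env w)) \<partial>M) +
    (\<bbbA>\<^sup>+w. ennreal (W 1 (env w) ^ n * first_sum (1 # \<beta>) (env w)))"
   by (subst nn_integral_add) (simp_all add: nn_integral_sum)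
  also have "\<dots> < \<infinity>"
   using up new by (simp only: ennreal_add_less_top infinity_ennreal_def) (auto simp: less_top)
  finally show ?case .
 qed
 show ?thesis
 proof (cases n)
  case 0
  then show ?thesis
   by (simp add: emeasure_space_1)
 next
  case (Suc n')
  have "first_sum [] E = 1" for E
  proof -
   have "incomparable_tuples 0 D = {[]}" for D
    by (auto simp: incomparable_tuples_def)
   then show ?thesis
    by (simp add: first_sum_def tuple_sum_def power_weight_def)
  qed
  then have power: "W 1 E ^ n = W 1 E ^ n' * first_sum [1] E" for E
   using W_1_mult_first_sum[of E "[]"] by (simp add: Suc)
  show ?thesis
   unfolding power by (rule main) (use n Suc in auto)
 qed
qed

end

lemma iter_log_at_top: "filterlim (iter_log l) at_top at_top"
proof (induction l)
 case 0
 then show ?case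
  by (simp add: iter_log_def filterlim_ident id_def)
next
 case (Suc l)
 then have "filterlim (\<lambda>x. ln (iter_log l x)) at_top at_top"
  by (rule filterlim_compose[OF ln_at_top])
 then show ?case
  by (simp add: iter_log_def)
qed

lemma length_le_sum_list: "(\<forall>b\<in>set \<beta>. 1 \<le> b) \<Longrightarrow> length \<beta> \<le> sum_list (\<beta> :: nat list)"
 by (induction \<beta>) auto

theorem corollary1p5:
 fixes M :: "'w measure"
  and \<mu> :: "real list measure"
  and env :: "'w \<Rightarrow> environment"
  and X :: "nat \<Rightarrow> 'w \<Rightarrow> vertex option"
  and Q :: "'s measure"
  and S :: "nat \<Rightarrow> 's \<Rightarrow> real"
  and k :: nat
  and \<delta>\<^sub>0 :: real
  and lo hi :: "nat \<Rightarrow> nat"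
 defines "P \<equiv> survival_cond M env"
  and "D \<equiv> \<lambda>n \<omega>. visited_between (env \<omega>) (\<lambda>j. X j \<omega>) lo hi n"
  and "L \<equiv> \<lambda>n. real (hi n) - real (lo n) + 1"
  and "A_lim \<equiv> \<lambda>m. A_inf M env k (split_indicator m)"
  and "W_lim \<equiv> \<lambda>\<omega>. W_inf (env \<omega>)"
 assumes walk: "walk_in_random_environment M \<mu> env X"
  and spine: "spine_walk Q M env S"
  and k: "k \<ge> 2"
  and \<delta>\<^sub>0: "\<delta>\<^sub>0 > 0"
   "\<exists>\<rho>\<^sub>1>1/2. \<forall>\<zeta>::nat. \<zeta> \<ge> 1 \<longrightarrow>
     measure M {\<omega> \<in> space M. \<forall>z\<in>generation (env \<omega>) (nat \<lceil>real \<zeta> / \<delta>\<^sub>0\<rceil>).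
      potential (env \<omega>) z \<ge> 3 * real \<zeta>} \<ge> 1 - exp (- \<rho>\<^sub>1 * real \<zeta>)"
  and hyp1: "(INF t\<in>{0..1}. \<psi> M env t) = 0" "\<psi> M env 1 = 0"
   "\<exists>d<0. ((\<lambda>t. real_of_ereal (\<psi> M env t)) has_real_derivative d) (at 1)"
   "ereal (2 * real k) < \<kappa> M env" "\<kappa> M env < \<infinity>"
  and hyp2: "\<exists>\<delta>\<^sub>1>0. let K = \<lceil>real_of_ereal (\<kappa> M env) + \<delta>\<^sub>1\<rceil> in
    (\<forall>t\<in>{1 - \<delta>\<^sub>1..real_of_int K}. \<psi> M env t < \<infinity>) \<and>
    (\<forall>j \<beta>. 1 \<le> j \<and> int j \<le> K \<and> length \<beta> = j \<and> (\<forall>b\<in>set \<beta>. 1 \<le> b) \<and> int (sum_list \<beta>) \<le> K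
      \<longrightarrow> tuple_moment M env j \<beta> < \<infinity>)"
  and hyp3: "\<exists>h>0. AE \<omega> in M. \<forall>x\<in>tree (env \<omega>). x \<noteq> [] \<longrightarrow>
    potential (env \<omega>) x - potential (env \<omega>) (butlast x) \<ge> - h"
  and hyp4: "\<forall>n\<ge>1. 1 \<le> lo n \<and> ln (real n) / \<delta>\<^sub>0 \<le> real (lo n) \<and> lo n \<le> hi n"
   "\<exists>l\<^sub>0. (\<lambda>n. real (hi n) / sqrt (real n) * iter_log l\<^sub>0 (real (hi n))) \<longlonglongrightarrow> 0"
 shows
  "(\<forall>m\<ge>1. tendsto_L2 P (\<lambda>l \<omega>. weighted_tuple_sum k l (split_indicator m) (env \<omega>)) (A_lim m)) \<and>
   (\<forall>m\<ge>1. tendsto_in_prob P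
    (\<lambda>n \<omega>. tuple_sum k (D n \<omega>) (split_indicator m) / (sqrt (real n) * L n) ^ k)
    (\<lambda>\<omega>. c_inf Q S ^ k * A_lim m \<omega>)) \<and>
   (tendsto_L2 P A_lim (\<lambda>\<omega>. W_lim \<omega> ^ k)) \<and>
   (\<forall>m\<ge>1. (\<lambda>n. measure (uniform_tuple_law P k (D n)) {xs. split_generation xs \<le> m})
    \<longlonglongrightarrow> (\<integral>\<omega>. A_lim m \<omega> / W_lim \<omega> ^ k \<partial>P)) \<and>
   (\<exists>\<nu>. real_distribution \<nu> \<and>
    weak_conv_m (\<lambda>n. distr (uniform_tuple_law P k (D n)) borel (\<lambda>xs. real (split_generation xs))) \<nu>)"
proof -
 interpret walk_in_random_environment M \<mu> env X by (rule walk)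
 interpret Sp: spine_walk Q M env S by (rule spine)
 let ?\<nu> = "distr Q borel (S 1)"
 interpret B: branching_law \<mu> ?\<nu>
  by (rule branching_law_of_spine[OF spine hyp1(2)])
 let ?m = "\<lambda>s. \<integral>\<^sup>+a. ennreal (exp (- (s * a))) \<partial>?\<nu>"
 have \<psi>_eq: "\<psi> M env t = log_ennreal (?m (t - 1))" for t
 proof -
  have "?m (t - 1) = (\<integral>\<^sup>+xs. (\<Sum>i<length xs. ennreal (exp (- (xs ! i))) * ennreal (exp (- ((t - 1) * (xs ! i))))) \<partial>\<mu>)"
   by (rule B.nn_integral_\<nu>) simp
  also have "\<dots> = (\<integral>\<^sup>+\<omega>. (\<Sum>i<length (env \<omega> []). ennreal (exp (- (env \<omega> [] ! i))) * ennreal (exp (- ((t - 1) * (env \<omega> [] ! i))))) \<partial>M)"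
   by (rule nn_integral_offspring) (intro sum_lessThan_measurable, measurable)
  also have "\<dots> = (\<integral>\<^sup>+\<omega>. ennreal (\<Sum>x\<in>generation (env \<omega>) 1. exp (- t * potential (env \<omega>) x)) \<partial>M)"
   unfolding sum_generation_1
   by (intro nn_integral_cong, subst sum_ennreal[symmetric])
    (auto simp: potential_Cons ennreal_mult[symmetric] exp_add[symmetric] algebra_simps)
  finally show ?thesis
   by (simp add: \<psi>_def)
 qed
 \<comment> \<open>as \<open>\<kappa>\<close> is finite, there is a zero of \<open>\<psi>\<close> beyond \<open>1\<close>, and it lies beyond \<open>2 k\<close>\<close>
 obtain t0 where t0: "1 < t0" "\<psi> M env t0 = 0" "2 * real k < t0"
 proof -
  have "{t. 1 < t \<and> \<psi> M env t = 0} \<noteq> {}"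
  proof
   assume none: "{t. 1 < t \<and> \<psi> M env t = 0} = {}"
   have "\<kappa> M env = \<infinity>"
    unfolding \<kappa>_def none by (simp add: top_ereal_def)
   with hyp1(5) show False
    by simp
  qed
  then obtain t where t: "1 < t" "\<psi> M env t = 0"
   by blast
  then have "\<kappa> M env \<le> ereal t"
   unfolding \<kappa>_def by (intro Inf_lower) auto
  then have "ereal (2 * real k) < ereal t"
   using hyp1(4) by (rule less_le_trans[rotated])
  with t show thesis
   using that by simp
 qed
 \<comment> \<open>the derivative of \<open>\<psi>\<close> at its zero \<open>1\<close> is negative\<close>
 obtain t1 where t1: "1 < t1" "t1 < t0" "?m (t1 - 1) < 1"
 proof -
  obtain d where "d < 0" "((\<lambda>t. real_of_ereal (\<psi> M env t)) has_real_derivative d) (at 1)"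
   using hyp1(3) by blast
  then obtain r where r: "r > 0" "\<And>h. 0 < h \<Longrightarrow> h < r \<Longrightarrow> real_of_ereal (\<psi> M env (1 + h)) < real_of_ereal (\<psi> M env 1)"
   using DERIV_neg_dec_right by blast
  define h where "h = min (r / 2) ((t0 - 1) / 2)"
  have h: "0 < h" "h < r" "1 + h < t0"
   using r(1) t0(1) by (auto simp: h_def min_def field_simps)
  have "?m (1 + h - 1) < 1"
   using r(2)[OF h(1,2)] unfolding hyp1(2) \<psi>_eq[of "1 + h"] by (intro less_1_of_log_ennreal) simp
  then show thesis
   using h by (intro that[of "1 + h"]) auto
 qed
 have less_1: "?m (t - 1) < 1" if "1 < t" "t < t0" for t
 proof (rule B.nn_integral_exp_less_1[where s = "t1 - 1" and b = "t0 - 1"])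
  show "?m (t0 - 1) = 1"
   using t0(2) unfolding \<psi>_eq log_ennreal_eq_0_iff .
 qed (use that t1 in simp_all)
 have W1: "(\<bbbE>E. W 1 E ^ n) < \<infinity>" if n: "n \<le> 2 * k + 1" for n
 proof -
  obtain \<delta>1 where \<delta>1: "\<delta>1 > 0" and tm: "\<And>j \<beta>. 1 \<le> j \<Longrightarrow> int j \<le> \<lceil>real_of_ereal (\<kappa> M env) + \<delta>1\<rceil> \<Longrightarrow> length \<beta> = j \<Longrightarrow>
    (\<forall>b\<in>set \<beta>. 1 \<le> b) \<Longrightarrow> int (sum_list \<beta>) \<le> \<lceil>real_of_ereal (\<kappa> M env) + \<delta>1\<rceil> \<Longrightarrow> tuple_moment M env j \<beta> < \<infinity>"
   using hyp2 unfolding Let_def by blast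
  have "2 * real k < real_of_ereal (\<kappa> M env)"
   using hyp1(4,5) by (cases "\<kappa> M env") auto
  then have K: "int (2 * k + 1) \<le> \<lceil>real_of_ereal (\<kappa> M env) + \<delta>1\<rceil>"
   using \<delta>1 by linarith
  have "tuple_moment M env (length \<beta>) \<beta> < \<infinity>" if "\<beta> \<noteq> []" "\<forall>b\<in>set \<beta>. 1 \<le> b" "sum_list \<beta> \<le> 2 * k + 1" for \<beta>
   using that length_le_sum_list[OF that(2)] K by (intro tm) (auto simp: Suc_le_eq)
  then have "(\<integral>\<^sup>+\<omega>. ennreal (W 1 (env \<omega>) ^ n) \<partial>M) < \<infinity>"
   using n by (rule W_1_moment_finite)
  then show ?thesis
   unfolding B.GW_def by (subst nn_integral_distr_env) auto
 qed
 interpret B: spine_branching_law \<mu> ?\<nu> Q S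
 proof unfold_locales
  show "B.\<rho> < 1"
   unfolding B.\<rho>_def using less_1[of 2] t0 k by simp
  show "(\<bbbE>E. (W 1 E)\<^sup>2) < \<infinity>"
   using W1[of 2] k by simp
 qed (use Sp.start Sp.increments_indep Sp.increments_law in auto)
 interpret branching_walk M \<mu> env X ?\<nu> Q S ..
 \<comment> \<open>an order beyond \<open>2 k\<close> which is below the zero \<open>t0\<close> and for which the first generation has moments\<close>
 define p where "p = min (2 * real k + 1) ((2 * real k + t0) / 2)"
 have p: "2 * real k < p" "p < t0" "p \<le> real (2 * k + 1)"
  using t0 by (auto simp: p_def min_def)
 obtain C where C: "\<And>n. (\<bbbE>E. W n E powr p) \<le> ennreal C"
 proof -
  have "(\<bbbE>E. W 1 E powr p) \<le> 1 + (\<bbbE>E. W 1 E powr real (2 * k + 1))"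
   using p k by (intro B.nn_integral_powr_finite_mono) (auto simp: W_nonneg)
  also have "(\<bbbE>E. W 1 E powr real (2 * k + 1)) = (\<bbbE>E. W 1 E ^ (2 * k + 1))"
   using W_nonneg[of 1] by (intro nn_integral_cong arg_cong[where f = ennreal] powr_realpow') auto
  finally have "(\<bbbE>E. W 1 E powr p) < \<infinity>"
   using W1[of "2 * k + 1"] by (simp add: le_less_trans ennreal_add_less_top)
  then have "\<exists>C\<ge>0. \<forall>n. (\<bbbE>E. W n E powr p) \<le> ennreal C"
   by (rule B.W_moment_bounded[rotated]) (use p k less_1 in auto)
  then show thesis
   using that by blast
 qed
 have lo_lim: "filterlim lo at_top sequentially"
  by (rule lower_bound_at_top[OF \<delta>\<^sub>0(1)]) (use hyp4(1) in blast)
 \<comment> \<open>the iterated logarithm tends to infinity, so it may be dropped from the bound on \<open>hi\<close>\<close>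
 have small: "(\<lambda>n. real (hi n) / sqrt (real n)) \<longlonglongrightarrow> 0"
 proof -
  obtain l where l: "(\<lambda>n. real (hi n) / sqrt (real n) * iter_log l (real (hi n))) \<longlonglongrightarrow> 0"
   using hyp4(2) by blast
  have "filterlim (\<lambda>n. real (hi n)) at_top sequentially"
  proof (rule filterlim_at_top_mono[OF filterlim_compose[OF filterlim_real_sequentially lo_lim]])
   show "eventually (\<lambda>n. real (lo n) \<le> real (hi n)) sequentially"
    using hyp4(1) by (intro eventually_sequentiallyI[of 1]) auto
  qed
  then have "filterlim (\<lambda>n. iter_log l (real (hi n))) at_top sequentially"
   by (rule filterlim_compose[OF iter_log_at_top])
  then have "eventually (\<lambda>n. 1 \<le> iter_log l (real (hi n))) sequentially"
   unfolding filterlim_at_top by blast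
  then have "eventually (\<lambda>n. real (hi n) / sqrt (real n) \<le> real (hi n) / sqrt (real n) * iter_log l (real (hi n))) sequentially"
   by eventually_elim (simp add: mult_le_cancel_left1 divide_simps)
  then show ?thesis
   by (intro tendsto_sandwich[OF _ _ tendsto_const l]) auto
 qed
 obtain \<rho>1 where \<rho>1: "\<rho>1 > 1/2" "\<And>\<zeta>::nat. \<zeta> \<ge> 1 \<Longrightarrow>
   prob {\<omega> \<in> space M. \<forall>z\<in>generation (env \<omega>) (nat \<lceil>real \<zeta> / \<delta>\<^sub>0\<rceil>). potential (env \<omega>) z \<ge> 3 * real \<zeta>} \<ge> 1 - exp (- \<rho>1 * real \<zeta>)"
  using \<delta>\<^sub>0(2) by blast
 interpret T: tuples_of_visited_vertices M \<mu> env X ?\<nu> Q S k p C lo hi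
 proof unfold_locales
  show "k \<ge> 1" "p > 2 * real k"
   using k p by auto
  show "(\<bbbE>E. W n E powr p) \<le> ennreal C" for n
   by (rule C)
  show "filterlim lo at_top sequentially"
   by (rule lo_lim)
  show "(\<lambda>n. \<integral>\<^sup>+\<omega>. ennreal (min 1 \<bar>visit_count (nat \<lfloor>sqrt (real n)\<rfloor>) u (lo n) (hi n) \<omega> /
    (sqrt (real n) * (real (hi n) - real (lo n) + 1)) - c_inf Q S * mass_below u (env \<omega>)\<bar>) \<partial>M) \<longlonglongrightarrow> 0" for u
   by (rule visit_count_tendsto[OF \<delta>\<^sub>0(1) _ \<rho>1(2) _ small]) (use \<rho>1(1) hyp4(1) in auto)
  show "sqrt (real n) * (real (hi n) - real (lo n) + 1) \<ge> 0" for n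
   using hyp4(1)[rule_format, of n] by (cases "n = 0") auto
 qed
 show ?thesis
  unfolding assms(1-5) using T.A_lim_L2 T.tuple_sums_in_prob T.A_lim_tendsto_W T.split_law_tendsto T.split_weak_conv
  unfolding T.split_cdf_def by blast
qed

end
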